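(* Let $\mathcal H$ be an MC-space and let $M$ be its majorant. Then there exist a measurable, positive function $m$ on $\mathbb R$ with $m\simeq 1$ and a real-entire function $g$ such that $$M(x)\simeq e^{g(x)}e^{\omega_m(x)}\qquad (x\in\mathbb R).$$
   Context: Notation. $f\lesssim g$ means $f\le Cg$ for some constant $C>0$ independent of the variables; $f\simeq g$ means $f\lesssim g$ and $g\lesssim f$. In particular $m\simeq 1$ means that $m$ is bounded above and below by positive constants. $f^*(z)=\overline{f(\bar z)}$. A function is real-entire if it is entire and $f^*=f$. $\mathbb C^{\pm}$ are the open upper/lower half-planes. de Branges spaces. A Hilbert space $\mathcal H$ of entire functions is a de Branges space if: point evaluations $f\mapsto f(z_0)$ are bounded for all $z_0\in\mathbb C$; $f\in\mathcal H$ implies $f^*\in\mathcal H$ with the same norm; $f\in\mathcal H$, $f(z_0)=0$ imply $f(z)\frac{z-\bar z_0}{z-z_0}\in\mathcal H$ with the same norm. Its majorant is $M(z)=\sup_{\|f\|_{\mathcal H}=1}|f(z)|$ (the norm of the reproducing kernel at $z$). Hermite–Biehler functions. An Hermite–Biehler (HB) function is an entire $E$ with $|E(z)|>|E(\bar z)|$ for $z\in\mathbb C^+$. A considered HB-function is an HB-function of the form $E(z)=Ce^{h(z)}\prod_{\lambda\in\Lambda}(1-z/\lambda)e^{p_\lambda(z)}$ with $C\in\mathbb C$, $h$ real-entire, $\Lambda\subset\mathbb C^-$ (the family of zeroes, with multiplicity) and $p_\lambda$ polynomials with real coefficients. On $\mathbb R$, $E(x)=|E(x)|e^{-i\varphi(x)}$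 with $\varphi$ real-analytic (the phase), and $\varphi'(x)=\sum_{\xi-i\eta\in\Lambda}\frac{\eta}{(x-\xi)^2+\eta^2}$. $\mathcal H(E)$ is the space of entire $f$ with $\|f/E\|_{L^2(\mathbb R)}<\infty$ and $f/E,\ f^*/E\in\mathcal N_0^+$, normed by $\|f\|_{\mathcal H(E)}=\|f/E\|_{L^2(\mathbb R)}$, where $\mathcal N^+_h$ is the class of functions of bounded type on $\mathbb C^+$ whose mean type $\limsup_{y\to+\infty}y^{-1}\log|f(iy)|$ does not exceed $h$. Mountain chains. A mountain chain is a piecewise continuous $\gamma:\mathbb R\to\mathbb R$ such that $\mathbb R$ is divided into a locally finite succession of intervals of two kinds: mountain bases and plateaux. On a mountain base with endpoints $a<b$, $\gamma(x)=\frac{\eta}{(x-\xi)^2+\eta^2}$ with $a<\xi<b$ and $1/\eta>1$ (the summit is $(\xi,1/\eta)$); the lengths $b-a$ are $\simeq 1$ and $\xi$ is at distance at least a fixed positive constant from $a$ and $b$ (constants uniform over all mountains). On plateaux, which may have any finite or infinite length, $\gamma=1$. Mountain chain axioms. Let $E$ be a considered HB-function with phase $\varphi$ and zeroes $\Lambda$; for $x\in\mathbb R$ let $\lambda(x)=\xi(x)-i\eta(x)$ be the zero closest to $x$ (in case of ties, the one with smallest real part). $E$ satisfies the mountain chain axioms if for some $\delta\in(0,1]$, with the critical strip $\mathcal S_\delta=\{-\delta<\operatorname{Im}z<0\}$: (1) $\varphi'\simeq\gamma_\delta$, where $\gamma_\delta(x)=\eta(x)/|x-\lambda(x)|^2$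 if $\lambda(x)\in\mathcal S_\delta$ and $\gamma_\delta(x)=1$ otherwise, and $\gamma_\delta$ is a mountain chain whose mountains correspond to the zeroes $\lambda=\xi-i\eta\in\Lambda\cap\mathcal S_\delta$ (base $\{x:\lambda(x)=\lambda\}$, summit $(\xi,1/\eta)$); (2) the zeroes in $\mathcal S_\delta$ are simple; (3) writing these zeroes as $\xi_k-i\eta_k$ in increasing order of $\xi_k$, for some $\varepsilon\in(0,1)$, $\log\eta_k-\log\eta_l=O(|\xi_k-\xi_l|^{1-\varepsilon})$ uniformly in $l$ as $|k-l|\to\infty$. A de Branges space is an MC-space if it is isometrically equal to $\mathcal H(E)$ for some considered HB-function $E$ satisfying the mountain chain axioms. Potentials. For $m$ bounded measurable on $\mathbb R$, $\omega_m(z)=\int_{-\infty}^\infty\big(\log|1-z/t|+\chi(t)\tfrac{\operatorname{Re}z}{t}\big)m(t)\,dt$ with $\chi(t)=1-\mathbf 1_{[-1,1]}(t)$; the integral converges absolutely. *)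

theory Defs
  imports "HOL-Complex_Analysis.Complex_Analysis" "HOL-Library.Disjoint_Sets"
begin

definition lesssim :: "('a \<Rightarrow> real) \<Rightarrow> ('a \<Rightarrow> real) \<Rightarrow> bool" where
  "lesssim f g \<longleftrightarrow> (\<exists>C>0. \<forall>x. f x \<le> C * g x)"

definition comparable :: "('a \<Rightarrow> real) \<Rightarrow> ('a \<Rightarrow> real) \<Rightarrow> bool" where
  "comparable f g \<longleftrightarrow> lesssim f g \<and> lesssim g f"

definition conj_fun :: "(complex \<Rightarrow> complex) \<Rightarrow> complex \<Rightarrow> complex" where
  "conj_fun f z = cnj (f (cnj z))"

definition real_entire :: "(complex \<Rightarrow> complex) \<Rightarrow> bool" where
  "real_entire f \<longleftrightarrow> f holomorphic_on UNIV \<and> conj_fun f = f"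

definition upper_half_plane :: "complex set" where
  "upper_half_plane = {z. Im z > 0}"

definition lower_half_plane :: "complex set" where
  "lower_half_plane = {z. Im z < 0}"


section \<open>Hilbert spaces of entire functions and de Branges spaces\<close>

text \<open>A space of functions is given by its carrier \<open>H\<close> and an inner product \<open>ip\<close>
  (linear in the first argument); values of \<open>ip\<close> outside \<open>H\<close> are irrelevant.\<close>

definition ip_norm ::
  "((complex \<Rightarrow> complex) \<Rightarrow> (complex \<Rightarrow> complex) \<Rightarrow> complex) \<Rightarrow> (complex \<Rightarrow> complex) \<Rightarrow> real" where
  "ip_norm ip f = sqrt (Re (ip f f))"

definition hilbert_function_space ::
  "(complex \<Rightarrow> complex) set \<Rightarrow>
   ((complex \<Rightarrow> complex) \<Rightarrow> (complex \<Rightarrow> complex) \<Rightarrow> complex) \<Rightarrow> bool" where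
  "hilbert_function_space H ip \<longleftrightarrow>
     (\<lambda>z. 0) \<in> H \<and>
     (\<forall>f\<in>H. \<forall>g\<in>H. (\<lambda>z. f z + g z) \<in> H) \<and>
     (\<forall>c. \<forall>f\<in>H. (\<lambda>z. c * f z) \<in> H) \<and>
     (\<forall>f\<in>H. \<forall>g\<in>H. \<forall>k\<in>H. ip (\<lambda>z. f z + g z) k = ip f k + ip g k) \<and>
     (\<forall>c. \<forall>f\<in>H. \<forall>g\<in>H. ip (\<lambda>z. c * f z) g = c * ip f g) \<and>
     (\<forall>f\<in>H. \<forall>g\<in>H. ip g f = cnj (ip f g)) \<and>
     (\<forall>f\<in>H. f \<noteq> (\<lambda>z. 0) \<longrightarrow> Re (ip f f) > 0) \<and>
     (\<forall>F :: nat \<Rightarrow> complex \<Rightarrow> complex.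
        range F \<subseteq> H \<and>
        (\<forall>e>0. \<exists>N. \<forall>i\<ge>N. \<forall>j\<ge>N. ip_norm ip (\<lambda>z. F i z - F j z) < e) \<longrightarrow>
        (\<exists>f\<in>H. (\<lambda>n. ip_norm ip (\<lambda>z. F n z - f z)) \<longlonglongrightarrow> 0))"

text \<open>The function \<open>f(z) (z - cnj z0) / (z - z0)\<close>, with its removable singularity
  at \<open>z0\<close> filled in (for \<open>f z0 = 0\<close>).\<close>

definition reflect_zero :: "complex \<Rightarrow> (complex \<Rightarrow> complex) \<Rightarrow> complex \<Rightarrow> complex" where
  "reflect_zero z0 f z =
     (if z = z0 then deriv f z0 * (z0 - cnj z0) else f z * ((z - cnj z0) / (z - z0)))"

definition de_branges_space ::
  "(complex \<Rightarrow> complex) set \<Rightarrow>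
   ((complex \<Rightarrow> complex) \<Rightarrow> (complex \<Rightarrow> complex) \<Rightarrow> complex) \<Rightarrow> bool" where
  "de_branges_space H ip \<longleftrightarrow>
     hilbert_function_space H ip \<and>
     (\<forall>f\<in>H. f holomorphic_on UNIV) \<and>
     (\<forall>z0. \<exists>C. \<forall>f\<in>H. cmod (f z0) \<le> C * ip_norm ip f) \<and>
     (\<forall>f\<in>H. conj_fun f \<in> H \<and> ip_norm ip (conj_fun f) = ip_norm ip f) \<and>
     (\<forall>f\<in>H. \<forall>z0. f z0 = 0 \<longrightarrow>
        reflect_zero z0 f \<in> H \<and> ip_norm ip (reflect_zero z0 f) = ip_norm ip f)"

definition majorant ::
  "(complex \<Rightarrow> complex) set \<Rightarrow>
   ((complex \<Rightarrow> complex) \<Rightarrow> (complex \<Rightarrow> complex) \<Rightarrow> complex) \<Rightarrow> complex \<Rightarrow> real" where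
  "majorant H ip z = (SUP f\<in>{f\<in>H. ip_norm ip f = 1}. cmod (f z))"


section \<open>Hermite--Biehler functions\<close>

definition hermite_biehler :: "(complex \<Rightarrow> complex) \<Rightarrow> bool" where
  "hermite_biehler E \<longleftrightarrow>
     E holomorphic_on UNIV \<and> (\<forall>z\<in>upper_half_plane. cmod (E z) > cmod (E (cnj z)))"

text \<open>The (finite or countable) family of zeroes is \<open>(lam n)\<close> for \<open>n \<in> I\<close>, repeated according to
  multiplicity, and the product converges locally uniformly. As \<open>E\<close> does not vanish identically,
  Hurwitz's theorem shows that the family is then exactly the family of zeroes of \<open>E\<close>, with
  multiplicities; below, the zeroes are therefore read off from \<open>E\<close> itself.\<close>

definition considered_HB :: "(complex \<Rightarrow> complex) \<Rightarrow> bool" where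
  "considered_HB E \<longleftrightarrow>
     hermite_biehler E \<and>
     (\<exists>(C::complex) h (I::nat set) (lam :: nat \<Rightarrow> complex) (p :: nat \<Rightarrow> real poly) P.
        real_entire h \<and>
        lam ` I \<subseteq> lower_half_plane \<and>
        (\<forall>K. compact K \<longrightarrow>
           uniform_limit K
             (\<lambda>N z. \<Prod>n\<in>I \<inter> {..<N}. (1 - z / lam n) * exp (poly (map_poly complex_of_real (p n)) z))
             P sequentially) \<and>
        (\<forall>z. E z = C * exp (h z) * P z))"

definition zeros :: "(complex \<Rightarrow> complex) \<Rightarrow> complex set" where
  "zeros E = {z. E z = 0}"

text \<open>Real analyticity of the phase is expressed by an analytic extension to a neighbourhood
  of the real line. The phase is unique up to an additive constant.\<close>

definition is_phase :: "(complex \<Rightarrow> complex) \<Rightarrow> (real \<Rightarrow> real) \<Rightarrow> bool" where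
  "is_phase E \<phi> \<longleftrightarrow>
     (\<exists>\<Phi>. \<Phi> analytic_on \<real> \<and> (\<forall>x::real. \<Phi> (of_real x) = of_real (\<phi> x))) \<and>
     (\<forall>x::real. E (of_real x) = of_real (cmod (E (of_real x))) * exp (- \<i> * of_real (\<phi> x)))"


section \<open>The spaces \<open>H(E)\<close>\<close>

definition bounded_type :: "(complex \<Rightarrow> complex) \<Rightarrow> bool" where
  "bounded_type f \<longleftrightarrow>
     f holomorphic_on upper_half_plane \<and>
     (\<exists>u v. u holomorphic_on upper_half_plane \<and> bounded (u ` upper_half_plane) \<and>
            v holomorphic_on upper_half_plane \<and> bounded (v ` upper_half_plane) \<and>
            (\<exists>z\<in>upper_half_plane. v z \<noteq> 0) \<and>
            (\<forall>z\<in>upper_half_plane. v z * f z = u z))"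

text \<open>The case distinction implements \<open>log 0 = -\<infinity>\<close>.\<close>

definition mean_type :: "(complex \<Rightarrow> complex) \<Rightarrow> ereal" where
  "mean_type f =
     Limsup at_top (\<lambda>y::real. if f (\<i> * of_real y) = 0 then -\<infinity>
                              else ereal (ln (cmod (f (\<i> * of_real y))) / y))"

definition N_plus :: "real \<Rightarrow> (complex \<Rightarrow> complex) set" where
  "N_plus h = {f. bounded_type f \<and> mean_type f \<le> ereal h}"

definition HE_space :: "(complex \<Rightarrow> complex) \<Rightarrow> (complex \<Rightarrow> complex) set" where
  "HE_space E =
     {f. f holomorphic_on UNIV \<and>
         integrable lborel (\<lambda>x::real. (cmod (f (of_real x) / E (of_real x)))\<^sup>2) \<and>
         (\<lambda>z. f z / E z) \<in> N_plus 0 \<and> (\<lambda>z. conj_fun f z / E z) \<in> N_plus 0}"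

definition HE_norm :: "(complex \<Rightarrow> complex) \<Rightarrow> (complex \<Rightarrow> complex) \<Rightarrow> real" where
  "HE_norm E f = sqrt (LINT x|lborel. (cmod (f (of_real x) / E (of_real x)))\<^sup>2)"


section \<open>Mountain chains\<close>

text \<open>\<open>mountain_chain \<gamma> Ms\<close> states that \<open>\<gamma>\<close> is a mountain chain whose mountains are the
  triples \<open>(B, \<xi>, \<eta>)\<close> in \<open>Ms\<close>, with base \<open>B\<close> and summit \<open>(\<xi>, 1/\<eta>)\<close>; \<open>Ps\<close> is the set of plateaux.
  Piecewise continuity of \<open>\<gamma>\<close> follows from its explicit form on the pieces.\<close>

definition mountain_chain :: "(real \<Rightarrow> real) \<Rightarrow> (real set \<times> real \<times> real) set \<Rightarrow> bool" where
  "mountain_chain \<gamma> Ms \<longleftrightarrow>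
     (\<exists>Ps :: real set set.
        partition_on UNIV (fst ` Ms \<union> Ps) \<and>
        locally_finite_in euclidean (fst ` Ms \<union> Ps) \<and>
        (\<forall>Q\<in>Ps. is_interval Q \<and> (\<forall>x\<in>Q. \<gamma> x = 1))) \<and>
     (\<exists>l>0. \<exists>L>0. \<exists>d>0. \<forall>(B, \<xi>, \<eta>)\<in>Ms.
        \<exists>a b. {a<..<b} \<subseteq> B \<and> B \<subseteq> {a..b} \<and> a < \<xi> \<and> \<xi> < b \<and>
              0 < \<eta> \<and> 1 / \<eta> > 1 \<and>
              l \<le> b - a \<and> b - a \<le> L \<and> d \<le> \<xi> - a \<and> d \<le> b - \<xi> \<and>
              (\<forall>x\<in>B. \<gamma> x = \<eta> / ((x - \<xi>)\<^sup>2 + \<eta>\<^sup>2)))"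

definition critical_strip :: "real \<Rightarrow> complex set" where
  "critical_strip \<delta> = {z. - \<delta> < Im z \<and> Im z < 0}"

definition closest_zero :: "(complex \<Rightarrow> complex) \<Rightarrow> real \<Rightarrow> complex" where
  "closest_zero E x =
     (THE w. w \<in> zeros E \<and>
        (\<forall>\<mu>\<in>zeros E. dist (of_real x) w \<le> dist (of_real x) \<mu>) \<and>
        (\<forall>\<mu>\<in>zeros E. dist (of_real x) \<mu> = dist (of_real x) w \<longrightarrow> Re w \<le> Re \<mu>))"

definition gamma_delta :: "(complex \<Rightarrow> complex) \<Rightarrow> real \<Rightarrow> real \<Rightarrow> real" where
  "gamma_delta E \<delta> x =
     (if closest_zero E x \<in> critical_strip \<delta>
      then - Im (closest_zero E x) / (cmod (of_real x - closest_zero E x))\<^sup>2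
      else 1)"

text \<open>In the last axiom the zeroes in the strip are enumerated by a (possibly empty, finite,
  one-sided or two-sided infinite) interval \<open>J\<close> of integers; the enumeration is unique up to a
  shift of the index.\<close>

definition mountain_chain_axioms :: "(complex \<Rightarrow> complex) \<Rightarrow> bool" where
  "mountain_chain_axioms E \<longleftrightarrow>
     (\<exists>\<delta>. 0 < \<delta> \<and> \<delta> \<le> 1 \<and>
        (\<exists>\<phi>. is_phase E \<phi> \<and> comparable (deriv \<phi>) (gamma_delta E \<delta>)) \<and>
        mountain_chain (gamma_delta E \<delta>)
          ((\<lambda>w. ({x. closest_zero E x = w}, Re w, - Im w)) ` (zeros E \<inter> critical_strip \<delta>)) \<and>
        (\<forall>w\<in>zeros E \<inter> critical_strip \<delta>. zorder E w = 1) \<and>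
        (\<exists>(J::int set) \<xi> \<eta>.
           (\<forall>i\<in>J. \<forall>j\<in>J. {i..j} \<subseteq> J) \<and>
           bij_betw (\<lambda>k. Complex (\<xi> k) (- \<eta> k)) J (zeros E \<inter> critical_strip \<delta>) \<and>
           strict_mono_on J \<xi> \<and>
           (\<exists>\<epsilon>. 0 < \<epsilon> \<and> \<epsilon> < 1 \<and>
              (\<exists>C N. \<forall>k\<in>J. \<forall>l\<in>J. \<bar>k - l\<bar> \<ge> N \<longrightarrow>
                 \<bar>ln (\<eta> k) - ln (\<eta> l)\<bar> \<le> C * \<bar>\<xi> k - \<xi> l\<bar> powr (1 - \<epsilon>)))))"

definition MC_space ::
  "(complex \<Rightarrow> complex) set \<Rightarrow>
   ((complex \<Rightarrow> complex) \<Rightarrow> (complex \<Rightarrow> complex) \<Rightarrow> complex) \<Rightarrow> bool" where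
  "MC_space H ip \<longleftrightarrow>
     de_branges_space H ip \<and>
     (\<exists>E. considered_HB E \<and> mountain_chain_axioms E \<and>
          H = HE_space E \<and> (\<forall>f\<in>H. ip_norm ip f = HE_norm E f))"


section \<open>Potentials\<close>

text \<open>The conventions \<open>ln 0 = 0\<close> and \<open>x / 0 = 0\<close> only affect the null set where \<open>t = 0\<close> or \<open>t = z\<close>.\<close>

definition potential :: "(real \<Rightarrow> real) \<Rightarrow> complex \<Rightarrow> real" where
  "potential m z =
     (LINT t|lebesgue.
        (ln (cmod (1 - z / of_real t)) + (1 - indicat_real {-1..1} t) * (Re z / t)) * m t)"

end

theory Submission
  imports Defs "HOL-Real_Asymp.Real_Asymp" "HOL-Probability.Sinc_Integral"
begin

text \<open>Let \<open>E = C e\<^sup>h P\<close> be the structure function, with zeroes \<open>\<lambda> = \<xi> - i\<eta>\<close> and phase \<open>\<phi>\<close>. On the real line the majorant is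
known exactly: \<open>M(x)\<^sup>2 = |E(x)|\<^sup>2 \<phi>'(x) / \<pi>\<close> (\<open>majorant_on_real_line\<close>). Hence
\<open>ln M = Re h + ln |P| + (ln \<phi>') / 2 + const\<close>, and what must be shown is that \<open>ln |P| + (ln \<phi>') / 2\<close> is, up to
a bounded error and the real part of a real-entire function, the potential of a density comparable to 1.

Sweeping a unit mass from \<open>\<xi> - ih\<close> onto the real line gives the Poisson density \<open>h / (\<pi> ((t - \<xi>)\<^sup>2 + h\<^sup>2))\<close>,
which has the same logarithmic potential on the line up to an affine function (\<open>log_kernel_poisson\<close>). Sweeping
all zeroes where they are would produce the density \<open>\<phi>' / \<pi>\<close>, which has high peaks. So each zero is first
lowered by 1, to \<open>\<lambda> - i\<close>. The resulting density \<open>m0 = (1/\<pi>) \<Sum> (\<eta> + 1) / ((t - \<xi>)\<^sup>2 + (\<eta> + 1)\<^sup>2)\<close> is comparable to 1: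
lowering flattens the peaks without making the density small anywhere (\<open>suminf_r_le\<close>, \<open>suminf_r_ge\<close>).
Lowering the zeroes changes \<open>ln |P|\<close> by the sum of the
\<open>D = ln (|x - \<lambda> + i| / |x - \<lambda>|)\<close>, so that the remaining discrepancy is \<open>L = (ln \<phi>') / 2 - \<Sum> D\<close>. On the base
of a mountain with zero \<open>\<xi>\<^sub>k - i \<eta>\<^sub>k\<close> the only unbounded term \<open>ln (1 / |x - \<lambda>\<^sub>k|)\<close> of the sum is cancelled by
\<open>\<phi>' \<simeq> \<eta>\<^sub>k / |x - \<lambda>\<^sub>k|\<^sup>2\<close>; there \<open>L = (ln \<eta>\<^sub>k) / 2 + O(1)\<close>, and \<open>L = O(1)\<close> on plateaux (\<open>L_covered\<close>, \<open>L_uncovered\<close>).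
The growth condition on \<open>ln \<eta>\<^sub>k\<close> therefore says that \<open>|L(x) - L(y)| \<le> C (1 + |x - y|)\<^sup>1\<^sup>-\<^sup>\<epsilon>\<close>
(\<open>L_large_scale_Holder\<close>).

Such an \<open>L\<close> is boundedly close to the potential of an arbitrarily small density \<open>m1\<close>, up to an affine function
(\<open>smoothing\<close>): averaging \<open>L\<close> at a large scale \<open>T\<close> changes it by a bounded amount, and the average is the
potential of a density of size \<open>O(T\<^sup>-\<^sup>\<epsilon>)\<close>. With \<open>|m1|\<close> below half of the lower bound of \<open>m0\<close>,
the density \<open>m = m0 + m1\<close> is comparable to 1. The convergence factors of the product \<open>P\<close> contribute only a
real-entire function (\<open>canonical_factorisation\<close>), and the affine functions are absorbed in it.\<close>

section \<open>Growth of functions of bounded type\<close>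

text \<open>On the unit circle \<open>cnj w = 1 / w\<close>, so products of boundary values of real parts of polynomials are again of
this form; this makes these boundary values an algebra.\<close>

lemma Re_mult_cnj_poly_circle:
  fixes p q :: "complex poly"
  shows "\<exists>r. \<forall>w. cmod w = 1 \<longrightarrow> Re (poly p w * cnj (poly q w)) = Re (poly r w)"
proof (induction p arbitrary: q)
  case 0
  show ?case by (rule exI[of _ 0]) simp
next
  case (pCons a p)
  obtain b q' where q: "q = pCons b q'" by (cases q)
  obtain r0 where r0: "\<And>w. cmod w = 1 \<Longrightarrow> Re (poly p w * cnj (poly q' w)) = Re (poly r0 w)"
    using pCons.IH[of q'] by blast
  let ?r = "[:a * cnj b:] + smult (cnj a) (pCons 0 q') + smult (cnj b) (pCons 0 p) + r0"
  have "Re (poly (pCons a p) w * cnj (poly q w)) = Re (poly ?r w)" if w: "cmod w = 1" for w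
  proof -
    have ww: "w * cnj w = 1" using w by (metis complex_norm_square one_power2 of_real_1)
    have "poly (pCons a p) w * cnj (poly q w)
        = a * cnj b + cnj (cnj a * (w * poly q' w)) + cnj b * (w * poly p w)
          + (w * cnj w) * (poly p w * cnj (poly q' w))"
      unfolding q by (simp add: algebra_simps)
    then have "Re (poly (pCons a p) w * cnj (poly q w))
        = Re (a * cnj b) + Re (cnj a * (w * poly q' w)) + Re (cnj b * (w * poly p w))
          + Re (poly p w * cnj (poly q' w))"
      unfolding ww by (simp only: plus_complex.sel complex_cnj mult_1 cnj.sel)
    also have "\<dots> = Re (poly ?r w)"
      using r0[OF w] by (simp only: poly_add poly_smult poly_pCons poly_0 plus_complex.sel mult_zero_right add_0_right add_0_left)
    finally show ?thesis .
  qed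
  then show ?case by blast
qed

text \<open>By Stone and Weierstrass, real parts of polynomials are uniformly dense in the continuous functions on the
circle. They replace the Poisson integral in the solution of the Dirichlet problem: the harmonic extension of
\<open>Re p\<close> is given, together with its harmonic conjugate, by the polynomial \<open>p\<close> itself.\<close>

lemma continuous_on_circle_approx_Re_poly:
  fixes \<psi> :: "complex \<Rightarrow> real"
  assumes "continuous_on (sphere 0 1) \<psi>" "0 < e"
  obtains p where "\<And>w. cmod w = 1 \<Longrightarrow> \<bar>\<psi> w - Re (poly p w)\<bar> < e"
proof -
  define R where "R = {f. \<exists>p. \<forall>w\<in>sphere 0 1. f w = Re (poly p w)}"
  interpret function_ring_on R "sphere (0::complex) 1"
  proof
    show "compact (sphere (0::complex) 1)" by simp
    show "continuous_on (sphere 0 1) f" if f: "f \<in> R" for f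
    proof -
      obtain p where p0: "\<forall>w\<in>sphere 0 1. f w = Re (poly p w)" using f unfolding R_def by blast
      then have p: "w \<in> sphere 0 1 \<Longrightarrow> f w = Re (poly p w)" for w by blast
      have "continuous_on (sphere 0 1) (\<lambda>w. Re (poly p w))" by (intro continuous_intros)
      then show ?thesis using p by (subst continuous_on_cong[OF refl p]) auto
    qed
    show "(\<lambda>x. f x + g x) \<in> R" if fg: "f \<in> R" "g \<in> R" for f g
    proof -
      obtain p q where "\<forall>w\<in>sphere 0 1. f w = Re (poly p w)" "\<forall>w\<in>sphere 0 1. g w = Re (poly q w)"
        using fg by (auto simp: R_def)
      then have "\<forall>w\<in>sphere 0 1. f w + g w = Re (poly (p + q) w)" by simp
      then show ?thesis unfolding R_def by blast
    qed
    show "(\<lambda>x. f x * g x) \<in> R" if fg: "f \<in> R" "g \<in> R" for f g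
    proof -
      obtain p q where p: "\<forall>w\<in>sphere 0 1. f w = Re (poly p w)" and q: "\<forall>w\<in>sphere 0 1. g w = Re (poly q w)"
        using fg by (auto simp: R_def)
      obtain r where r: "\<And>w. cmod w = 1 \<Longrightarrow> Re (poly p w * cnj (poly q w)) = Re (poly r w)"
        using Re_mult_cnj_poly_circle[of p q] by blast
      have "f w * g w = Re (poly (smult (1/2) (p * q + r)) w)" if w: "w \<in> sphere 0 1" for w
      proof -
        have "2 * (f w * g w) = Re (poly p w * poly q w) + Re (poly p w * cnj (poly q w))"
          using p q w by simp
        also have "\<dots> = Re (poly (p * q + r) w)" using r[of w] w by simp
        finally have "f w * g w = Re (poly (p * q + r) w) / 2" by simp
        then show ?thesis by (simp add: field_simps)
      qed
      then show ?thesis unfolding R_def by blast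
    qed
    show "(\<lambda>_. c) \<in> R" for c
      unfolding R_def by (rule CollectI, rule exI[of _ "[:of_real c:]"]) simp
    show "\<exists>f\<in>R. f x \<noteq> f y" if "x \<in> sphere 0 1" "y \<in> sphere 0 1" "x \<noteq> y" for x y
    proof -
      have "Re \<in> R" unfolding R_def by (rule CollectI, rule exI[of _ "[:0,1:]"]) simp
      moreover have "Im \<in> R" unfolding R_def by (rule CollectI, rule exI[of _ "[:0,-\<i>:]"]) simp
      ultimately show ?thesis using that(3) complex_eq_iff by blast
    qed
  qed
  obtain f where "f \<in> R" and f: "\<forall>x\<in>sphere 0 1. \<bar>\<psi> x - f x\<bar> < e"
    using Stone_Weierstrass_basic[OF assms] by blast
  then obtain p where "\<forall>w\<in>sphere 0 1. f w = Re (poly p w)" by (auto simp: R_def)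
  with f show thesis by (intro that[of p]) simp
qed

lemma Re_poly_ge_disc:
  fixes p :: "complex poly"
  assumes "\<And>w. cmod w = 1 \<Longrightarrow> e \<le> Re (poly p w)" and "cmod w \<le> 1"
  shows "e \<le> Re (poly p w)"
proof -
  have "cmod (exp (- poly p w)) \<le> exp (- e)"
  proof (rule maximum_modulus_frontier[of "\<lambda>w. exp (- poly p w)" "cball 0 1"])
    show "(\<lambda>w. exp (- poly p w)) holomorphic_on interior (cball 0 1)" by (intro holomorphic_intros)
    show "continuous_on (closure (cball 0 1)) (\<lambda>w. exp (- poly p w))" by (intro continuous_intros)
  qed (use assms in \<open>auto simp: norm_exp_eq_Re\<close>)
  then show ?thesis by (simp add: norm_exp_eq_Re)
qed

text \<open>Harnack's inequality. The Cayley transform \<open>(p - c) / (p + cnj c)\<close> with \<open>c = p(0)\<close> maps the disc into itself and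
vanishes at 0, so Schwarz' lemma applies to it.\<close>

lemma Harnack_Re_poly:
  fixes p :: "complex poly"
  assumes pos: "\<And>w. cmod w = 1 \<Longrightarrow> e \<le> Re (poly p w)" and e: "0 < e" and w: "cmod w < 1"
  shows "Re (poly p w) \<le> 2 / (1 - cmod w) * Re (poly p 0)"
proof -
  define c where "c = poly p 0"
  define a where "a = Re c"
  have re: "e \<le> Re (poly p z)" if "cmod z < 1" for z
    using Re_poly_ge_disc[OF pos, of z] that by simp
  have a: "0 < a" using re[of 0] e by (simp add: a_def c_def)
  have nz: "poly p z + cnj c \<noteq> 0" if "cmod z < 1" for z
  proof
    assume "poly p z + cnj c = 0"
    then have "Re (poly p z) + a = 0" unfolding a_def by (metis cnj.sel(1) plus_complex.sel(1) zero_complex.sel(1))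
    then show False using re[OF that] e a by simp
  qed
  define q where "q = (\<lambda>z. (poly p z - c) / (poly p z + cnj c))"
  have "cmod (q w) \<le> cmod w"
  proof (rule Schwarz_Lemma(1))
    show "q holomorphic_on ball 0 1" unfolding q_def by (intro holomorphic_intros) (use nz in auto)
    show "q 0 = 0" by (simp add: q_def c_def)
    show "cmod (q z) < 1" if z: "cmod z < 1" for z
    proof -
      have "(cmod (poly p z + cnj c))\<^sup>2 - (cmod (poly p z - c))\<^sup>2 = 4 * Re (poly p z) * a"
        unfolding cmod_power2 a_def by (simp add: power2_eq_square algebra_simps)
      moreover have "0 < 4 * Re (poly p z) * a" using re[OF z] e a by simp
      ultimately have "(cmod (poly p z - c))\<^sup>2 < (cmod (poly p z + cnj c))\<^sup>2" by linarith
      then have "cmod (poly p z - c) < cmod (poly p z + cnj c)" by (rule power2_less_imp_less) simp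
      then show ?thesis using nz[OF z] by (simp add: q_def norm_divide)
    qed
  qed (use w in auto)
  then have le: "cmod (poly p w - c) \<le> cmod w * cmod (poly p w + cnj c)"
    using nz[OF w] by (simp add: q_def norm_divide field_simps)
  define s where "s = poly p w - \<i> * of_real (Im c)"
  have c': "c = of_real a + \<i> * of_real (Im c)" by (simp add: a_def complex_eq_iff)
  have "poly p w - c = s - of_real a" "poly p w + cnj c = s + of_real a"
    unfolding s_def a_def by (simp_all add: complex_eq_iff)
  with le have le2: "cmod (s - of_real a) \<le> cmod w * cmod (s + of_real a)" by simp
  have "cmod s - a \<le> cmod (s - of_real a)" using norm_triangle_ineq2[of s "of_real a"] a by simp
  also have "\<dots> \<le> cmod w * (cmod s + a)"
  proof -
    have "cmod (s + of_real a) \<le> cmod s + a" using norm_triangle_ineq[of s "of_real a"] a by simp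
    then have "cmod w * cmod (s + of_real a) \<le> cmod w * (cmod s + a)" by (rule mult_left_mono) simp
    with le2 show ?thesis by linarith
  qed
  finally have "cmod s * (1 - cmod w) \<le> a * (1 + cmod w)" by (simp add: algebra_simps)
  also have "\<dots> \<le> a * 2" using a w by simp
  finally have "cmod s \<le> 2 / (1 - cmod w) * a" using w by (simp add: field_simps)
  moreover have "Re (poly p w) = Re s" by (simp add: s_def)
  ultimately show ?thesis using complex_Re_le_cmod[of s] by (simp add: a_def c_def)
qed

text \<open>A quotient \<open>g = u / v\<close> of functions bounded by 1 grows at most like the exponential of a multiple of
\<open>1 / (1 - |w|)\<close>. Indeed \<open>- ln |v|\<close> on the circle dominates \<open>ln |g|\<close>; a polynomial \<open>p\<close> whose real part is slightly
above it dominates \<open>ln |g|\<close> inside as well, while \<open>Re p(0)\<close> is at most about \<open>- ln |v(0)|\<close>; Harnack's inequality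
compares \<open>Re p(w)\<close> to \<open>Re p(0)\<close>.\<close>

lemma quotient_bound_unit_disc_aux:
  assumes hol: "v holomorphic_on ball 0 r" "g holomorphic_on ball 0 r" and r: "1 < r"
    and v1: "\<And>z. cmod z = 1 \<Longrightarrow> cmod (v z) \<le> 1"
    and gv: "\<And>z. cmod z = 1 \<Longrightarrow> cmod (g z * v z) \<le> 1"
    and v0: "v 0 \<noteq> 0" and w: "cmod w < 1"
  shows "cmod (g w) \<le> exp (2 / (1 - cmod w) * (- ln (cmod (v 0))))"
proof -
  define K where "K = 2 / (1 - cmod w)"
  have K: "0 < K" using w by (simp add: K_def)
  have sub: "cball 0 1 \<subseteq> ball (0::complex) r" using r by auto
  have contv: "continuous_on (cball 0 1) v" and contg: "continuous_on (cball 0 1) g"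
    using hol sub holomorphic_on_imp_continuous_on holomorphic_on_subset by blast+
  have "compact (g ` sphere 0 1)"
    by (intro compact_continuous_image continuous_on_subset[OF contg]) auto
  then obtain B where B: "\<And>z. cmod z = 1 \<Longrightarrow> cmod (g z) \<le> B"
    unfolding bounded_iff[THEN iffD1, OF compact_imp_bounded, THEN exE] 
    by (metis (no_types, lifting) bounded_iff compact_imp_bounded image_eqI mem_sphere_0)
  have step: "cmod (g w) \<le> exp (K * (- ln (cmod (v 0)) + 4 * \<epsilon>))" if eps: "0 < \<epsilon>" for \<epsilon>
  proof -
    (* The summand s bounds the logarithm below near the zeroes of v on the circle, and is so
       small that |g|^2 (|v|^2 + s) is at most 1 + \<epsilon> there. *)
    define s where "s = \<epsilon> / (1 + B\<^sup>2)"
    have Bpos: "0 < 1 + B\<^sup>2" by (smt (verit) zero_le_power2)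
    have s: "0 < s" "s \<le> \<epsilon>" "s * B\<^sup>2 \<le> \<epsilon>"
    proof -
      show "0 < s" using eps Bpos by (simp add: s_def)
      show "s \<le> \<epsilon>" unfolding s_def using eps Bpos by (simp add: divide_le_eq)
      have "s * B\<^sup>2 \<le> s * (1 + B\<^sup>2)" using \<open>0 < s\<close> by simp
      also have "\<dots> = \<epsilon>" using Bpos by (simp add: s_def)
      finally show "s * B\<^sup>2 \<le> \<epsilon>" .
    qed
    define \<psi> where "\<psi> z = ln ((1 + \<epsilon>) / ((cmod (v z))\<^sup>2 + s)) / 2" for z
    have dpos: "0 < (cmod (v z))\<^sup>2 + s" for z using s by (smt (verit) zero_le_power2)
    have exp2: "(exp (\<psi> z))\<^sup>2 = (1 + \<epsilon>) / ((cmod (v z))\<^sup>2 + s)" for z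
      using eps dpos[of z] by (simp add: \<psi>_def flip: exp_double)
    have psi0: "0 \<le> \<psi> z" if z: "cmod z = 1" for z
    proof -
      have "(cmod (v z))\<^sup>2 \<le> 1" using v1[OF z] by (simp add: power_le_one)
      then have "1 \<le> (1 + \<epsilon>) / ((cmod (v z))\<^sup>2 + s)" using dpos[of z] s by (simp add: le_divide_eq)
      then show ?thesis by (simp add: \<psi>_def)
    qed
    have psi_g: "cmod (g z) \<le> exp (\<psi> z)" if z: "cmod z = 1" for z
    proof (rule power2_le_imp_le)
      have "(cmod (g z))\<^sup>2 * ((cmod (v z))\<^sup>2 + s) = (cmod (g z * v z))\<^sup>2 + s * (cmod (g z))\<^sup>2"
        by (simp add: norm_mult power_mult_distrib algebra_simps)
      also have "\<dots> \<le> 1 + s * B\<^sup>2"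
        using gv[OF z] B[OF z] s by (intro add_mono mult_left_mono power_mono) (auto simp: power_le_one)
      also have "\<dots> \<le> 1 + \<epsilon>" using s by simp
      finally show "(cmod (g z))\<^sup>2 \<le> (exp (\<psi> z))\<^sup>2" using dpos[of z] by (simp add: exp2 le_divide_eq)
    qed simp
    have "continuous_on (sphere 0 1) \<psi>" unfolding \<psi>_def
      using dpos eps by (intro continuous_intros continuous_on_subset[OF contv]) (auto simp: less_imp_neq[symmetric])
    then have "continuous_on (sphere 0 1) (\<lambda>z. \<psi> z + 2 * \<epsilon>)" by (intro continuous_intros)
    then obtain p where p: "\<And>z. cmod z = 1 \<Longrightarrow> \<bar>\<psi> z + 2 * \<epsilon> - Re (poly p z)\<bar> < \<epsilon>"
      using continuous_on_circle_approx_Re_poly eps by metis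
    have pge: "\<psi> z + \<epsilon> \<le> Re (poly p z)" and ple: "Re (poly p z) \<le> \<psi> z + 3 * \<epsilon>" if "cmod z = 1" for z
      using p[OF that] by linarith+
    have "cmod (g w * exp (- poly p w)) \<le> 1"
    proof (rule maximum_modulus_frontier[of "\<lambda>w. g w * exp (- poly p w)" "cball 0 1"])
      show "(\<lambda>w. g w * exp (- poly p w)) holomorphic_on interior (cball 0 1)"
        using sub by (intro holomorphic_intros holomorphic_on_subset[OF hol(2)]) auto
      show "continuous_on (closure (cball 0 1)) (\<lambda>w. g w * exp (- poly p w))"
        using contg by (intro continuous_intros) auto
      show "cmod (g z * exp (- poly p z)) \<le> 1" if "z \<in> frontier (cball 0 1)" for z
      proof -
        have z: "cmod z = 1" using that by simp
        have "cmod (g z) \<le> exp (Re (poly p z))"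
          using psi_g[OF z] pge[OF z] eps by (smt (verit) exp_le_cancel_iff)
        then have "cmod (g z) * exp (- Re (poly p z)) \<le> exp (Re (poly p z)) * exp (- Re (poly p z))"
          by (rule mult_right_mono) simp
        then show ?thesis by (simp add: norm_mult flip: exp_add)
      qed
    qed (use w in auto)
    then have "cmod (g w) * exp (- Re (poly p w)) * exp (Re (poly p w)) \<le> 1 * exp (Re (poly p w))"
      by (intro mult_right_mono) (auto simp: norm_mult)
    then have gw: "cmod (g w) \<le> exp (Re (poly p w))"
      by (simp only: mult.assoc exp_add[symmetric] add.left_inverse exp_zero mult_1_right mult_1_left)
    have "cmod (v 0 * exp (poly p 0)) \<le> exp (4 * \<epsilon>)"
    proof (rule maximum_modulus_frontier[of "\<lambda>w. v w * exp (poly p w)" "cball 0 1"])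
      show "(\<lambda>w. v w * exp (poly p w)) holomorphic_on interior (cball 0 1)"
        using sub by (intro holomorphic_intros holomorphic_on_subset[OF hol(1)]) auto
      show "continuous_on (closure (cball 0 1)) (\<lambda>w. v w * exp (poly p w))"
        using contv by (intro continuous_intros) auto
      show "cmod (v z * exp (poly p z)) \<le> exp (4 * \<epsilon>)" if "z \<in> frontier (cball 0 1)" for z
      proof -
        have z: "cmod z = 1" using that by simp
        have "cmod (v z) * exp (\<psi> z) \<le> exp \<epsilon>"
        proof (rule power2_le_imp_le)
          have "(cmod (v z) * exp (\<psi> z))\<^sup>2 = (cmod (v z))\<^sup>2 * (1 + \<epsilon>) / ((cmod (v z))\<^sup>2 + s)"
            by (simp add: power_mult_distrib exp2)
          also have "\<dots> \<le> 1 + \<epsilon>" using s eps dpos[of z] by (simp add: divide_le_eq algebra_simps)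
          also have "\<dots> \<le> exp \<epsilon>" by simp
          also have "\<dots> \<le> (exp \<epsilon>)\<^sup>2" using eps by (simp flip: exp_double)
          finally show "(cmod (v z) * exp (\<psi> z))\<^sup>2 \<le> (exp \<epsilon>)\<^sup>2" .
        qed simp
        then have "cmod (v z) * exp (\<psi> z) * exp (3 * \<epsilon>) \<le> exp \<epsilon> * exp (3 * \<epsilon>)" by (rule mult_right_mono) simp
        moreover have "cmod (v z) * exp (Re (poly p z)) \<le> cmod (v z) * exp (\<psi> z) * exp (3 * \<epsilon>)"
          using ple[OF z] by (simp add: mult.assoc mult_left_mono flip: exp_add)
        moreover have "exp \<epsilon> * exp (3 * \<epsilon>) = exp (4 * \<epsilon>)" by (simp flip: exp_add)
        ultimately show ?thesis by (simp add: norm_mult norm_exp_eq_Re)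
      qed
    qed auto
    then have "exp (Re (poly p 0)) \<le> exp (4 * \<epsilon>) / cmod (v 0)"
      using v0 by (simp add: norm_mult norm_exp_eq_Re field_simps)
    also have "\<dots> = exp (4 * \<epsilon> - ln (cmod (v 0)))" using v0 by (simp add: exp_diff)
    finally have p0: "Re (poly p 0) \<le> 4 * \<epsilon> - ln (cmod (v 0))" by simp
    have "Re (poly p w) \<le> K * Re (poly p 0)"
      unfolding K_def by (rule Harnack_Re_poly[of \<epsilon>]) (use pge psi0 eps w in \<open>force+\<close>)
    also have "\<dots> \<le> K * (- ln (cmod (v 0)) + 4 * \<epsilon>)" using p0 K by (intro mult_left_mono) auto
    finally show ?thesis using gw by (smt (verit) exp_le_cancel_iff)
  qed
  have "((\<lambda>\<epsilon>. exp (K * (- ln (cmod (v 0)) + 4 * \<epsilon>))) \<longlongrightarrow> exp (K * (- ln (cmod (v 0)) + 4 * 0))) (at_right 0)"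
    by (intro tendsto_intros)
  moreover have "eventually (\<lambda>\<epsilon>. cmod (g w) \<le> exp (K * (- ln (cmod (v 0)) + 4 * \<epsilon>))) (at_right 0)"
    using eventually_at_right_less by eventually_elim (use step in auto)
  ultimately have "cmod (g w) \<le> exp (K * (- ln (cmod (v 0)) + 4 * 0))"
    by (intro tendsto_lowerbound) auto
  then show ?thesis by (simp add: K_def)
qed

text \<open>The functions need not extend beyond the disc: apply the previous bound on discs of radius \<open>\<rho> < 1\<close> and let
\<open>\<rho>\<close> tend to 1.\<close>

lemma quotient_bound_unit_disc:
  assumes hol: "v holomorphic_on ball 0 1" "g holomorphic_on ball 0 1"
    and v1: "\<And>z. cmod z < 1 \<Longrightarrow> cmod (v z) \<le> 1"
    and gv: "\<And>z. cmod z < 1 \<Longrightarrow> cmod (g z * v z) \<le> 1"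
    and v0: "v 0 \<noteq> 0" and w: "cmod w < 1"
  shows "cmod (g w) \<le> exp (2 / (1 - cmod w) * (- ln (cmod (v 0))))"
proof -
  have step: "cmod (g w) \<le> exp (2 / (1 - cmod w / \<rho>) * (- ln (cmod (v 0))))" if \<rho>: "cmod w < \<rho>" "\<rho> < 1" for \<rho>
  proof -
    have \<rho>0: "0 < \<rho>" using \<rho> norm_ge_zero[of w] by linarith
    have sub: "(\<lambda>z. of_real \<rho> * z) ` ball 0 (1/\<rho>) \<subseteq> ball (0::complex) 1"
      using \<rho>0 by (auto simp: norm_mult field_simps)
    have "cmod ((g \<circ> (\<lambda>z. of_real \<rho> * z)) (w / of_real \<rho>))
       \<le> exp (2 / (1 - cmod (w / of_real \<rho>)) * (- ln (cmod ((v \<circ> (\<lambda>z. of_real \<rho> * z)) 0))))"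
    proof (rule quotient_bound_unit_disc_aux)
      show "v \<circ> (\<lambda>z. of_real \<rho> * z) holomorphic_on ball 0 (1/\<rho>)"
        "g \<circ> (\<lambda>z. of_real \<rho> * z) holomorphic_on ball 0 (1/\<rho>)"
        using sub hol by (auto intro!: holomorphic_on_compose_gen[where t = "ball 0 1"] holomorphic_intros)
    qed (use \<rho> \<rho>0 v1 gv v0 in \<open>auto simp: norm_mult norm_divide\<close>)
    then show ?thesis using \<rho>0 by (simp add: norm_divide)
  qed
  have "((\<lambda>\<rho>. exp (2 / (1 - cmod w / \<rho>) * (- ln (cmod (v 0)))))
      \<longlongrightarrow> exp (2 / (1 - cmod w / 1) * (- ln (cmod (v 0))))) (at_left 1)"
    using w by (intro tendsto_intros) auto
  moreover have "eventually (\<lambda>\<rho>. cmod w < \<rho> \<and> \<rho> < 1) (at_left 1)"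
    using eventually_at_left_real[OF w] by eventually_elim auto
  then have "eventually (\<lambda>\<rho>. cmod (g w) \<le> exp (2 / (1 - cmod w / \<rho>) * (- ln (cmod (v 0))))) (at_left 1)"
    by eventually_elim (use step in auto)
  ultimately show ?thesis
    by (intro tendsto_lowerbound[where F = "at_left 1"]) auto
qed

text \<open>The disc bound is carried to the half-plane by a Moebius map \<open>T\<close> that sends 0 to a point \<open>a\<close> where the denominator
does not vanish; \<open>1 / (1 - |w|)\<close> becomes a multiple of \<open>(1 + |z|\<^sup>2) / Im z\<close>.\<close>

lemma bounded_type_growth:
  assumes "bounded_type G"
  obtains C where "0 \<le> C" "\<And>z. 0 < Im z \<Longrightarrow> cmod (G z) \<le> exp (C * ((1 + (cmod z)\<^sup>2) / Im z))"
proof -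
  obtain u v where hG: "G holomorphic_on upper_half_plane"
    and "bounded (u ` upper_half_plane)"
    and hv: "v holomorphic_on upper_half_plane" and "bounded (v ` upper_half_plane)"
    and "\<exists>z\<in>upper_half_plane. v z \<noteq> 0" and eq: "\<And>z. z \<in> upper_half_plane \<Longrightarrow> v z * G z = u z"
    using assms unfolding bounded_type_def by auto
  then obtain Bu Bv a where Bu: "\<And>z. 0 < Im z \<Longrightarrow> cmod (u z) \<le> Bu"
    and Bv: "\<And>z. 0 < Im z \<Longrightarrow> cmod (v z) \<le> Bv" and a: "0 < Im a" "v a \<noteq> 0"
    unfolding bounded_iff upper_half_plane_def by (auto simp: image_iff) 
  define B where "B = max 1 (max Bu Bv)"
  define T where "T w = (a - cnj a * w) / (1 - w)" for w
  have ImT: "0 < Im (T w)" if w: "cmod w < 1" for w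
  proof -
    have "w \<noteq> 1" using w by auto
    have "Im (T w) = Im a * (1 - (cmod w)\<^sup>2) / (cmod (1 - w))\<^sup>2"
    proof -
      have "Im (T w) = Im ((a - cnj a * w) * cnj (1 - w)) / (cmod (1 - w))\<^sup>2"
        unfolding T_def complex_div_cnj[of _ "1 - w"] Im_divide_of_real[symmetric] by simp
      also have "Im ((a - cnj a * w) * cnj (1 - w)) = Im a * (1 - (cmod w)\<^sup>2)"
        unfolding cmod_power2 by (simp add: power2_eq_square algebra_simps)
      finally show ?thesis .
    qed
    then show ?thesis using a w \<open>w \<noteq> 1\<close> by (simp add: power_less_one_iff abs_square_less_1)
  qed
  have holT: "T holomorphic_on ball 0 1" unfolding T_def by (intro holomorphic_intros) auto
  have holc: "F \<circ> T holomorphic_on ball 0 1" if "F holomorphic_on upper_half_plane" for F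
    by (rule holomorphic_on_compose_gen[OF holT that]) (use ImT in \<open>auto simp: upper_half_plane_def\<close>)
  define l where "l = - ln (cmod (v a) / B)"
  have B: "1 \<le> B" "Bu \<le> B" "Bv \<le> B" by (auto simp: B_def)
  have l: "0 \<le> l" using a Bv[of a] B by (simp add: l_def)
  define C where "C = l * (2 + 2 * (cmod a)\<^sup>2) / Im a"
  have C: "0 \<le> C" using l a by (simp add: C_def)
  show thesis
  proof (rule that[OF C])
    fix z assume z: "0 < Im z"
    define w where "w = (z - a) / (z - cnj a)"
    have nz: "z - cnj a \<noteq> 0" using z a by (auto simp: complex_eq_iff)
    have diff: "(cmod (z - cnj a))\<^sup>2 - (cmod (z - a))\<^sup>2 = 4 * Im z * Im a"
      unfolding cmod_power2 by (simp add: power2_eq_square algebra_simps)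
    have w1: "1 - (cmod w)\<^sup>2 = 4 * Im z * Im a / (cmod (z - cnj a))\<^sup>2"
      using nz by (simp add: w_def norm_divide power_divide flip: diff) (simp add: field_simps)
    then have "0 < 1 - (cmod w)\<^sup>2" using z a nz by simp
    then have w: "cmod w < 1" by (simp add: abs_square_less_1)
    have Tw: "T w = z"
    proof -
      have "1 - w = (a - cnj a) / (z - cnj a)" "a - cnj a * w = z * (a - cnj a) / (z - cnj a)"
        using nz by (simp_all add: w_def field_simps)
      moreover have "a - cnj a \<noteq> 0" using a by (auto simp: complex_eq_iff)
      ultimately show ?thesis using nz by (simp add: T_def)
    qed
    have "cmod ((G \<circ> T) w) \<le> exp (2 / (1 - cmod w) * (- ln (cmod (((\<lambda>z. v z / of_real B) \<circ> T) 0))))"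
    proof (rule quotient_bound_unit_disc)
      show "(\<lambda>z. v z / of_real B) \<circ> T holomorphic_on ball 0 1"
        using B by (intro holc holomorphic_intros hv) auto
      show "G \<circ> T holomorphic_on ball 0 1" by (rule holc[OF hG])
      show "cmod (((\<lambda>z. v z / of_real B) \<circ> T) x) \<le> 1" if "cmod x < 1" for x
        using Bv[OF ImT[OF that]] B by (simp add: norm_divide)
      show "cmod ((G \<circ> T) x * ((\<lambda>z. v z / of_real B) \<circ> T) x) \<le> 1" if "cmod x < 1" for x
        using Bu[OF ImT[OF that]] B eq[of "T x"] ImT[OF that]
        by (simp add: norm_divide upper_half_plane_def mult.commute flip: norm_mult)
    qed (use a B w in \<open>auto simp: T_def\<close>)
    then have "cmod (G z) \<le> exp (2 / (1 - cmod w) * l)"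
      using B by (simp add: Tw l_def) (simp add: T_def norm_divide)
    also have "2 / (1 - cmod w) * l \<le> C * ((1 + (cmod z)\<^sup>2) / Im z)"
    proof -
      have "1 - (cmod w)\<^sup>2 \<le> 2 * (1 - cmod w)"
        using zero_le_power2[of "cmod w - 1"] by (simp add: power2_eq_square algebra_simps)
      have "2 / (1 - cmod w) \<le> (cmod (z - cnj a))\<^sup>2 / (Im z * Im a)"
        using \<open>1 - (cmod w)\<^sup>2 \<le> 2 * (1 - cmod w)\<close> w1 w z a nz by (simp add: field_simps)
      also have "\<dots> \<le> ((2 + 2 * (cmod a)\<^sup>2) * (1 + (cmod z)\<^sup>2)) / (Im z * Im a)"
      proof (rule divide_right_mono)
        have "cmod (z - cnj a) \<le> cmod z + cmod a" using norm_triangle_ineq4[of z "cnj a"] by simp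
        then have "(cmod (z - cnj a))\<^sup>2 \<le> (cmod z + cmod a)\<^sup>2" by (rule power_mono) simp
        also have "\<dots> \<le> 2 * (cmod z)\<^sup>2 + 2 * (cmod a)\<^sup>2"
          using zero_le_power2[of "cmod z - cmod a"] by (simp add: power2_eq_square algebra_simps)
        also have "\<dots> \<le> (2 + 2 * (cmod a)\<^sup>2) * (1 + (cmod z)\<^sup>2)" by (simp add: algebra_simps)
        finally show "(cmod (z - cnj a))\<^sup>2 \<le> (2 + 2 * (cmod a)\<^sup>2) * (1 + (cmod z)\<^sup>2)" .
      qed (use z a in auto)
      finally have "2 / (1 - cmod w) * l \<le> ((2 + 2 * (cmod a)\<^sup>2) * (1 + (cmod z)\<^sup>2)) / (Im z * Im a) * l"
        using l by (rule mult_right_mono)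
      also have "\<dots> = C * ((1 + (cmod z)\<^sup>2) / Im z)" by (simp add: C_def field_simps)
      finally show ?thesis .
    qed
    finally show "cmod (G z) \<le> exp (C * ((1 + (cmod z)\<^sup>2) / Im z))" by simp
  qed
qed

section \<open>Phragmen-Lindelof principles in the half-plane\<close>

lemma Re_half_plane_kernel:
  "Re (\<i> / (z - of_real a)) = Im z / (cmod (z - of_real a))\<^sup>2"
  by (simp add: Re_divide cmod_power2)

text \<open>On the half-circle the sum of the two kernels with poles \<open>R\<close> and \<open>-R\<close>, multiplied by \<open>R\<^sup>2 Im z\<close>, is exactly
\<open>R\<^sup>2 / Im z\<close>. This harmonic function therefore controls a growth \<open>exp (c R\<^sup>2 / Im z)\<close>, which blows up at both
ends of the arc, although it is only of size \<open>Im z\<close> at a fixed point.\<close>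

lemma sum_inverse_squares_on_circle:
  assumes "cmod z = R" "0 < Im z"
  shows "1 / (cmod (z - of_real R))\<^sup>2 + 1 / (cmod (z + of_real R))\<^sup>2 = 1 / (Im z)\<^sup>2"
proof -
  have R2: "(Re z)\<^sup>2 + (Im z)\<^sup>2 = R\<^sup>2" using assms(1) by (simp flip: cmod_power2)
  have a: "(cmod (z - of_real R))\<^sup>2 = 2 * R * (R - Re z)" "(cmod (z + of_real R))\<^sup>2 = 2 * R * (R + Re z)"
    using R2 unfolding cmod_power2 by (simp_all add: power2_eq_square algebra_simps)
  have "(Re z)\<^sup>2 < R\<^sup>2" using R2 zero_less_power[OF assms(2), of 2] by linarith
  moreover have "0 \<le> R" using assms(1) norm_ge_zero[of z] by simp
  ultimately have "\<bar>Re z\<bar> < R" using power2_less_imp_less[of "\<bar>Re z\<bar>" R] by simp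
  then have "0 < R - Re z" "0 < R + Re z" "0 < R" by linarith+
  then have "1 / (2 * R * (R - Re z)) + 1 / (2 * R * (R + Re z)) = 1 / ((R - Re z) * (R + Re z))"
  proof -
    have "1 / (2 * R * p) + 1 / (2 * R * q) = 1 / (p * q)" if "0 < p" "0 < q" "p + q = 2 * R" for p q
    proof -
      have "1 / ((p + q) * p) = q / ((p + q) * (p * q))" "1 / ((p + q) * q) = p / ((p + q) * (p * q))"
        using that by simp_all
      then have "1 / ((p + q) * p) + 1 / ((p + q) * q) = (q + p) / ((p + q) * (p * q))"
        by (simp only: add_divide_distrib)
      also have "\<dots> = 1 / (p * q)" using that by (simp add: add.commute)
      finally show ?thesis using that by simp
    qed
    then show ?thesis using \<open>0 < R - Re z\<close> \<open>0 < R + Re z\<close> by simp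
  qed
  also have "(R - Re z) * (R + Re z) = (Im z)\<^sup>2" using R2 by (simp add: power2_eq_square algebra_simps)
  finally show ?thesis by (simp only: a)
qed

text \<open>The maximum principle is applied on a half-disc of radius \<open>R\<close> to \<open>F exp (- A)\<close>, where \<open>Re A\<close> is the positive harmonic
function given by the two half-plane kernels. On the arc it compensates the permitted growth, and at the fixed
point \<open>z0\<close> it is only \<open>O(c)\<close>, with \<open>c\<close> arbitrarily small.\<close>

lemma Phragmen_Lindelof_half_plane:
  assumes cont: "continuous_on {z. 0 \<le> Im z} F" and hol: "F holomorphic_on {z. 0 < Im z}"
    and B: "0 \<le> B" and real: "\<And>x::real. cmod (F (of_real x)) \<le> B"
    and grow: "\<And>c R0. 0 < c \<Longrightarrow> \<exists>R\<ge>R0. \<forall>z. cmod z = R \<and> 0 < Im z \<longrightarrow> cmod (F z) \<le> B * exp (c * R\<^sup>2 / Im z)"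
    and z0: "0 < Im z0"
  shows "cmod (F z0) \<le> B"
proof -
  have step: "cmod (F z0) \<le> (B + c) * exp (32 * c * Im z0)" if c: "0 < c" for c
  proof -
    obtain R where R: "2 * cmod z0 + 1 \<le> R"
      and gr: "\<And>z. cmod z = R \<Longrightarrow> 0 < Im z \<Longrightarrow> cmod (F z) \<le> B * exp (c * R\<^sup>2 / Im z)"
      using grow[OF c] by blast
    have R0: "0 < R" "cmod z0 < R" using R norm_ge_zero[of z0] by linarith+
    define S where "S = cball 0 R \<inter> {z. 0 \<le> Im z}"
    have near: "\<exists>r>0. \<forall>z. 0 \<le> Im z \<and> dist z (of_real x) < r \<longrightarrow> cmod (F z) \<le> B + c" for x :: real
    proof -
      have "continuous (at (of_real x) within {z. 0 \<le> Im z}) F"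
        using cont by (simp add: continuous_on_eq_continuous_within)
      then obtain r where "0 < r" and r: "\<And>z. 0 \<le> Im z \<Longrightarrow> dist z (of_real x) < r \<Longrightarrow> dist (F z) (F (of_real x)) < c"
        unfolding continuous_within_eps_delta using c by (metis mem_Collect_eq)
      have "cmod (F z) \<le> B + c" if "0 \<le> Im z" "dist z (of_real x) < r" for z
        using r[OF that] real[of x] norm_triangle_ineq2[of "F z" "F (of_real x)"] by (simp add: dist_norm)
      then show ?thesis using \<open>0 < r\<close> by blast
    qed
    obtain r1 where r1: "0 < r1" "\<And>z. 0 \<le> Im z \<Longrightarrow> dist z (of_real R) < r1 \<Longrightarrow> cmod (F z) \<le> B + c"
      using near[of R] by blast
    obtain r2 where r2: "0 < r2" "\<And>z. 0 \<le> Im z \<Longrightarrow> dist z (of_real (-R)) < r2 \<Longrightarrow> cmod (F z) \<le> B + c"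
      using near[of "-R"] by blast
    define r where "r = min r1 r2"
    have r: "0 < r" using r1 r2 by (simp add: r_def)
    (* The poles are moved out from R and -R by r. On the part of the arc that is farther than r from
       both ends this costs at most the factor 4; on the rest of it F is close to its values on the line. *)
    define P where "P = R + r"
    define A where "A z = of_real (4 * c * R\<^sup>2) * (\<i> / (z - of_real P) + \<i> / (z - of_real (-P)))" for z
    have nz: "z - of_real P \<noteq> 0" "z - of_real (-P) \<noteq> 0" if "cmod z \<le> R" for z
    proof -
      have "z \<noteq> of_real x" if "\<bar>x\<bar> = P" for x :: real
        using \<open>cmod z \<le> R\<close> r that by (auto simp: P_def)
      from this[of P] this[of "-P"] show "z - of_real P \<noteq> 0" "z - of_real (-P) \<noteq> 0"
        using r R0 by (simp_all only: P_def abs_minus_cancel abs_of_pos add_pos_pos right_minus_eq simp_thms)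
    qed
    have ReA: "Re (A z) = 4 * c * R\<^sup>2 * Im z * (1 / (cmod (z - of_real P))\<^sup>2 + 1 / (cmod (z - of_real (-P)))\<^sup>2)" for z
      unfolding A_def times_complex.sel plus_complex.sel Re_half_plane_kernel Re_complex_of_real Im_complex_of_real
      by (simp add: algebra_simps)
    have ReA0: "0 \<le> Re (A z)" if "0 \<le> Im z" for z using that c by (simp add: ReA)
    have contA: "continuous_on S A" unfolding A_def S_def
      by (intro continuous_intros) (use nz in auto)
    have contF: "continuous_on S F" unfolding S_def by (rule continuous_on_subset[OF cont]) auto
    have clS: "closed S" unfolding S_def by (intro closed_Int closed_cball closed_halfspace_Im_ge)
    have intS: "interior S \<subseteq> cball 0 R \<inter> {z. 0 < Im z}"
    proof
      fix z assume z: "z \<in> interior S"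
      then obtain e where e: "0 < e" "ball z e \<subseteq> S" by (auto simp: mem_interior)
      define w where "w = Complex (Re z) (Im z - e / 2)"
      have "z - w = \<i> * of_real (e / 2)" by (simp add: w_def complex_eq_iff)
      then have "cmod (z - w) = e / 2" using e by (simp only: norm_mult norm_of_real) simp
      then have "w \<in> ball z e" using e by (simp add: dist_norm)
      with e have "0 \<le> Im w" unfolding S_def by blast
      then have "0 < Im z" using e by (simp add: w_def)
      then show "z \<in> cball 0 R \<inter> {z. 0 < Im z}"
        using interior_subset[of S] z e by (auto simp: S_def)
    qed
    have holA: "A holomorphic_on interior S" unfolding A_def
      by (intro holomorphic_intros) (use nz intS in auto)
    have "cmod (F z0 * exp (- A z0)) \<le> B + c"
    proof (rule maximum_modulus_frontier[of "\<lambda>z. F z * exp (- A z)" S])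
      show "(\<lambda>z. F z * exp (- A z)) holomorphic_on interior S"
        using intS by (intro holomorphic_intros holA holomorphic_on_subset[OF hol]) auto
      show "continuous_on (closure S) (\<lambda>z. F z * exp (- A z))"
        using clS contA contF by (auto intro!: continuous_intros)
      show "bounded S" unfolding S_def by (simp add: bounded_Int)
      show "z0 \<in> S" using z0 R0 by (auto simp: S_def)
      show "cmod (F z * exp (- A z)) \<le> B + c" if z: "z \<in> frontier S" for z
      proof -
        have zS: "z \<in> S" using z clS by (simp add: frontier_def)
        have Im0: "0 \<le> Im z" and zR: "cmod z \<le> R" using zS by (auto simp: S_def)
        have "ball 0 R \<inter> {z. 0 < Im z} \<subseteq> interior S"
          by (rule interior_maximal) (auto simp: S_def intro!: open_Int open_halfspace_Im_gt)
        moreover have "z \<notin> interior S" using z by (simp add: frontier_def)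
        ultimately have "\<not> (cmod z < R \<and> 0 < Im z)" by (metis Int_iff mem_Collect_eq mem_ball_0 subsetD)
        then have "Im z = 0 \<or> cmod z = R" using Im0 zR by linarith
        have le1: "cmod (F z * exp (- A z)) \<le> cmod (F z)"
          using ReA0[OF Im0] by (simp add: norm_mult mult_left_le)
        consider "Im z = 0" | "0 < Im z" "cmod z = R" "dist z (of_real R) < r \<or> dist z (of_real (-R)) < r"
          | "0 < Im z" "cmod z = R" "r \<le> dist z (of_real R)" "r \<le> dist z (of_real (-R))"
          using \<open>Im z = 0 \<or> cmod z = R\<close> Im0 by (cases "Im z = 0") force+
        then show ?thesis
        proof cases
          case 1
          then have "z = of_real (Re z)" by (simp add: complex_eq_iff)
          then have "cmod (F z) \<le> B" using real by metis
          then show ?thesis using le1 c by linarith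
        next
          case 2
          then have "cmod (F z) \<le> B + c" using r1(2) r2(2) Im0 by (auto simp: r_def)
          then show ?thesis using le1 by linarith
        next
          case 3
          have half: "1 / (cmod (z - of_real x))\<^sup>2 \<le> 4 / (cmod (z - of_real y))\<^sup>2"
            if "cmod (z - of_real y) \<le> cmod (z - of_real x) + r" "r \<le> cmod (z - of_real x)" "z - of_real y \<noteq> 0" for x y :: real
          proof -
            have "(cmod (z - of_real y))\<^sup>2 \<le> (2 * cmod (z - of_real x))\<^sup>2"
              using that by (intro power_mono) auto
            moreover have "0 < (cmod (z - of_real x))\<^sup>2" using that r by auto
            moreover have "0 < (cmod (z - of_real y))\<^sup>2" using that by simp
            ultimately show ?thesis by (simp add: field_simps)
          qed
          have "1 / (cmod (z - of_real R))\<^sup>2 \<le> 4 / (cmod (z - of_real P))\<^sup>2"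
            using 3 nz[OF zR] norm_triangle_ineq4[of "z - of_real R" "of_real r"] r
            by (intro half) (auto simp: dist_norm P_def algebra_simps)
          moreover have "1 / (cmod (z - of_real (-R)))\<^sup>2 \<le> 4 / (cmod (z - of_real (-P)))\<^sup>2"
            using 3 nz[OF zR] norm_triangle_ineq[of "z + of_real R" "of_real r"] r
            by (intro half) (auto simp: dist_norm P_def algebra_simps)
          ultimately have "1 / (Im z)\<^sup>2 \<le> 4 * (1 / (cmod (z - of_real P))\<^sup>2 + 1 / (cmod (z - of_real (-P)))\<^sup>2)"
            using sum_inverse_squares_on_circle[OF 3(2,1)] by simp
          then have "c * R\<^sup>2 * Im z * (1 / (Im z)\<^sup>2) \<le> c * R\<^sup>2 * Im z * (4 * (1 / (cmod (z - of_real P))\<^sup>2 + 1 / (cmod (z - of_real (-P)))\<^sup>2))"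
            using c 3 by (intro mult_left_mono) auto
          also have "\<dots> = Re (A z)" by (simp add: ReA)
          finally have "c * R\<^sup>2 / Im z \<le> Re (A z)" using 3 by (simp add: power2_eq_square)
          then have "B * exp (c * R\<^sup>2 / Im z) \<le> B * exp (Re (A z))" using B by (simp add: mult_left_mono)
          then have "cmod (F z) \<le> B * exp (Re (A z))" using gr[OF 3(2,1)] by linarith
          then have "cmod (F z) * exp (- Re (A z)) \<le> B * exp (Re (A z)) * exp (- Re (A z))"
            by (rule mult_right_mono) simp
          then have "cmod (F z * exp (- A z)) \<le> B" by (simp add: norm_mult mult.assoc flip: exp_add)
          then show ?thesis using c by linarith
        qed
      qed
    qed
    then have "cmod (F z0) * exp (- Re (A z0)) * exp (Re (A z0)) \<le> (B + c) * exp (Re (A z0))"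
      by (intro mult_right_mono) (auto simp: norm_mult)
    then have F: "cmod (F z0) \<le> (B + c) * exp (Re (A z0))" by (simp add: mult.assoc flip: exp_add)
    have far: "1 / (cmod (z0 - of_real x))\<^sup>2 \<le> 4 / R\<^sup>2" if "\<bar>x\<bar> = P" for x :: real
    proof -
      have "R / 2 \<le> cmod (z0 - of_real x)"
        using norm_triangle_ineq3[of "z0" "of_real x"] R R0 r that by (simp add: P_def)
      then have "(R / 2)\<^sup>2 \<le> (cmod (z0 - of_real x))\<^sup>2" using R0 by (intro power_mono) auto
      moreover have "0 < (R / 2)\<^sup>2" using R0 by simp
      ultimately have "1 / (cmod (z0 - of_real x))\<^sup>2 \<le> 1 / (R / 2)\<^sup>2" by (intro divide_left_mono mult_pos_pos) auto
      then show ?thesis by (simp add: power_divide)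
    qed
    have "1 / (cmod (z0 - of_real P))\<^sup>2 + 1 / (cmod (z0 - of_real (-P)))\<^sup>2 \<le> 4 / R\<^sup>2 + 4 / R\<^sup>2"
      using R0 r by (intro add_mono far) (auto simp: P_def)
    then have "Re (A z0) \<le> 4 * c * R\<^sup>2 * Im z0 * (4 / R\<^sup>2 + 4 / R\<^sup>2)"
      unfolding ReA using c z0 by (intro mult_left_mono) auto
    also have "\<dots> = 32 * c * Im z0" using R0 by simp
    finally have "(B + c) * exp (Re (A z0)) \<le> (B + c) * exp (32 * c * Im z0)"
      using B c by (intro mult_left_mono) auto
    with F show ?thesis by linarith
  qed
  have "((\<lambda>c. (B + c) * exp (32 * c * Im z0)) \<longlongrightarrow> (B + 0) * exp (32 * 0 * Im z0)) (at_right 0)"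
    by (intro tendsto_intros)
  moreover have "eventually (\<lambda>c. cmod (F z0) \<le> (B + c) * exp (32 * c * Im z0)) (at_right 0)"
    using eventually_at_right_less by eventually_elim (use step in auto)
  ultimately have "cmod (F z0) \<le> (B + 0) * exp (32 * 0 * Im z0)" by (intro tendsto_lowerbound) auto
  then show ?thesis by simp
qed

lemma isCont_csqrt_0: "isCont csqrt 0"
proof -
  have "((\<lambda>z. sqrt (cmod z)) \<longlongrightarrow> sqrt (cmod 0)) (at 0)" by (intro tendsto_intros)
  then have "((\<lambda>z. cmod (csqrt z)) \<longlongrightarrow> 0) (at 0)" by simp
  then have "(csqrt \<longlongrightarrow> 0) (at 0)" by (rule tendsto_norm_zero_cancel)
  then show ?thesis by (simp add: isCont_def)
qed

text \<open>The square root maps the half-plane onto the quadrant and halves the order of growth, which turns the exponent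
\<open>O(|z|\<^sup>3 / (Re z Im z))\<close> into \<open>o(|\<zeta>|\<^sup>2 / Im \<zeta>)\<close>. The hypothesis on the growth is symmetric in the two axes, so
that it holds on both quadrants for a function whose growth is bounded by \<open>exp (C (1 + |z|\<^sup>2) / Im z)\<close>.\<close>

lemma Phragmen_Lindelof_quadrant:
  assumes cont: "continuous_on {z. 0 \<le> Re z \<and> 0 \<le> Im z} F"
    and hol: "F holomorphic_on {z. 0 < Re z \<and> 0 < Im z}"
    and B: "1 \<le> B" and real: "\<And>x. 0 \<le> x \<Longrightarrow> cmod (F (of_real x)) \<le> B"
    and imag: "\<And>y. 0 \<le> y \<Longrightarrow> cmod (F (\<i> * of_real y)) \<le> B"
    and C: "0 \<le> C"
    and grow: "\<And>z. 0 < Re z \<Longrightarrow> 0 < Im z \<Longrightarrow> cmod (F z) \<le> exp (C * ((1 + (cmod z)\<^sup>2) * cmod z / (Re z * Im z)))"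
    and z0: "0 < Re z0" "0 < Im z0"
  shows "cmod (F z0) \<le> B"
proof -
  define s where "s \<zeta> = (1 + \<i>) / of_real (sqrt 2) * csqrt (- \<i> * \<zeta>)" for \<zeta>
  have c2: "((1 + \<i>) / complex_of_real (sqrt 2))\<^sup>2 = \<i>"
    by (simp add: power_divide power2_eq_square complex_eq_iff Re_divide Im_divide algebra_simps)
  have sq: "(s \<zeta>)\<^sup>2 = \<zeta>" for \<zeta>
    unfolding s_def power_mult_distrib c2 power2_csqrt by simp
  have norms: "(cmod (s \<zeta>))\<^sup>2 = cmod \<zeta>" for \<zeta> by (metis norm_power sq)
  have quad: "0 \<le> Re (s \<zeta>) \<and> 0 \<le> Im (s \<zeta>)" if "0 \<le> Im \<zeta>" for \<zeta>
  proof -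
    define q where "q = csqrt (- \<i> * \<zeta>)"
    have "Re (q\<^sup>2) = Im \<zeta>" by (simp add: q_def)
    then have "(Im q)\<^sup>2 \<le> (Re q)\<^sup>2" using that by (simp add: power2_eq_square)
    then have "\<bar>Im q\<bar> \<le> Re q" using Re_csqrt[of "- \<i> * \<zeta>"] by (metis abs_le_square_iff abs_of_nonneg q_def)
    moreover have "Re (s \<zeta>) = (Re q - Im q) / sqrt 2" "Im (s \<zeta>) = (Re q + Im q) / sqrt 2"
      unfolding s_def q_def[symmetric] by (simp_all add: Re_divide Im_divide power2_eq_square field_simps)
    ultimately show ?thesis by auto
  qed
  have Im_s: "Im \<zeta> = 2 * Re (s \<zeta>) * Im (s \<zeta>)" for \<zeta>
    using arg_cong[OF sq[of \<zeta>], of Im] by (simp add: power2_eq_square mult.commute)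
  have quad': "0 < Re (s \<zeta>) \<and> 0 < Im (s \<zeta>)" if "0 < Im \<zeta>" for \<zeta>
  proof -
    have "0 \<noteq> 2 * Re (s \<zeta>) * Im (s \<zeta>)" using Im_s[of \<zeta>] that by linarith
    then show ?thesis using quad[of \<zeta>] that by (auto simp: less_le)
  qed
  have conts: "continuous_on {\<zeta>. 0 \<le> Im \<zeta>} s"
  proof -
    have "isCont csqrt w" if "0 \<le> Re w" for w
    proof (cases "w = 0")
      case False
      then have "w \<notin> \<real>\<^sub>\<le>\<^sub>0" using that by (auto simp: complex_nonpos_Reals_iff complex_eq_iff)
      then show ?thesis by (rule continuous_at_csqrt)
    qed (simp add: isCont_csqrt_0)
    then have "continuous_on {w. 0 \<le> Re w} csqrt"
      by (intro continuous_at_imp_continuous_on) auto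
    then have "continuous_on {\<zeta>. 0 \<le> Im \<zeta>} (\<lambda>\<zeta>. csqrt (- \<i> * \<zeta>))"
      by (rule continuous_on_compose2) (auto intro!: continuous_intros)
    then show ?thesis unfolding s_def by (intro continuous_intros) auto
  qed
  have hols: "s holomorphic_on {\<zeta>. 0 < Im \<zeta>}" unfolding s_def
    by (intro holomorphic_intros) (auto simp: complex_nonpos_Reals_iff)
  define w where "w = z0\<^sup>2"
  have Imw: "0 < Im w" using z0 by (simp add: w_def power2_eq_square)
  have sw: "s w = z0"
  proof -
    have "(s w - z0) * (s w + z0) = 0" using sq[of w] by (simp add: w_def power2_eq_square algebra_simps)
    moreover have "s w + z0 \<noteq> 0" using quad'[OF Imw] z0 by (auto simp: complex_eq_iff)
    ultimately show ?thesis by simp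
  qed
  have "cmod ((F \<circ> s) w) \<le> B"
  proof (rule Phragmen_Lindelof_half_plane[of "F \<circ> s" B w])
    show "continuous_on {z. 0 \<le> Im z} (F \<circ> s)"
      by (rule continuous_on_compose[OF conts continuous_on_subset[OF cont]]) (use quad in auto)
    show "F \<circ> s holomorphic_on {z. 0 < Im z}"
      by (rule holomorphic_on_compose_gen[OF hols hol]) (use quad' in auto)
    show "0 \<le> B" using B by simp
    show "cmod ((F \<circ> s) (of_real x)) \<le> B" for x
    proof -
      have "Re (s (of_real x)) = 0 \<or> Im (s (of_real x)) = 0" using Im_s[of "of_real x"] by simp
      then have "s (of_real x) = \<i> * of_real (Im (s (of_real x))) \<or> s (of_real x) = of_real (Re (s (of_real x)))"
        by (auto simp: complex_eq_iff)
      then show ?thesis using quad[of "of_real x"] real imag by (metis Im_complex_of_real comp_apply order_refl)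
    qed
    show "\<exists>R\<ge>R0. \<forall>z. cmod z = R \<and> 0 < Im z \<longrightarrow> cmod ((F \<circ> s) z) \<le> B * exp (c * R\<^sup>2 / Im z)"
      if c: "0 < c" for c R0
    proof -
      (* If |z| = k^2, then s z has modulus k, and the exponent is at most
         C (1 + k^2) k / (Re (s z) Im (s z)), which is below c k^4 / (2 Re (s z) Im (s z)) = c |z|^2 / Im z. *)
      define k where "k = max 1 (max (4 * C / c) R0)"
      have "1 \<le> k" "4 * C / c \<le> k" "R0 \<le> k" by (auto simp: k_def)
      then have k: "1 \<le> k" "4 * C \<le> c * k" "R0 \<le> k"
        using c by (auto simp: pos_divide_le_eq mult.commute)
      have kk: "k \<le> k\<^sup>2" using k by (simp add: power2_eq_square)
      have "cmod ((F \<circ> s) z) \<le> B * exp (c * (k\<^sup>2)\<^sup>2 / Im z)" if z: "cmod z = k\<^sup>2" "0 < Im z" for z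
      proof -
        have nk: "cmod (s z) = k" using norms[of z] z k by (metis norm_ge_zero power2_eq_iff_nonneg order_trans zero_le_one)
        have "C * ((1 + k\<^sup>2) * k) \<le> C * (2 * k\<^sup>2 * k)" using k kk C by (intro mult_left_mono mult_right_mono) auto
        also have "\<dots> = 4 * C * (k^3 / 2)" by (simp add: power2_eq_square power3_eq_cube)
        also have "\<dots> \<le> c * k * (k^3 / 2)" using k by (intro mult_right_mono) auto
        finally have *: "C * ((1 + k\<^sup>2) * k) \<le> c * k^4 / 2" by (simp add: power_numeral_reduce)
        have "cmod (F (s z)) \<le> exp (C * ((1 + k\<^sup>2) * k / (Re (s z) * Im (s z))))"
          using grow[of "s z"] quad'[OF z(2)] by (simp add: nk)
        also have "C * ((1 + k\<^sup>2) * k / (Re (s z) * Im (s z))) \<le> (c * k^4 / 2) / (Re (s z) * Im (s z))"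
          using divide_right_mono[OF *, of "Re (s z) * Im (s z)"] quad'[OF z(2)] by simp
        also have "\<dots> = c * (k\<^sup>2)\<^sup>2 / Im z" unfolding Im_s[of z] by (simp add: field_simps flip: power_mult)
        finally have "cmod (F (s z)) \<le> 1 * exp (c * (k\<^sup>2)\<^sup>2 / Im z)" by simp
        also have "\<dots> \<le> B * exp (c * (k\<^sup>2)\<^sup>2 / Im z)" using B by (intro mult_right_mono) auto
        finally show ?thesis by simp
      qed
      then show ?thesis using k kk by (intro exI[of _ "k\<^sup>2"]) auto
    qed
  qed (rule Imw)
  then show ?thesis by (simp add: sw)
qed

text \<open>The maximum principle for functions of bounded type and nonpositive mean type. Multiplication by
\<open>exp (i \<epsilon> z)\<close> makes the function bounded on the imaginary axis; it is then bounded on both quadrants, and finally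
bounded by its supremum on the real line.\<close>

lemma Phragmen_Lindelof_mean_type:
  assumes cont: "continuous_on {z. 0 \<le> Im z} F" and hol: "F holomorphic_on {z. 0 < Im z}"
    and B: "0 < B" and real: "\<And>x::real. cmod (F (of_real x)) \<le> B"
    and C: "0 \<le> C" and grow: "\<And>z. 0 < Im z \<Longrightarrow> cmod (F z) \<le> exp (C * ((1 + (cmod z)\<^sup>2) / Im z))"
    and mt: "\<And>\<epsilon>. 0 < \<epsilon> \<Longrightarrow> \<exists>K. \<forall>y\<ge>0. cmod (F (\<i> * of_real y)) \<le> K * exp (\<epsilon> * y)"
    and z0: "0 < Im z0"
  shows "cmod (F z0) \<le> B"
proof -
  have step: "cmod (F z0) * exp (- \<epsilon> * Im z0) \<le> B" if eps: "0 < \<epsilon>" for \<epsilon>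
  proof -
    define H where "H z = F z * exp (\<i> * of_real \<epsilon> * z)" for z
    have nH: "cmod (H z) = cmod (F z) * exp (- \<epsilon> * Im z)" for z
      by (simp add: H_def norm_mult)
    obtain K where K: "\<And>y. 0 \<le> y \<Longrightarrow> cmod (F (\<i> * of_real y)) \<le> K * exp (\<epsilon> * y)" using mt[OF eps] by blast
    define B' where "B' = max 1 (max B K)"
    have B': "1 \<le> B'" "B \<le> B'" "K \<le> B'" by (auto simp: B'_def)
    have contH: "continuous_on {z. 0 \<le> Im z} H" unfolding H_def by (intro continuous_intros cont)
    have holH: "H holomorphic_on {z. 0 < Im z}" unfolding H_def by (intro holomorphic_intros hol)
    have HF: "cmod (H z) \<le> cmod (F z)" if "0 \<le> Im z" for z
      using eps that by (simp add: nH mult_left_le)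
    have re: "cmod (H (of_real x)) \<le> B" for x :: real using HF[of "of_real x"] real[of x] by simp
    have im: "cmod (H (\<i> * of_real y)) \<le> B'" if "0 \<le> y" for y
    proof -
      have "cmod (F (\<i> * of_real y)) * exp (- \<epsilon> * y) \<le> K * exp (\<epsilon> * y) * exp (- \<epsilon> * y)"
        using K[OF that] by (rule mult_right_mono) simp
      then show ?thesis using B' by (simp add: nH mult.assoc flip: exp_add)
    qed
    have gr: "cmod (H z) \<le> exp (C * ((1 + (cmod z)\<^sup>2) * cmod z / (\<bar>Re z\<bar> * Im z)))"
      if z: "0 < \<bar>Re z\<bar>" "0 < Im z" for z
    proof -
      have "(1 + (cmod z)\<^sup>2) / Im z * 1 \<le> (1 + (cmod z)\<^sup>2) / Im z * (cmod z / \<bar>Re z\<bar>)"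
        using abs_Re_le_cmod[of z] z by (intro mult_left_mono) (auto simp: field_simps)
      then have "C * ((1 + (cmod z)\<^sup>2) / Im z) \<le> C * ((1 + (cmod z)\<^sup>2) * cmod z / (\<bar>Re z\<bar> * Im z))"
        using C by (intro mult_left_mono) (auto simp: field_simps)
      then show ?thesis using grow[OF z(2)] HF[of z] z by (smt (verit) exp_le_cancel_iff)
    qed
    have bdd: "cmod (H z) \<le> B'" if z: "0 < Im z" for z
    proof -
      consider "Re z = 0" | "0 < Re z" | "Re z < 0" by linarith
      then show ?thesis
      proof cases
        case 1
        then have "z = \<i> * of_real (Im z)" by (simp add: complex_eq_iff)
        then show ?thesis using im z by (metis less_imp_le)
      next
        case 2
        show ?thesis
        proof (rule Phragmen_Lindelof_quadrant[of H B' C])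
          show "continuous_on {z. 0 \<le> Re z \<and> 0 \<le> Im z} H" by (rule continuous_on_subset[OF contH]) auto
          show "H holomorphic_on {z. 0 < Re z \<and> 0 < Im z}" by (rule holomorphic_on_subset[OF holH]) auto
          show "cmod (H (of_real x)) \<le> B'" for x using re[of x] B' by linarith
          show "cmod (H z) \<le> exp (C * ((1 + (cmod z)\<^sup>2) * cmod z / (Re z * Im z)))" if "0 < Re z" "0 < Im z" for z
            using gr[of z] that by simp
        qed (use 2 z B' C im in auto)
      next
        case 3
        have "cmod ((H \<circ> (\<lambda>z. \<i> * z)) (- \<i> * z)) \<le> B'"
        proof (rule Phragmen_Lindelof_quadrant[of "H \<circ> (\<lambda>z. \<i> * z)" B' C])
          show "continuous_on {z. 0 \<le> Re z \<and> 0 \<le> Im z} (H \<circ> (\<lambda>z. \<i> * z))"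
            by (rule continuous_on_compose[OF _ continuous_on_subset[OF contH]]) (auto intro!: continuous_intros)
          show "H \<circ> (\<lambda>z. \<i> * z) holomorphic_on {z. 0 < Re z \<and> 0 < Im z}"
            by (rule holomorphic_on_compose_gen[OF _ holH]) (auto intro!: holomorphic_intros)
          show "cmod ((H \<circ> (\<lambda>z. \<i> * z)) (of_real x)) \<le> B'" if "0 \<le> x" for x using im[OF that] by simp
          show "cmod ((H \<circ> (\<lambda>z. \<i> * z)) (\<i> * of_real y)) \<le> B'" if "0 \<le> y" for y
            using re[of "-y"] B' by simp
          show "cmod ((H \<circ> (\<lambda>z. \<i> * z)) z) \<le> exp (C * ((1 + (cmod z)\<^sup>2) * cmod z / (Re z * Im z)))" if "0 < Re z" "0 < Im z" for z
            using gr[of "\<i> * z"] that by (simp add: norm_mult mult.commute)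
        qed (use 3 z B' C in auto)
        then show ?thesis by simp
      qed
    qed
    have "cmod (H z0) \<le> B"
    proof (rule Phragmen_Lindelof_half_plane[OF contH holH _ re _ z0])
      show "\<exists>R\<ge>R0. \<forall>z. cmod z = R \<and> 0 < Im z \<longrightarrow> cmod (H z) \<le> B * exp (c * R\<^sup>2 / Im z)"
        if c: "0 < c" for c R0
      proof -
        (* H is already bounded by B'; for |z| = R the exponent c R^2 / Im z is at least c R, and it
           absorbs the quotient B' / B. *)
        define R where "R = max 1 (max R0 (ln (B' / B) / c))"
        have R': "1 \<le> R" "R0 \<le> R" "ln (B' / B) / c \<le> R" by (auto simp: R_def)
        then have R: "1 \<le> R" "R0 \<le> R" "ln (B' / B) \<le> c * R"
          using c by (auto simp: pos_divide_le_eq mult.commute)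
        have "cmod (H z) \<le> B * exp (c * R\<^sup>2 / Im z)" if z: "cmod z = R" "0 < Im z" for z
        proof -
          have "Im z \<le> R" using abs_Im_le_cmod[of z] z by linarith
          then have "R \<le> R\<^sup>2 / Im z" using z R by (simp add: field_simps power2_eq_square)
          then have "ln (B' / B) \<le> c * R\<^sup>2 / Im z" using R c by (smt (verit) mult_left_mono times_divide_eq_right)
          then have "exp (ln (B' / B)) \<le> exp (c * R\<^sup>2 / Im z)" by simp
          then have "B' / B \<le> exp (c * R\<^sup>2 / Im z)" using B B' by simp
          then have "B' \<le> B * exp (c * R\<^sup>2 / Im z)" using B by (simp add: field_simps)
          then show ?thesis using bdd[OF z(2)] by linarith
        qed
        then show ?thesis using R by (intro exI[of _ R]) auto
      qed
    qed (use B in auto)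
    then show ?thesis by (simp add: nH)
  qed
  have "((\<lambda>\<epsilon>. cmod (F z0) * exp (- \<epsilon> * Im z0)) \<longlongrightarrow> cmod (F z0) * exp (- 0 * Im z0)) (at_right 0)"
    by (intro tendsto_intros)
  moreover have "eventually (\<lambda>\<epsilon>. cmod (F z0) * exp (- \<epsilon> * Im z0) \<le> B) (at_right 0)"
    using eventually_at_right_less by eventually_elim (use step in auto)
  ultimately have "cmod (F z0) * exp (- 0 * Im z0) \<le> B" by (intro tendsto_upperbound) auto
  then show ?thesis by simp
qed

section \<open>Vanishing of integrals along the real line\<close>

lemma closed_half_plane_facts:
  shows "convex {z. 0 \<le> Im z}" and "closed {z. 0 \<le> Im z}" and "interior {z. 0 \<le> Im z} = {z. 0 < Im z}"
proof -
  have e: "{z. 0 \<le> Im z} = {z. inner \<i> z \<ge> 0}" "{z. 0 < Im z} = {z. inner \<i> z > 0}"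
    by (simp_all add: inner_complex_def)
  show "convex {z. 0 \<le> Im z}" unfolding e by (rule convex_halfspace_ge)
  show "closed {z. 0 \<le> Im z}" unfolding e by (rule closed_halfspace_ge)
  show "interior {z. 0 \<le> Im z} = {z. 0 < Im z}" unfolding e by (rule interior_halfspace_ge) simp
qed

lemma divide_le_self: "a / n \<le> a" if "1 \<le> n" "0 \<le> a" for a n :: real
proof -
  have "a * 1 \<le> a * n" using that by (intro mult_left_mono) auto
  then show ?thesis using that by (simp add: divide_le_eq)
qed

lemma integral_interval_tendsto:
  fixes f :: "real \<Rightarrow> complex"
  assumes "integrable lborel f"
  shows "(\<lambda>n. LINT t|lborel. indicator {- real n..real n} t *\<^sub>R f t) \<longlonglongrightarrow> (LINT t|lborel. f t)"
proof (rule integral_dominated_convergence)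
  show "AE x in lborel. (\<lambda>n. indicator {- real n..real n} x *\<^sub>R f x) \<longlonglongrightarrow> f x"
  proof (rule AE_I2)
    fix x :: real
    obtain N where N: "\<bar>x\<bar> \<le> real N" using real_arch_simple by blast
    have "eventually (\<lambda>n. indicator {- real n..real n} x *\<^sub>R f x = f x) sequentially"
      using eventually_ge_at_top[of N] by eventually_elim (use N in \<open>auto simp: indicator_def\<close>)
    then show "(\<lambda>n. indicator {- real n..real n} x *\<^sub>R f x) \<longlonglongrightarrow> f x" by (rule tendsto_eventually)
  qed
  show "integrable lborel (\<lambda>x. norm (f x))" using assms by simp
qed (use assms in \<open>auto simp: indicator_def\<close>)

text \<open>Cauchy's theorem on half-discs, where the integral over the arc vanishes in the limit.\<close>

lemma integral_real_line_eq_0: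
  assumes cont: "continuous_on {z. 0 \<le> Im z} F" and hol: "F holomorphic_on {z. 0 < Im z}"
    and int: "integrable lborel (\<lambda>t. F (of_real t))"
    and decay: "\<And>e. 0 < e \<Longrightarrow> \<exists>R0. \<forall>z. R0 \<le> cmod z \<and> 0 \<le> Im z \<longrightarrow> cmod z * cmod (F z) \<le> e"
  shows "(LINT t|lborel. F (of_real t)) = 0"
proof -
  define J where "J R = (LINT t|lborel. indicator {- R..R} t *\<^sub>R F (of_real t))" for R :: real
  have J: "cmod (J R) \<le> e * pi" if R: "0 < R" and e: "0 \<le> e" and bd: "\<And>z. cmod z = R \<Longrightarrow> 0 \<le> Im z \<Longrightarrow> cmod z * cmod (F z) \<le> e" for R e
  proof -
    let ?g1 = "linepath (of_real (-R)) (of_real R)"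
    let ?g2 = "part_circlepath 0 R 0 pi"
    have ends: "pathfinish ?g1 = pathstart ?g2" "pathfinish ?g2 = pathstart ?g1"
      by (simp_all add: exp_pi_i')
    have p2: "path_image ?g2 \<subseteq> {z. cmod z = R \<and> 0 \<le> Im z}"
      using R by (auto simp: path_image_part_circlepath norm_mult Im_exp sin_ge_zero)
    have p1: "path_image ?g1 \<subseteq> {z. 0 \<le> Im z}"
      using closed_segment_subset[of "of_real (-R)" "{z. 0 \<le> Im z}" "of_real R"] closed_half_plane_facts(1) by (simp add: path_image_linepath)
    have c: "(F has_contour_integral 0) (?g1 +++ ?g2)"
    proof (rule Cauchy_theorem_convex[OF cont closed_half_plane_facts(1), of "{}"])
      show "F field_differentiable at x" if "x \<in> interior {z. 0 \<le> Im z} - {}" for x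
        using hol that unfolding closed_half_plane_facts(3)
        by (simp add: holomorphic_on_open open_halfspace_Im_gt field_differentiable_def)
      show "path_image (?g1 +++ ?g2) \<subseteq> {z. 0 \<le> Im z}" using p1 p2 by (auto simp: path_image_join_subset dest!: subsetD[OF path_image_join_subset])
    qed (use ends in \<open>auto intro!: valid_path_join\<close>)
    have i1: "F contour_integrable_on ?g1"
      using cont p1 by (intro contour_integrable_continuous_linepath) (auto elim: continuous_on_subset simp: path_image_linepath)
    have i2: "F contour_integrable_on ?g2"
      using cont p2 by (intro contour_integrable_continuous_part_circlepath) (auto elim: continuous_on_subset)
    have "contour_integral ?g1 F + contour_integral ?g2 F = 0"
      using contour_integral_unique[OF c] i1 i2 ends by (subst (asm) contour_integral_join) auto
    then have eq: "cmod (contour_integral ?g1 F) = cmod (contour_integral ?g2 F)"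
      by (metis add_eq_0_iff norm_minus_cancel)
    have "cmod (contour_integral ?g2 F) \<le> (e / R) * R * (pi - 0)"
    proof (rule has_contour_integral_bound_part_circlepath[OF has_contour_integral_integral[OF i2]])
      show "cmod (F x) \<le> e / R" if "x \<in> path_image ?g2" for x
        using bd[of x] p2 that R by (auto simp: field_simps)
    qed (use R e in auto)
    moreover have "contour_integral ?g1 F = integral {-R..R} (\<lambda>x. F (of_real x))"
      using R by (subst contour_integral_linepath_Reals_eq) auto
    moreover have "J R = integral {-R..R} (\<lambda>x. F (of_real x))"
    proof -
      have "set_integrable lborel {-R..R} (\<lambda>x. F (of_real x))"
        unfolding set_integrable_def using int by (intro integrable_mult_indicator) auto
      then show ?thesis unfolding J_def set_lebesgue_integral_def[symmetric]
        by (rule set_borel_integral_eq_integral(2))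
    qed
    ultimately show ?thesis using eq R by simp
  qed
  have "(\<lambda>n. J (real n)) \<longlonglongrightarrow> (LINT t|lborel. F (of_real t))"
    unfolding J_def by (rule integral_interval_tendsto[OF int])
  moreover have "(\<lambda>n. J (real n)) \<longlonglongrightarrow> 0"
  proof (rule LIMSEQ_I)
    fix r :: real assume r: "0 < r"
    then have e: "0 < r / (2 * pi)" by simp
    obtain R0 where R0: "\<And>z. R0 \<le> cmod z \<Longrightarrow> 0 \<le> Im z \<Longrightarrow> cmod z * cmod (F z) \<le> r / (2 * pi)" using decay[OF e] by blast
    obtain N where N: "R0 \<le> real N" using real_arch_simple by blast
    have "norm (J (real n) - 0) < r" if "n \<ge> Suc N" for n
    proof -
      have "cmod (J (real n)) \<le> r / (2 * pi) * pi"
        using that N e by (intro J R0) auto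
      then show ?thesis using r by simp
    qed
    then show "\<exists>no. \<forall>n\<ge>no. norm (J (real n) - 0) < r" by blast
  qed
  ultimately show ?thesis by (rule LIMSEQ_unique)
qed

lemma integral_real_line_tendsto_diff:
  fixes W :: "complex \<Rightarrow> complex"
  assumes W: "\<And>z. 0 \<le> Im z \<Longrightarrow> (W has_field_derivative w z) (at z within {z. 0 \<le> Im z})"
    and int: "integrable lborel (\<lambda>t. w (of_real t))"
  shows "(\<lambda>n. W (of_nat n) - W (- of_nat n)) \<longlonglongrightarrow> (LINT t|lborel. w (of_real t))"
    and "a \<le> b \<Longrightarrow> cmod (W (of_real b) - W (of_real a)) \<le> (LINT t|lborel. cmod (w (of_real t)))"
proof -
  have ftc: "W (of_real b) - W (of_real a) = (LINT t|lborel. indicator {a..b} t *\<^sub>R w (of_real t))" if "a \<le> b" for a b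
  proof -
    have "((\<lambda>t. W (of_real t)) has_vector_derivative w (of_real t)) (at t within {a..b})" for t
    proof -
      have "(W has_field_derivative w (of_real t)) (at (of_real t) within of_real ` {a..b})"
        using W[of "of_real t"] by (rule DERIV_subset) auto
      then have "((W \<circ> of_real) has_vector_derivative 1 * w (of_real t)) (at t within {a..b})"
        by (intro field_vector_diff_chain_within has_vector_derivative_of_real) (auto intro!: derivative_eq_intros)
      then show ?thesis by (simp add: o_def)
    qed
    then have "((\<lambda>t. w (of_real t)) has_integral (W (of_real b) - W (of_real a))) {a..b}"
      by (intro fundamental_theorem_of_calculus that) 
    then have "integral {a..b} (\<lambda>t. w (of_real t)) = W (of_real b) - W (of_real a)" by (rule integral_unique)
    moreover have "set_integrable lborel {a..b} (\<lambda>x. w (of_real x))"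
      unfolding set_integrable_def using int by (intro integrable_mult_indicator) auto
    ultimately show ?thesis
      using set_borel_integral_eq_integral(2)[of "{a..b}" "\<lambda>x. w (of_real x)"] by (simp add: set_lebesgue_integral_def)
  qed
  show "(\<lambda>n. W (of_nat n) - W (- of_nat n)) \<longlonglongrightarrow> (LINT t|lborel. w (of_real t))"
    using integral_interval_tendsto[OF int] ftc[of "- real n" "real n" for n] by simp
  show "a \<le> b \<Longrightarrow> cmod (W (of_real b) - W (of_real a)) \<le> (LINT t|lborel. cmod (w (of_real t)))"
  proof -
    assume "a \<le> b"
    have "cmod (W (of_real b) - W (of_real a)) \<le> (LINT t|lborel. cmod (indicator {a..b} t *\<^sub>R w (of_real t)))"
      unfolding ftc[OF \<open>a \<le> b\<close>] by (rule integral_norm_bound)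
    also have "\<dots> \<le> (LINT t|lborel. cmod (w (of_real t)))"
    proof (rule integral_mono)
      show "integrable lborel (\<lambda>t. cmod (indicator {a..b} t *\<^sub>R w (of_real t)))"
        using int by (intro integrable_norm integrable_mult_indicator) auto
    qed (use int in \<open>auto simp: indicator_def\<close>)
    finally show ?thesis .
  qed
qed

lemma integral_one_over_one_plus_square:
  "integrable lborel (\<lambda>t::real. 1 / (1 + t\<^sup>2))"
  "(LINT t|lborel. 1 / (1 + t\<^sup>2 :: real)) = pi"
proof -
  have "set_integrable lborel (einterval (-\<infinity>) \<infinity>) (\<lambda>x. inverse (1 + x\<^sup>2) :: real)"
    and "(LBINT x=-\<infinity>..\<infinity>. inverse (1 + x\<^sup>2) :: real) = pi"
    by (rule integrable_inverse_1_plus_square, rule LBINT_inverse_1_plus_square)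
  then show "integrable lborel (\<lambda>t::real. 1 / (1 + t\<^sup>2))" "(LINT t|lborel. 1 / (1 + t\<^sup>2 :: real)) = pi"
    by (simp_all add: set_integrable_def interval_lebesgue_integral_def set_lebesgue_integral_def inverse_eq_divide)
qed

text \<open>The integral over the real line of a function of the Hardy class \<open>H\<^sup>1\<close> vanishes. The growth of \<open>Q\<close> off the line is
known only in the weak form that bounded type and mean type give. Its primitive \<open>P\<close> has the same weak growth and
is bounded on the line, hence is bounded. Then, for \<open>\<delta> > 0\<close>, integration by parts moves the derivative to
\<open>1 / (1 - i \<delta> z)\<close>, and Cauchy's theorem applies to \<open>P / (1 - i \<delta> z)\<^sup>2\<close>, which has decay \<open>|z|\<^sup>-\<^sup>2\<close>; let \<open>\<delta>\<close> tend to 0.\<close>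

lemma integral_Hardy_eq_0:
  assumes cont: "continuous_on {z. 0 \<le> Im z} Q" and hol: "Q holomorphic_on {z. 0 < Im z}"
    and int: "integrable lborel (\<lambda>t. Q (of_real t))"
    and C: "0 \<le> C" and grow: "\<And>z. 0 < Im z \<Longrightarrow> cmod (Q z) \<le> exp (C * ((1 + (cmod z)\<^sup>2) / Im z))"
    and mt: "\<And>\<epsilon>. 0 < \<epsilon> \<Longrightarrow> \<exists>K. \<forall>y\<ge>0. cmod (Q (\<i> * of_real y)) \<le> K * exp (\<epsilon> * y)"
  shows "(LINT t|lborel. Q (of_real t)) = 0"
proof -
  let ?H = "{z. 0 \<le> Im z}"
  have fd: "Q field_differentiable at x" if "x \<in> interior ?H - {}" for x
    using hol that unfolding closed_half_plane_facts(3)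
    by (simp add: holomorphic_on_open open_halfspace_Im_gt field_differentiable_def)
  obtain P0 where P0: "\<And>z. z \<in> ?H \<Longrightarrow> (P0 has_field_derivative Q z) (at z within ?H)"
    using holomorphic_convex_primitive[OF closed_half_plane_facts(1) finite.emptyI cont fd] by blast
  define P where "P z = P0 z - P0 0" for z
  have P: "(P has_field_derivative Q z) (at z within ?H)" if "0 \<le> Im z" for z
    unfolding P_def using P0[of z] that by (auto intro!: derivative_eq_intros)
  have [simp]: "P 0 = 0" by (simp add: P_def)
  have contP: "continuous_on ?H P"
    by (rule DERIV_continuous_on[of _ P Q]) (use P in auto)
  have holP: "P holomorphic_on {z. 0 < Im z}"
  proof -
    have "(P has_field_derivative Q z) (at z within {z. 0 < Im z})" if "0 < Im z" for z
      by (rule DERIV_subset[OF P]) (use that in auto)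
    then show ?thesis by (auto simp: holomorphic_on_def field_differentiable_def)
  qed
  have diffbd: "cmod (P b - P a) \<le> B * cmod (b - a)"
    if "0 \<le> Im a" "0 \<le> Im b" "\<And>z. z \<in> closed_segment a b \<Longrightarrow> cmod (Q z) \<le> B" for a b B
  proof (rule field_differentiable_bound[of "closed_segment a b" P Q])
    have sub: "closed_segment a b \<subseteq> ?H"
      using that closed_half_plane_facts(1) by (intro closed_segment_subset) auto
    show "(P has_field_derivative Q z) (at z within closed_segment a b)" if "z \<in> closed_segment a b" for z
      by (rule DERIV_subset[OF P sub]) (use sub that in auto)
  qed (use that in auto)
  define B where "B = (LINT t|lborel. cmod (Q (of_real t))) + 1"
  have Bpos: "0 < B" unfolding B_def
    by (smt (verit) integral_nonneg norm_ge_zero Bochner_Integration.integral_nonneg)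
  have real: "cmod (P (of_real x)) \<le> B" for x
    using integral_real_line_tendsto_diff(2)[OF P int, of 0 x] integral_real_line_tendsto_diff(2)[OF P int, of x 0]
    by (cases "0 \<le> x") (auto simp: B_def)
  have bound: "cmod (P z) \<le> B" if z: "0 < Im z" for z
  proof (rule Phragmen_Lindelof_mean_type[OF contP holP Bpos real _ _ _ z])
    define C' where "C' = cmod (P \<i>) + 2 + 5 * C"
    show "0 \<le> C'" using C by (simp add: C'_def)
    show "cmod (P z) \<le> exp (C' * ((1 + (cmod z)\<^sup>2) / Im z))" if z: "0 < Im z" for z
    proof -
      define X where "X = (1 + (cmod z)\<^sup>2) / Im z"
      have Imz: "Im z \<le> cmod z" using abs_Im_le_cmod[of z] z by linarith
      have cz: "2 * cmod z \<le> 1 + (cmod z)\<^sup>2" using zero_le_power2[of "cmod z - 1"] by (simp add: power2_eq_square algebra_simps)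
      have X1: "1 \<le> X" using Imz cz z by (simp add: X_def)
      (* The primitive is estimated along the segment from \<i> to z, on which
         (1 + |w|^2) / Im w is at most five times its value at z. *)
      have seg: "cmod (Q w) \<le> exp (C * (5 * X))" if w: "w \<in> closed_segment \<i> z" for w
      proof -
        obtain \<tau> where \<tau>: "0 \<le> \<tau>" "\<tau> \<le> 1" and w': "w = (1 - \<tau>) *\<^sub>R \<i> + \<tau> *\<^sub>R z"
          using w by (auto simp: in_segment)
        have Imw: "Im w = (1 - \<tau>) + \<tau> * Im z" by (simp add: w')
        have nw: "cmod w \<le> 1 + \<tau> * cmod z"
          using norm_triangle_ineq[of "(1 - \<tau>) *\<^sub>R \<i>" "\<tau> *\<^sub>R z"] \<tau> by (simp add: w')
        have "(cmod w)\<^sup>2 \<le> (1 + \<tau> * cmod z)\<^sup>2" using nw by (intro power_mono) auto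
        also have "\<dots> \<le> 2 + 2 * (\<tau> * cmod z)\<^sup>2"
          using zero_le_power2[of "\<tau> * cmod z - 1"] by (simp add: power2_eq_square algebra_simps)
        finally have w2: "1 + (cmod w)\<^sup>2 \<le> 3 + 2 * \<tau>\<^sup>2 * (cmod z)\<^sup>2" by (simp add: power_mult_distrib)
        have Xz: "(cmod z)\<^sup>2 \<le> X * Im z" "1 + (cmod z)\<^sup>2 = X * Im z" using z by (auto simp: X_def)
        have t2: "\<tau>\<^sup>2 \<le> \<tau>" "\<tau>\<^sup>2 \<le> 1" using \<tau> by (auto simp: power2_eq_square mult_left_le mult_le_one)
        have "3 + 2 * \<tau>\<^sup>2 * (cmod z)\<^sup>2 \<le> 5 * X * Im w"
        proof (cases "1 \<le> Im z")
          case True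
          have 1: "1 \<le> Im w" using True \<tau> mult_left_mono[of 1 "Im z" \<tau>] by (simp add: Imw)
          have 2: "\<tau> * Im z \<le> Im w" using \<tau> by (simp add: Imw)
          have "2 * \<tau>\<^sup>2 * (cmod z)\<^sup>2 \<le> 2 * \<tau> * (X * Im z)"
            using t2 Xz \<tau> by (intro mult_mono) auto
          also have "\<dots> = 2 * X * (\<tau> * Im z)" by simp
          also have "\<dots> \<le> 2 * X * Im w" using 2 X1 by (intro mult_left_mono) auto
          finally have "2 * \<tau>\<^sup>2 * (cmod z)\<^sup>2 \<le> 2 * X * Im w" .
          moreover have "1 * 1 \<le> X * Im w" using X1 1 by (intro mult_mono) auto
          ultimately show ?thesis by linarith
        next
          case False
          then have 1: "Im z \<le> Im w" using \<tau> mult_left_mono[of "Im z" 1 "1 - \<tau>"] by (simp add: Imw algebra_simps)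
          have "2 * \<tau>\<^sup>2 * (cmod z)\<^sup>2 \<le> 2 * 1 * (cmod z)\<^sup>2" using t2 by (intro mult_right_mono) auto
          then have "3 + 2 * \<tau>\<^sup>2 * (cmod z)\<^sup>2 \<le> 5 * (X * Im z)"
          proof -
            have "3 + A \<le> 5 * (1 + B)" if "A \<le> 2 * 1 * B" "0 \<le> B" for A B :: real using that by simp
            then show ?thesis
              unfolding Xz(2)[symmetric]
              using \<open>2 * \<tau>\<^sup>2 * (cmod z)\<^sup>2 \<le> 2 * 1 * (cmod z)\<^sup>2\<close> zero_le_power2 by blast
          qed
          also have "\<dots> \<le> 5 * (X * Im w)" using 1 X1 by (intro mult_left_mono) auto
          finally show ?thesis by simp
        qed
        moreover have Imw0: "0 < Im w"
          using \<tau> z unfolding Imw by (cases "\<tau> = 1") (auto intro: add_pos_nonneg)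
        ultimately have "(1 + (cmod w)\<^sup>2) / Im w \<le> 5 * X" using w2 by (simp add: pos_divide_le_eq)
        then show ?thesis using grow[OF Imw0] C by (smt (verit) exp_le_cancel_iff mult_left_mono)
      qed
      have "cmod (P z - P \<i>) \<le> exp (C * (5 * X)) * cmod (z - \<i>)"
        using z by (intro diffbd seg) auto
      moreover have "cmod (z - \<i>) \<le> 2 * X"
      proof -
        have "Im z * (1 + cmod z) \<le> (1 + (cmod z)\<^sup>2) * 2"
        proof -
          have "Im z * (1 + cmod z) \<le> cmod z * (1 + cmod z)" using Imz by (intro mult_right_mono) auto
          moreover have "cmod z * (1 + cmod z) = cmod z + (cmod z)\<^sup>2" by (simp add: power2_eq_square distrib_left)
          moreover have "0 \<le> (cmod z)\<^sup>2" by simp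
          moreover have "a \<le> (1 + q) * 2" if "a \<le> b" "b = c + q" "0 \<le> q" "2 * c \<le> 1 + q" for a b c q :: real
            using that by simp
          ultimately show ?thesis using cz by blast
        qed
        then have "1 + cmod z \<le> 2 * X" using z by (simp add: X_def field_simps)
        then show ?thesis using norm_triangle_ineq4[of z \<i>] by simp
      qed
      ultimately have "cmod (P z - P \<i>) \<le> exp (C * (5 * X)) * (2 * X)"
        by (smt (verit) exp_ge_zero mult_left_mono)
      then have "cmod (P z) \<le> cmod (P \<i>) + exp (C * (5 * X)) * (2 * X)"
        using norm_triangle_ineq2[of "P z" "P \<i>"] by linarith
      also have "\<dots> \<le> exp (C * (5 * X)) * cmod (P \<i>) * X + exp (C * (5 * X)) * (2 * X)"
      proof -
        have "cmod (P \<i>) * (1 * 1) \<le> cmod (P \<i>) * (exp (C * (5 * X)) * X)"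
          using C X1 by (intro mult_left_mono mult_mono) auto
        then show ?thesis by (simp add: mult_ac)
      qed
      also have "\<dots> = exp (C * (5 * X)) * ((cmod (P \<i>) + 2) * X)" by (simp add: algebra_simps)
      also have "\<dots> \<le> exp (C * (5 * X)) * exp ((cmod (P \<i>) + 2) * X)"
      proof (rule mult_left_mono)
          show "(cmod (P \<i>) + 2) * X \<le> exp ((cmod (P \<i>) + 2) * X)"
            using exp_ge_add_one_self[of "(cmod (P \<i>) + 2) * X"] by linarith
        qed simp
      also have "\<dots> = exp (C' * X)" by (simp add: C'_def algebra_simps flip: exp_add)
      finally show ?thesis by (simp add: X_def)
    qed
    show "\<exists>K. \<forall>y\<ge>0. cmod (P (\<i> * of_real y)) \<le> K * exp (\<epsilon> * y)" if eps: "0 < \<epsilon>" for \<epsilon>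
    proof -
      obtain K where K: "\<And>y. 0 \<le> y \<Longrightarrow> cmod (Q (\<i> * of_real y)) \<le> K * exp (\<epsilon> / 2 * y)"
        using mt[of "\<epsilon> / 2"] eps by auto
      have K0: "0 \<le> K" using order_trans[OF norm_ge_zero K[of 0]] by simp
      have "cmod (P (\<i> * of_real y)) \<le> (K * (2 / \<epsilon>)) * exp (\<epsilon> * y)" if y: "0 \<le> y" for y
      proof -
        have "cmod (P (\<i> * of_real y) - P 0) \<le> K * exp (\<epsilon> / 2 * y) * cmod (\<i> * of_real y - 0)"
        proof (rule diffbd)
          show "cmod (Q z) \<le> K * exp (\<epsilon> / 2 * y)" if seg: "z \<in> closed_segment 0 (\<i> * of_real y)" for z
          proof -
            obtain u where u: "0 \<le> u" "u \<le> 1" "z = u *\<^sub>R (\<i> * of_real y)" using seg by (auto simp: in_segment)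
            then have z: "z = \<i> * of_real (u * y)" by (simp add: scaleR_conv_of_real)
            have "u * y \<le> y" using u y by (simp add: mult_left_le_one_le)
            then have "K * exp (\<epsilon> / 2 * (u * y)) \<le> K * exp (\<epsilon> / 2 * y)" using K0 eps by (intro mult_left_mono) auto
            then show ?thesis using K[of "u * y"] u y unfolding z by force
          qed
        qed (use y in auto)
        also have "\<dots> = K * exp (\<epsilon> / 2 * y) * (2 / \<epsilon>) * (\<epsilon> / 2 * y)" using y eps by (simp add: norm_mult)
        also have "\<dots> \<le> K * exp (\<epsilon> / 2 * y) * (2 / \<epsilon>) * exp (\<epsilon> / 2 * y)"
        proof (rule mult_left_mono)
          show "\<epsilon> / 2 * y \<le> exp (\<epsilon> / 2 * y)" using exp_ge_add_one_self[of "\<epsilon> / 2 * y"] by linarith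
        qed (use K0 eps in auto)
        also have "\<dots> = K * (2 / \<epsilon>) * (exp (\<epsilon> / 2 * y) * exp (\<epsilon> / 2 * y))" by (simp only: mult_ac)
        also have "\<dots> = K * (2 / \<epsilon>) * exp (\<epsilon> * y)" by (simp flip: exp_add)
        finally show ?thesis by simp
      qed
      then show ?thesis by blast
    qed
  qed
  have bound': "cmod (P z) \<le> B" if "0 \<le> Im z" for z
  proof (cases "Im z = 0")
    case True
    then have "z = of_real (Re z)" by (simp add: complex_eq_iff)
    then show ?thesis using real by metis
  qed (use bound that in auto)
  have delta: "(LINT t|lborel. Q (of_real t) / (1 - \<i> * of_real (\<delta> * t))) = 0" if d: "0 < \<delta>" for \<delta>
  proof -
    have nz: "1 - \<i> * of_real \<delta> * z \<noteq> 0" and ge: "1 + \<delta> * Im z \<le> cmod (1 - \<i> * of_real \<delta> * z)"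
      and ge2: "\<delta> * cmod z \<le> cmod (1 - \<i> * of_real \<delta> * z)" if "0 \<le> Im z" for z
    proof -
      have re: "Re (1 - \<i> * of_real \<delta> * z) = 1 + \<delta> * Im z" "Im (1 - \<i> * of_real \<delta> * z) = - \<delta> * Re z" by simp_all
      show "1 + \<delta> * Im z \<le> cmod (1 - \<i> * of_real \<delta> * z)"
        using abs_Re_le_cmod[of "1 - \<i> * of_real \<delta> * z"] re by simp
      have "0 < 1 + \<delta> * Im z" using d that by (simp add: add_pos_nonneg)
      then show "1 - \<i> * of_real \<delta> * z \<noteq> 0" using re by (metis less_irrefl zero_complex.sel(1))
      show "\<delta> * cmod z \<le> cmod (1 - \<i> * of_real \<delta> * z)"
      proof (rule power2_le_imp_le)
        have "(cmod (1 - \<i> * of_real \<delta> * z))\<^sup>2 = (1 + \<delta> * Im z)\<^sup>2 + (\<delta> * Re z)\<^sup>2"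
          unfolding cmod_power2 re by simp
        moreover have "(\<delta> * Im z)\<^sup>2 \<le> (1 + \<delta> * Im z)\<^sup>2" using d that by (intro power_mono) auto
        ultimately show "(\<delta> * cmod z)\<^sup>2 \<le> (cmod (1 - \<i> * of_real \<delta> * z))\<^sup>2"
          by (simp add: power_mult_distrib cmod_power2 algebra_simps)
      qed simp
    qed
    define W where "W z = P z / (1 - \<i> * of_real \<delta> * z)" for z
    define F where "F z = \<i> * of_real \<delta> * P z / (1 - \<i> * of_real \<delta> * z)\<^sup>2" for z
    have dW: "(W has_field_derivative (Q z / (1 - \<i> * of_real \<delta> * z) + F z)) (at z within ?H)" if "0 \<le> Im z" for z
      unfolding W_def F_def using nz[OF that]
      by (auto intro!: derivative_eq_intros P that simp: power2_eq_square divide_simps)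
    have Fb: "cmod (F z) \<le> \<delta> * B / (cmod (1 - \<i> * of_real \<delta> * z))\<^sup>2" if "0 \<le> Im z" for z
      using bound'[OF that] d by (simp add: F_def norm_mult norm_divide norm_power divide_right_mono)
    have contF: "continuous_on ?H F" unfolding F_def by (intro continuous_intros contP) (use nz in auto)
    have n1: "(cmod (1 - \<i> * of_real \<delta> * of_real t))\<^sup>2 = 1 + (\<delta> * t)\<^sup>2" for t
      unfolding cmod_power2 by simp
    have meas: "(\<lambda>t. G (of_real t)) \<in> borel_measurable borel" if "continuous_on ?H G" for G :: "complex \<Rightarrow> complex"
      by (intro borel_measurable_continuous_onI continuous_on_compose2[OF that]) (auto intro!: continuous_intros)
    have intF: "integrable lborel (\<lambda>t. F (of_real t))"
    proof (rule Bochner_Integration.integrable_bound)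
      have "integrable lborel (\<lambda>t::real. 1 / (1 + (0 + \<delta> * t)\<^sup>2))"
        using lborel_integrable_real_affine[OF integral_one_over_one_plus_square(1), of \<delta> 0] d by simp
      then have "integrable lborel (\<lambda>t::real. 1 / (1 + (\<delta> * t)\<^sup>2))" by simp
      then show "integrable lborel (\<lambda>t::real. \<delta> * B * (1 / (1 + (\<delta> * t)\<^sup>2)))"
        by (rule integrable_mult_right)
      show "AE t in lborel. norm (F (of_real t)) \<le> norm (\<delta> * B * (1 / (1 + (\<delta> * t)\<^sup>2)))"
        using Fb[of "of_real t" for t] n1 d Bpos by (simp add: abs_mult)
      show "(\<lambda>t. F (of_real t)) \<in> borel_measurable lborel" using meas[OF contF] by simp
    qed
    have F0: "(LINT t|lborel. F (of_real t)) = 0"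
    proof (rule integral_real_line_eq_0[OF contF _ intF])
      show "F holomorphic_on {z. 0 < Im z}" unfolding F_def by (intro holomorphic_intros holP) (use nz in auto)
      show "\<exists>R0. \<forall>z. R0 \<le> cmod z \<and> 0 \<le> Im z \<longrightarrow> cmod z * cmod (F z) \<le> e" if e: "0 < e" for e
      proof (intro exI allI impI)
        fix z assume z: "max 1 (B / (\<delta> * e)) \<le> cmod z \<and> 0 \<le> Im z"
        then have z1: "1 \<le> cmod z" "B / (\<delta> * e) \<le> cmod z" "0 \<le> Im z" by auto
        have "(\<delta> * cmod z)\<^sup>2 \<le> (cmod (1 - \<i> * of_real \<delta> * z))\<^sup>2" using ge2[OF z1(3)] d by (intro power_mono) auto
        then have "cmod (F z) \<le> \<delta> * B / (\<delta> * cmod z)\<^sup>2"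
          using Fb[OF z1(3)] z1 d Bpos by (smt (verit) divide_left_mono mult_pos_pos zero_less_power zero_le_mult_iff)
        then have "cmod z * cmod (F z) \<le> cmod z * (\<delta> * B / (\<delta> * cmod z)\<^sup>2)" by (rule mult_left_mono) simp
        also have "\<dots> = B / (\<delta> * cmod z)" using z1 d by (auto simp: power2_eq_square)
        also have "\<dots> \<le> e"
        proof -
          have "0 < \<delta> * cmod z" using z1 d by (intro mult_pos_pos) auto
          moreover have "B \<le> e * (\<delta> * cmod z)" using z1 d e by (auto simp: field_simps)
          ultimately show ?thesis by (simp add: pos_divide_le_eq)
        qed
        finally show "cmod z * cmod (F z) \<le> e" .
      qed
    qed
    have intQ: "integrable lborel (\<lambda>t. Q (of_real t) / (1 - \<i> * of_real \<delta> * of_real t))"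
    proof (rule Bochner_Integration.integrable_bound[OF integrable_norm[OF int]])
      have "continuous_on ?H (\<lambda>z. Q z / (1 - \<i> * of_real \<delta> * z))" by (intro continuous_intros cont) (use nz in auto)
      from meas[OF this] show "(\<lambda>t. Q (of_real t) / (1 - \<i> * of_real \<delta> * of_real t)) \<in> borel_measurable lborel" by simp
      have "cmod (Q (of_real t)) / cmod (1 - \<i> * of_real \<delta> * of_real t) \<le> cmod (Q (of_real t))" for t
      proof -
        have "1 \<le> cmod (1 - \<i> * of_real \<delta> * of_real t)" using ge[of "of_real t"] by simp
        from divide_le_self[OF this] show ?thesis by simp
      qed
      then show "AE t in lborel. norm (Q (of_real t) / (1 - \<i> * of_real \<delta> * of_real t)) \<le> norm (cmod (Q (of_real t)))"
        by (simp add: norm_divide)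
    qed
    have "(\<lambda>n. W (of_nat n) - W (- of_nat n)) \<longlonglongrightarrow> (LINT t|lborel. Q (of_real t) / (1 - \<i> * of_real \<delta> * of_real t) + F (of_real t))"
      by (rule integral_real_line_tendsto_diff(1)[OF dW]) (use intQ intF in auto)
    moreover have "(\<lambda>n. W (of_nat n) - W (- of_nat n)) \<longlonglongrightarrow> 0 - 0"
    proof (rule tendsto_diff)
      have lim: "(\<lambda>n. B / (\<delta> * real n)) \<longlonglongrightarrow> 0" using d by real_asymp
      have b: "cmod (W z) \<le> B / (\<delta> * cmod z)" if "0 \<le> Im z" "0 < cmod z" for z
        using ge2[OF that(1)] bound'[OF that(1)] that d Bpos unfolding W_def norm_divide
        by (intro frac_le) auto
      show "(\<lambda>n. W (of_nat n)) \<longlonglongrightarrow> 0"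
        by (rule Lim_null_comparison[OF eventually_mono[OF eventually_gt_at_top[of 0]] lim]) (use b[of "of_nat n" for n] in auto)
      show "(\<lambda>n. W (- of_nat n)) \<longlonglongrightarrow> 0"
        by (rule Lim_null_comparison[OF eventually_mono[OF eventually_gt_at_top[of 0]] lim]) (use b[of "- of_nat n" for n] in auto)
    qed
    ultimately have "(LINT t|lborel. Q (of_real t) / (1 - \<i> * of_real \<delta> * of_real t) + F (of_real t)) = 0"
      using LIMSEQ_unique by fastforce
    then have "(LINT t|lborel. Q (of_real t) / (1 - \<i> * of_real \<delta> * of_real t)) = 0"
      using F0 intQ intF by (subst (asm) Bochner_Integration.integral_add) auto
    then show ?thesis by (simp add: mult.assoc)
  qed
  have "(\<lambda>n. LINT t|lborel. Q (of_real t) / (1 - \<i> * of_real (1 / real (Suc n) * t))) \<longlonglongrightarrow> (LINT t|lborel. Q (of_real t))"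
  proof (rule integral_dominated_convergence[where w = "\<lambda>t. cmod (Q (of_real t))"])
    show "(\<lambda>t. Q (of_real t)) \<in> borel_measurable lborel" using int by (rule borel_measurable_integrable)
    then show "(\<lambda>t. Q (of_real t) / (1 - \<i> * of_real (1 / real (Suc n) * t))) \<in> borel_measurable lborel" for n
      by measurable
    show "integrable lborel (\<lambda>t. cmod (Q (of_real t)))" using int by (rule integrable_norm)
    show "AE t in lborel. (\<lambda>n. Q (of_real t) / (1 - \<i> * of_real (1 / real (Suc n) * t))) \<longlonglongrightarrow> Q (of_real t)"
    proof (rule AE_I2)
      fix t :: real
      have "(\<lambda>n. 1 / real (Suc n)) \<longlonglongrightarrow> 0" by real_asymp
      then have "(\<lambda>n. Q (of_real t) / (1 - \<i> * of_real (1 / real (Suc n) * t))) \<longlonglongrightarrow> Q (of_real t) / (1 - \<i> * of_real (0 * t))"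
        by (intro tendsto_intros) auto
      then show "(\<lambda>n. Q (of_real t) / (1 - \<i> * of_real (1 / real (Suc n) * t))) \<longlonglongrightarrow> Q (of_real t)" by simp
    qed
    show "AE t in lborel. norm (Q (of_real t) / (1 - \<i> * of_real (1 / real (Suc n) * t))) \<le> cmod (Q (of_real t))" for n
    proof (rule AE_I2)
      fix t :: real
      have "1 \<le> cmod (1 - \<i> * of_real (1 / real (Suc n) * t))"
        using abs_Re_le_cmod[of "1 - \<i> * of_real (1 / real (Suc n) * t)"] by simp
      from divide_le_self[OF this, of "cmod (Q (of_real t))"]
      show "norm (Q (of_real t) / (1 - \<i> * of_real (1 / real (Suc n) * t))) \<le> cmod (Q (of_real t))"
        by (simp add: norm_divide)
    qed
  qed
  moreover have "(LINT t|lborel. Q (of_real t) / (1 - \<i> * of_real (1 / real (Suc n) * t))) = 0" for n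
    by (rule delta) simp
  ultimately show ?thesis by (simp add: LIMSEQ_const_iff)
qed

section \<open>The majorant on the real line\<close>

text \<open>\<open>E e\<^sup>i\<^sup>\<phi>\<close> is real on the line, so that the imaginary part of its derivative vanishes.\<close>

lemma phase_deriv:
  assumes E: "E holomorphic_on UNIV" and nz: "E (of_real x) \<noteq> 0" and ph: "is_phase E \<phi>"
  shows "deriv \<phi> x = - Im (deriv E (of_real x) / E (of_real x))"
proof -
  obtain \<Phi> where an: "\<Phi> analytic_on \<real>" and \<Phi>: "\<And>t. \<Phi> (of_real t) = of_real (\<phi> t)"
    and eq: "\<And>t. E (of_real t) = of_real (cmod (E (of_real t))) * exp (- \<i> * of_real (\<phi> t))"
    using ph unfolding is_phase_def by blast
  have chain: "((\<lambda>t. F (of_real t)) has_vector_derivative F') (at x)"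
    if "(F has_field_derivative F') (at (of_real x))" for F :: "complex \<Rightarrow> complex" and F'
  proof -
    have "((\<lambda>t. of_real t :: complex) has_vector_derivative of_real 1) (at x)"
      by (rule has_vector_derivative_of_real[OF DERIV_ident])
    then show ?thesis
      using field_vector_diff_chain_within[of "of_real" 1 x UNIV F F'] that
      by (simp add: o_def has_field_derivative_at_within)
  qed
  have "\<Phi> field_differentiable at (of_real x)"
    using an by (rule analytic_on_imp_differentiable_at) auto
  then have "((\<lambda>t. \<Phi> (of_real t)) has_vector_derivative deriv \<Phi> (of_real x)) (at x)"
    by (intro chain) (simp add: field_differentiable_derivI)
  from bounded_linear.has_vector_derivative[OF bounded_linear_Re this]
  have d\<phi>: "(\<phi> has_real_derivative Re (deriv \<Phi> (of_real x))) (at x)"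
    unfolding \<Phi> by (simp add: has_real_derivative_iff_has_vector_derivative)
  then have d\<phi>': "(\<phi> has_real_derivative deriv \<phi> x) (at x)" by (simp add: DERIV_imp_deriv)
  define p where "p = deriv \<phi> x"
  have vE: "((\<lambda>t. E (of_real t)) has_vector_derivative deriv E (of_real x)) (at x)"
    using E by (intro chain) (auto intro: holomorphic_derivI)
  have ve: "((\<lambda>t. exp (\<i> * of_real (\<phi> t))) has_vector_derivative (\<i> * of_real p * exp (\<i> * of_real (\<phi> x)))) (at x)"
  proof -
    have "((\<lambda>t. \<i> * of_real (\<phi> t)) has_vector_derivative (\<i> * of_real p)) (at x)"
      using d\<phi>' unfolding p_def
      by (intro has_vector_derivative_mult_right has_vector_derivative_of_real)
         (simp add: has_real_derivative_iff_has_vector_derivative)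
    from field_vector_diff_chain_within[OF this, of exp "exp (\<i> * of_real (\<phi> x))"] show ?thesis
      by (simp add: o_def DERIV_exp has_field_derivative_at_within mult.commute)
  qed
  have q: "E (of_real t) * exp (\<i> * of_real (\<phi> t)) = of_real (cmod (E (of_real t)))" for t
  proof -
    have "E (of_real t) * exp (\<i> * of_real (\<phi> t))
        = of_real (cmod (E (of_real t))) * (exp (- (\<i> * of_real (\<phi> t))) * exp (\<i> * of_real (\<phi> t)))"
      by (subst eq) simp
    also have "exp (- (\<i> * of_real (\<phi> t))) * exp (\<i> * of_real (\<phi> t)) = 1" by (simp flip: exp_add)
    finally show ?thesis by simp
  qed
  have "((\<lambda>t. E (of_real t) * exp (\<i> * of_real (\<phi> t))) has_vector_derivative
      (E (of_real x) * (\<i> * of_real p * exp (\<i> * of_real (\<phi> x))) + deriv E (of_real x) * exp (\<i> * of_real (\<phi> x)))) (at x)"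
    by (rule has_vector_derivative_mult[OF vE ve])
  from bounded_linear.has_vector_derivative[OF bounded_linear_Im this]
  have "((\<lambda>t. 0) has_vector_derivative
      Im (E (of_real x) * (\<i> * of_real p * exp (\<i> * of_real (\<phi> x))) + deriv E (of_real x) * exp (\<i> * of_real (\<phi> x)))) (at x)"
    by (simp only: q Im_complex_of_real)
  then have "Im (E (of_real x) * (\<i> * of_real p * exp (\<i> * of_real (\<phi> x))) + deriv E (of_real x) * exp (\<i> * of_real (\<phi> x))) = 0"
    using vector_derivative_unique_at has_vector_derivative_const by blast
  moreover have "E (of_real x) * (\<i> * of_real p * exp (\<i> * of_real (\<phi> x))) + deriv E (of_real x) * exp (\<i> * of_real (\<phi> x))
     = (\<i> * of_real p + deriv E (of_real x) / E (of_real x)) * (E (of_real x) * exp (\<i> * of_real (\<phi> x)))"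
    using nz by (simp add: field_simps)
  ultimately have "Im ((\<i> * of_real p + deriv E (of_real x) / E (of_real x)) * of_real (cmod (E (of_real x)))) = 0"
    unfolding q by simp
  then have "p + Im (deriv E (of_real x) / E (of_real x)) = 0" using nz by simp
  then show ?thesis by (simp add: p_def)
qed

lemma integrable_continuous_decay:
  fixes f :: "real \<Rightarrow> 'a::{banach,second_countable_topology}"
  assumes cont: "continuous_on UNIV f" and dec: "\<And>t. R \<le> \<bar>t\<bar> \<Longrightarrow> norm (f t) \<le> A / t\<^sup>2" 
  shows "integrable lborel f"
proof -
  define S where "S = max 1 R"
  have "compact (f ` {-S..S})" by (intro compact_continuous_image continuous_on_subset[OF cont]) auto
  then obtain K where K: "\<And>t. t \<in> {-S..S} \<Longrightarrow> norm (f t) \<le> K"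
    by (meson bounded_iff compact_imp_bounded image_eqI)
  have K0: "0 \<le> K" using order_trans[OF norm_ge_zero K[of 0]] by (simp add: S_def)
  show ?thesis
  proof (rule Bochner_Integration.integrable_bound)
    show "integrable lborel (\<lambda>t::real. (K * (1 + S\<^sup>2) + 2 * \<bar>A\<bar>) * (1 / (1 + t\<^sup>2)))"
      by (intro integrable_mult_right integral_one_over_one_plus_square(1))
    show "f \<in> borel_measurable lborel" using cont by (simp add: borel_measurable_continuous_onI)
    show "AE t in lborel. norm (f t) \<le> norm ((K * (1 + S\<^sup>2) + 2 * \<bar>A\<bar>) * (1 / (1 + t\<^sup>2)))"
    proof (rule AE_I2)
      fix t :: real
      have pos: "0 < 1 + t\<^sup>2" by (simp add: add_pos_nonneg)
      have "norm (f t) * (1 + t\<^sup>2) \<le> K * (1 + S\<^sup>2) + 2 * \<bar>A\<bar>"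
      proof (cases "\<bar>t\<bar> \<le> S")
        case True
        then have "t\<^sup>2 \<le> S\<^sup>2" by (simp add: abs_le_square_iff[symmetric])
        then have "norm (f t) * (1 + t\<^sup>2) \<le> K * (1 + S\<^sup>2)" using True K0 by (intro mult_mono K) auto
        then show ?thesis by simp
      next
        case False
        then have t: "R \<le> \<bar>t\<bar>" "1 \<le> \<bar>t\<bar>" by (auto simp: S_def)
        then have t2: "1 \<le> t\<^sup>2" using power_mono[of 1 "\<bar>t\<bar>" 2] by simp
        have "norm (f t) * (1 + t\<^sup>2) \<le> \<bar>A\<bar> / t\<^sup>2 * (2 * t\<^sup>2)"
        proof (rule mult_mono)
          have "A / t\<^sup>2 \<le> \<bar>A\<bar> / t\<^sup>2" by (intro divide_right_mono) auto
          then show "norm (f t) \<le> \<bar>A\<bar> / t\<^sup>2" using dec[OF t(1)] by linarith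
        qed (use t2 in auto)
        also have "\<dots> = 2 * \<bar>A\<bar>" using t2 by auto
        finally show ?thesis using K0 by (smt (verit) mult_nonneg_nonneg zero_le_power2)
      qed
      then have "norm (f t) \<le> (K * (1 + S\<^sup>2) + 2 * \<bar>A\<bar>) * (1 / (1 + t\<^sup>2))"
        using pos by (simp add: le_divide_eq)
      also have "\<dots> \<le> norm ((K * (1 + S\<^sup>2) + 2 * \<bar>A\<bar>) * (1 / (1 + t\<^sup>2)))"
        unfolding real_norm_def by (rule abs_ge_self)
      finally show "norm (f t) \<le> norm ((K * (1 + S\<^sup>2) + 2 * \<bar>A\<bar>) * (1 / (1 + t\<^sup>2)))" .
    qed
  qed
qed

lemma mean_type_bound:
  assumes "mean_type f \<le> 0" "0 < \<epsilon>"
  obtains Y where "\<And>y. Y \<le> y \<Longrightarrow> cmod (f (\<i> * of_real y)) \<le> exp (\<epsilon> * y)"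
proof -
  have "mean_type f < ereal \<epsilon>" using assms by (metis ereal_less(2) order_le_less_trans)
  then have "eventually (\<lambda>y. (if f (\<i> * of_real y) = 0 then -\<infinity>
      else ereal (ln (cmod (f (\<i> * of_real y))) / y)) < ereal \<epsilon>) at_top"
    unfolding mean_type_def by (rule Limsup_lessD)
  then have "eventually (\<lambda>y. cmod (f (\<i> * of_real y)) \<le> exp (\<epsilon> * y)) at_top"
    using eventually_gt_at_top[of 0]
  proof eventually_elim
    case (elim y)
    show ?case
    proof (cases "f (\<i> * of_real y) = 0")
      case False
      then have "ln (cmod (f (\<i> * of_real y))) < \<epsilon> * y" using elim by (simp add: divide_less_eq)
      then have "exp (ln (cmod (f (\<i> * of_real y)))) \<le> exp (\<epsilon> * y)" by simp
      then show ?thesis using False by simp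
    qed simp
  qed
  then show thesis using that by (auto simp: eventually_at_top_linorder)
qed

context
  fixes E :: "complex \<Rightarrow> complex"
  assumes HB: "hermite_biehler E" and nzr: "\<And>x::real. E (of_real x) \<noteq> 0"
begin

lemma holE: "E holomorphic_on S"
  using HB holomorphic_on_subset by (auto simp: hermite_biehler_def)

lemma nzE: "0 \<le> Im z \<Longrightarrow> E z \<noteq> 0"
proof -
  assume "0 \<le> Im z"
  then consider "0 < Im z" | "Im z = 0" by linarith
  then show ?thesis
  proof cases
    case 1
    then have "cmod (E (cnj z)) < cmod (E z)" using HB by (auto simp: hermite_biehler_def upper_half_plane_def)
    then show ?thesis by (metis norm_ge_zero norm_zero not_less)
  next
    case 2
    then have "z = of_real (Re z)" by (simp add: complex_eq_iff)
    then show ?thesis using nzr by metis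
  qed
qed

lemma openE: "open {z. E z \<noteq> 0}"
proof -
  have "open (E -` (- {0}))"
    using holE[of UNIV] by (intro open_vimage) (auto intro: holomorphic_on_imp_continuous_on)
  then show ?thesis by (simp add: vimage_def)
qed

lemma subE: "{z. 0 \<le> Im z} \<subseteq> {z. E z \<noteq> 0}" using nzE by auto

lemma quotient_at_real_zero:
  assumes "f holomorphic_on S" "open S" "{z. 0 \<le> Im z} \<subseteq> S" "f (of_real x) = 0"
  obtains Q where "Q holomorphic_on S" "\<And>z. z \<noteq> of_real x \<Longrightarrow> Q z = f z / (z - of_real x)"
    "Q (of_real x) = deriv f (of_real x)" "continuous_on {z. 0 \<le> Im z} Q" "Q holomorphic_on {z. 0 < Im z}"
    "\<And>z. (z - of_real x) * Q z = f z" "continuous_on UNIV (\<lambda>t::real. Q (of_real t))"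
proof -
  define Q where "Q z = (if z = of_real x then deriv f (of_real x) else (f z - f (of_real x)) / (z - of_real x))" for z
  have Q: "Q holomorphic_on S" unfolding Q_def
    by (rule pole_lemma) (use assms in \<open>auto simp: interior_open\<close>)
  have c: "continuous_on {z. 0 \<le> Im z} Q"
    using Q assms(3) holomorphic_on_imp_continuous_on holomorphic_on_subset by blast
  show thesis
  proof (rule that[OF Q _ _ c])
    show "Q holomorphic_on {z. 0 < Im z}" using assms(3) by (intro holomorphic_on_subset[OF Q]) auto
    show "continuous_on UNIV (\<lambda>t::real. Q (of_real t))"
      by (rule continuous_on_compose2[OF c]) (auto intro!: continuous_intros)
  qed (use assms(4) in \<open>auto simp: Q_def\<close>)
qed

text \<open>\<open>f / E\<close> is in the Hardy class \<open>H\<^sup>2\<close>, and so is \<open>1 / (t - x)\<close> away from \<open>x\<close>; as \<open>f(x) = 0\<close>, the product is in \<open>H\<^sup>1\<close>.\<close>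

lemma HE_integral_quotient_eq_0:
  assumes f: "f \<in> HE_space E" and fx: "f (of_real x) = 0"
  shows "integrable lborel (\<lambda>t. f (of_real t) / E (of_real t) / of_real (t - x))"
    and "(LINT t|lborel. f (of_real t) / E (of_real t) / of_real (t - x)) = 0"
proof -
  define G where "G z = f z / E z" for z
  have holf: "f holomorphic_on UNIV" and intf: "integrable lborel (\<lambda>t. (cmod (G (of_real t)))\<^sup>2)"
    and bt: "bounded_type G" and mt: "mean_type G \<le> 0"
    using f unfolding HE_space_def N_plus_def G_def by (auto simp: zero_ereal_def)
  have holG: "G holomorphic_on {z. E z \<noteq> 0}" unfolding G_def
    by (intro holomorphic_intros holE holomorphic_on_subset[OF holf]) auto
  obtain Q where holQ: "Q holomorphic_on {z. 0 < Im z}" and contQ: "continuous_on {z. 0 \<le> Im z} Q"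
    and Q: "\<And>z. z \<noteq> of_real x \<Longrightarrow> Q z = G z / (z - of_real x)"
    and cQ: "continuous_on UNIV (\<lambda>t::real. Q (of_real t))" and mQ: "\<And>z. (z - of_real x) * Q z = G z"
    by (rule quotient_at_real_zero[OF holG openE subE, of x]) (use fx in \<open>auto simp: G_def\<close>)
  have "compact ((\<lambda>t::real. Q (of_real t)) ` {x-1..x+1})"
    by (intro compact_continuous_image continuous_on_subset[OF cQ]) auto
  then obtain K where K: "\<And>t. t \<in> {x-1..x+1} \<Longrightarrow> norm (Q (of_real t)) \<le> K"
    by (meson bounded_iff compact_imp_bounded image_eqI)
  have K0: "0 \<le> K" using order_trans[OF norm_ge_zero K[of x]] by simp
  have int: "integrable lborel (\<lambda>t. Q (of_real t))"
  proof (rule Bochner_Integration.integrable_bound)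
    have "integrable lborel (\<lambda>t::real. 1 / (1 + (- x + 1 * t)\<^sup>2))"
      by (rule lborel_integrable_real_affine[OF integral_one_over_one_plus_square(1)]) simp
    then have "integrable lborel (\<lambda>t::real. (2 * K + 2) * (1 / (1 + (t - x)\<^sup>2)))"
      by (intro integrable_mult_right) simp
    then show "integrable lborel (\<lambda>t. (cmod (G (of_real t)))\<^sup>2 + (2 * K + 2) * (1 / (1 + (t - x)\<^sup>2)))"
      by (intro Bochner_Integration.integrable_add intf)
    show "(\<lambda>t. Q (of_real t)) \<in> borel_measurable lborel" using cQ by (simp add: borel_measurable_continuous_onI)
    show "AE t in lborel. norm (Q (of_real t)) \<le> norm ((cmod (G (of_real t)))\<^sup>2 + (2 * K + 2) * (1 / (1 + (t - x)\<^sup>2)))"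
    proof (rule AE_I2)
      fix t :: real
      define s where "s = t - x"
      have pos: "0 < 1 + s\<^sup>2" by (simp add: add_pos_nonneg)
      have "norm (Q (of_real t)) \<le> (cmod (G (of_real t)))\<^sup>2 + (2 * K + 2) * (1 / (1 + s\<^sup>2))"
      proof (cases "\<bar>s\<bar> \<le> 1")
        case True
        then have "norm (Q (of_real t)) \<le> K" by (intro K) (auto simp: s_def abs_le_iff)
        have "s\<^sup>2 \<le> 1" using True by (simp add: abs_square_le_1)
        then have "K * (1 + s\<^sup>2) \<le> K * 2" using K0 by (intro mult_left_mono) auto
        then have "K \<le> (2 * K + 2) * (1 / (1 + s\<^sup>2))" using pos by (simp add: le_divide_eq)
        with \<open>norm (Q (of_real t)) \<le> K\<close> show ?thesis by (smt (verit) zero_le_power2)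
      next
        case False
        then have "t \<noteq> x" "1 \<le> s\<^sup>2" using abs_le_square_iff[of 1 s] by (auto simp: s_def)
        have "norm (Q (of_real t)) = cmod (G (of_real t)) * (1 / \<bar>s\<bar>)"
          using Q[of "of_real t"] \<open>t \<noteq> x\<close> by (simp add: norm_divide s_def flip: of_real_diff)
        also have "\<dots> \<le> (cmod (G (of_real t)))\<^sup>2 + (1 / \<bar>s\<bar>)\<^sup>2"
        proof -
          have ab: "a * b \<le> a\<^sup>2 + b\<^sup>2" if "0 \<le> a" "0 \<le> b" for a b :: real
            using zero_le_power2[of "a - b"] mult_nonneg_nonneg[OF that] by (simp add: power2_eq_square algebra_simps)
          show ?thesis by (rule ab) auto
        qed
        also have "(1 / \<bar>s\<bar>)\<^sup>2 \<le> 2 * (1 / (1 + s\<^sup>2))"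
          using \<open>1 \<le> s\<^sup>2\<close> pos by (simp add: power_divide divide_simps)
        also have "\<dots> \<le> (2 * K + 2) * (1 / (1 + s\<^sup>2))" using K0 pos by (intro mult_right_mono) auto
        finally show ?thesis by simp
      qed
      then show "norm (Q (of_real t)) \<le> norm ((cmod (G (of_real t)))\<^sup>2 + (2 * K + 2) * (1 / (1 + (t - x)\<^sup>2)))"
        by (simp add: s_def)
    qed
  qed
  obtain C where C: "0 \<le> C" and grow: "\<And>z. 0 < Im z \<Longrightarrow> cmod (G z) \<le> exp (C * ((1 + (cmod z)\<^sup>2) / Im z))"
    using bounded_type_growth[OF bt] by blast
  have QG: "cmod (Q z) \<le> cmod (G z) * (1 / Im z)" if z: "0 < Im z" for z
  proof -
    have "Im z \<le> cmod (z - of_real x)" using abs_Im_le_cmod[of "z - of_real x"] z by simp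
    moreover have "z \<noteq> of_real x" using z by auto
    then have "cmod (Q z) = cmod (G z) / cmod (z - of_real x)" by (simp add: Q norm_divide)
    moreover have "cmod (G z) / cmod (z - of_real x) \<le> cmod (G z) / Im z"
      using z \<open>Im z \<le> cmod (z - of_real x)\<close> by (intro frac_le) auto
    ultimately show ?thesis by simp
  qed
  have zero: "(LINT t|lborel. Q (of_real t)) = 0"
  proof (rule integral_Hardy_eq_0[OF contQ holQ int])
    show "0 \<le> C + 1" using C by simp
    show "cmod (Q z) \<le> exp ((C + 1) * ((1 + (cmod z)\<^sup>2) / Im z))" if z: "0 < Im z" for z
    proof -
      have "1 / Im z \<le> exp ((1 + (cmod z)\<^sup>2) / Im z)"
      proof -
        have "1 / Im z \<le> (1 + (cmod z)\<^sup>2) / Im z" using z by (intro divide_right_mono) auto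
        also have "\<dots> \<le> exp ((1 + (cmod z)\<^sup>2) / Im z)" using exp_ge_add_one_self[of "(1 + (cmod z)\<^sup>2) / Im z"] by linarith
        finally show ?thesis .
      qed
      then have "cmod (G z) * (1 / Im z) \<le> exp (C * ((1 + (cmod z)\<^sup>2) / Im z)) * exp ((1 + (cmod z)\<^sup>2) / Im z)"
        using grow[OF z] z by (intro mult_mono) auto
      also have "\<dots> = exp ((C + 1) * ((1 + (cmod z)\<^sup>2) / Im z))" by (simp only: distrib_right exp_add mult_1)
      finally show ?thesis using QG[OF z] by linarith
    qed
    show "\<exists>K. \<forall>y\<ge>0. cmod (Q (\<i> * of_real y)) \<le> K * exp (\<epsilon> * y)" if eps: "0 < \<epsilon>" for \<epsilon>
    proof -
      obtain Y where Y: "\<And>y. Y \<le> y \<Longrightarrow> cmod (G (\<i> * of_real y)) \<le> exp (\<epsilon> * y)"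
        using mean_type_bound[OF mt eps] by blast
      define Z where "Z = max 1 Y"
      have "continuous_on {0..Z} (\<lambda>y::real. Q (\<i> * of_real y))"
        by (rule continuous_on_compose2[OF contQ]) (auto intro!: continuous_intros)
      then have "compact ((\<lambda>y::real. Q (\<i> * of_real y)) ` {0..Z})" by (rule compact_continuous_image) auto
      then obtain B where B: "\<And>y. y \<in> {0..Z} \<Longrightarrow> cmod (Q (\<i> * of_real y)) \<le> B"
        by (meson bounded_iff compact_imp_bounded image_eqI)
      have B0: "0 \<le> B" using order_trans[OF norm_ge_zero B[of 0]] by (simp add: Z_def)
      have "cmod (Q (\<i> * of_real y)) \<le> (B + 1) * exp (\<epsilon> * y)" if y: "0 \<le> y" for y
      proof (cases "y \<le> Z")
        case True
        then have "cmod (Q (\<i> * of_real y)) \<le> (B + 1) * 1" using B[of y] y by simp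
        also have "\<dots> \<le> (B + 1) * exp (\<epsilon> * y)" using B0 y eps by (intro mult_left_mono) auto
        finally show ?thesis .
      next
        case False
        then have y1: "1 \<le> y" "Y \<le> y" by (auto simp: Z_def)
        have "cmod (Q (\<i> * of_real y)) \<le> cmod (G (\<i> * of_real y)) * (1 / y)" using QG[of "\<i> * of_real y"] y1 by simp
        also have "\<dots> \<le> exp (\<epsilon> * y) * 1" using Y[OF y1(2)] y1 by (intro mult_mono) auto
        also have "\<dots> \<le> (B + 1) * exp (\<epsilon> * y)" using B0 by simp
        finally show ?thesis .
      qed
      then show ?thesis by blast
    qed
  qed
  have ae: "AE t in lborel. Q (of_real t) = f (of_real t) / E (of_real t) / of_real (t - x)"
    using AE_lborel_singleton[of x] by eventually_elim (use Q in \<open>auto simp: G_def\<close>)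
  have meas: "(\<lambda>t. f (of_real t) / E (of_real t) / of_real (t - x)) \<in> borel_measurable lborel"
  proof -
    have "(\<lambda>t::real. f (of_real t)) \<in> borel_measurable borel" "(\<lambda>t::real. E (of_real t)) \<in> borel_measurable borel"
      by (intro borel_measurable_continuous_onI continuous_on_compose2[OF holomorphic_on_imp_continuous_on[OF holf]]
          continuous_on_compose2[OF holomorphic_on_imp_continuous_on[OF holE[of UNIV]]] continuous_intros; simp)+
    then show ?thesis by measurable
  qed
  have measQ: "(\<lambda>t. Q (of_real t)) \<in> borel_measurable lborel" using int by (rule borel_measurable_integrable)
  show "integrable lborel (\<lambda>t. f (of_real t) / E (of_real t) / of_real (t - x))"
    using int ae meas measQ by (subst integrable_cong_AE[symmetric]) auto
  show "(LINT t|lborel. f (of_real t) / E (of_real t) / of_real (t - x)) = 0"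
    using zero ae meas measQ by (subst integral_cong_AE[symmetric]) auto
qed

text \<open>Up to a constant, the reproducing kernel at \<open>x\<close> is \<open>k(z) = (E(z) - c E\<^sup>*(z)) / (z - x)\<close> with the unimodular constant
\<open>c = E(x) / E\<^sup>*(x)\<close>: a function of the space that vanishes at \<open>x\<close> is orthogonal to \<open>k\<close>, because its product with
\<open>cnj k\<close> splits into a function of \<open>H\<^sup>1\<close> and the conjugate of one. The supremum is therefore attained at
\<open>k / \<parallel>k\<parallel>\<close>, where \<open>|k(x)| = 2 \<phi>'(x) |E(x)|\<close> and \<open>\<parallel>k\<parallel>\<^sup>2 = 4 \<pi> \<phi>'(x)\<close>.\<close>

lemma majorant_on_real_line:
  assumes dB: "de_branges_space H ip" and H: "H = HE_space E"
    and nrm: "\<And>f. f \<in> H \<Longrightarrow> ip_norm ip f = HE_norm E f"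
    and ph: "is_phase E \<phi>" and pos: "0 < deriv \<phi> x"
  shows "majorant H ip (of_real x) = cmod (E (of_real x)) * sqrt (deriv \<phi> x / pi)"
proof -
  define p where "p = deriv \<phi> x"
  let ?x = "of_real x :: complex"
  define Es where "Es = conj_fun E"
  have Esr: "Es (of_real t) = cnj (E (of_real t))" for t by (simp add: Es_def conj_fun_def)
  have cc: "cnj \<circ> E \<circ> cnj = Es" by (auto simp: Es_def conj_fun_def)
  have dEs: "(Es has_field_derivative cnj (deriv E (cnj z))) (at z)" for z
    using has_field_derivative_cnj_cnj[of E "deriv E (cnj z)" z] holomorphic_derivI[OF holE[of UNIV]] by (simp add: cc)
  have holEs: "Es holomorphic_on S" for S
    unfolding holomorphic_on_def field_differentiable_def
    using dEs has_field_derivative_at_within by blast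
  have EsE: "cmod (Es z) \<le> cmod (E z)" if "0 \<le> Im z" for z
  proof (cases "Im z = 0")
    case True
    then have "z = of_real (Re z)" by (simp add: complex_eq_iff)
    then show ?thesis using Esr by (metis complex_mod_cnj order_refl)
  next
    case False
    then show ?thesis using that HB
      by (auto simp: Es_def conj_fun_def hermite_biehler_def upper_half_plane_def intro: less_imp_le)
  qed
  define c where "c = E ?x / Es ?x"
  have Ex: "E ?x \<noteq> 0" "Es ?x \<noteq> 0" using nzr by (auto simp: Esr)
  have nc: "cmod c = 1" using Ex by (simp add: c_def norm_divide Esr)
  define N where "N z = E z - c * Es z" for z
  have holN: "N holomorphic_on S" for S unfolding N_def by (intro holomorphic_intros holE holEs)
  have Nx: "N ?x = 0" using Ex by (simp add: N_def c_def)
  have dN: "deriv N ?x = - 2 * \<i> * of_real p * E ?x"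
  proof -
    define d where "d = deriv E ?x / E ?x"
    have pd: "p = - Im d" unfolding p_def d_def by (rule phase_deriv[OF holE nzr ph])
    have "(N has_field_derivative (deriv E ?x - c * cnj (deriv E (cnj ?x)))) (at ?x)"
      unfolding N_def
    proof (rule DERIV_diff)
      show "(E has_field_derivative deriv E ?x) (at ?x)" by (rule holomorphic_derivI[OF holE[of UNIV]]) auto
      show "((\<lambda>z. c * Es z) has_field_derivative c * cnj (deriv E (cnj ?x))) (at ?x)"
        by (rule DERIV_cmult[OF dEs])
    qed
    then have "deriv N ?x = deriv E ?x - c * cnj (deriv E ?x)" by (simp add: DERIV_imp_deriv)
    also have "\<dots> = E ?x * (d - cnj d)" using Ex by (simp add: d_def c_def Esr field_simps)
    also have "d - cnj d = - 2 * \<i> * of_real p" by (simp add: pd complex_eq_iff)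
    finally show ?thesis by simp
  qed
  obtain k where holk: "k holomorphic_on UNIV" and k: "\<And>z. z \<noteq> ?x \<Longrightarrow> k z = N z / (z - ?x)"
    and kx: "k ?x = deriv N ?x" and km: "\<And>z. (z - ?x) * k z = N z"
    by (rule quotient_at_real_zero[OF holN open_UNIV _ Nx]) auto
  have p: "0 < p" using pos by (simp add: p_def)
  have kx0: "k ?x \<noteq> 0" and nkx: "cmod (k ?x) = 2 * p * cmod (E ?x)"
    using kx dN p Ex by (auto simp: norm_mult)
  define g where "g z = N z / E z" for z
  have holg: "g holomorphic_on {z. E z \<noteq> 0}" unfolding g_def by (intro holomorphic_intros holN holE) auto
  have g2: "cmod (g z) \<le> 2" if "0 \<le> Im z" for z
  proof -
    have "cmod (N z) \<le> cmod (E z) + cmod (c * Es z)" unfolding N_def by (rule norm_triangle_ineq4)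
    also have "\<dots> \<le> 2 * cmod (E z)" using EsE[OF that] by (simp add: norm_mult nc)
    finally show ?thesis using nzE[OF that] by (simp add: g_def norm_divide divide_le_eq)
  qed
  have gE: "k z / E z = g z / (z - ?x)" if "z \<noteq> ?x" for z using k[OF that] by (simp add: g_def)
  have kEcont: "continuous_on UNIV (\<lambda>t::real. k (of_real t) / E (of_real t))"
    by (intro continuous_on_divide continuous_on_compose2[OF holomorphic_on_imp_continuous_on[OF holk]]
          continuous_on_compose2[OF holomorphic_on_imp_continuous_on[OF holE[of UNIV]]] continuous_intros) (use nzr in auto)
  have kEb: "(cmod (k (of_real t) / E (of_real t)))\<^sup>2 \<le> 16 / t\<^sup>2" if t: "2 * \<bar>x\<bar> + 1 \<le> \<bar>t\<bar>" for t
  proof -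
    have tx: "t \<noteq> x" "\<bar>t\<bar> / 2 \<le> \<bar>t - x\<bar>" "0 < \<bar>t\<bar>" using t by linarith+
    have "cmod (k (of_real t) / E (of_real t)) = cmod (g (of_real t)) / \<bar>t - x\<bar>"
      using gE[of "of_real t"] tx by (simp add: norm_divide flip: of_real_diff)
    also have "\<dots> \<le> 2 / (\<bar>t\<bar> / 2)" using g2[of "of_real t"] tx by (intro frac_le) auto
    finally have "(cmod (k (of_real t) / E (of_real t)))\<^sup>2 \<le> (2 / (\<bar>t\<bar> / 2))\<^sup>2" by (intro power_mono) auto
    then show ?thesis by (simp add: power_divide)
  qed
  have kint: "integrable lborel (\<lambda>t. (cmod (k (of_real t) / E (of_real t)))\<^sup>2)"
    by (rule integrable_continuous_decay[of _ "2 * \<bar>x\<bar> + 1" 16])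
       (use kEcont kEb in \<open>auto intro!: continuous_intros\<close>)
  have knorm: "(LINT t|lborel. (cmod (k (of_real t) / E (of_real t)))\<^sup>2) = 4 * pi * p"
  proof -
    obtain g1 where holg1: "g1 holomorphic_on {z. E z \<noteq> 0}" and g1: "\<And>z. z \<noteq> ?x \<Longrightarrow> g1 z = g z / (z - ?x)"
      and g1x: "g1 ?x = deriv g ?x"
      by (rule quotient_at_real_zero[OF holg openE subE]) (use Nx in \<open>auto simp: g_def\<close>)
    define a where "a = - 2 * \<i> * of_real p"
    have "g1 ?x = a"
    proof -
      have "((\<lambda>z. N z / E z) has_field_derivative (deriv N ?x * E ?x - N ?x * deriv E ?x) / (E ?x * E ?x)) (at ?x)"
        using Ex by (intro DERIV_divide holomorphic_derivI[OF holN[of UNIV]] holomorphic_derivI[OF holE[of UNIV]]) auto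
      then have "deriv g ?x = deriv N ?x / E ?x" using Ex Nx unfolding g_def by (simp add: DERIV_imp_deriv)
      then show ?thesis using g1x dN Ex by (simp add: a_def)
    qed
    define S where "S = {z. E z \<noteq> 0} \<inter> {z. -1 < Im z}"
    have S: "open S" "{z. 0 \<le> Im z} \<subseteq> S" using openE subE open_halfspace_Im_gt by (auto simp: S_def intro!: open_Int)
    (* On the line |k / E|^2 = 2 Re g / (t - x)^2, the real part of a function with a simple pole at x.
       Subtracting a \<i> / ((z - x) (z - x + \<i>)) removes the pole; on the line this term contributes
       4 p / (1 + (t - x)^2), whose integral is 4 \<pi> p, and the rest integrates to 0. *)
    define h where "h z = g1 z - a * (\<i> / (z - ?x + \<i>))" for z
    have holh: "h holomorphic_on S" unfolding h_def S_def
      by (intro holomorphic_intros holomorphic_on_subset[OF holg1]) (auto simp: complex_eq_iff)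
    have hx: "h ?x = 0" using \<open>g1 ?x = a\<close> by (simp add: h_def)
    obtain F where contF: "continuous_on {z. 0 \<le> Im z} F" and holF: "F holomorphic_on {z. 0 < Im z}"
      and F: "\<And>z. z \<noteq> ?x \<Longrightarrow> F z = h z / (z - ?x)" and cF: "continuous_on UNIV (\<lambda>t::real. F (of_real t))"
      by (rule quotient_at_real_zero[OF holh S hx]) blast
    define A where "A = 4 * (2 + 2 * p)"
    have Fb: "cmod (F z) \<le> A / (cmod z)\<^sup>2" if z: "0 \<le> Im z" "2 * \<bar>x\<bar> + 1 \<le> cmod z" for z
    proof -
      have zx: "cmod z / 2 \<le> cmod (z - ?x)" "0 < cmod z" using norm_triangle_ineq2[of z ?x] z by (auto)
      then have zx': "0 < cmod (z - ?x)" "z \<noteq> ?x" by auto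
      have zi: "cmod (z - ?x) \<le> cmod (z - ?x + \<i>)"
      proof (rule power2_le_imp_le)
        show "(cmod (z - ?x))\<^sup>2 \<le> (cmod (z - ?x + \<i>))\<^sup>2" using z(1) unfolding cmod_power2 by (simp add: power2_eq_square algebra_simps)
      qed simp
      have "cmod (h z) \<le> cmod (g1 z) + cmod (a * (\<i> / (z - ?x + \<i>)))" unfolding h_def by (rule norm_triangle_ineq4)
      also have "\<dots> = cmod (g z) / cmod (z - ?x) + 2 * p / cmod (z - ?x + \<i>)"
        using zx' p by (simp add: g1 norm_divide norm_mult a_def)
      also have "\<dots> \<le> 2 / cmod (z - ?x) + 2 * p / cmod (z - ?x)"
        using g2[OF z(1)] zi zx' p by (intro add_mono frac_le) auto
      also have "\<dots> = (2 + 2 * p) / cmod (z - ?x)" by (simp add: add_divide_distrib)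
      finally have "cmod (F z) \<le> (2 + 2 * p) / cmod (z - ?x) / cmod (z - ?x)"
        unfolding F[OF zx'(2)] norm_divide by (rule divide_right_mono) simp
      also have "\<dots> = (2 + 2 * p) / (cmod (z - ?x))\<^sup>2" by (simp add: power2_eq_square)
      also have "\<dots> \<le> (2 + 2 * p) / (cmod z / 2)\<^sup>2" using zx zx'(1) p by (intro divide_left_mono power_mono mult_pos_pos zero_less_power) auto
      also have "\<dots> = A / (cmod z)\<^sup>2" by (simp add: A_def power_divide)
      finally show ?thesis .
    qed
    have intF: "integrable lborel (\<lambda>t. F (of_real t))"
      by (rule integrable_continuous_decay[of _ "2 * \<bar>x\<bar> + 1" A]) (use cF Fb[of "of_real t" for t] in auto)
    have F0: "(LINT t|lborel. F (of_real t)) = 0"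
    proof (rule integral_real_line_eq_0[OF contF holF intF])
      fix e :: real assume e: "0 < e"
      have "cmod z * cmod (F z) \<le> e" if z: "max (2 * \<bar>x\<bar> + 1) (A / e) \<le> cmod z" "0 \<le> Im z" for z
      proof -
        have z1: "0 < cmod z" "A / e \<le> cmod z" "2 * \<bar>x\<bar> + 1 \<le> cmod z" using z(1) by (auto simp del: zero_less_norm_iff)
        have "cmod z * cmod (F z) \<le> cmod z * (A / (cmod z)\<^sup>2)" using Fb[OF z(2) z1(3)] by (intro mult_left_mono) auto
        also have "\<dots> = A / cmod z" using z1 by (simp add: power2_eq_square)
        also have "\<dots> \<le> e" using z1(1,2) e by (simp add: divide_le_eq mult.commute)
        finally show ?thesis .
      qed
      then show "\<exists>R0. \<forall>z. R0 \<le> cmod z \<and> 0 \<le> Im z \<longrightarrow> cmod z * cmod (F z) \<le> e" by blast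
    qed
    have ident: "(cmod (k (of_real t) / E (of_real t)))\<^sup>2 = 2 * Re (F (of_real t)) + 4 * p * (1 / (1 + (t - x)\<^sup>2))" if tx: "t \<noteq> x" for t
    proof -
      define s where "s = t - x"
      have s: "s \<noteq> 0" "of_real t - ?x = of_real s" using tx by (auto simp: s_def)
      have one: "cmod (c * Es (of_real t) / E (of_real t)) = 1" using nzr[of t] nc by (simp add: norm_divide norm_mult Esr)
      have gt: "g (of_real t) = 1 - c * Es (of_real t) / E (of_real t)" using nzr[of t] by (simp add: g_def N_def diff_divide_distrib)
      have g22: "(cmod (g (of_real t)))\<^sup>2 = 2 * Re (g (of_real t))"
      proof -
        define w where "w = c * Es (of_real t) / E (of_real t)"
        have "(Re w)\<^sup>2 + (Im w)\<^sup>2 = 1" using one by (simp add: w_def flip: cmod_power2)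
        then show ?thesis unfolding gt w_def[symmetric] cmod_power2 by (simp add: power2_eq_square algebra_simps)
      qed
      have "F (of_real t) = (g (of_real t) / of_real s - a * (\<i> / (of_real s + \<i>))) / of_real s"
        using tx s by (simp add: F h_def g1)
      also have "\<dots> = g (of_real t) / of_real (s\<^sup>2) - a * \<i> / (of_real s * (of_real s + \<i>))"
        using s by (simp add: diff_divide_distrib power2_eq_square)
      finally have "Re (F (of_real t)) = Re (g (of_real t)) / s\<^sup>2 - Re (a * \<i> / (of_real s * (of_real s + \<i>)))"
        by (simp only: minus_complex.sel Re_divide_of_real)
      also have "a * \<i> = of_real (2 * p)" by (simp add: a_def)
      also have "Re (of_real (2 * p) / (of_real s * (of_real s + \<i>))) = 2 * p / (1 + s\<^sup>2)"
      proof -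
        have nz1: "(of_real s + \<i>) * (of_real s - \<i>) = of_real (1 + s\<^sup>2)"
          by (simp add: complex_eq_iff power2_eq_square)
        have nz2: "of_real s - \<i> \<noteq> 0" by (simp add: complex_eq_iff)
        have "of_real (2 * p) / (of_real s * (of_real s + \<i>)) = of_real (2 * p) * (of_real s - \<i>) / (of_real s * ((of_real s + \<i>) * (of_real s - \<i>)))"
          using nz2 by (simp add: mult.assoc[symmetric])
        also have "\<dots> = of_real (2 * p) * (of_real s - \<i>) / of_real (s * (1 + s\<^sup>2))" unfolding nz1 by simp
        finally have "Re (of_real (2 * p) / (of_real s * (of_real s + \<i>))) = Re (of_real (2 * p) * (of_real s - \<i>)) / (s * (1 + s\<^sup>2))"
          by (simp only: Re_divide_of_real)
        then show ?thesis using s by simp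
      qed
      finally have "2 * Re (F (of_real t)) + 4 * p * (1 / (1 + s\<^sup>2)) = (cmod (g (of_real t)))\<^sup>2 / s\<^sup>2"
        unfolding g22 by simp
      also have "\<dots> = (cmod (k (of_real t) / E (of_real t)))\<^sup>2"
        using gE[of "of_real t"] tx s by (simp add: norm_divide power_divide flip: of_real_diff)
      finally show ?thesis by (simp add: s_def)
    qed
    have "(LINT t|lborel. (cmod (k (of_real t) / E (of_real t)))\<^sup>2) = (LINT t|lborel. 2 * Re (F (of_real t)) + 4 * p * (1 / (1 + (t - x)\<^sup>2)))"
    proof (rule integral_cong_AE)
      show "AE t in lborel. (cmod (k (of_real t) / E (of_real t)))\<^sup>2 = 2 * Re (F (of_real t)) + 4 * p * (1 / (1 + (t - x)\<^sup>2))"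
        using AE_lborel_singleton[of x] by eventually_elim (use ident in auto)
      show "(\<lambda>t. (cmod (k (of_real t) / E (of_real t)))\<^sup>2) \<in> borel_measurable lborel" using kint by (rule borel_measurable_integrable)
      show "(\<lambda>t. 2 * Re (F (of_real t)) + 4 * p * (1 / (1 + (t - x)\<^sup>2))) \<in> borel_measurable lborel"
        using borel_measurable_integrable[OF intF] by measurable
    qed
    also have "\<dots> = 2 * (LINT t|lborel. Re (F (of_real t))) + 4 * p * (LINT t|lborel. 1 / (1 + (t - x)\<^sup>2))"
    proof -
      have "integrable lborel (\<lambda>t::real. 1 / (1 + (- x + 1 * t)\<^sup>2))"
        by (rule lborel_integrable_real_affine[OF integral_one_over_one_plus_square(1)]) simp
      then have i: "integrable lborel (\<lambda>t::real. 1 / (1 + (t - x)\<^sup>2))" by simp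
      show ?thesis
        using integrable_mult_right[OF integrable_Re[OF intF], of 2] integrable_mult_right[OF i, of "4 * p"]
        by (simp only: Bochner_Integration.integral_add integral_mult_right_zero)
    qed
    also have "(LINT t|lborel. Re (F (of_real t))) = 0" using F0 intF by simp
    also have "(LINT t|lborel. 1 / (1 + (t - x)\<^sup>2)) = pi"
      using lborel_integral_real_affine[of 1 "\<lambda>t::real. 1 / (1 + t\<^sup>2)" "- x"] integral_one_over_one_plus_square(2) by simp
    finally show ?thesis by simp
  qed
  have kH: "k \<in> H"
  proof -
    have bt: "(\<lambda>z. k z / E z) \<in> N_plus 0"
    proof -
      have hol: "(\<lambda>z. k z / E z) holomorphic_on upper_half_plane"
        by (intro holomorphic_intros holE holomorphic_on_subset[OF holk]) (use nzE in \<open>auto simp: upper_half_plane_def\<close>)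
      have "bounded_type (\<lambda>z. k z / E z)" unfolding bounded_type_def
      proof (intro conjI hol exI)
        (* k / E = g / (z - x) is a quotient of functions bounded in the half-plane after division of
           numerator and denominator by z - x + \<i>. *)
        show "(\<lambda>z. g z / (z - ?x + \<i>)) holomorphic_on upper_half_plane"
          by (intro holomorphic_intros holomorphic_on_subset[OF holg]) (use nzE in \<open>auto simp: upper_half_plane_def complex_eq_iff\<close>)
        show "(\<lambda>z. (z - ?x) / (z - ?x + \<i>)) holomorphic_on upper_half_plane"
          by (intro holomorphic_intros) (auto simp: upper_half_plane_def complex_eq_iff)
        have im: "1 \<le> cmod (z - ?x + \<i>)" "cmod (z - ?x) \<le> cmod (z - ?x + \<i>)" if "0 < Im z" for z
        proof -
          show "1 \<le> cmod (z - ?x + \<i>)" using abs_Im_le_cmod[of "z - ?x + \<i>"] that by simp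
          show "cmod (z - ?x) \<le> cmod (z - ?x + \<i>)"
          proof (rule power2_le_imp_le)
            show "(cmod (z - ?x))\<^sup>2 \<le> (cmod (z - ?x + \<i>))\<^sup>2" using that unfolding cmod_power2 by (simp add: power2_eq_square algebra_simps)
          qed simp
        qed
        show "bounded ((\<lambda>z. g z / (z - ?x + \<i>)) ` upper_half_plane)"
          unfolding bounded_iff
        proof (intro exI ballI)
          fix w assume "w \<in> (\<lambda>z. g z / (z - ?x + \<i>)) ` upper_half_plane"
          then obtain z where z: "0 < Im z" "w = g z / (z - ?x + \<i>)" by (auto simp: upper_half_plane_def)
          have "cmod w \<le> 2 / 1" unfolding z(2) norm_divide using g2[of z] im[OF z(1)] z by (intro frac_le) auto
          then show "cmod w \<le> 2" by simp
        qed
        show "bounded ((\<lambda>z. (z - ?x) / (z - ?x + \<i>)) ` upper_half_plane)"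
          unfolding bounded_iff
        proof (intro exI ballI)
          fix w assume "w \<in> (\<lambda>z. (z - ?x) / (z - ?x + \<i>)) ` upper_half_plane"
          then obtain z where z: "0 < Im z" "w = (z - ?x) / (z - ?x + \<i>)" by (auto simp: upper_half_plane_def)
          have "0 < cmod (z - ?x + \<i>)" using im(1)[OF z(1)] by linarith
          then show "cmod w \<le> 1" unfolding z(2) norm_divide using im(2)[OF z(1)] by (simp add: divide_le_eq)
        qed
        show "\<exists>z\<in>upper_half_plane. (z - ?x) / (z - ?x + \<i>) \<noteq> 0"
          by (rule bexI[of _ "?x + \<i>"]) (auto simp: upper_half_plane_def complex_eq_iff)
        show "\<forall>z\<in>upper_half_plane. (z - ?x) / (z - ?x + \<i>) * (k z / E z) = g z / (z - ?x + \<i>)"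
        proof
          fix z assume "z \<in> upper_half_plane"
          then have "z \<noteq> ?x" by (auto simp: upper_half_plane_def)
          then show "(z - ?x) / (z - ?x + \<i>) * (k z / E z) = g z / (z - ?x + \<i>)" by (simp add: gE)
        qed
      qed
      moreover have "mean_type (\<lambda>z. k z / E z) \<le> 0" unfolding mean_type_def
      proof (rule Limsup_bounded)
        show "eventually (\<lambda>y. (if k (\<i> * of_real y) / E (\<i> * of_real y) = 0 then -\<infinity>
           else ereal (ln (cmod (k (\<i> * of_real y) / E (\<i> * of_real y))) / y)) \<le> 0) at_top"
          using eventually_ge_at_top[of 2]
        proof eventually_elim
          case (elim y)
          have "y \<le> cmod (\<i> * of_real y - ?x)" using abs_Im_le_cmod[of "\<i> * of_real y - ?x"] elim by simp
          moreover have "\<i> * of_real y \<noteq> ?x" using elim by (auto simp: complex_eq_iff)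
          then have "k (\<i> * of_real y) / E (\<i> * of_real y) = g (\<i> * of_real y) / (\<i> * of_real y - ?x)" by (rule gE)
          moreover have "cmod (g (\<i> * of_real y)) / cmod (\<i> * of_real y - ?x) \<le> 2 / y"
            using g2[of "\<i> * of_real y"] elim \<open>y \<le> cmod (\<i> * of_real y - ?x)\<close> by (intro frac_le) auto
          ultimately have "cmod (k (\<i> * of_real y) / E (\<i> * of_real y)) \<le> 2 / y" by (simp add: norm_divide)
          also have "\<dots> \<le> 1" using elim by simp
          finally have 1: "cmod (k (\<i> * of_real y) / E (\<i> * of_real y)) \<le> 1" .
          have "ln (cmod (k (\<i> * of_real y) / E (\<i> * of_real y))) / y \<le> 0"
            if "k (\<i> * of_real y) / E (\<i> * of_real y) \<noteq> 0"
            using 1 that elim ln_le_zero_iff[of "cmod (k (\<i> * of_real y) / E (\<i> * of_real y))"]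
            by (intro divide_nonpos_pos) auto
          then show ?case by (auto simp: zero_ereal_def)
        qed
      qed
      ultimately show ?thesis by (simp add: N_plus_def zero_ereal_def)
    qed
    have cj: "conj_fun k z = - cnj c * k z" for z
    proof (cases "z = ?x")
      case True
      have "E ?x * cnj (E ?x) = of_real ((cmod (E ?x))\<^sup>2)" by (metis complex_norm_square)
      have "conj_fun k ?x = cnj (deriv N ?x)" using kx by (simp add: conj_fun_def)
      also have "\<dots> = 2 * \<i> * of_real p * cnj (E ?x)" unfolding dN by simp
      also have "cnj (E ?x) = cnj c * E ?x" using Ex by (simp add: c_def Esr)
      finally show ?thesis using True kx dN by simp
    next
      case False
      then have "cnj z \<noteq> ?x" by (metis complex_cnj_cnj complex_cnj_complex_of_real)
      then have "conj_fun k z = cnj (N (cnj z)) / (z - ?x)" by (simp add: conj_fun_def k)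
      also have "cnj (N (cnj z)) = Es z - cnj c * E z" by (simp add: N_def Es_def conj_fun_def)
      also have "Es z - cnj c * E z = - cnj c * N z"
      proof -
        have "c * cnj c = 1" using nc by (metis complex_norm_square one_power2 of_real_1)
        then have "cnj c * (c * Es z) = Es z" by (metis mult.assoc mult.commute mult_1)
        then show ?thesis by (simp add: N_def algebra_simps)
      qed
      finally show ?thesis using False by (simp add: k)
    qed
    have "(\<lambda>z. conj_fun k z / E z) \<in> N_plus 0"
    proof -
      have eq: "(\<lambda>z. conj_fun k z / E z) = (\<lambda>z. - cnj c * (k z / E z))" by (simp add: cj)
      have "bounded_type (\<lambda>z. - cnj c * (k z / E z))"
      proof -
        obtain u v where uv: "(\<lambda>z. k z / E z) holomorphic_on upper_half_plane" "u holomorphic_on upper_half_plane" "bounded (u ` upper_half_plane)"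
            "v holomorphic_on upper_half_plane" "bounded (v ` upper_half_plane)"
            "\<exists>z\<in>upper_half_plane. v z \<noteq> 0" "\<forall>z\<in>upper_half_plane. v z * (k z / E z) = u z"
          using bt unfolding N_plus_def bounded_type_def by blast
        have "bounded ((\<lambda>z. - cnj c * u z) ` upper_half_plane)"
          using uv(3) unfolding bounded_iff by (simp add: norm_mult nc)
        have "\<forall>z\<in>upper_half_plane. v z * (- cnj c * (k z / E z)) = - cnj c * u z"
          using uv(7) by (metis mult.left_commute)
        note calculation = this \<open>bounded ((\<lambda>z. - cnj c * u z) ` upper_half_plane)\<close>
        show ?thesis unfolding bounded_type_def
        proof (intro conjI)
          show "(\<lambda>z. - cnj c * (k z / E z)) holomorphic_on upper_half_plane"
            by (rule holomorphic_on_mult[OF holomorphic_on_const uv(1)])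
          have "(\<lambda>z. - cnj c * u z) holomorphic_on upper_half_plane"
            by (rule holomorphic_on_mult[OF holomorphic_on_const uv(2)])
          then show "\<exists>u v. u holomorphic_on upper_half_plane \<and> bounded (u ` upper_half_plane) \<and>
            v holomorphic_on upper_half_plane \<and> bounded (v ` upper_half_plane) \<and>
            (\<exists>z\<in>upper_half_plane. v z \<noteq> 0) \<and>
            (\<forall>z\<in>upper_half_plane. v z * (- cnj c * (k z / E z)) = u z)"
            using calculation uv(4-6) by blast
        qed
      qed
      moreover have "mean_type (\<lambda>z. - cnj c * (k z / E z)) = mean_type (\<lambda>z. k z / E z)"
      proof -
        have "cmod (- cnj c * w) = cmod w" "(- cnj c * w = 0) = (w = 0)" for w
          using nc by (auto simp: norm_mult)
        then show ?thesis unfolding mean_type_def by (simp only:)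
      qed
      ultimately show ?thesis using bt unfolding eq N_plus_def by simp
    qed
    then show ?thesis unfolding H HE_space_def using holk kint bt by simp
  qed
  have HEk: "HE_norm E k = sqrt (4 * pi * p)" using knorm by (simp add: HE_norm_def)
  have upper: "cmod (f ?x) * sqrt (4 * pi * p) \<le> cmod (k ?x) * HE_norm E f" if fH: "f \<in> H" for f
  proof -
    (* f is decomposed into b k and a function f1 that vanishes at x and is orthogonal to k. *)
    define b where "b = f ?x / k ?x"
    define f1 where "f1 z = f z + (- b) * k z" for z
    have hs: "hilbert_function_space H ip" using dB by (simp add: de_branges_space_def)
    have f1H: "f1 \<in> H"
    proof -
      have "(\<lambda>z. (- b) * k z) \<in> H" using hs kH unfolding hilbert_function_space_def by blast
      moreover have add: "\<forall>f\<in>H. \<forall>g\<in>H. (\<lambda>z. f z + g z) \<in> H"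
        using hs unfolding hilbert_function_space_def by (elim conjE)
      ultimately have "(\<lambda>z. f z + (- b) * k z) \<in> H" using bspec[OF bspec[OF add fH]] by blast
      then show ?thesis by (simp only: f1_def[abs_def])
    qed
    have f1x: "f1 ?x = 0" using kx0 by (simp add: f1_def b_def)
    have f1sH: "conj_fun f1 \<in> H" using dB f1H by (simp add: de_branges_space_def)
    have f1sx: "conj_fun f1 ?x = 0" using f1x by (simp add: conj_fun_def)
    note Z1 = HE_integral_quotient_eq_0[OF f1H[unfolded H] f1x]
    note Z2 = HE_integral_quotient_eq_0[OF f1sH[unfolded H] f1sx]
    define Q1 where "Q1 t = f1 (of_real t) / E (of_real t) / of_real (t - x)" for t
    define Q2 where "Q2 t = conj_fun f1 (of_real t) / E (of_real t) / of_real (t - x)" for t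
    define u where "u t = f1 (of_real t) / E (of_real t)" for t :: real
    define v where "v t = k (of_real t) / E (of_real t)" for t :: real
    have uv: "u t * cnj (v t) = Q1 t - cnj c * cnj (Q2 t)" if "t \<noteq> x" for t
    proof -
      have vt: "v t = (1 - c * cnj (E (of_real t)) / E (of_real t)) / of_real (t - x)"
        using gE[of "of_real t"] that nzr[of t] by (simp add: v_def g_def N_def Esr diff_divide_distrib)
      have "u t * cnj (v t) = f1 (of_real t) / E (of_real t) * (1 - cnj c * E (of_real t) / cnj (E (of_real t))) / of_real (t - x)"
        unfolding u_def vt by simp
      also have "\<dots> = f1 (of_real t) / E (of_real t) / of_real (t - x) - cnj c * (f1 (of_real t) / cnj (E (of_real t)) / of_real (t - x))"
      proof -
        have "f1 (of_real t) / E (of_real t) * (cnj c * E (of_real t) / cnj (E (of_real t))) = cnj c * (f1 (of_real t) / cnj (E (of_real t)))"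
          using nzr[of t] by simp
        then show ?thesis by (simp only: right_diff_distrib diff_divide_distrib mult_1_right times_divide_eq_right)
      qed
      also have "\<dots> = Q1 t - cnj c * cnj (Q2 t)" by (simp add: Q1_def Q2_def conj_fun_def)
      finally show ?thesis .
    qed
    have iQ: "integrable lborel (\<lambda>t. Q1 t - cnj c * cnj (Q2 t))"
      using Z1(1) Z2(1) unfolding Q1_def[symmetric] Q2_def[symmetric] by (intro Bochner_Integration.integrable_diff integrable_mult_right) auto
    have zQ: "(LINT t|lborel. Q1 t - cnj c * cnj (Q2 t)) = 0"
      using Z1 Z2 unfolding Q1_def[symmetric] Q2_def[symmetric] by (subst Bochner_Integration.integral_diff) (auto intro!: integrable_mult_right)
    have intu: "integrable lborel (\<lambda>t. (cmod (u t))\<^sup>2)" and intf: "integrable lborel (\<lambda>t. (cmod (f (of_real t) / E (of_real t)))\<^sup>2)"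
      using f1H fH unfolding H HE_space_def u_def by auto
    have exp: "(cmod (f (of_real t) / E (of_real t)))\<^sup>2 = (cmod (u t))\<^sup>2 + (cmod b)\<^sup>2 * (cmod (v t))\<^sup>2 + 2 * Re (cnj b * (Q1 t - cnj c * cnj (Q2 t)))"
      if tx: "t \<noteq> x" for t
    proof -
      have "f (of_real t) / E (of_real t) = u t + b * v t" by (simp add: u_def v_def f1_def add_divide_distrib[symmetric])
      then have "(cmod (f (of_real t) / E (of_real t)))\<^sup>2 = (cmod (u t + b * v t))\<^sup>2" by simp
      also have "\<dots> = (cmod (u t))\<^sup>2 + (cmod (b * v t))\<^sup>2 + 2 * Re (u t * cnj (b * v t))"
        unfolding cmod_power2 by (simp add: power2_eq_square algebra_simps)
      also have "u t * cnj (b * v t) = cnj b * (Q1 t - cnj c * cnj (Q2 t))" by (simp add: uv[OF tx, symmetric] mult.left_commute)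
      finally show ?thesis by (simp add: norm_mult power_mult_distrib)
    qed
    have "(LINT t|lborel. (cmod (f (of_real t) / E (of_real t)))\<^sup>2)
       = (LINT t|lborel. ((cmod (u t))\<^sup>2 + (cmod b)\<^sup>2 * (cmod (v t))\<^sup>2) + 2 * Re (cnj b * (Q1 t - cnj c * cnj (Q2 t))))"
    proof (rule integral_cong_AE)
      show "AE t in lborel. (cmod (f (of_real t) / E (of_real t)))\<^sup>2 = ((cmod (u t))\<^sup>2 + (cmod b)\<^sup>2 * (cmod (v t))\<^sup>2) + 2 * Re (cnj b * (Q1 t - cnj c * cnj (Q2 t)))"
        using AE_lborel_singleton[of x] by eventually_elim (use exp in auto)
      show "(\<lambda>t. (cmod (f (of_real t) / E (of_real t)))\<^sup>2) \<in> borel_measurable lborel" using intf by (rule borel_measurable_integrable)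
      show "(\<lambda>t. ((cmod (u t))\<^sup>2 + (cmod b)\<^sup>2 * (cmod (v t))\<^sup>2) + 2 * Re (cnj b * (Q1 t - cnj c * cnj (Q2 t)))) \<in> borel_measurable lborel"
        using borel_measurable_integrable[OF intu] borel_measurable_integrable[OF kint] borel_measurable_integrable[OF iQ] unfolding v_def
        by measurable
    qed
    also have "\<dots> = (LINT t|lborel. (cmod (u t))\<^sup>2) + (cmod b)\<^sup>2 * (4 * pi * p) + 2 * Re (cnj b * (LINT t|lborel. Q1 t - cnj c * cnj (Q2 t)))"
    proof -
      have i2: "integrable lborel (\<lambda>t. (cmod b)\<^sup>2 * (cmod (v t))\<^sup>2)" using kint unfolding v_def by (rule integrable_mult_right)
      have i3: "integrable lborel (\<lambda>t. cnj b * (Q1 t - cnj c * cnj (Q2 t)))" using iQ by (rule integrable_mult_right)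
      have i4: "integrable lborel (\<lambda>t. 2 * Re (cnj b * (Q1 t - cnj c * cnj (Q2 t))))"
        by (intro integrable_mult_right integrable_Re i3)
      have "(LINT t|lborel. 2 * Re (cnj b * (Q1 t - cnj c * cnj (Q2 t)))) = 2 * Re (cnj b * (LINT t|lborel. Q1 t - cnj c * cnj (Q2 t)))"
        using i3 by (simp only: integral_mult_right_zero integral_Re)
      moreover have "(LINT t|lborel. (cmod b)\<^sup>2 * (cmod (v t))\<^sup>2) = (cmod b)\<^sup>2 * (4 * pi * p)"
        using knorm by (simp add: v_def)
      ultimately show ?thesis
        using intu i2 i4 by (simp only: Bochner_Integration.integral_add Bochner_Integration.integrable_add)
    qed
    also have "\<dots> = (LINT t|lborel. (cmod (u t))\<^sup>2) + (cmod b)\<^sup>2 * (4 * pi * p)" by (simp add: zQ)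
    finally have "(cmod b)\<^sup>2 * (4 * pi * p) \<le> (LINT t|lborel. (cmod (f (of_real t) / E (of_real t)))\<^sup>2)"
      by simp
    then have "sqrt ((cmod b)\<^sup>2 * (4 * pi * p)) \<le> HE_norm E f" unfolding HE_norm_def by (rule real_sqrt_le_mono)
    then have "cmod b * sqrt (4 * pi * p) \<le> HE_norm E f" by (simp add: real_sqrt_mult)
    then have "cmod (k ?x) * (cmod b * sqrt (4 * pi * p)) \<le> cmod (k ?x) * HE_norm E f" by (rule mult_left_mono) simp
    then show ?thesis using kx0 by (simp add: b_def norm_divide)
  qed
  define r where "r = sqrt (4 * pi * p)"
  have r: "0 < r" using p by (simp add: r_def)
  define e where "e z = of_real (1 / r) * k z" for z
  have eH: "e \<in> H"
  proof -
    have "\<forall>c. \<forall>f\<in>H. (\<lambda>z. c * f z) \<in> H"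
      using dB unfolding de_branges_space_def hilbert_function_space_def by (elim conjE)
    from bspec[OF spec[OF this] kH] have "(\<lambda>z. of_real (1 / r) * k z) \<in> H" .
    then show ?thesis by (simp only: e_def[abs_def])
  qed
  have "HE_norm E e = 1"
  proof -
    have "(cmod (e z / w))\<^sup>2 = (1 / r)\<^sup>2 * (cmod (k z / w))\<^sup>2" for z w
      by (simp add: e_def norm_mult norm_divide power_mult_distrib power_divide)
    then have "HE_norm E e = sqrt ((1 / r)\<^sup>2 * (4 * pi * p))" by (simp add: HE_norm_def knorm)
    also have "\<dots> = 1" using r p by (simp add: r_def power_divide)
    finally show ?thesis .
  qed
  then have e1: "ip_norm ip e = 1" using nrm[OF eH] by simp
  have "majorant H ip ?x = cmod (k ?x) / r" unfolding majorant_def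
  proof (rule cSup_eq_maximum)
    show "cmod (k ?x) / r \<in> (\<lambda>f. cmod (f ?x)) ` {f \<in> H. ip_norm ip f = 1}"
      by (rule image_eqI[of _ _ e]) (use eH e1 r in \<open>auto simp: e_def norm_mult norm_divide\<close>)
    fix y assume "y \<in> (\<lambda>f. cmod (f ?x)) ` {f \<in> H. ip_norm ip f = 1}"
    then obtain f where f: "f \<in> H" "ip_norm ip f = 1" "y = cmod (f ?x)" by blast
    then show "y \<le> cmod (k ?x) / r" using upper[OF f(1)] nrm[OF f(1)] r by (simp add: r_def le_divide_eq)
  qed
  also have "\<dots> = cmod (E ?x) * sqrt (p / pi)"
  proof -
    have "2 * p / r = sqrt ((2 * p)\<^sup>2 / (4 * pi * p))"
      using p by (simp only: r_def real_sqrt_divide real_sqrt_abs)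
    also have "(2 * p)\<^sup>2 / (4 * pi * p) = p / pi" using p by (simp add: power2_eq_square)
    finally have "2 * p / r = sqrt (p / pi)" .
    moreover have "cmod (k ?x) / r = cmod (E ?x) * (2 * p / r)" by (simp add: nkx)
    ultimately show ?thesis by (simp only:)
  qed
  finally show ?thesis by (simp add: p_def)
qed

end

section \<open>Logarithmic potentials of Poisson kernels\<close>

lemma integrable_one_plus_abs_powr:
  assumes "p < - 1"
  shows "integrable lborel (\<lambda>t::real. (1 + \<bar>t\<bar>) powr p)"
proof -
  define h where "h t = indicator {0..} t * (1 + t) powr p" for t :: real
  have meas: "h \<in> borel_measurable borel" unfolding h_def by measurable
  have "(\<integral>\<^sup>+t. ennreal ((1 + t) powr p) * indicator {0..} t \<partial>lborel) = ennreal (0 - (1 + 0) powr (p + 1) / (p + 1))"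
  proof (rule nn_integral_FTC_atLeast)
    show "((\<lambda>t. (1 + t) powr (p + 1) / (p + 1)) has_real_derivative (1 + t) powr p) (at t)" if "0 \<le> t" for t :: real
      using that assms by (auto intro!: derivative_eq_intros)
    have "((\<lambda>t. (1 + t) powr (p + 1)) \<longlongrightarrow> 0) at_top"
      by (rule tendsto_neg_powr) (use assms in \<open>auto intro!: filterlim_tendsto_add_at_top tendsto_const filterlim_ident\<close>)
    from tendsto_divide[OF this tendsto_const, of "p + 1"] show "((\<lambda>t. (1 + t) powr (p + 1) / (p + 1)) \<longlongrightarrow> 0) at_top"
      using assms by simp
  qed auto
  moreover have "(\<integral>\<^sup>+t. ennreal (norm (h t)) \<partial>lborel) = (\<integral>\<^sup>+t. ennreal ((1 + t) powr p) * indicator {0..} t \<partial>lborel)"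
    by (rule nn_integral_cong) (auto simp: h_def indicator_def)
  ultimately have ih: "integrable lborel h"
    using meas by (intro integrableI_bounded) auto
  have ih': "integrable lborel (\<lambda>t. h (0 + (-1) * t))"
    by (rule lborel_integrable_real_affine[OF ih]) simp
  show ?thesis
  proof (rule Bochner_Integration.integrable_bound[OF Bochner_Integration.integrable_add[OF ih ih']])
    show "AE t in lborel. norm ((1 + \<bar>t\<bar>) powr p) \<le> norm (h t + h (0 + (-1) * t))"
      by (rule AE_I2) (auto simp: h_def indicator_def)
  qed measurable
qed

lemma integrable_powr_decay:
  fixes f :: "real \<Rightarrow> 'a::{banach,second_countable_topology}"
  assumes "f \<in> borel_measurable borel" and "p < -1" and "\<And>t. norm (f t) \<le> A * (1 + \<bar>t\<bar>) powr p"
  shows "integrable lborel f"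
proof (rule Bochner_Integration.integrable_bound)
  show "integrable lborel (\<lambda>t. A * (1 + \<bar>t\<bar>) powr p)"
    by (intro integrable_mult_right integrable_one_plus_abs_powr assms)
  show "AE t in lborel. norm (f t) \<le> norm (A * (1 + \<bar>t\<bar>) powr p)"
  proof (rule AE_I2)
    fix t show "norm (f t) \<le> norm (A * (1 + \<bar>t\<bar>) powr p)"
      using assms(3)[of t] unfolding real_norm_def by (rule order_trans) (rule abs_ge_self)
  qed
qed (use assms in auto)

lemma one_plus_square_ge: "(1 + \<bar>t\<bar>)\<^sup>2 \<le> 2 * (1 + t\<^sup>2)" for t :: real
  using zero_le_power2[of "1 - \<bar>t\<bar>"] by (simp add: power2_eq_square algebra_simps abs_mult_self_eq flip: abs_mult)

lemma abs_ln_le_sqrt: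
  assumes "b \<le> s" "0 < b"
  shows "\<bar>ln s\<bar> \<le> \<bar>ln b\<bar> + 2 * sqrt s"
proof -
  have s: "0 < s" using assms by linarith
  have "ln (sqrt s) \<le> sqrt s - 1" using s by (intro ln_le_minus_one) auto
  then have "ln s \<le> 2 * sqrt s" using s by (simp add: ln_sqrt)
  moreover have "ln b \<le> ln s" using assms by simp
  ultimately show ?thesis using s by (smt (verit) real_sqrt_ge_zero)
qed

text \<open>The Poisson integral at \<open>i\<close> of the harmonic function \<open>ln |z - a + i b|\<close>: with \<open>f\<close> a holomorphic logarithm, the
function \<open>(f(z) - f(i)) / (z\<^sup>2 + 1)\<close> is holomorphic in the upper half-plane and decays like \<open>|z|\<^sup>-\<^sup>3\<^sup>/\<^sup>2\<close>.\<close>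

lemma Poisson_log_shifted:
  assumes b: "0 < b"
  shows "integrable lborel (\<lambda>t. ln (cmod (of_real (t - a) + \<i> * of_real b)) / (1 + t\<^sup>2))"
    and "(LINT t|lborel. ln (cmod (of_real (t - a) + \<i> * of_real b)) / (1 + t\<^sup>2)) = pi * ln (sqrt (a\<^sup>2 + (1 + b)\<^sup>2))"
proof -
  define f where "f z = Ln (of_real b - \<i> * (z - of_real a))" for z
  define S where "S = {z. - b < Im z}"
  have openS: "open S" unfolding S_def by (rule open_halfspace_Im_gt)
  have holf: "f holomorphic_on S" unfolding f_def S_def
    by (intro holomorphic_intros) (auto simp: complex_nonpos_Reals_iff)
  define q where "q z = (if z = \<i> then deriv f \<i> else (f z - f \<i>) / (z - \<i>))" for z
  have holq: "q holomorphic_on S" unfolding q_def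
    by (rule pole_lemma[OF holf]) (use b in \<open>simp add: interior_open[OF openS], simp add: S_def\<close>)
  define F where "F z = q z / (z + \<i>)" for z
  have holF: "F holomorphic_on {z. 0 < Im z}" unfolding F_def
    by (intro holomorphic_intros holomorphic_on_subset[OF holq]) (use b in \<open>auto simp: S_def complex_eq_iff\<close>)
  have contF: "continuous_on {z. 0 \<le> Im z} F" unfolding F_def
    by (intro continuous_intros continuous_on_subset[OF holomorphic_on_imp_continuous_on[OF holq]])
       (use b in \<open>auto simp: S_def complex_eq_iff\<close>)
  define k where "k = \<bar>a\<bar> + b + 1"
  define B where "B = \<bar>ln b\<bar> + pi + cmod (f \<i>)"
  have fb: "cmod (f z - f \<i>) \<le> 2 * sqrt (cmod z + k) + B" if z: "0 \<le> Im z" for z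
  proof -
    define w where "w = of_real b - \<i> * (z - of_real a)"
    have Rew: "b \<le> Re w" using z by (simp add: w_def)
    then have w0: "b \<le> cmod w" using complex_Re_le_cmod[of w] by linarith
    have w1: "cmod w \<le> cmod z + k"
    proof -
      have "cmod w \<le> cmod (of_real b :: complex) + cmod (\<i> * (z - of_real a))" unfolding w_def by (rule norm_triangle_ineq4)
      also have "cmod (\<i> * (z - of_real a)) \<le> cmod z + \<bar>a\<bar>" using norm_triangle_ineq4[of z "of_real a"] by (simp add: norm_mult)
      finally show ?thesis using b by (simp add: k_def)
    qed
    have wnz: "w \<noteq> 0" using w0 b by auto
    have "cmod (Ln w) \<le> \<bar>Re (Ln w)\<bar> + \<bar>Im (Ln w)\<bar>" by (rule cmod_le)
    also have "Re (Ln w) = ln (cmod w)" using wnz by simp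
    also have "\<bar>ln (cmod w)\<bar> \<le> \<bar>ln b\<bar> + 2 * sqrt (cmod w)" by (rule abs_ln_le_sqrt[OF w0 b])
    also have "sqrt (cmod w) \<le> sqrt (cmod z + k)" using w1 by (rule real_sqrt_le_mono)
    also have "\<bar>Im (Ln w)\<bar> \<le> pi" using mpi_less_Im_Ln[OF wnz] Im_Ln_le_pi[OF wnz] by (simp add: abs_le_iff)
    finally have "cmod (f z) \<le> \<bar>ln b\<bar> + 2 * sqrt (cmod z + k) + pi" by (simp add: f_def w_def)
    then show ?thesis using norm_triangle_ineq4[of "f z" "f \<i>"] by (simp add: B_def)
  qed
  have Fb: "cmod (F z) \<le> 4 * (2 * sqrt (cmod z + k) + B) / (cmod z)\<^sup>2" if z: "0 \<le> Im z" "2 \<le> cmod z" for z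
  proof -
    have z1: "cmod z / 2 \<le> cmod (z - \<i>)" "cmod z / 2 \<le> cmod (z + \<i>)"
      using norm_triangle_ineq2[of z \<i>] norm_triangle_ineq2[of z "- \<i>"] z by auto
    then have nz: "z \<noteq> \<i>" "z + \<i> \<noteq> 0" using z by auto
    have "cmod (F z) = cmod (f z - f \<i>) / (cmod (z - \<i>) * cmod (z + \<i>))"
      using nz by (simp add: F_def q_def norm_divide norm_mult)
    also have "\<dots> \<le> (2 * sqrt (cmod z + k) + B) / ((cmod z / 2) * (cmod z / 2))"
      using z z1 fb[OF z(1)] by (intro frac_le mult_mono mult_pos_pos order_trans[OF norm_ge_zero fb[OF z(1)]]) auto
    finally show ?thesis by (simp add: power2_eq_square field_simps)
  qed
  have B0: "0 \<le> B" by (simp add: B_def)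
  have k1: "1 \<le> k" using b by (simp add: k_def)
  have cF: "continuous_on UNIV (\<lambda>t::real. F (of_real t))"
    by (rule continuous_on_compose2[OF contF]) (auto intro!: continuous_intros)
  have intF: "integrable lborel (\<lambda>t. F (of_real t))"
  proof -
    have "compact ((\<lambda>t::real. F (of_real t)) ` {-2..2})"
      by (intro compact_continuous_image continuous_on_subset[OF cF]) auto
    then obtain K where K: "\<And>t. t \<in> {-2..2} \<Longrightarrow> norm (F (of_real t)) \<le> K"
      by (meson bounded_iff compact_imp_bounded image_eqI)
    have K0: "0 \<le> K" using order_trans[OF norm_ge_zero K[of 0]] by simp
    define A where "A = K * 3 powr (3/2) + 16 * (2 * sqrt k + B)"
    have "norm (F (of_real t)) \<le> A * (1 + \<bar>t\<bar>) powr (- (3/2))" for t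
    proof -
      have pos: "0 < 1 + \<bar>t\<bar>" by linarith
      have "norm (F (of_real t)) * (1 + \<bar>t\<bar>) powr (3/2) \<le> A"
      proof (cases "\<bar>t\<bar> \<le> 2")
        case True
        have "norm (F (of_real t)) * (1 + \<bar>t\<bar>) powr (3/2) \<le> K * 3 powr (3/2)"
          using True K0 by (intro mult_mono K powr_mono2) auto
        moreover have "0 \<le> 16 * (2 * sqrt k + B)" using B0 k1 by simp
        ultimately show ?thesis by (simp only: A_def)
      next
        case False
        have "sqrt (\<bar>t\<bar> + k) \<le> sqrt (k * (1 + \<bar>t\<bar>))"
        proof (rule real_sqrt_le_mono)
          have "\<bar>t\<bar> * 1 \<le> \<bar>t\<bar> * k" using k1 by (intro mult_left_mono) auto
          then show "\<bar>t\<bar> + k \<le> k * (1 + \<bar>t\<bar>)" by (simp add: distrib_left mult.commute)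
        qed
        also have "\<dots> = sqrt k * (1 + \<bar>t\<bar>) powr (1/2)" using k1 pos by (simp add: real_sqrt_mult powr_half_sqrt)
        finally have 1: "sqrt (\<bar>t\<bar> + k) \<le> sqrt k * (1 + \<bar>t\<bar>) powr (1/2)" .
        have "1 \<le> (1 + \<bar>t\<bar>) powr (1/2)" by (rule ge_one_powr_ge_zero) auto
        then have "B * 1 \<le> B * (1 + \<bar>t\<bar>) powr (1/2)" using B0 by (intro mult_left_mono) auto
        with 1 have 2: "2 * sqrt (\<bar>t\<bar> + k) + B \<le> (2 * sqrt k + B) * (1 + \<bar>t\<bar>) powr (1/2)" by (simp add: algebra_simps)
        have "norm (F (of_real t)) \<le> 4 * (2 * sqrt (\<bar>t\<bar> + k) + B) / t\<^sup>2" using Fb[of "of_real t"] False by simp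
        also have "\<dots> \<le> 4 * ((2 * sqrt k + B) * (1 + \<bar>t\<bar>) powr (1/2)) / t\<^sup>2" using 2 by (intro divide_right_mono) auto
        also have "\<dots> \<le> 4 * ((2 * sqrt k + B) * (1 + \<bar>t\<bar>) powr (1/2)) / ((1 + \<bar>t\<bar>)\<^sup>2 / 4)"
        proof (rule divide_left_mono)
          have "(1 + \<bar>t\<bar>)\<^sup>2 \<le> (2 * \<bar>t\<bar>)\<^sup>2" using False by (intro power_mono) auto
          then show "(1 + \<bar>t\<bar>)\<^sup>2 / 4 \<le> t\<^sup>2" by (simp add: power_mult_distrib)
        qed (use B0 k1 False pos in auto)
        also have "\<dots> = 16 * (2 * sqrt k + B) * ((1 + \<bar>t\<bar>) powr (1/2) / (1 + \<bar>t\<bar>) powr 2)"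
          using pos by (simp add: powr_numeral)
        also have "(1 + \<bar>t\<bar>) powr (1/2) / (1 + \<bar>t\<bar>) powr 2 = (1 + \<bar>t\<bar>) powr (- (3/2))"
          by (simp only: powr_diff[symmetric]) simp
        finally have "norm (F (of_real t)) * (1 + \<bar>t\<bar>) powr (3/2) \<le> 16 * (2 * sqrt k + B) * (1 + \<bar>t\<bar>) powr (- (3/2)) * (1 + \<bar>t\<bar>) powr (3/2)"
          by (rule mult_right_mono) simp
        also have "\<dots> = 16 * (2 * sqrt k + B)" using pos by (simp add: mult.assoc flip: powr_add)
        finally have "norm (F (of_real t)) * (1 + \<bar>t\<bar>) powr (3/2) \<le> 16 * (2 * sqrt k + B)" .
        moreover have "0 \<le> K * 3 powr (3/2)" using K0 by simp
        ultimately show ?thesis unfolding A_def by linarith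
      qed
      then show ?thesis using pos by (simp add: powr_minus field_simps)
    qed
    then show ?thesis
      using cF by (intro integrable_powr_decay[where p = "- (3/2)"]) (auto intro: borel_measurable_continuous_onI)
  qed
  have F0: "(LINT t|lborel. F (of_real t)) = 0"
  proof (rule integral_real_line_eq_0[OF contF holF intF])
    fix e :: real assume e: "0 < e"
    have "((\<lambda>r::real. 4 * (2 * sqrt (r + k) + B) / r) \<longlongrightarrow> 0) at_top" by real_asymp
    then have "eventually (\<lambda>r. 4 * (2 * sqrt (r + k) + B) / r < e) at_top" using e by (rule order_tendstoD)
    then obtain R where R: "\<And>r. R \<le> r \<Longrightarrow> 4 * (2 * sqrt (r + k) + B) / r < e" by (auto simp: eventually_at_top_linorder)
    have "cmod z * cmod (F z) \<le> e" if z: "max R 2 \<le> cmod z" "0 \<le> Im z" for z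
    proof -
      have z2: "2 \<le> cmod z" "R \<le> cmod z" using z by auto
      have "cmod z * cmod (F z) \<le> cmod z * (4 * (2 * sqrt (cmod z + k) + B) / (cmod z)\<^sup>2)"
        using Fb[OF z(2) z2(1)] by (rule mult_left_mono) simp
      also have "\<dots> = 4 * (2 * sqrt (cmod z + k) + B) / cmod z" using z2 by (auto simp: power2_eq_square)
      finally show ?thesis using R[OF z2(2)] by linarith
    qed
    then show "\<exists>R0. \<forall>z. R0 \<le> cmod z \<and> 0 \<le> Im z \<longrightarrow> cmod z * cmod (F z) \<le> e" by blast
  qed
  define r where "r = ln (sqrt (a\<^sup>2 + (1 + b)\<^sup>2))"
  have fi: "Re (f \<i>) = r"
  proof -
    have "of_real b - \<i> * (\<i> - of_real a) = Complex (1 + b) a" by (simp add: complex_eq_iff)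
    moreover have "Complex (1 + b) a \<noteq> 0" using b by (simp add: complex_eq_iff)
    ultimately have "Re (f \<i>) = ln (cmod (Complex (1 + b) a))" unfolding f_def by (simp only:) (rule Re_Ln)
    then show ?thesis by (simp add: r_def cmod_def add.commute)
  qed
  have id: "ln (cmod (of_real (t - a) + \<i> * of_real b)) / (1 + t\<^sup>2) = Re (F (of_real t)) + r * (1 / (1 + t\<^sup>2))" for t
  proof -
    have "F (of_real t) = (f (of_real t) - f \<i>) / ((of_real t - \<i>) * (of_real t + \<i>))"
      unfolding F_def q_def by (auto simp: complex_eq_iff)
    also have "(of_real t - \<i>) * (of_real t + \<i>) = of_real (1 + t\<^sup>2)" by (simp add: complex_eq_iff power2_eq_square)
    finally have "Re (F (of_real t)) = (Re (f (of_real t)) - r) / (1 + t\<^sup>2)"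
      by (simp only: Re_divide_of_real minus_complex.sel fi)
    moreover have "Re (f (of_real t)) = ln (cmod (of_real (t - a) + \<i> * of_real b))"
    proof -
      have "of_real b - \<i> * (of_real t - of_real a) \<noteq> 0" using b by (simp add: complex_eq_iff)
      moreover have "of_real b - \<i> * (of_real t - of_real a) = - \<i> * (of_real (t - a) + \<i> * of_real b)"
        by (simp add: complex_eq_iff)
      then have "cmod (of_real b - \<i> * (of_real t - of_real a)) = cmod (of_real (t - a) + \<i> * of_real b)"
        by (simp add: norm_mult)
      ultimately show ?thesis unfolding f_def by (simp add: Re_Ln)
    qed
    ultimately show ?thesis by (simp add: diff_divide_distrib)
  qed
  have iR: "integrable lborel (\<lambda>t. Re (F (of_real t)))" using intF by simp
  show "integrable lborel (\<lambda>t. ln (cmod (of_real (t - a) + \<i> * of_real b)) / (1 + t\<^sup>2))"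
    unfolding id by (intro Bochner_Integration.integrable_add iR integrable_mult_right integral_one_over_one_plus_square(1))
  have "(LINT t|lborel. ln (cmod (of_real (t - a) + \<i> * of_real b)) / (1 + t\<^sup>2)) = (LINT t|lborel. Re (F (of_real t))) + r * (LINT t|lborel. 1 / (1 + t\<^sup>2))"
    unfolding id using iR integral_one_over_one_plus_square(1)
      integrable_mult_right[OF integral_one_over_one_plus_square(1), of r]
    by (simp only: Bochner_Integration.integral_add integral_mult_right_zero)
  also have "(LINT t|lborel. Re (F (of_real t))) = 0" using F0 intF by simp
  finally show "(LINT t|lborel. ln (cmod (of_real (t - a) + \<i> * of_real b)) / (1 + t\<^sup>2)) = pi * ln (sqrt (a\<^sup>2 + (1 + b)\<^sup>2))"
    by (simp add: integral_one_over_one_plus_square(2) r_def)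
qed

text \<open>The singularity is allowed to reach the line: let \<open>b\<close> decrease to 0 and use monotone convergence.\<close>

lemma Poisson_log:
  shows "integrable lborel (\<lambda>t. ln \<bar>t - a\<bar> / (1 + t\<^sup>2))"
    and "(LINT t|lborel. ln \<bar>t - a\<bar> / (1 + t\<^sup>2)) = pi * ln (sqrt (a\<^sup>2 + 1))"
proof -
  define b where "b n = 1 / real (Suc n)" for n
  define f where "f n t = - (ln (cmod (of_real (t - a) + \<i> * of_real (b n))) / (1 + t\<^sup>2))" for n t
  have b: "0 < b n" for n by (simp add: b_def)
  have blim: "b \<longlonglongrightarrow> 0" unfolding b_def by real_asymp
  have i: "integrable lborel (f n)" for n unfolding f_def by (intro integrable_minus Poisson_log_shifted b)
  have fmono: "f m t \<le> f n t" if mn: "m \<le> n" for m n t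
  proof -
    have "b n \<le> b m" using mn by (simp add: b_def frac_le)
    then have "(b n)\<^sup>2 \<le> (b m)\<^sup>2" using b[of n] by (intro power_mono) auto
    then have "cmod (of_real (t - a) + \<i> * of_real (b n)) \<le> cmod (of_real (t - a) + \<i> * of_real (b m))"
      unfolding cmod_def by (intro real_sqrt_le_mono) simp
    moreover have "0 < cmod (of_real (t - a) + \<i> * of_real (b n))" using b[of n] by (simp add: complex_eq_iff)
    ultimately have "ln (cmod (of_real (t - a) + \<i> * of_real (b n))) \<le> ln (cmod (of_real (t - a) + \<i> * of_real (b m)))"
      by (meson ln_le_cancel_iff order_less_le_trans)
    then show ?thesis unfolding f_def
      by (intro le_imp_neg_le divide_right_mono) (auto simp: add_nonneg_nonneg)
  qed
  then have c1: "AE t in lborel. mono (\<lambda>n. f n t)"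
    by (intro AE_I2 monoI)
  have c2: "AE t in lborel. (\<lambda>n. f n t) \<longlonglongrightarrow> - (ln \<bar>t - a\<bar> / (1 + t\<^sup>2))"
    using AE_lborel_singleton[of a]
  proof eventually_elim
    case (elim t)
    have "(\<lambda>n. f n t) \<longlonglongrightarrow> - (ln (cmod (of_real (t - a) + \<i> * of_real 0)) / (1 + t\<^sup>2))"
      unfolding f_def using elim
      by (intro tendsto_intros blim) (auto simp: add_nonneg_eq_0_iff complex_eq_iff power2_eq_square sum_squares_eq_zero_iff[of 1])
    moreover have "cmod (of_real (t - a)) = \<bar>t - a\<bar>" by (rule norm_of_real)
    ultimately show ?case by (simp del: of_real_diff)
  qed
  have c3: "(\<lambda>n. integral\<^sup>L lborel (f n)) \<longlonglongrightarrow> - (pi * ln (sqrt (a\<^sup>2 + 1)))"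
  proof -
    have pos: "0 < a\<^sup>2 + 1" by (simp add: add_nonneg_pos)
    have "(\<lambda>n. - (pi * ln (sqrt (a\<^sup>2 + (1 + b n)\<^sup>2)))) \<longlonglongrightarrow> - (pi * ln (sqrt (a\<^sup>2 + (1 + 0)\<^sup>2)))"
      by (intro tendsto_intros blim) (use pos in auto)
    moreover have "integral\<^sup>L lborel (f n) = - (pi * ln (sqrt (a\<^sup>2 + (1 + b n)\<^sup>2)))" for n
      unfolding f_def using Poisson_log_shifted(2)[OF b] by simp
    ultimately show ?thesis by simp
  qed
  have c4: "(\<lambda>t. - (ln \<bar>t - a\<bar> / (1 + t\<^sup>2))) \<in> borel_measurable lborel" by measurable
  show "integrable lborel (\<lambda>t. ln \<bar>t - a\<bar> / (1 + t\<^sup>2))"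
    using integrable_minus[OF integrable_monotone_convergence[OF i c1 c2 c3 c4]] by simp
  show "(LINT t|lborel. ln \<bar>t - a\<bar> / (1 + t\<^sup>2)) = pi * ln (sqrt (a\<^sup>2 + 1))"
    using integral_monotone_convergence[OF i c1 c2 c3 c4] by simp
qed

definition poisson :: "real \<Rightarrow> real \<Rightarrow> real" where
  "poisson h u = h / (u\<^sup>2 + h\<^sup>2) / pi"

lemma poisson_nonneg: "0 \<le> h \<Longrightarrow> 0 \<le> poisson h u" by (simp add: poisson_def)

lemma poisson_measurable [measurable]: "poisson h \<in> borel_measurable borel"
  unfolding poisson_def by measurable

lemma poisson_scale: "0 < h \<Longrightarrow> poisson h (h * s) = 1 / (pi * h) * (1 / (1 + s\<^sup>2))"
proof -
  assume h: "0 < h"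
  have "(h * s)\<^sup>2 + h\<^sup>2 = h * (h * (1 + s\<^sup>2))" by (simp add: power2_eq_square algebra_simps)
  then show ?thesis using h unfolding poisson_def by simp
qed

lemma poisson_integral:
  assumes "0 < h"
  shows "integrable lborel (\<lambda>t. poisson h (t - \<xi>))" "(LINT t|lborel. poisson h (t - \<xi>)) = 1"
proof -
  have "has_bochner_integral lborel (\<lambda>s. poisson h ((\<xi> + h * s) - \<xi>)) (1 /\<^sub>R \<bar>h\<bar>)"
  proof -
    have "has_bochner_integral lborel (\<lambda>s::real. 1 / (pi * h) * (1 / (1 + s\<^sup>2))) (1 / (pi * h) * pi)"
      by (intro has_bochner_integral_mult_right) (use integral_one_over_one_plus_square in \<open>auto simp: has_bochner_integral_iff\<close>)
    moreover have "poisson h ((\<xi> + h * s) - \<xi>) = 1 / (pi * h) * (1 / (1 + s\<^sup>2))" for s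
      using poisson_scale[OF assms, of s] by simp
    moreover have "1 / (pi * h) * pi = 1 /\<^sub>R \<bar>h\<bar>" using assms by (simp add: inverse_eq_divide)
    ultimately show ?thesis by (simp only:)
  qed
  then have "has_bochner_integral lborel (\<lambda>t. poisson h (t - \<xi>)) 1"
    by (subst lborel_has_bochner_integral_real_affine_iff[of h _ _ \<xi>]) (use assms in auto)
  then show "integrable lborel (\<lambda>t. poisson h (t - \<xi>))" "(LINT t|lborel. poisson h (t - \<xi>)) = 1"
    by (auto simp: has_bochner_integral_iff)
qed

lemma poisson_log:
  assumes h: "0 < h"
  shows "integrable lborel (\<lambda>t. ln \<bar>x - t\<bar> * poisson h (t - \<xi>))"
    and "(LINT t|lborel. ln \<bar>x - t\<bar> * poisson h (t - \<xi>)) = ln (sqrt ((x - \<xi>)\<^sup>2 + h\<^sup>2))"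
proof -
  define a where "a = (x - \<xi>) / h"
  define v where "v = ln h + ln (sqrt (a\<^sup>2 + 1))"
  have v: "v = ln (sqrt ((x - \<xi>)\<^sup>2 + h\<^sup>2))"
  proof -
    have "(x - \<xi>)\<^sup>2 + h\<^sup>2 = h\<^sup>2 * (a\<^sup>2 + 1)" using h by (simp add: a_def power_divide field_simps)
    then have "sqrt ((x - \<xi>)\<^sup>2 + h\<^sup>2) = h * sqrt (a\<^sup>2 + 1)" using h by (simp add: real_sqrt_mult)
    moreover have "0 < sqrt (a\<^sup>2 + 1)" by (simp add: add_nonneg_pos)
    ultimately show ?thesis using h by (simp add: v_def ln_mult)
  qed
  have "has_bochner_integral lborel (\<lambda>s. 1 / (pi * h) * (ln h * (1 / (1 + s\<^sup>2)) + ln \<bar>s - a\<bar> / (1 + s\<^sup>2)))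
      (1 / (pi * h) * (ln h * pi + pi * ln (sqrt (a\<^sup>2 + 1))))"
    by (intro has_bochner_integral_mult_right has_bochner_integral_add)
       (use integral_one_over_one_plus_square Poisson_log in \<open>auto simp: has_bochner_integral_iff\<close>)
  moreover have "1 / (pi * h) * (ln h * pi + pi * ln (sqrt (a\<^sup>2 + 1))) = v / h" using h by (simp add: v_def field_simps)
  ultimately have 1: "has_bochner_integral lborel (\<lambda>s. 1 / (pi * h) * (ln h * (1 / (1 + s\<^sup>2)) + ln \<bar>s - a\<bar> / (1 + s\<^sup>2))) (v / h)"
    by simp
  have ae: "AE s in lborel. 1 / (pi * h) * (ln h * (1 / (1 + s\<^sup>2)) + ln \<bar>s - a\<bar> / (1 + s\<^sup>2)) = ln \<bar>x - (\<xi> + h * s)\<bar> * poisson h ((\<xi> + h * s) - \<xi>)"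
    using AE_lborel_singleton[of a]
  proof eventually_elim
    case (elim s)
    have "x - (\<xi> + h * s) = - (h * (s - a))" using h by (simp add: a_def field_simps)
    then have "\<bar>x - (\<xi> + h * s)\<bar> = h * \<bar>s - a\<bar>" using h by (simp add: abs_mult)
    then have "ln \<bar>x - (\<xi> + h * s)\<bar> = ln h + ln \<bar>s - a\<bar>" using h elim by (simp add: ln_mult)
    moreover have "poisson h ((\<xi> + h * s) - \<xi>) = 1 / (pi * h) * (1 / (1 + s\<^sup>2))"
      using poisson_scale[OF h, of s] by simp
    ultimately have "ln \<bar>x - (\<xi> + h * s)\<bar> * poisson h ((\<xi> + h * s) - \<xi>) = (ln h + ln \<bar>s - a\<bar>) * (1 / (pi * h) * (1 / (1 + s\<^sup>2)))"
      by (simp only:)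
    then show ?case by (simp add: distrib_left distrib_right add_divide_distrib)
  qed
  have "has_bochner_integral lborel (\<lambda>s. ln \<bar>x - (\<xi> + h * s)\<bar> * poisson h ((\<xi> + h * s) - \<xi>)) (v /\<^sub>R \<bar>h\<bar>)"
    using 1 h by (subst has_bochner_integral_cong_AE[OF _ _ ae, symmetric]) (auto simp: divide_inverse mult.commute)
  then have "has_bochner_integral lborel (\<lambda>t. ln \<bar>x - t\<bar> * poisson h (t - \<xi>)) v"
    by (subst lborel_has_bochner_integral_real_affine_iff[of h _ _ \<xi>]) (use h in auto)
  then show "integrable lborel (\<lambda>t. ln \<bar>x - t\<bar> * poisson h (t - \<xi>))"
    "(LINT t|lborel. ln \<bar>x - t\<bar> * poisson h (t - \<xi>)) = ln (sqrt ((x - \<xi>)\<^sup>2 + h\<^sup>2))"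
    by (auto simp: has_bochner_integral_iff v)
qed

text \<open>The integrand of the potential at a real point.\<close>

definition log_kernel :: "real \<Rightarrow> real \<Rightarrow> real" where
  "log_kernel x t = ln (cmod (1 - of_real x / of_real t)) + (1 - indicat_real {-1..1} t) * (x / t)"

text \<open>The function \<open>\<chi>(t) / t\<close> that makes the integral defining the potential converge at infinity.\<close>

definition tail_inverse :: "real \<Rightarrow> real" where "tail_inverse t = (1 - indicat_real {-1..1} t) / t"

lemma tail_inverse_measurable [measurable]: "tail_inverse \<in> borel_measurable borel"
  unfolding tail_inverse_def by measurable

lemma abs_tail_inverse_le: "\<bar>tail_inverse t\<bar> \<le> 1"
  by (auto simp: tail_inverse_def indicator_def abs_divide divide_le_eq)

lemma log_kernel_measurable [measurable]: "log_kernel x \<in> borel_measurable borel"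
  unfolding log_kernel_def by measurable

lemma potential_eq_log_kernel:
  assumes "m \<in> borel_measurable borel"
  shows "potential m (of_real x) = (LINT t|lborel. log_kernel x t * m t)"
  unfolding potential_def log_kernel_def using assms by (subst integral_completion) auto

lemma log_kernel_eq:
  assumes "t \<noteq> 0" "t \<noteq> x"
  shows "log_kernel x t = ln \<bar>x - t\<bar> - ln \<bar>0 - t\<bar> + x * tail_inverse t"
proof -
  have "1 - complex_of_real x / of_real t = of_real ((t - x) / t)" using assms by (simp add: diff_divide_distrib)
  then have "cmod (1 - of_real x / of_real t) = \<bar>x - t\<bar> / \<bar>t\<bar>" by (simp only: norm_of_real abs_divide) (simp add: abs_minus_commute)
  then show ?thesis using assms by (simp add: log_kernel_def tail_inverse_def ln_div)
qed

text \<open>The compensating term cancels the first order of \<open>ln (1 - x / t)\<close> at infinity.\<close>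

lemma log_kernel_decay:
  assumes t: "2 * \<bar>x\<bar> + 2 \<le> \<bar>t\<bar>"
  shows "\<bar>log_kernel x t\<bar> \<le> 4 * x\<^sup>2 / (1 + t\<^sup>2)"
proof -
  define u where "u = x / t"
  have u: "\<bar>u\<bar> \<le> 1/2" using t by (simp add: u_def abs_divide divide_le_eq)
  have "t \<notin> {-1..1}" using t by auto
  then have "log_kernel x t = ln (cmod (of_real (1 - u))) + u" by (simp add: log_kernel_def u_def)
  also have "cmod (of_real (1 - u)) = 1 + (- u)" unfolding norm_of_real using u by linarith
  finally have "\<bar>log_kernel x t\<bar> = \<bar>ln (1 + (- u)) - (- u)\<bar>" by simp
  also have "\<dots> \<le> 2 * (- u)\<^sup>2" by (rule abs_ln_one_plus_x_minus_x_bound) (use u in simp)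
  also have "\<dots> = 2 * x\<^sup>2 / t\<^sup>2" by (simp add: u_def power_divide)
  also have "\<dots> \<le> 2 * x\<^sup>2 / ((1 + t\<^sup>2) / 2)"
  proof (rule divide_left_mono)
    have "1 \<le> t\<^sup>2" using t power_mono[of 1 "\<bar>t\<bar>" 2] by simp
    then show "(1 + t\<^sup>2) / 2 \<le> t\<^sup>2" "0 < t\<^sup>2 * ((1 + t\<^sup>2) / 2)" by (auto intro!: mult_pos_pos)
  qed auto
  finally show ?thesis by simp
qed

lemma integrable_log_kernel_mult:
  assumes m: "m \<in> borel_measurable borel" and q: "q < 1" "0 \<le> q" and W: "\<And>t. \<bar>m t\<bar> \<le> W * (1 + \<bar>t\<bar>) powr q"
  shows "integrable lborel (\<lambda>t. log_kernel x t * m t)"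
proof -
  define R where "R = 2 * \<bar>x\<bar> + 2"
  have W0: "0 \<le> W" using W[of 0] by simp
  define J where "J t = (1 + R\<^sup>2) * (W * (1 + R) powr q) * (\<bar>ln \<bar>t - x\<bar> / (1 + t\<^sup>2)\<bar> + \<bar>ln \<bar>t - 0\<bar> / (1 + t\<^sup>2)\<bar> + \<bar>x\<bar> * (1 / (1 + t\<^sup>2)))
     + 8 * x\<^sup>2 * W * (1 + \<bar>t\<bar>) powr (q - 2)" for t
  show ?thesis
  proof (rule Bochner_Integration.integrable_bound)
    show "integrable lborel J" unfolding J_def
      by (intro Bochner_Integration.integrable_add integrable_mult_right integrable_abs Poisson_log
          integral_one_over_one_plus_square integrable_one_plus_abs_powr) (use q in auto)
    show "(\<lambda>t. log_kernel x t * m t) \<in> borel_measurable lborel" using m by measurable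
    show "AE t in lborel. norm (log_kernel x t * m t) \<le> norm (J t)"
      using AE_lborel_singleton[of x] AE_lborel_singleton[of 0]
    proof eventually_elim
      case (elim t)
      have R0: "0 \<le> R" by (simp add: R_def)
      have pos: "0 < 1 + t\<^sup>2" by (simp add: add_pos_nonneg)
      have "\<bar>log_kernel x t * m t\<bar> \<le> J t"
      proof (cases "\<bar>t\<bar> < R")
        case True
        define l where "l = \<bar>ln \<bar>t - x\<bar>\<bar> + \<bar>ln \<bar>t - 0\<bar>\<bar> + \<bar>x\<bar>"
        have l0: "0 \<le> l" by (simp add: l_def)
        have "\<bar>log_kernel x t\<bar> \<le> \<bar>ln \<bar>x - t\<bar>\<bar> + \<bar>ln \<bar>0 - t\<bar>\<bar> + \<bar>x * tail_inverse t\<bar>" using log_kernel_eq[of t x] elim by linarith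
        also have "\<bar>x * tail_inverse t\<bar> \<le> \<bar>x\<bar>" using abs_tail_inverse_le[of t] by (simp add: abs_mult mult_left_le)
        finally have k: "\<bar>log_kernel x t\<bar> \<le> l" by (simp add: l_def abs_minus_commute)
        have "\<bar>m t\<bar> \<le> W * (1 + R) powr q"
          using W[of t] True W0 q by (smt (verit) mult_left_mono powr_mono2)
        with k have "\<bar>log_kernel x t * m t\<bar> \<le> l * (W * (1 + R) powr q)"
          unfolding abs_mult using l0 by (intro mult_mono) auto
        also have "\<dots> = (1 + t\<^sup>2) * (W * (1 + R) powr q) * (l / (1 + t\<^sup>2))" using pos by simp
        also have "\<dots> \<le> (1 + R\<^sup>2) * (W * (1 + R) powr q) * (l / (1 + t\<^sup>2))"
        proof (intro mult_right_mono)
          show "1 + t\<^sup>2 \<le> 1 + R\<^sup>2" using True by (simp add: abs_le_square_iff[symmetric])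
        qed (use W0 l0 pos in auto)
        also have "l / (1 + t\<^sup>2) = \<bar>ln \<bar>t - x\<bar> / (1 + t\<^sup>2)\<bar> + \<bar>ln \<bar>t - 0\<bar> / (1 + t\<^sup>2)\<bar> + \<bar>x\<bar> * (1 / (1 + t\<^sup>2))"
          using pos by (simp add: l_def add_divide_distrib abs_divide)
        finally show ?thesis unfolding J_def using W0 by (smt (verit) mult_nonneg_nonneg powr_ge_zero zero_le_power2)
      next
        case False
        have "\<bar>log_kernel x t * m t\<bar> \<le> (4 * x\<^sup>2 / (1 + t\<^sup>2)) * (W * (1 + \<bar>t\<bar>) powr q)"
          unfolding abs_mult using log_kernel_decay[of x t] False W[of t] by (intro mult_mono) (auto simp: R_def)
        also have "\<dots> \<le> (4 * x\<^sup>2 / ((1 + \<bar>t\<bar>)\<^sup>2 / 2)) * (W * (1 + \<bar>t\<bar>) powr q)"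
          using one_plus_square_ge[of t] pos W0 by (intro mult_right_mono divide_left_mono mult_pos_pos) auto
        also have "\<dots> = 8 * x\<^sup>2 * W * ((1 + \<bar>t\<bar>) powr q / (1 + \<bar>t\<bar>) powr 2)" by (simp add: powr_numeral)
        also have "(1 + \<bar>t\<bar>) powr q / (1 + \<bar>t\<bar>) powr 2 = (1 + \<bar>t\<bar>) powr (q - 2)" by (simp add: powr_diff)
        finally show ?thesis unfolding J_def using W0 R0 pos by (smt (verit) mult_nonneg_nonneg powr_ge_zero zero_le_power2 divide_nonneg_nonneg zero_le_divide_1_iff abs_ge_zero)
      qed
      then show ?case by simp
    qed
  qed
qed

lemma integrable_tail_inverse_poisson: 
  assumes "0 < h" shows "integrable lborel (\<lambda>t. tail_inverse t * poisson h (t - \<xi>))"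
proof (rule Bochner_Integration.integrable_bound[OF poisson_integral(1)[OF assms, of \<xi>]])
  show "AE t in lborel. norm (tail_inverse t * poisson h (t - \<xi>)) \<le> norm (poisson h (t - \<xi>))"
    using abs_tail_inverse_le by (intro AE_I2) (simp add: abs_mult mult_left_le_one_le)
qed measurable

text \<open>The Poisson density is the balayage of the unit mass at \<open>\<xi> - i h\<close>: its potential is \<open>ln |x - \<xi> + i h|\<close>, normalised
at 0, plus a linear term that comes from the compensation at infinity.\<close>

lemma log_kernel_poisson:
  assumes h: "0 < h"
  shows "integrable lborel (\<lambda>t. log_kernel x t * poisson h (t - \<xi>))"
    and "(LINT t|lborel. log_kernel x t * poisson h (t - \<xi>)) =
       ln (sqrt ((x - \<xi>)\<^sup>2 + h\<^sup>2)) - ln (sqrt (\<xi>\<^sup>2 + h\<^sup>2)) + x * (LINT t|lborel. tail_inverse t * poisson h (t - \<xi>))"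
proof -
  have hb: "has_bochner_integral lborel (\<lambda>t. ln \<bar>x - t\<bar> * poisson h (t - \<xi>) - ln \<bar>0 - t\<bar> * poisson h (t - \<xi>) + x * (tail_inverse t * poisson h (t - \<xi>)))
     (ln (sqrt ((x - \<xi>)\<^sup>2 + h\<^sup>2)) - ln (sqrt ((0 - \<xi>)\<^sup>2 + h\<^sup>2)) + x * (LINT t|lborel. tail_inverse t * poisson h (t - \<xi>)))"
    by (intro has_bochner_integral_add has_bochner_integral_diff has_bochner_integral_mult_right)
       (use poisson_log[OF h] integrable_tail_inverse_poisson[OF h] in \<open>auto simp: has_bochner_integral_iff simp del: diff_0\<close>)
  have ae: "AE t in lborel. ln \<bar>x - t\<bar> * poisson h (t - \<xi>) - ln \<bar>0 - t\<bar> * poisson h (t - \<xi>) + x * (tail_inverse t * poisson h (t - \<xi>)) = log_kernel x t * poisson h (t - \<xi>)"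
    using AE_lborel_singleton[of x] AE_lborel_singleton[of 0]
    by eventually_elim (simp add: log_kernel_eq algebra_simps)
  have "has_bochner_integral lborel (\<lambda>t. log_kernel x t * poisson h (t - \<xi>))
     (ln (sqrt ((x - \<xi>)\<^sup>2 + h\<^sup>2)) - ln (sqrt ((0 - \<xi>)\<^sup>2 + h\<^sup>2)) + x * (LINT t|lborel. tail_inverse t * poisson h (t - \<xi>)))"
    using hb by (subst has_bochner_integral_cong_AE[OF _ _ ae, symmetric]) auto
  then show "integrable lborel (\<lambda>t. log_kernel x t * poisson h (t - \<xi>))"
    "(LINT t|lborel. log_kernel x t * poisson h (t - \<xi>)) =
       ln (sqrt ((x - \<xi>)\<^sup>2 + h\<^sup>2)) - ln (sqrt (\<xi>\<^sup>2 + h\<^sup>2)) + x * (LINT t|lborel. tail_inverse t * poisson h (t - \<xi>))"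
    by (auto simp: has_bochner_integral_iff)
qed

text \<open>Balayage of infinitely many point masses: the partial sums of the Poisson densities are dominated by the bounded
total density.\<close>

lemma log_kernel_poisson_series:
  fixes s :: "nat \<Rightarrow> real \<Rightarrow> real"
  assumes I: "\<And>n. n \<in> I \<Longrightarrow> 0 < h n"
    and sums: "\<And>t. (\<lambda>n. if n \<in> I then poisson (h n) (t - \<xi> n) else 0) sums m t" and bd: "\<And>t. m t \<le> M"
  shows "m \<in> borel_measurable borel"
    and "(\<lambda>n. if n \<in> I then ln (sqrt ((x - \<xi> n)\<^sup>2 + (h n)\<^sup>2)) - ln (sqrt ((\<xi> n)\<^sup>2 + (h n)\<^sup>2))
        + x * (LINT t|lborel. tail_inverse t * poisson (h n) (t - \<xi> n)) else 0) sums (LINT t|lborel. log_kernel x t * m t)"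
proof -
  define s where "s n t = (if n \<in> I then poisson (h n) (t - \<xi> n) else 0)" for n t
  have s0: "0 \<le> s n t" for n t using I[of n] by (auto simp: s_def intro: poisson_nonneg less_imp_le)
  have sm [measurable]: "s n \<in> borel_measurable borel" for n unfolding s_def by measurable
  have sms: "(\<lambda>n. s n t) sums m t" for t using sums[of t] by (simp add: s_def)
  have "m = (\<lambda>t. \<Sum>n. s n t)" using sms by (auto simp: sums_iff)
  then show mm: "m \<in> borel_measurable borel" by simp
  have part: "(\<Sum>n<N. s n t) \<le> m t" for N t
    using sms[of t] s0 by (metis sums_summable sums_unique sum_le_suminf finite_lessThan)
  have m0: "0 \<le> m t" for t using part[where N = 0 and t = t] by simp
  have "(\<lambda>N. LINT t|lborel. log_kernel x t * (\<Sum>n<N. s n t)) \<longlonglongrightarrow> (LINT t|lborel. log_kernel x t * m t)"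
  proof (rule integral_dominated_convergence)
    show "integrable lborel (\<lambda>t. \<bar>log_kernel x t * m t\<bar>)"
      by (intro integrable_abs integrable_log_kernel_mult[where q = 0 and W = M] mm) (use m0 bd in auto)
    show "(\<lambda>t. log_kernel x t * m t) \<in> borel_measurable lborel" using mm by measurable
    show "(\<lambda>t. log_kernel x t * (\<Sum>n<N. s n t)) \<in> borel_measurable lborel" for N by measurable
    show "AE t in lborel. (\<lambda>N. log_kernel x t * (\<Sum>n<N. s n t)) \<longlonglongrightarrow> log_kernel x t * m t"
      using sms unfolding sums_def by (intro AE_I2 tendsto_mult_left)
    show "AE t in lborel. norm (log_kernel x t * (\<Sum>n<N. s n t)) \<le> \<bar>log_kernel x t * m t\<bar>" for N
    proof (rule AE_I2)
      fix t
      have "\<bar>\<Sum>n<N. s n t\<bar> \<le> \<bar>m t\<bar>" using part[where N = N and t = t] m0[of t] s0 by (simp add: sum_nonneg)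
      then show "norm (log_kernel x t * (\<Sum>n<N. s n t)) \<le> \<bar>log_kernel x t * m t\<bar>" by (simp add: abs_mult mult_left_mono)
    qed
  qed
  moreover have "(LINT t|lborel. log_kernel x t * (\<Sum>n<N. s n t)) = (\<Sum>n<N. if n \<in> I then ln (sqrt ((x - \<xi> n)\<^sup>2 + (h n)\<^sup>2)) - ln (sqrt ((\<xi> n)\<^sup>2 + (h n)\<^sup>2))
        + x * (LINT t|lborel. tail_inverse t * poisson (h n) (t - \<xi> n)) else 0)" for N
  proof -
    have i: "integrable lborel (\<lambda>t. log_kernel x t * s n t)" for n
      by (cases "n \<in> I") (auto simp: s_def intro: log_kernel_poisson(1)[OF I])
    have "(LINT t|lborel. log_kernel x t * (\<Sum>n<N. s n t)) = (\<Sum>n<N. LINT t|lborel. log_kernel x t * s n t)"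
      using i by (simp add: sum_distrib_left)
    also have "\<dots> = (\<Sum>n<N. if n \<in> I then ln (sqrt ((x - \<xi> n)\<^sup>2 + (h n)\<^sup>2)) - ln (sqrt ((\<xi> n)\<^sup>2 + (h n)\<^sup>2))
        + x * (LINT t|lborel. tail_inverse t * poisson (h n) (t - \<xi> n)) else 0)"
      by (rule sum.cong) (auto simp: s_def log_kernel_poisson(2)[OF I])
    finally show ?thesis .
  qed
  ultimately show "(\<lambda>n. if n \<in> I then ln (sqrt ((x - \<xi> n)\<^sup>2 + (h n)\<^sup>2)) - ln (sqrt ((\<xi> n)\<^sup>2 + (h n)\<^sup>2))
        + x * (LINT t|lborel. tail_inverse t * poisson (h n) (t - \<xi> n)) else 0) sums (LINT t|lborel. log_kernel x t * m t)"
    by (simp add: sums_def)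
qed

section \<open>Slowly varying functions as potentials of small densities\<close>

text \<open>A large-scale Hoelder function varies by \<open>O(T\<^sup>q)\<close> at scale \<open>T\<close>.\<close>

lemma poisson_weight:
  assumes T: "0 < T" and q: "0 \<le> q" "q < 1"
  shows "integrable lborel (\<lambda>u. (1 + \<bar>u - x\<bar>) powr q * poisson T (u - x))"
    and "(LINT u|lborel. (1 + \<bar>u - x\<bar>) powr q * poisson T (u - x)) \<le> (1 + T) powr q * (LINT v|lborel. (1 + \<bar>v\<bar>) powr q * poisson 1 v)"
proof -
  have base: "integrable lborel (\<lambda>v. (1 + \<bar>v\<bar>) powr q * poisson 1 v)"
  proof (rule integrable_powr_decay[where p = "q - 2" and A = 2])
    fix t :: real
    have pos: "0 < 1 + \<bar>t\<bar>" by simp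
    have "poisson 1 t \<le> 1 / (t\<^sup>2 + 1)" using divide_le_self[of pi "1 / (t\<^sup>2 + 1)"] pi_gt3 by (simp add: poisson_def)
    also have "\<dots> \<le> 1 / ((1 + \<bar>t\<bar>)\<^sup>2 / 2)" using one_plus_square_ge[of t] pos
      by (intro divide_left_mono mult_pos_pos) (auto simp: add_nonneg_pos)
    also have "\<dots> = 2 / (1 + \<bar>t\<bar>) powr 2" by (simp add: powr_numeral)
    finally have "(1 + \<bar>t\<bar>) powr q * poisson 1 t \<le> (1 + \<bar>t\<bar>) powr q * (2 / (1 + \<bar>t\<bar>) powr 2)" by (rule mult_left_mono) simp
    also have "\<dots> = 2 * (1 + \<bar>t\<bar>) powr (q - 2)" by (simp add: powr_diff)
    finally show "norm ((1 + \<bar>t\<bar>) powr q * poisson 1 t) \<le> 2 * (1 + \<bar>t\<bar>) powr (q - 2)" using poisson_nonneg[of 1 t] by (simp add: abs_mult)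
    show "q - 2 < - 1" using q by simp
    show "(\<lambda>v. (1 + \<bar>v\<bar>) powr q * poisson 1 v) \<in> borel_measurable borel" by measurable
  qed
  have scale: "poisson T (T * v) = poisson 1 v / T" for v
    using poisson_scale[OF T, of v] poisson_scale[of 1 v] by simp
  define F where "F u = (1 + \<bar>u - x\<bar>) powr q * poisson T (u - x)" for u
  have Fv: "F (x + T * v) = (1 + T * \<bar>v\<bar>) powr q * poisson 1 v / T" for v using T by (simp add: F_def scale abs_mult)
  have le: "F (x + T * v) \<le> (1 + T) powr q / T * ((1 + \<bar>v\<bar>) powr q * poisson 1 v)" for v
  proof -
    have "1 + T * \<bar>v\<bar> \<le> (1 + T) * (1 + \<bar>v\<bar>)" using T by (simp add: algebra_simps)
    then have "(1 + T * \<bar>v\<bar>) powr q \<le> ((1 + T) * (1 + \<bar>v\<bar>)) powr q" using q T by (intro powr_mono2) auto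
    then have "(1 + T * \<bar>v\<bar>) powr q \<le> (1 + T) powr q * (1 + \<bar>v\<bar>) powr q" using T by (simp add: powr_mult)
    then have "(1 + T * \<bar>v\<bar>) powr q * poisson 1 v / T \<le> (1 + T) powr q * (1 + \<bar>v\<bar>) powr q * poisson 1 v / T"
      using T poisson_nonneg[of 1 v] by (intro divide_right_mono mult_right_mono) auto
    then show ?thesis by (simp add: Fv field_simps)
  qed
  have F0: "0 \<le> F u" for u using T poisson_nonneg[of T] by (simp add: F_def)
  have iF: "integrable lborel (\<lambda>v. F (x + T * v))"
  proof (rule Bochner_Integration.integrable_bound)
    show "integrable lborel (\<lambda>v. (1 + T) powr q / T * ((1 + \<bar>v\<bar>) powr q * poisson 1 v))" by (rule integrable_mult_right[OF base])
    show "AE v in lborel. norm (F (x + T * v)) \<le> norm ((1 + T) powr q / T * ((1 + \<bar>v\<bar>) powr q * poisson 1 v))"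
      using le F0 T by (intro AE_I2) (smt (verit) real_norm_def abs_of_nonneg)
  qed (simp add: F_def)
  have "integrable lborel F"
    using iF lborel_integrable_real_affine_iff[of T F x] T by simp
  then show "integrable lborel (\<lambda>u. (1 + \<bar>u - x\<bar>) powr q * poisson T (u - x))" by (simp add: F_def[abs_def])
  have "(LINT u|lborel. F u) = T * (LINT v|lborel. F (x + T * v))"
    using lborel_integral_real_affine[of T F x] T by simp
  also have "\<dots> \<le> T * (LINT v|lborel. (1 + T) powr q / T * ((1 + \<bar>v\<bar>) powr q * poisson 1 v))"
    using T by (intro mult_left_mono integral_mono iF integrable_mult_right base le) auto
  also have "\<dots> = (1 + T) powr q * (LINT v|lborel. (1 + \<bar>v\<bar>) powr q * poisson 1 v)" using T by simp
  finally show "(LINT u|lborel. (1 + \<bar>u - x\<bar>) powr q * poisson T (u - x)) \<le> (1 + T) powr q * (LINT v|lborel. (1 + \<bar>v\<bar>) powr q * poisson 1 v)"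
    by (simp add: F_def[abs_def])
qed

text \<open>An averaging kernel of width \<open>T\<close>. By \<open>log_kernel_poisson\<close> it is the potential of the difference of the Poisson
kernels of heights \<open>2 T\<close> and \<open>T\<close>, up to an affine function.\<close>

definition log_step :: "real \<Rightarrow> real \<Rightarrow> real" where
  "log_step T u = ln (sqrt (u\<^sup>2 + (2 * T)\<^sup>2)) - ln (sqrt (u\<^sup>2 + T\<^sup>2))"

lemma log_step_measurable [measurable]: "log_step T \<in> borel_measurable borel" unfolding log_step_def by measurable

lemma poisson_minus: "poisson h (- u) = poisson h u" by (simp add: poisson_def)

text \<open>The kernel has total mass of order \<open>T\<close> and the tails of a Poisson kernel.\<close>

lemma log_step_bounds:
  assumes T: "0 < T"
  shows "3 * pi * T / 4 * poisson (2 * T) u \<le> log_step T u" "log_step T u \<le> 3 * pi * T / 2 * poisson T u" "0 \<le> log_step T u"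
proof -
  define A where "A = u\<^sup>2 + (2 * T)\<^sup>2"
  define B where "B = u\<^sup>2 + T\<^sup>2"
  have AB: "0 < A" "0 < B" "A = B + 3 * T\<^sup>2" using T by (auto simp: A_def B_def power_mult_distrib add_nonneg_pos)
  have qe: "log_step T u = ln (A / B) / 2" 
    unfolding log_step_def A_def[symmetric] B_def[symmetric] using AB(1,2) by (simp add: ln_sqrt ln_div diff_divide_distrib)
  have "ln (A / B) \<le> A / B - 1" using AB by (intro ln_le_minus_one) auto
  also have "A / B - 1 = 3 * T\<^sup>2 / B" using AB by (simp add: field_simps)
  finally have "log_step T u \<le> 3 * T\<^sup>2 / B / 2" unfolding qe by (rule divide_right_mono) simp
  moreover have "3 * pi * T / 2 * poisson T u = 3 * T\<^sup>2 / B / 2" unfolding poisson_def B_def by (simp add: power2_eq_square)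
  ultimately show "log_step T u \<le> 3 * pi * T / 2 * poisson T u" by simp
  have "ln (B / A) \<le> B / A - 1" using AB by (intro ln_le_minus_one) auto
  moreover have "B / A - 1 = - (3 * T\<^sup>2 / A)" using AB by (simp add: field_simps)
  moreover have "ln (B / A) = - ln (A / B)" using AB by (simp add: ln_div)
  ultimately have "3 * T\<^sup>2 / A \<le> ln (A / B)" by simp
  then have "3 * T\<^sup>2 / A / 2 \<le> log_step T u" unfolding qe by (rule divide_right_mono) simp
  moreover have "3 * pi * T / 4 * poisson (2 * T) u = 3 * T\<^sup>2 / A / 2" unfolding poisson_def A_def by (simp add: power2_eq_square)
  ultimately show "3 * pi * T / 4 * poisson (2 * T) u \<le> log_step T u" by simp
  moreover have "0 \<le> 3 * pi * T / 4 * poisson (2 * T) u" using T by (intro mult_nonneg_nonneg poisson_nonneg) auto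
  ultimately show "0 \<le> log_step T u" by linarith
qed

lemma poisson_diff_bound:
  assumes T: "0 < T"
  shows "\<bar>poisson (2 * T) u - poisson T u\<bar> \<le> poisson T u"
proof -
  have "poisson (2 * T) u \<le> 2 * poisson T u"
  proof -
    have "2 * T / (u\<^sup>2 + (2 * T)\<^sup>2) \<le> 2 * T / (u\<^sup>2 + T\<^sup>2)"
      using T by (intro divide_left_mono mult_pos_pos add_left_mono power_mono) (auto simp: add_nonneg_pos)
    from divide_right_mono[OF this, of pi] show ?thesis unfolding poisson_def by simp
  qed
  then show ?thesis using poisson_nonneg[of "2 * T" u] T by simp
qed

text \<open>\<open>Lt\<close> is the average of \<open>L\<close> against the normalised kernel \<open>log_step T\<close>, whose mass \<open>\<kappa>\<close> is of order \<open>T\<close>. Since \<open>L\<close> varies by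
\<open>O(T\<^sup>q)\<close> at scale \<open>T\<close>, the average differs from \<open>L\<close> by a bounded amount. As \<open>log_step T\<close> is, up to an affine function, the potential of
\<open>D = poisson (2 T) - poisson T\<close>, Fubini's theorem exhibits \<open>Lt\<close>, up to
an affine function, as the potential of \<open>m\<close>, the convolution of \<open>L\<close> with \<open>D / \<kappa>\<close>. The integral of \<open>D\<close>
vanishes, so \<open>L\<close> may be replaced by \<open>L - L(t)\<close> in \<open>m(t)\<close>; thus \<open>m\<close> has size \<open>O(T\<^sup>q / \<kappa>) = O(T\<^sup>q\<^sup>-\<^sup>1)\<close>.\<close>

lemma smoothing:
  fixes L :: "real \<Rightarrow> real"
  assumes L [measurable]: "L \<in> borel_measurable borel" and q: "0 \<le> q" "q < 1" and C: "0 \<le> C"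
    and hol: "\<And>s t. \<bar>L s - L t\<bar> \<le> C * (1 + \<bar>s - t\<bar>) powr q" and e: "0 < e"
  obtains m Lt c B where "m \<in> borel_measurable borel" "\<And>t. \<bar>m t\<bar> \<le> e" "\<And>x. \<bar>Lt x - L x\<bar> \<le> B"
    "\<And>x. (LINT t|lborel. log_kernel x t * m t) = Lt x - Lt 0 + c * x"
proof -
  define Aq where "Aq = (LINT v|lborel. (1 + \<bar>v\<bar>) powr q * poisson 1 v)"
  have Aq0: "0 \<le> Aq" unfolding Aq_def by (intro Bochner_Integration.integral_nonneg mult_nonneg_nonneg poisson_nonneg) auto
  have "\<exists>T>0. C * ((1 + T) powr q * Aq) / (3 * pi * T / 4) \<le> e"
  proof -
    define k where "k = C * 2 powr q * Aq / (3 * pi / 4)"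
    have k0: "0 \<le> k" using C Aq0 by (simp add: k_def)
    have "((\<lambda>T. k * T powr (q - 1)) \<longlongrightarrow> k * 0) at_top"
      by (intro tendsto_mult_left tendsto_neg_powr filterlim_ident) (use q in auto)
    then have "eventually (\<lambda>T. k * T powr (q - 1) < e) at_top" using e by (intro order_tendstoD(2)) auto
    then have "eventually (\<lambda>T. 0 < T \<and> C * ((1 + T) powr q * Aq) / (3 * pi * T / 4) \<le> e) at_top"
      using eventually_ge_at_top[of 1]
    proof eventually_elim
      case (elim T)
      have "(1 + T) powr q \<le> (2 * T) powr q" using elim q by (intro powr_mono2) auto
      also have "\<dots> = 2 powr q * T powr q" using elim by (simp add: powr_mult)
      finally have "C * ((1 + T) powr q * Aq) / (3 * pi * T / 4) \<le> C * (2 powr q * T powr q * Aq) / (3 * pi * T / 4)"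
        using C Aq0 elim by (intro divide_right_mono mult_left_mono mult_right_mono) auto
      also have "\<dots> = k * (T powr q / T powr 1)" using elim by (simp add: k_def)
      also have "T powr q / T powr 1 = T powr (q - 1)" using elim by (simp add: powr_diff)
      finally show ?case using elim by auto
    qed
    then show ?thesis using eventually_happens'[OF trivial_limit_at_top_linorder] by blast
  qed
  then obtain T where T: "0 < T" and Te: "C * ((1 + T) powr q * Aq) / (3 * pi * T / 4) \<le> e" by blast
  have T2: "0 < 2 * T" using T by simp
  define W where "W = (1 + T) powr q * Aq"
  have W0: "0 \<le> W" using Aq0 by (simp add: W_def)
  define D where "D u = poisson (2 * T) u - poisson T u" for u
  have D_meas [measurable]: "D \<in> borel_measurable borel" unfolding D_def by measurable
  have Dm: "D (- u) = D u" for u by (simp add: D_def poisson_minus)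
  have Db: "\<bar>D u\<bar> \<le> poisson T u" for u unfolding D_def by (rule poisson_diff_bound[OF T])
  have wt: "integrable lborel (\<lambda>s. (1 + \<bar>s - x\<bar>) powr q * poisson T (s - x))"
    "(LINT s|lborel. (1 + \<bar>s - x\<bar>) powr q * poisson T (s - x)) \<le> W" for x
    using poisson_weight[OF T q, of x] by (auto simp: W_def Aq_def)
  (* Averages of L against kernels with Poisson tails, compared to the value at the centre. *)
  have avg: "integrable lborel (\<lambda>s. (L s - L x) * g (s - x))"
    "(LINT s|lborel. \<bar>(L s - L x) * g (s - x)\<bar>) \<le> C * G * W"
    "integrable lborel (\<lambda>s. L s * g (s - x))"
    if g [measurable]: "g \<in> borel_measurable borel" and gb: "\<And>u. \<bar>g u\<bar> \<le> G * poisson T u" and G: "0 \<le> G" for g G x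
  proof -
    have b: "\<bar>(L s - L x) * g (s - x)\<bar> \<le> C * G * ((1 + \<bar>s - x\<bar>) powr q * poisson T (s - x))" for s
    proof -
      have "\<bar>L s - L x\<bar> * \<bar>g (s - x)\<bar> \<le> C * (1 + \<bar>s - x\<bar>) powr q * (G * poisson T (s - x))"
        using hol gb C by (intro mult_mono) auto
      then show ?thesis by (simp add: abs_mult mult_ac)
    qed
    show i: "integrable lborel (\<lambda>s. (L s - L x) * g (s - x))"
    proof (rule Bochner_Integration.integrable_bound[OF integrable_mult_right[OF wt(1)[of x], of "C * G"]])
      show "AE s in lborel. norm ((L s - L x) * g (s - x)) \<le> norm (C * G * ((1 + \<bar>s - x\<bar>) powr q * poisson T (s - x)))"
        using b by (intro AE_I2) (smt (verit) real_norm_def)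
    qed measurable
    have "(LINT s|lborel. \<bar>(L s - L x) * g (s - x)\<bar>) \<le> (LINT s|lborel. C * G * ((1 + \<bar>s - x\<bar>) powr q * poisson T (s - x)))"
      by (intro integral_mono integrable_abs i integrable_mult_right wt(1) b)
    also have "\<dots> = C * G * (LINT s|lborel. (1 + \<bar>s - x\<bar>) powr q * poisson T (s - x))" by simp
    also have "\<dots> \<le> C * G * W" using wt(2) C G by (intro mult_left_mono) auto
    finally show "(LINT s|lborel. \<bar>(L s - L x) * g (s - x)\<bar>) \<le> C * G * W" .
    have gi: "integrable lborel (\<lambda>s. g (s - x))"
    proof (rule Bochner_Integration.integrable_bound[OF integrable_mult_right[OF poisson_integral(1)[OF T, of x], of G]])
      show "AE s in lborel. norm (g (s - x)) \<le> norm (G * poisson T (s - x))"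
        using gb by (intro AE_I2) (smt (verit) real_norm_def)
    qed measurable
    have "integrable lborel (\<lambda>s. (L s - L x) * g (s - x) + L x * g (s - x))"
      by (intro Bochner_Integration.integrable_add i integrable_mult_right gi)
    then show "integrable lborel (\<lambda>s. L s * g (s - x))" by (simp add: algebra_simps)
  qed
  have qb: "\<bar>log_step T u\<bar> \<le> 3 * pi * T / 2 * poisson T u" for u using log_step_bounds[OF T, of u] by simp
  have Db1: "\<bar>D u\<bar> \<le> 1 * poisson T u" for u using Db by simp
  have G0: "0 \<le> 3 * pi * T / 2" using T by simp
  define \<kappa> where "\<kappa> = (LINT u|lborel. log_step T u)"
  have iq: "integrable lborel (\<lambda>s. log_step T (s - x))" for x
  proof (rule Bochner_Integration.integrable_bound[OF integrable_mult_right[OF poisson_integral(1)[OF T, of x], of "3 * pi * T / 2"]])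
    show "AE s in lborel. norm (log_step T (s - x)) \<le> norm (3 * pi * T / 2 * poisson T (s - x))"
      using qb by (intro AE_I2) (smt (verit) real_norm_def)
  qed measurable
  have kx: "(LINT s|lborel. log_step T (s - x)) = \<kappa>" for x
    using lborel_integral_real_affine[of 1 "log_step T" "- x"] by (simp add: \<kappa>_def)
  have \<kappa>: "3 * pi * T / 4 \<le> \<kappa>"
  proof -
    have "(LINT s|lborel. 3 * pi * T / 4 * poisson (2 * T) (s - 0)) \<le> (LINT s|lborel. log_step T (s - 0))"
      by (intro integral_mono integrable_mult_right poisson_integral(1)[OF T2] iq) (use log_step_bounds(1)[OF T] in simp)
    moreover have "(LINT s|lborel. 3 * pi * T / 4 * poisson (2 * T) (s - 0)) = 3 * pi * T / 4 * (LINT s|lborel. poisson (2 * T) (s - 0))"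
      by (rule integral_mult_right_zero)
    ultimately show ?thesis using poisson_integral(2)[OF T2, of 0] by (simp add: \<kappa>_def)
  qed
  have \<kappa>0: "0 < \<kappa>" using \<kappa> T by (smt (verit) divide_pos_pos mult_pos_pos pi_gt_zero)
  define m where "m t = (LINT s|lborel. L s * D (s - t)) / \<kappa>" for t
  define Lt where "Lt x = (LINT s|lborel. L s * log_step T (s - x)) / \<kappa>" for x
  have D0: "(LINT s|lborel. D (s - x)) = 0" "integrable lborel (\<lambda>s. D (s - x))" for x
  proof -
    show "integrable lborel (\<lambda>s. D (s - x))" unfolding D_def
      by (intro Bochner_Integration.integrable_diff poisson_integral(1) T T2)
    show "(LINT s|lborel. D (s - x)) = 0" unfolding D_def
      using poisson_integral[OF T, of x] poisson_integral[OF T2, of x] by simp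
  qed
  have m_meas: "m \<in> borel_measurable borel" unfolding m_def by measurable
  have m_le: "\<bar>m t\<bar> \<le> e" for t
  proof -
    have "(LINT s|lborel. L s * D (s - t)) = (LINT s|lborel. (L s - L t) * D (s - t) + L t * D (s - t))"
      by (simp add: algebra_simps)
    also have "\<dots> = (LINT s|lborel. (L s - L t) * D (s - t)) + L t * (LINT s|lborel. D (s - t))"
      using avg(1)[OF D_meas Db1, of t] D0(2)[of t] by simp
    finally have "\<bar>LINT s|lborel. L s * D (s - t)\<bar> = \<bar>LINT s|lborel. (L s - L t) * D (s - t)\<bar>" using D0 by simp
    also have "\<dots> \<le> (LINT s|lborel. \<bar>(L s - L t) * D (s - t)\<bar>)" by (rule integral_abs_bound)
    also have "\<dots> \<le> C * 1 * W" by (rule avg(2)[OF D_meas Db1]) simp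
    finally have "\<bar>m t\<bar> \<le> C * W / \<kappa>" using \<kappa>0 by (simp add: m_def abs_divide divide_right_mono)
    also have "\<dots> \<le> C * W / (3 * pi * T / 4)" using \<kappa> T \<kappa>0 C W0 by (intro divide_left_mono mult_pos_pos) auto
    also have "\<dots> \<le> e" using Te by (simp add: W_def)
    finally show ?thesis .
  qed
  have Lt_le: "\<bar>Lt x - L x\<bar> \<le> C * (3 * pi * T / 2) * W / \<kappa>" for x
  proof -
    have "(LINT s|lborel. L s * log_step T (s - x)) = (LINT s|lborel. (L s - L x) * log_step T (s - x) + L x * log_step T (s - x))"
      by (simp add: algebra_simps)
    also have "\<dots> = (LINT s|lborel. (L s - L x) * log_step T (s - x)) + L x * \<kappa>"
      using avg(1)[OF log_step_measurable qb G0, of x] iq[of x] kx[of x] by simp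
    finally have "Lt x - L x = (LINT s|lborel. (L s - L x) * log_step T (s - x)) / \<kappa>"
      using \<kappa>0 by (simp add: Lt_def add_divide_distrib)
    moreover have "\<bar>LINT s|lborel. (L s - L x) * log_step T (s - x)\<bar> \<le> C * (3 * pi * T / 2) * W"
      using integral_abs_bound[of lborel "\<lambda>s. (L s - L x) * log_step T (s - x)"] avg(2)[OF log_step_measurable qb G0, of x] by linarith
    then have "\<bar>LINT s|lborel. (L s - L x) * log_step T (s - x)\<bar> / \<kappa> \<le> C * (3 * pi * T / 2) * W / \<kappa>"
      using \<kappa>0 by (intro divide_right_mono) auto
    ultimately show ?thesis using \<kappa>0 by (simp only: abs_divide abs_of_pos)
  qed
  define c where "c s = (LINT t|lborel. tail_inverse t * D (t - s))" for s
  have inner: "(LINT t|lborel. log_kernel x t * (L s * D (s - t))) = L s * (log_step T (s - x) - log_step T (s - 0) + x * c s)" for x s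
  proof -
    have Ds: "D (s - t) = D (t - s)" for t using Dm[of "t - s"] by simp
    have "(LINT t|lborel. log_kernel x t * (L s * D (s - t))) = L s * (LINT t|lborel. log_kernel x t * poisson (2 * T) (t - s) - log_kernel x t * poisson T (t - s))"
    proof -
      have "log_kernel x t * (L s * D (s - t)) = L s * (log_kernel x t * poisson (2 * T) (t - s) - log_kernel x t * poisson T (t - s))" for t
        unfolding Ds[of t] by (simp add: D_def algebra_simps)
      then show ?thesis by (simp only: integral_mult_right_zero)
    qed
    also have "(LINT t|lborel. log_kernel x t * poisson (2 * T) (t - s) - log_kernel x t * poisson T (t - s))
      = (ln (sqrt ((x - s)\<^sup>2 + (2 * T)\<^sup>2)) - ln (sqrt (s\<^sup>2 + (2 * T)\<^sup>2)) + x * (LINT t|lborel. tail_inverse t * poisson (2 * T) (t - s)))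
      - (ln (sqrt ((x - s)\<^sup>2 + T\<^sup>2)) - ln (sqrt (s\<^sup>2 + T\<^sup>2)) + x * (LINT t|lborel. tail_inverse t * poisson T (t - s)))"
      using log_kernel_poisson[OF T, of x s] log_kernel_poisson[OF T2, of x s] by (simp only: Bochner_Integration.integral_diff)
    also have "(LINT t|lborel. tail_inverse t * poisson (2 * T) (t - s)) = c s + (LINT t|lborel. tail_inverse t * poisson T (t - s))"
    proof -
      have "c s = (LINT t|lborel. tail_inverse t * poisson (2 * T) (t - s) - tail_inverse t * poisson T (t - s))" unfolding c_def D_def by (simp add: algebra_simps)
      then show ?thesis using integrable_tail_inverse_poisson[OF T, of s] integrable_tail_inverse_poisson[OF T2, of s] by simp
    qed
    finally show ?thesis by (simp add: log_step_def power2_commute[of x s] algebra_simps)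
  qed
  have Fub: "integrable (lborel \<Otimes>\<^sub>M lborel) (\<lambda>(t, s). log_kernel x t * (L s * D (s - t)))" for x
  proof (rule lborel_pair.Fubini_integrable)
    show "(\<lambda>(t, s). log_kernel x t * (L s * D (s - t))) \<in> borel_measurable (lborel \<Otimes>\<^sub>M lborel)" by measurable
    show "AE t in lborel. integrable lborel (\<lambda>s. case (t, s) of (t, s) \<Rightarrow> log_kernel x t * (L s * D (s - t)))"
      using avg(3)[OF D_meas Db1] by (intro AE_I2) simp
    define V where "V t = (LINT s|lborel. \<bar>L s * D (s - t)\<bar>)" for t
    have Vm: "V \<in> borel_measurable borel" unfolding V_def by measurable
    have Vb: "\<bar>V t\<bar> \<le> (C * W + \<bar>L 0\<bar> + C) * (1 + \<bar>t\<bar>) powr q" for t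
    proof -
      have "V t \<le> (LINT s|lborel. \<bar>(L s - L t) * D (s - t)\<bar> + \<bar>L t\<bar> * poisson T (s - t))"
        unfolding V_def
      proof (rule integral_mono)
        show "integrable lborel (\<lambda>s. \<bar>L s * D (s - t)\<bar>)" by (intro integrable_abs avg(3)[OF D_meas Db1]) simp
        show "integrable lborel (\<lambda>s. \<bar>(L s - L t) * D (s - t)\<bar> + \<bar>L t\<bar> * poisson T (s - t))"
          by (intro Bochner_Integration.integrable_add integrable_abs avg(1)[OF D_meas Db1] integrable_mult_right poisson_integral(1)[OF T]) simp
        fix s
        have "L s * D (s - t) = (L s - L t) * D (s - t) + L t * D (s - t)" by (simp add: algebra_simps)
        then have "\<bar>L s * D (s - t)\<bar> \<le> \<bar>(L s - L t) * D (s - t)\<bar> + \<bar>L t\<bar> * \<bar>D (s - t)\<bar>" by (metis abs_mult abs_triangle_ineq)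
        also have "\<bar>L t\<bar> * \<bar>D (s - t)\<bar> \<le> \<bar>L t\<bar> * poisson T (s - t)" using Db by (intro mult_left_mono) auto
        finally show "\<bar>L s * D (s - t)\<bar> \<le> \<bar>(L s - L t) * D (s - t)\<bar> + \<bar>L t\<bar> * poisson T (s - t)" by simp
      qed
      also have "\<dots> = (LINT s|lborel. \<bar>(L s - L t) * D (s - t)\<bar>) + \<bar>L t\<bar> * (LINT s|lborel. poisson T (s - t))"
        using integrable_abs[OF avg(1)[OF D_meas Db1, of t]] integrable_mult_right[OF poisson_integral(1)[OF T, of t], of "\<bar>L t\<bar>"]
        by (simp only: Bochner_Integration.integral_add integral_mult_right_zero zero_le_one)
      also have "\<dots> \<le> C * 1 * W + \<bar>L t\<bar> * 1"
        using avg(2)[OF D_meas Db1, of t] poisson_integral(2)[OF T, of t] by simp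
      also have "\<bar>L t\<bar> \<le> \<bar>L 0\<bar> + C * (1 + \<bar>t\<bar>) powr q" using hol[of t 0] by simp
      finally have "V t \<le> C * W + \<bar>L 0\<bar> + C * (1 + \<bar>t\<bar>) powr q" by simp
      moreover have "(C * W + \<bar>L 0\<bar>) * 1 \<le> (C * W + \<bar>L 0\<bar>) * (1 + \<bar>t\<bar>) powr q"
        using C W0 q by (intro mult_left_mono ge_one_powr_ge_zero) auto
      moreover have "0 \<le> V t" unfolding V_def by (intro Bochner_Integration.integral_nonneg) auto
      ultimately show ?thesis by (simp add: algebra_simps)
    qed
    have "integrable lborel (\<lambda>t. \<bar>log_kernel x t * V t\<bar>)"
      by (intro integrable_abs integrable_log_kernel_mult[OF Vm q(2,1) Vb])
    moreover have "(LINT s|lborel. norm (log_kernel x t * (L s * D (s - t)))) = \<bar>log_kernel x t * V t\<bar>" for t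
    proof -
      have "0 \<le> V t" unfolding V_def by (intro Bochner_Integration.integral_nonneg) auto
      then show ?thesis by (simp add: V_def abs_mult)
    qed
    ultimately show "integrable lborel (\<lambda>t. LINT s|lborel. norm (case (t, s) of (t, s) \<Rightarrow> log_kernel x t * (L s * D (s - t))))"
      by simp
  qed
  have main: "(LINT t|lborel. log_kernel x t * m t) = (LINT s|lborel. L s * (log_step T (s - x) - log_step T (s - 0) + x * c s)) / \<kappa>"
    "integrable lborel (\<lambda>s. L s * (log_step T (s - x) - log_step T (s - 0) + x * c s))" for x
  proof -
    have "(LINT t|lborel. log_kernel x t * m t) = (LINT t|lborel. (LINT s|lborel. log_kernel x t * (L s * D (s - t)))) / \<kappa>"
      by (simp add: m_def)
    also have "(LINT t|lborel. (LINT s|lborel. log_kernel x t * (L s * D (s - t)))) = (LINT s|lborel. (LINT t|lborel. log_kernel x t * (L s * D (s - t))))"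
      using lborel_pair.Fubini_integral[OF Fub[of x]] by simp
    finally show "(LINT t|lborel. log_kernel x t * m t) = (LINT s|lborel. L s * (log_step T (s - x) - log_step T (s - 0) + x * c s)) / \<kappa>"
      by (simp only: inner)
    have "integrable lborel (\<lambda>s. LINT t|lborel. log_kernel x t * (L s * D (s - t)))"
      using lborel_pair.integrable_snd[OF Fub[of x]] by simp
    then show "integrable lborel (\<lambda>s. L s * (log_step T (s - x) - log_step T (s - 0) + x * c s))" by (simp only: inner)
  qed
  have iLq: "integrable lborel (\<lambda>s. L s * log_step T (s - x))" for x by (rule avg(3)[OF log_step_measurable qb G0])
  have iLc: "integrable lborel (\<lambda>s. L s * c s)"
  proof -
    have "integrable lborel (\<lambda>s. L s * (log_step T (s - 1) - log_step T (s - 0) + 1 * c s) - L s * log_step T (s - 1) + L s * log_step T (s - 0))"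
      by (intro Bochner_Integration.integrable_add Bochner_Integration.integrable_diff main(2) iLq)
    then show ?thesis by (simp add: algebra_simps)
  qed
  show thesis
  proof (rule that[OF m_meas m_le Lt_le])
    fix x
    have "(LINT s|lborel. L s * (log_step T (s - x) - log_step T (s - 0) + x * c s)) = (LINT s|lborel. L s * log_step T (s - x) - L s * log_step T (s - 0) + x * (L s * c s))"
      by (simp add: algebra_simps)
    also have "\<dots> = (LINT s|lborel. L s * log_step T (s - x)) - (LINT s|lborel. L s * log_step T (s - 0)) + x * (LINT s|lborel. L s * c s)"
      using iLq[of x] iLq[of 0] integrable_mult_right[OF iLc, of x]
      by (simp only: Bochner_Integration.integral_add Bochner_Integration.integral_diff Bochner_Integration.integrable_diff integral_mult_right_zero)
    finally show "(LINT t|lborel. log_kernel x t * m t) = Lt x - Lt 0 + ((LINT s|lborel. L s * c s) / \<kappa>) * x"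
      unfolding main Lt_def by (simp add: add_divide_distrib diff_divide_distrib)
  qed
qed

section \<open>Zeroes below a mountain chain\<close>

lemma continuous_bounds_closure:
  fixes f g :: "real \<Rightarrow> real"
  assumes "continuous_on UNIV f" "continuous_on UNIV g" "\<And>x. a < x \<Longrightarrow> x < b \<Longrightarrow> f x \<le> g x" "a < b" "a \<le> x" "x \<le> b"
  shows "f x \<le> g x"
proof -
  have "closed {x. f x \<le> g x}" using assms(1,2) by (rule closed_Collect_le)
  then have "closure {a<..<b} \<subseteq> {x. f x \<le> g x}" using assms(3) by (intro closure_minimal) auto
  moreover have "x \<in> closure {a<..<b}" using assms by (simp add: closure_greaterThanLessThan)
  ultimately show ?thesis by auto
qed

text \<open>The data that the mountain chain axioms give about \<open>p = \<phi>'\<close>: \<open>lam\<close> lists the zeroes with multiplicity; \<open>idx\<close> selects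
those in the critical strip, in increasing order of their real parts, with mountain bases between \<open>a k\<close> and
\<open>b k\<close>; all other zeroes have distance at least \<open>\<delta>\<close> from the line. The constant \<open>q\<close> is \<open>1 - \<epsilon>\<close>.\<close>

locale mountain_zeros =
  fixes I :: "nat set" and lam :: "nat \<Rightarrow> complex" and J :: "int set" and idx :: "int \<Rightarrow> nat"
    and a b :: "int \<Rightarrow> real" and p :: "real \<Rightarrow> real" and \<delta> d l c1 c2 q A :: real and N :: nat
  assumes low: "\<And>n. n \<in> I \<Longrightarrow> Im (lam n) < 0"
    and psum: "\<And>x. (\<lambda>n. if n \<in> I then - Im (lam n) / (cmod (of_real x - lam n))\<^sup>2 else 0) sums p x"
    and pcont: "continuous_on UNIV p"
    and \<delta>: "0 < \<delta>" and d: "0 < d"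
    and idx: "inj_on idx J" "\<And>k. k \<in> J \<Longrightarrow> idx k \<in> I"
    and far: "\<And>n. n \<in> I \<Longrightarrow> n \<notin> idx ` J \<Longrightarrow> Im (lam n) \<le> - \<delta>"
    and near: "\<And>k. k \<in> J \<Longrightarrow> - 1 < Im (lam (idx k))"
    and base: "\<And>k. k \<in> J \<Longrightarrow> a k + d \<le> Re (lam (idx k))" "\<And>k. k \<in> J \<Longrightarrow> Re (lam (idx k)) + d \<le> b k"
      "\<And>k. k \<in> J \<Longrightarrow> b k - a k \<le> l"
    and disj: "\<And>k j. k \<in> J \<Longrightarrow> j \<in> J \<Longrightarrow> k < j \<Longrightarrow> b k \<le> a j"
    and Jconv: "\<And>i j. i \<in> J \<Longrightarrow> j \<in> J \<Longrightarrow> {i..j} \<subseteq> J"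
    and c1: "0 < c1" and c2: "0 < c2"
    and mount: "\<And>k x. k \<in> J \<Longrightarrow> a k < x \<Longrightarrow> x < b k \<Longrightarrow>
        c1 * (- Im (lam (idx k)) / (cmod (of_real x - lam (idx k)))\<^sup>2) \<le> p x \<and>
        p x \<le> c2 * (- Im (lam (idx k)) / (cmod (of_real x - lam (idx k)))\<^sup>2)"
    and plat: "\<And>x. (\<And>k. k \<in> J \<Longrightarrow> \<not> (a k \<le> x \<and> x \<le> b k)) \<Longrightarrow> c1 \<le> p x \<and> p x \<le> c2"
    and q: "0 \<le> q" "q < 1" and A: "0 \<le> A"
    and slow: "\<And>k j. k \<in> J \<Longrightarrow> j \<in> J \<Longrightarrow> int N \<le> \<bar>k - j\<bar> \<Longrightarrow>
        \<bar>ln (- Im (lam (idx k))) - ln (- Im (lam (idx j)))\<bar> \<le> A * \<bar>Re (lam (idx k)) - Re (lam (idx j))\<bar> powr q"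
begin

definition xi :: "nat \<Rightarrow> real" where "xi n = Re (lam n)"
definition et :: "nat \<Rightarrow> real" where "et n = - Im (lam n)"
definition dd :: "nat \<Rightarrow> real \<Rightarrow> real" where "dd n x = (x - xi n)\<^sup>2 + (et n)\<^sup>2"
text \<open>\<open>r n\<close> is \<open>\<pi>\<close> times the Poisson density of the zero lowered by 1.\<close>

definition r :: "nat \<Rightarrow> real \<Rightarrow> real" where
  "r n x = (if n \<in> I then (et n + 1) / ((x - xi n)\<^sup>2 + (et n + 1)\<^sup>2) else 0)"
text \<open>The change of \<open>ln |x - \<lambda>|\<close> when the zero is lowered by 1.\<close>

definition D :: "nat \<Rightarrow> real \<Rightarrow> real" where
  "D n x = (if n \<in> I then ln (sqrt ((x - xi n)\<^sup>2 + (et n + 1)\<^sup>2)) - ln (sqrt (dd n x)) else 0)"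
text \<open>What remains of the logarithm of the majorant once the potential of the lowered zeroes is removed.\<close>

definition L :: "real \<Rightarrow> real" where "L x = ln (p x) / 2 - (\<Sum>n. D n x)"
definition \<rho> :: real where "\<rho> = min \<delta> d"
definition K1 :: real where "K1 = 2 + 2 / \<rho>\<^sup>2"

lemma et_pos: "n \<in> I \<Longrightarrow> 0 < et n" using low by (simp add: et_def)
lemma et1: "k \<in> J \<Longrightarrow> et (idx k) < 1" using near[of k] by (simp add: et_def)
lemma cmod_dd: "(cmod (of_real x - lam n))\<^sup>2 = dd n x"
  unfolding cmod_power2 dd_def xi_def et_def by (simp add: power2_eq_square algebra_simps)
lemma dd_pos: "n \<in> I \<Longrightarrow> 0 < dd n x" using et_pos[of n] by (simp add: dd_def add_nonneg_pos)
lemma p_sums: "(\<lambda>n. if n \<in> I then et n / dd n x else 0) sums p x"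
  using psum[of x] unfolding cmod_dd et_def .
lemma den_pos: "n \<in> I \<Longrightarrow> 0 < (x - xi n)\<^sup>2 + (et n + 1)\<^sup>2"
  using et_pos[of n] by (simp add: add_nonneg_pos)
lemma r_nonneg: "0 \<le> r n x"
proof (cases "n \<in> I")
  case True
  then show ?thesis using et_pos[OF True] den_pos[OF True, of x] by (simp only: r_def if_True) (intro divide_nonneg_pos, auto)
qed (simp add: r_def)
lemma rho: "0 < \<rho>" "\<rho> \<le> \<delta>" "\<rho> \<le> d" using \<delta> d by (auto simp: \<rho>_def)
lemma K1_pos: "0 < K1" using rho by (simp add: K1_def add_pos_nonneg)
lemma base': "k \<in> J \<Longrightarrow> a k + d \<le> xi (idx k)" "k \<in> J \<Longrightarrow> xi (idx k) + d \<le> b k"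
  using base by (auto simp: xi_def)

text \<open>By continuity the comparison on a mountain base extends to the endpoints, whichever neighbour they belong to.\<close>

lemma mount':
  assumes "k \<in> J" "a k \<le> x" "x \<le> b k"
  shows "c1 * (et (idx k) / dd (idx k) x) \<le> p x" "p x \<le> c2 * (et (idx k) / dd (idx k) x)"
proof -
  have cd: "continuous_on UNIV (\<lambda>x. c * (et (idx k) / dd (idx k) x))" for c
  proof -
    have "(x - xi (idx k))\<^sup>2 + (et (idx k))\<^sup>2 \<noteq> 0" for x
      using dd_pos[OF idx(2)[OF assms(1)], of x] unfolding dd_def by linarith
    then show ?thesis unfolding dd_def by (intro continuous_intros) auto
  qed
  have ab: "a k < b k" using base'[OF assms(1)] d by linarith
  note m = mount[OF assms(1), unfolded cmod_dd, folded et_def]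
  show "c1 * (et (idx k) / dd (idx k) x) \<le> p x"
    by (rule continuous_bounds_closure[OF cd pcont _ ab assms(2,3)]) (use m in auto)
  show "p x \<le> c2 * (et (idx k) / dd (idx k) x)"
    by (rule continuous_bounds_closure[OF pcont cd _ ab assms(2,3)]) (use m in auto)
qed

text \<open>A point on no base, or on the base of another mountain, has a fixed distance from the zero \<open>lam n\<close>. For such zeroes
lowering by 1 changes distances only by bounded factors.\<close>

lemma separated:
  assumes n: "n \<in> I" and no: "\<And>k. k \<in> J \<Longrightarrow> n = idx k \<Longrightarrow> \<not> (a k < x \<and> x < b k)"
  shows "\<rho>\<^sup>2 \<le> dd n x"
proof (cases "n \<in> idx ` J")
  case True
  then obtain k where k: "k \<in> J" "n = idx k" by blast
  have "d \<le> \<bar>x - xi n\<bar>" using no[OF k] base'[OF k(1)] d k by force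
  then have "\<rho>\<^sup>2 \<le> \<bar>x - xi n\<bar>\<^sup>2" using rho by (intro power_mono) auto
  then show ?thesis unfolding dd_def by (simp add: add_increasing2)
next
  case False
  then have "\<rho> \<le> et n" using far[OF n] rho by (simp add: et_def)
  then have "\<rho>\<^sup>2 \<le> (et n)\<^sup>2" using rho by (intro power_mono) auto
  then show ?thesis unfolding dd_def by (simp add: add_increasing)
qed

lemma separated_other:
  assumes "n \<in> I" "k \<in> J" "a k \<le> x" "x \<le> b k" "n \<noteq> idx k"
  shows "\<rho>\<^sup>2 \<le> dd n x"
proof (rule separated[OF assms(1)])
  fix j assume j: "j \<in> J" "n = idx j"
  then have "j \<noteq> k" using assms(5) by auto
  then have "j < k \<or> k < j" by linarith
  then show "\<not> (a j < x \<and> x < b j)" using disj[OF j(1) assms(2)] disj[OF assms(2) j(1)] assms by auto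
qed

lemma den_le: 
  assumes "n \<in> I" "\<rho>\<^sup>2 \<le> dd n x"
  shows "(x - xi n)\<^sup>2 + (et n + 1)\<^sup>2 \<le> K1 * dd n x"
proof -
  have "(et n + 1)\<^sup>2 \<le> 2 * (et n)\<^sup>2 + 2" using zero_le_power2[of "et n - 1"] by (simp add: power2_eq_square algebra_simps)
  moreover have "X + F \<le> 2 * (X + Y) + 2" if "F \<le> 2 * Y + 2" "0 \<le> X" for X Y F :: real using that by simp
  ultimately have "(x - xi n)\<^sup>2 + (et n + 1)\<^sup>2 \<le> 2 * dd n x + 2" unfolding dd_def using zero_le_power2 by blast
  moreover have "2 \<le> 2 / \<rho>\<^sup>2 * dd n x" using assms(2) rho by (simp add: pos_le_divide_eq)
  moreover have "K1 * dd n x = 2 * dd n x + 2 / \<rho>\<^sup>2 * dd n x" by (simp add: K1_def distrib_right)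
  ultimately show ?thesis by linarith
qed

lemma one_over_dd_le:
  assumes "n \<in> I" "\<rho>\<^sup>2 \<le> dd n x"
  shows "(et n + 1) / dd n x \<le> K1 * r n x"
proof -
  have "(et n + 1) * ((x - xi n)\<^sup>2 + (et n + 1)\<^sup>2) \<le> (et n + 1) * (K1 * dd n x)"
    using den_le[OF assms] et_pos[OF assms(1)] by (intro mult_left_mono) auto
  then show ?thesis using assms dd_pos[OF assms(1), of x] den_pos[OF assms(1), of x]
    by (simp add: r_def divide_simps mult_ac)
qed

lemma w_le:
  assumes "n \<in> I" "\<rho>\<^sup>2 \<le> dd n x"
  shows "et n / dd n x \<le> K1 * r n x"
proof -
  have "et n / dd n x \<le> (et n + 1) / dd n x" using dd_pos[OF assms(1), of x] by (intro divide_right_mono) auto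
  then show ?thesis using one_over_dd_le[OF assms] by linarith
qed

lemma D_eq: "n \<in> I \<Longrightarrow> D n x = ln (1 + (2 * et n + 1) / dd n x) / 2"
proof -
  assume n: "n \<in> I"
  have "(x - xi n)\<^sup>2 + (et n + 1)\<^sup>2 = dd n x + (2 * et n + 1)" by (simp add: dd_def power2_eq_square algebra_simps)
  then have "D n x = ln ((dd n x + (2 * et n + 1)) / dd n x) / 2"
    using n dd_pos[OF n, of x] et_pos[OF n] by (simp add: D_def ln_sqrt ln_div diff_divide_distrib)
  also have "(dd n x + (2 * et n + 1)) / dd n x = 1 + (2 * et n + 1) / dd n x" using dd_pos[OF n, of x] by (simp add: add_divide_distrib)
  finally show ?thesis .
qed

lemma D_nonneg: "0 \<le> D n x"
proof (cases "n \<in> I")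
  case True
  have "0 \<le> (2 * et n + 1) / dd n x" using et_pos[OF True] dd_pos[OF True, of x] by (intro divide_nonneg_pos) auto
  then have "0 \<le> ln (1 + (2 * et n + 1) / dd n x)" by (intro ln_ge_zero) simp
  then show ?thesis by (simp only: D_eq[OF True])
qed (simp add: D_def)

lemma D_le:
  assumes "n \<in> I" "\<rho>\<^sup>2 \<le> dd n x"
  shows "D n x \<le> K1 * r n x"
proof -
  have "ln (1 + (2 * et n + 1) / dd n x) \<le> (2 * et n + 1) / dd n x"
    using dd_pos[OF assms(1), of x] et_pos[OF assms(1)] by (intro ln_add_one_self_le_self divide_nonneg_pos) auto
  also have "\<dots> \<le> (2 * (et n + 1)) / dd n x" using dd_pos[OF assms(1), of x] by (intro divide_right_mono) auto
  also have "\<dots> = 2 * ((et n + 1) / dd n x)" by simp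
  finally have "D n x \<le> (et n + 1) / dd n x" unfolding D_eq[OF assms(1)] by linarith
  then show ?thesis using one_over_dd_le[OF assms] by linarith
qed

lemma r_far_le:
  assumes "n \<in> I" "n \<notin> idx ` J"
  shows "r n x \<le> (1 + 1 / \<delta>) * (et n / dd n x)"
proof -
  have e: "\<delta> \<le> et n" using far[OF assms] by (simp add: et_def)
  have "et n + 1 \<le> (1 + 1 / \<delta>) * et n" using e \<delta> by (simp add: field_simps)
  moreover have "dd n x \<le> (x - xi n)\<^sup>2 + (et n + 1)\<^sup>2" unfolding dd_def using et_pos[OF assms(1)] by (intro add_left_mono power_mono) auto
  ultimately have "(et n + 1) / ((x - xi n)\<^sup>2 + (et n + 1)\<^sup>2) \<le> (1 + 1 / \<delta>) * et n / dd n x"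
    using dd_pos[OF assms(1), of x] et_pos[OF assms(1)] \<delta> by (intro frac_le) auto
  then show ?thesis using assms by (simp add: r_def)
qed

lemma r_Harnack:
  assumes "\<bar>x - y\<bar> \<le> l"
  shows "r n x \<le> (2 + 2 * l\<^sup>2) * r n y"
proof (cases "n \<in> I")
  case True
  have "\<bar>y - xi n\<bar> \<le> \<bar>x - xi n\<bar> + l" using assms by linarith
  then have "\<bar>y - xi n\<bar>\<^sup>2 \<le> (\<bar>x - xi n\<bar> + l)\<^sup>2" by (intro power_mono) auto
  also have "\<dots> \<le> 2 * (x - xi n)\<^sup>2 + 2 * l\<^sup>2" using zero_le_power2[of "\<bar>x - xi n\<bar> - l"]
    by (simp add: power2_eq_square algebra_simps flip: abs_mult)
  finally have 1: "(y - xi n)\<^sup>2 \<le> 2 * (x - xi n)\<^sup>2 + 2 * l\<^sup>2" by simp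
  have e1: "1 \<le> (et n + 1)\<^sup>2" using et_pos[OF True] by (intro one_le_power) auto
  have "2 * l\<^sup>2 * 1 \<le> 2 * l\<^sup>2 * (et n + 1)\<^sup>2" using e1 by (intro mult_left_mono) auto
  moreover have "0 \<le> 2 * l\<^sup>2 * (x - xi n)\<^sup>2" by simp
  moreover have "Y + F \<le> (2 + 2 * M) * (X + F)"
    if "Y \<le> 2 * X + 2 * M" "2 * M * 1 \<le> 2 * M * F" "0 \<le> 2 * M * X" "0 \<le> F" for X Y F M :: real
    using that by (simp add: algebra_simps)
  ultimately have "(y - xi n)\<^sup>2 + (et n + 1)\<^sup>2 \<le> (2 + 2 * l\<^sup>2) * ((x - xi n)\<^sup>2 + (et n + 1)\<^sup>2)"
    using 1 zero_le_power2 by blast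
  then have "(et n + 1) * ((y - xi n)\<^sup>2 + (et n + 1)\<^sup>2) \<le> (et n + 1) * ((2 + 2 * l\<^sup>2) * ((x - xi n)\<^sup>2 + (et n + 1)\<^sup>2))"
    using et_pos[OF True] by (intro mult_left_mono) auto
  then show ?thesis using True den_pos[OF True, of x] den_pos[OF True, of y] by (simp add: r_def divide_simps mult_ac)
qed (simp add: r_def)

text \<open>The zeroes of the strip have real parts separated by \<open>2 d\<close>, so their lowered Poisson kernels are dominated by
integrals of \<open>1 / (1 + (t - x)\<^sup>2)\<close> over the disjoint intervals \<open>U k\<close>.\<close>

lemma strip_sum:
  assumes F: "finite F" "F \<subseteq> J"
  shows "(\<Sum>k\<in>F. r (idx k) x) \<le> (2 + 2 * d\<^sup>2) * pi / d"
proof -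
  define f where "f t = 1 / (1 + (t - x)\<^sup>2)" for t :: real
  have "integrable lborel (\<lambda>t::real. 1 / (1 + (- x + 1 * t)\<^sup>2))"
    by (rule lborel_integrable_real_affine[OF integral_one_over_one_plus_square(1)]) simp
  then have fi: "integrable lborel f" by (simp add: f_def[abs_def])
  have fpi: "(LINT t|lborel. f t) = pi" unfolding f_def
    using lborel_integral_real_affine[of 1 "\<lambda>t::real. 1 / (1 + t\<^sup>2)" "- x"] integral_one_over_one_plus_square(2) by simp
  have f0: "0 \<le> f t" for t by (simp add: f_def add_pos_nonneg)
  define U where "U k = {xi (idx k) - d<..<xi (idx k) + d}" for k
  have disjU: "k = j" if "k \<in> J" "j \<in> J" "t \<in> U k" "t \<in> U j" for k j t
  proof (rule ccontr)
    assume "k \<noteq> j"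
    then have "k < j \<or> j < k" by linarith
    then show False using disj[OF that(1,2)] disj[OF that(2,1)] base'[OF that(1)] base'[OF that(2)] that(3,4)
      by (auto simp: U_def)
  qed
  have one: "r (idx k) x \<le> (2 + 2 * d\<^sup>2) / d * (LINT t|lborel. indicator (U k) t * f t)" if k: "k \<in> F" for k
  proof -
    have kJ: "k \<in> J" using k F by auto
    define X where "X = xi (idx k)"
    have e: "0 < et (idx k)" "et (idx k) < 1" using et_pos[OF idx(2)[OF kJ]] et1[OF kJ] .
    have pos: "0 < 1 + (X - x)\<^sup>2" by (simp add: add_pos_nonneg)
    have "1 \<le> (et (idx k) + 1)\<^sup>2" using e by (intro one_le_power) auto
    then have "1 + (X - x)\<^sup>2 \<le> (x - X)\<^sup>2 + (et (idx k) + 1)\<^sup>2" by (simp add: power2_commute)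
    then have r1: "r (idx k) x \<le> 2 / (1 + (X - x)\<^sup>2)"
      using idx(2)[OF kJ] e pos unfolding r_def X_def[symmetric] by (simp, intro frac_le) auto
    define c where "c = 1 / ((2 + 2 * d\<^sup>2) * (1 + (X - x)\<^sup>2))"
    have c_le: "c \<le> f t" if t: "t \<in> U k" for t
    proof -
      have td: "\<bar>t - X\<bar> \<le> d" using t by (auto simp: U_def X_def)
      have "(t - x)\<^sup>2 \<le> 2 * (X - x)\<^sup>2 + 2 * (t - X)\<^sup>2"
        using zero_le_power2[of "(X - x) - (t - X)"] by (simp add: power2_eq_square algebra_simps)
      also have "(t - X)\<^sup>2 \<le> d\<^sup>2" using power_mono[OF td, of 2] by simp
      finally have "1 + (t - x)\<^sup>2 \<le> 1 + 2 * (X - x)\<^sup>2 + 2 * d\<^sup>2" by simp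
      also have "\<dots> \<le> (2 + 2 * d\<^sup>2) * (1 + (X - x)\<^sup>2)" by (simp add: algebra_simps)
      finally have "1 + (t - x)\<^sup>2 \<le> (2 + 2 * d\<^sup>2) * (1 + (X - x)\<^sup>2)" .
      then show ?thesis unfolding c_def f_def by (intro divide_left_mono mult_pos_pos) (auto simp: add_pos_nonneg)
    qed
    have "(LINT t|lborel. indicator (U k) t * c) \<le> (LINT t|lborel. indicator (U k) t * f t)"
    proof (rule integral_mono)
      show "integrable lborel (\<lambda>t. indicator (U k) t * c)"
        using d by (intro integrable_mult_left integrable_real_indicator) (auto simp: U_def)
      show "integrable lborel (\<lambda>t. indicator (U k) t * f t)"
        using integrable_mult_indicator[OF _ fi, of "U k"] by (simp add: U_def)
      show "indicator (U k) t * c \<le> indicator (U k) t * f t" for t using c_le by (auto simp: indicator_def)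
    qed
    moreover have "(LINT t|lborel. indicator (U k) t * c) = 2 * d * c" using d by (simp add: U_def)
    ultimately have "(2 + 2 * d\<^sup>2) / d * (2 * d * c) \<le> (2 + 2 * d\<^sup>2) / d * (LINT t|lborel. indicator (U k) t * f t)"
      using d by (intro mult_left_mono) auto
    moreover have "(2 + 2 * d\<^sup>2) / d * (2 * d * c) = 2 / (1 + (X - x)\<^sup>2)"
    proof -
      have "2 + 2 * d\<^sup>2 \<noteq> 0" by (smt (verit) zero_le_power2)
      then have "(2 + 2 * d\<^sup>2) * c = 1 / (1 + (X - x)\<^sup>2)" unfolding c_def times_divide_eq_right mult_1_right by (rule nonzero_divide_mult_cancel_left)
      moreover have "(2 + 2 * d\<^sup>2) / d * (2 * d * c) = 2 * ((2 + 2 * d\<^sup>2) * c)" using d by simp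
      ultimately show ?thesis by simp
    qed
    ultimately show ?thesis using r1 by linarith
  qed
  have "(\<Sum>k\<in>F. r (idx k) x) \<le> (\<Sum>k\<in>F. (2 + 2 * d\<^sup>2) / d * (LINT t|lborel. indicator (U k) t * f t))"
    by (rule sum_mono) (rule one)
  also have "\<dots> = (2 + 2 * d\<^sup>2) / d * (\<Sum>k\<in>F. LINT t|lborel. indicator (U k) t * f t)" by (simp only: sum_distrib_left)
  finally have le1: "(\<Sum>k\<in>F. r (idx k) x) \<le> (2 + 2 * d\<^sup>2) / d * (\<Sum>k\<in>F. LINT t|lborel. indicator (U k) t * f t)" .
  have "(\<Sum>k\<in>F. LINT t|lborel. indicator (U k) t * f t) = (LINT t|lborel. (\<Sum>k\<in>F. indicator (U k) t * f t))"
    using integrable_mult_indicator[OF _ fi] by (subst Bochner_Integration.integral_sum) (auto simp: U_def)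
  also have "\<dots> \<le> (LINT t|lborel. f t)"
  proof (rule integral_mono)
    show "integrable lborel (\<lambda>t. \<Sum>k\<in>F. indicator (U k) t * f t)"
      using integrable_mult_indicator[OF _ fi] by (intro Bochner_Integration.integrable_sum) (auto simp: U_def)
    show "(\<Sum>k\<in>F. indicator (U k) t * f t) \<le> f t" for t
    proof (cases "\<exists>k0\<in>F. t \<in> U k0")
      case True
      then obtain k0 where k0: "k0 \<in> F" "t \<in> U k0" by blast
      have "(\<Sum>k\<in>F. indicator (U k) t * f t) = (\<Sum>k\<in>{k0}. indicator (U k) t * f t)"
      proof (rule sum.mono_neutral_right)
        have "t \<notin> U k" if "k \<in> F - {k0}" for k using that F k0 disjU[of k k0 t] by auto
        then show "\<forall>k\<in>F - {k0}. indicator (U k) t * f t = 0" by (simp add: indicator_def)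
      qed (use F k0 in auto)
      then show ?thesis using k0 by simp
    next
      case False
      then have "(\<Sum>k\<in>F. indicator (U k) t * f t) = 0" by (intro sum.neutral) (auto simp: indicator_def)
      then show ?thesis using f0 by simp
    qed
  qed (rule fi)
  finally have "(2 + 2 * d\<^sup>2) / d * (\<Sum>k\<in>F. LINT t|lborel. indicator (U k) t * f t) \<le> (2 + 2 * d\<^sup>2) / d * pi"
    unfolding fpi using d by (intro mult_left_mono) auto
  then show ?thesis using le1 by simp
qed

lemma r_sum_aux:
  "(\<Sum>n<M. r n x) \<le> (1 + 1 / \<delta>) * p x + (2 + 2 * d\<^sup>2) * pi / d"
proof -
  define F where "F = {k \<in> J. idx k < M}"
  have finF: "finite F"
  proof -
    have "idx ` F \<subseteq> {..<M}" "inj_on idx F" using idx(1) by (auto simp: F_def inj_on_def)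
    then show ?thesis using finite_imageD finite_subset by blast
  qed
  have "(\<Sum>n<M. r n x) = (\<Sum>n\<in>{..<M} - idx ` J. r n x) + (\<Sum>n\<in>{..<M} \<inter> idx ` J. r n x)"
    by (subst sum.union_disjoint[symmetric]) (auto intro: sum.cong)
  also have "{..<M} \<inter> idx ` J = idx ` F" by (auto simp: F_def)
  also have "(\<Sum>n\<in>idx ` F. r n x) = (\<Sum>k\<in>F. r (idx k) x)"
    using idx(1) by (subst sum.reindex) (auto simp: F_def inj_on_def)
  also have "\<dots> \<le> (2 + 2 * d\<^sup>2) * pi / d" by (rule strip_sum[OF finF]) (auto simp: F_def)
  also have "(\<Sum>n\<in>{..<M} - idx ` J. r n x) \<le> (\<Sum>n\<in>{..<M} - idx ` J. (1 + 1 / \<delta>) * (if n \<in> I then et n / dd n x else 0))"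
  proof (rule sum_mono)
    fix n assume n: "n \<in> {..<M} - idx ` J"
    show "r n x \<le> (1 + 1 / \<delta>) * (if n \<in> I then et n / dd n x else 0)"
      using r_far_le[of n x] n by (cases "n \<in> I") (auto simp: r_def)
  qed
  also have "\<dots> = (1 + 1 / \<delta>) * (\<Sum>n\<in>{..<M} - idx ` J. (if n \<in> I then et n / dd n x else 0))" by (simp only: sum_distrib_left)
  also have "(\<Sum>n\<in>{..<M} - idx ` J. (if n \<in> I then et n / dd n x else 0)) \<le> p x"
  proof -
    have "(\<Sum>n\<in>{..<M} - idx ` J. (if n \<in> I then et n / dd n x else 0)) \<le> (\<Sum>n. if n \<in> I then et n / dd n x else 0)"
      using p_sums[of x] et_pos dd_pos by (intro sum_le_suminf) (auto simp: sums_iff less_imp_le)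
    then show ?thesis using p_sums[of x] by (simp add: sums_iff)
  qed
  finally show ?thesis using \<delta> by (simp add: mult_left_mono)
qed

definition C0 :: real where
  "C0 = (2 + 2 * l\<^sup>2) * ((1 + 1 / \<delta>) * (c2 + c2 / d\<^sup>2) + (2 + 2 * d\<^sup>2) * pi / d)"

text \<open>Zeroes below the strip contribute at most a multiple of \<open>p\<close>, which is bounded on plateaux and at the feet of mountains.
A point of a base is joined to the foot by Harnack's inequality.\<close>

lemma r_sum_le: "(\<Sum>n<M. r n x) \<le> C0"
proof (cases "\<exists>k\<in>J. a k \<le> x \<and> x \<le> b k")
  case True
  then obtain k where k: "k \<in> J" "a k \<le> x" "x \<le> b k" by blast
  have ak: "a k \<le> b k" using base'[OF k(1)] d by linarith
  have dk: "d\<^sup>2 \<le> dd (idx k) (a k)"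
  proof -
    have "d\<^sup>2 \<le> (xi (idx k) - a k)\<^sup>2" using base'[OF k(1)] d by (intro power_mono) auto
    then show ?thesis unfolding dd_def by (simp add: power2_commute add_increasing2)
  qed
  have "p (a k) \<le> c2 * (et (idx k) / dd (idx k) (a k))" by (rule mount'(2)[OF k(1) order_refl ak])
  also have "\<dots> \<le> c2 * (1 / d\<^sup>2)"
    using dk et1[OF k(1)] et_pos[OF idx(2)[OF k(1)]] d c2 by (intro mult_left_mono frac_le) auto
  finally have pk: "p (a k) \<le> c2 / d\<^sup>2" by simp
  have "(\<Sum>n<M. r n x) \<le> (\<Sum>n<M. (2 + 2 * l\<^sup>2) * r n (a k))"
    using k base(3)[OF k(1)] by (intro sum_mono r_Harnack) auto
  also have "\<dots> = (2 + 2 * l\<^sup>2) * (\<Sum>n<M. r n (a k))" by (simp only: sum_distrib_left)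
  also have "\<dots> \<le> (2 + 2 * l\<^sup>2) * ((1 + 1 / \<delta>) * p (a k) + (2 + 2 * d\<^sup>2) * pi / d)"
    by (intro mult_left_mono r_sum_aux) auto
  also have "\<dots> \<le> C0" unfolding C0_def using pk \<delta> c2 by (intro mult_left_mono add_right_mono) auto
  finally show ?thesis .
next
  case False
  then have "p x \<le> c2" using plat[of x] by blast
  have "(\<Sum>n<M. r n x) \<le> (1 + 1 / \<delta>) * p x + (2 + 2 * d\<^sup>2) * pi / d" by (rule r_sum_aux)
  also have "\<dots> \<le> (1 + 1 / \<delta>) * (c2 + c2 / d\<^sup>2) + (2 + 2 * d\<^sup>2) * pi / d"
    using \<open>p x \<le> c2\<close> \<delta> c2 by (intro mult_left_mono add_right_mono) (auto intro: add_increasing2)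
  also have "\<dots> \<le> C0"
  proof -
    have "0 \<le> (1 + 1 / \<delta>) * (c2 + c2 / d\<^sup>2) + (2 + 2 * d\<^sup>2) * pi / d" using \<delta> c2 d by (intro add_nonneg_nonneg mult_nonneg_nonneg divide_nonneg_nonneg) auto
    then have "1 * ((1 + 1 / \<delta>) * (c2 + c2 / d\<^sup>2) + (2 + 2 * d\<^sup>2) * pi / d) \<le> C0"
      unfolding C0_def by (intro mult_right_mono) (auto simp: add_increasing2)
    then show ?thesis by simp
  qed
  finally show ?thesis .
qed

lemma summable_r: "summable (\<lambda>n. r n x)"
  by (rule summableI_nonneg_bounded[OF r_nonneg r_sum_le])

lemma suminf_r_le: "(\<Sum>n. r n x) \<le> C0"
  by (rule suminf_le_const[OF summable_r r_sum_le])

text \<open>On a base the zero of the mountain alone contributes a fixed amount; elsewhere the sum dominates a multiple of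
\<open>p\<close>, which is bounded below there.\<close>

lemma suminf_r_ge: "\<exists>c>0. \<forall>x. c \<le> (\<Sum>n. r n x)"
proof (intro exI conjI allI)
  show "0 < min (1 / (l\<^sup>2 + 4)) (c1 / K1)" using c1 K1_pos by (simp add: add_nonneg_pos)
  fix x
  show "min (1 / (l\<^sup>2 + 4)) (c1 / K1) \<le> (\<Sum>n. r n x)"
  proof (cases "\<exists>k\<in>J. a k \<le> x \<and> x \<le> b k")
    case True
    then obtain k where k: "k \<in> J" "a k \<le> x" "x \<le> b k" by blast
    have e: "0 < et (idx k)" "et (idx k) < 1" using et_pos[OF idx(2)[OF k(1)]] et1[OF k(1)] .
    have "\<bar>x - xi (idx k)\<bar> \<le> l" using k base'[OF k(1)] base(3)[OF k(1)] d by linarith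
    then have "\<bar>x - xi (idx k)\<bar>\<^sup>2 \<le> l\<^sup>2" by (intro power_mono) auto
    moreover have "(et (idx k) + 1)\<^sup>2 \<le> 2\<^sup>2" using e by (intro power_mono) auto
    ultimately have "1 / (l\<^sup>2 + 4) \<le> r (idx k) x"
      using idx(2)[OF k(1)] e den_pos[OF idx(2)[OF k(1)], of x] by (simp add: r_def) (intro frac_le, auto)
    also have "\<dots> = (\<Sum>n\<in>{idx k}. r n x)" by simp
    also have "\<dots> \<le> (\<Sum>n. r n x)" by (rule sum_le_suminf[OF summable_r]) (auto simp: r_nonneg)
    finally show ?thesis by simp
  next
    case False
    then have "c1 \<le> p x" using plat[of x] by blast
    also have "p x \<le> (\<Sum>n. K1 * r n x)"
    proof -
      have "(if n \<in> I then et n / dd n x else 0) \<le> K1 * r n x" for n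
        using w_le[of n x] separated[of n x] False by (cases "n \<in> I") (force simp: r_def)+
      from suminf_le[OF this sums_summable[OF p_sums] summable_mult[OF summable_r]] show ?thesis
        using sums_unique[OF p_sums[of x]] by simp
    qed
    also have "\<dots> = K1 * (\<Sum>n. r n x)" by (rule suminf_mult[OF summable_r])
    finally have "c1 / K1 \<le> (\<Sum>n. r n x)" using K1_pos by (simp add: divide_le_eq mult.commute)
    then show ?thesis by simp
  qed
qed

lemma D_uncovered:
  assumes "\<And>k. k \<in> J \<Longrightarrow> \<not> (a k \<le> x \<and> x \<le> b k)"
  shows "summable (\<lambda>n. D n x)" "0 \<le> (\<Sum>n. D n x)" "(\<Sum>n. D n x) \<le> K1 * C0"
proof -
  have le: "D n x \<le> K1 * r n x" for n
    using D_le[of n x] separated[of n x] assms by (cases "n \<in> I") (force simp: r_def D_def)+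
  show s: "summable (\<lambda>n. D n x)"
    by (rule summable_comparison_test'[OF summable_mult[OF summable_r[of x], of K1], of 0]) (use le D_nonneg in auto)
  show "0 \<le> (\<Sum>n. D n x)" by (rule suminf_nonneg[OF s D_nonneg])
  have "(\<Sum>n. D n x) \<le> (\<Sum>n. K1 * r n x)" by (rule suminf_le[OF le s summable_mult[OF summable_r]])
  also have "\<dots> = K1 * (\<Sum>n. r n x)" by (rule suminf_mult[OF summable_r])
  also have "\<dots> \<le> K1 * C0" using suminf_r_le K1_pos by (intro mult_left_mono) auto
  finally show "(\<Sum>n. D n x) \<le> K1 * C0" .
qed

lemma D_covered:
  assumes k: "k \<in> J" "a k \<le> x" "x \<le> b k"
  shows "summable (\<lambda>n. D n x)" "D (idx k) x \<le> (\<Sum>n. D n x)" "(\<Sum>n. D n x) \<le> D (idx k) x + K1 * C0"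
proof -
  (* Only the zero of the mountain itself is close to the points of its base. *)
  define D' where "D' n = (if n = idx k then 0 else D n x)" for n
  have le: "D' n \<le> K1 * r n x" for n
  proof (cases "n \<in> I \<and> n \<noteq> idx k")
    case False
    then have "D' n = 0" by (auto simp: D'_def D_def)
    then show ?thesis using K1_pos r_nonneg[of n x] by simp
  qed (use D_le[of n x] separated_other[OF _ k, of n] in \<open>auto simp: D'_def\<close>)
  have D'0: "0 \<le> D' n" for n using D_nonneg by (simp add: D'_def)
  have s': "summable D'"
    by (rule summable_comparison_test'[OF summable_mult[OF summable_r[of x], of K1], of 0]) (use le D'0 in auto)
  have "D' sums suminf D'" using s' by (rule summable_sums)
  from sums_add[OF this sums_single[of "idx k" "\<lambda>n. D n x"]]
  have "(\<lambda>n. D' n + (if n = idx k then D n x else 0)) sums (suminf D' + D (idx k) x)" .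
  moreover have "(\<lambda>n. D' n + (if n = idx k then D n x else 0)) = (\<lambda>n. D n x)" by (auto simp: D'_def)
  ultimately have S: "(\<lambda>n. D n x) sums (suminf D' + D (idx k) x)" by simp
  show "summable (\<lambda>n. D n x)" using S by (rule sums_summable)
  have eq: "(\<Sum>n. D n x) = suminf D' + D (idx k) x" using S by (rule sums_unique[symmetric])
  have "0 \<le> suminf D'" by (rule suminf_nonneg[OF s' D'0])
  then show "D (idx k) x \<le> (\<Sum>n. D n x)" using eq by simp
  have "suminf D' \<le> (\<Sum>n. K1 * r n x)" by (rule suminf_le[OF le s' summable_mult[OF summable_r]])
  also have "\<dots> = K1 * (\<Sum>n. r n x)" by (rule suminf_mult[OF summable_r])
  also have "\<dots> \<le> K1 * C0" using suminf_r_le K1_pos by (intro mult_left_mono) auto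
  finally show "(\<Sum>n. D n x) \<le> D (idx k) x + K1 * C0" using eq by simp
qed

lemma summable_D: "summable (\<lambda>n. D n x)"
  using D_uncovered(1)[of x] D_covered(1)[of _ x] by blast

text \<open>Summability holds at \<open>x = 0\<close> for all zeroes separated from 0; at most one zero is not.\<close>

lemma summable_inverse_squares: "summable (\<lambda>n. if n \<in> I then 1 / (cmod (lam n))\<^sup>2 else 0)"
proof -
  have dd0: "(cmod (lam n))\<^sup>2 = dd n 0" for n using cmod_dd[of 0 n] by simp
  have b: "1 / dd n 0 \<le> K1 * r n 0" if "n \<in> I" "\<rho>\<^sup>2 \<le> dd n 0" for n
  proof -
    have "1 / dd n 0 \<le> (et n + 1) / dd n 0" using dd_pos[OF that(1), of 0] et_pos[OF that(1)] by (intro divide_right_mono) auto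
    then show ?thesis using one_over_dd_le[OF that] by linarith
  qed
  have "\<exists>M. \<forall>n\<ge>M. norm (if n \<in> I then 1 / (cmod (lam n))\<^sup>2 else 0) \<le> K1 * r n 0"
  proof (cases "\<exists>k\<in>J. a k \<le> 0 \<and> 0 \<le> b k")
    case True
    then obtain k where k: "k \<in> J" "a k \<le> 0" "0 \<le> b k" by blast
    have "norm (if n \<in> I then 1 / (cmod (lam n))\<^sup>2 else 0) \<le> K1 * r n 0" if "Suc (idx k) \<le> n" for n
      using b[of n] separated_other[OF _ k, of n] that by (cases "n \<in> I") (auto simp: dd0 r_def dd_def)
    then show ?thesis by blast
  next
    case False
    have "norm (if n \<in> I then 1 / (cmod (lam n))\<^sup>2 else 0) \<le> K1 * r n 0" for n
      using b[of n] separated[of n 0] False by (cases "n \<in> I") (force simp: dd0 r_def dd_def)+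
    then show ?thesis by blast
  qed
  then obtain M where "\<And>n. M \<le> n \<Longrightarrow> norm (if n \<in> I then 1 / (cmod (lam n))\<^sup>2 else 0) \<le> K1 * r n 0" by blast
  then show ?thesis by (rule summable_comparison_test'[OF summable_mult[OF summable_r]])
qed

lemma p_pos: "0 < p x"
proof (cases "\<exists>k\<in>J. a k \<le> x \<and> x \<le> b k")
  case True
  then obtain k where k: "k \<in> J" "a k \<le> x" "x \<le> b k" by blast
  have "0 < c1 * (et (idx k) / dd (idx k) x)" using c1 et_pos[OF idx(2)[OF k(1)]] dd_pos[OF idx(2)[OF k(1)], of x] by simp
  then show ?thesis using mount'(1)[OF k] by linarith
next
  case False
  then show ?thesis using plat[of x] c1 by force
qed

definition K5 :: real where "K5 = \<bar>ln c1\<bar> + \<bar>ln c2\<bar> + \<bar>ln (l\<^sup>2 + 4)\<bar> + K1 * C0"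

lemma C0_nonneg: "0 \<le> C0" using r_sum_le[where M = 0] by simp

text \<open>On the base of the mountain \<open>k\<close> both \<open>(ln p) / 2\<close> and \<open>D (idx k)\<close> contain the unbounded term
\<open>- (ln |x - \<lambda>\<^sub>k|\<^sup>2) / 2\<close>; it cancels in \<open>L\<close>.\<close>

lemma L_covered:
  assumes k: "k \<in> J" "a k \<le> x" "x \<le> b k"
  shows "\<bar>L x - ln (et (idx k)) / 2\<bar> \<le> K5"
proof -
  have kI: "idx k \<in> I" using idx(2)[OF k(1)] .
  have e: "0 < et (idx k)" "et (idx k) < 1" using et_pos[OF kI] et1[OF k(1)] .
  have dp: "0 < dd (idx k) x" using dd_pos[OF kI] .
  have lnw: "ln (c * (et (idx k) / dd (idx k) x)) = ln c + ln (et (idx k)) - ln (dd (idx k) x)" if "0 < c" for c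
    using that e dp by (simp add: ln_mult ln_div)
  have wp: "0 < c * (et (idx k) / dd (idx k) x)" if "0 < c" for c using that e dp by simp
  have p1: "ln c1 + ln (et (idx k)) - ln (dd (idx k) x) \<le> ln (p x)"
    using mount'(1)[OF k] wp[OF c1] lnw[OF c1] by (metis ln_mono)
  have p2: "ln (p x) \<le> ln c2 + ln (et (idx k)) - ln (dd (idx k) x)"
    using mount'(2)[OF k] p_pos[of x] lnw[OF c2] by (metis ln_mono)
  define G where "G = (x - xi (idx k))\<^sup>2 + (et (idx k) + 1)\<^sup>2"
  have "\<bar>x - xi (idx k)\<bar> \<le> l" using k base'[OF k(1)] base(3)[OF k(1)] d by linarith
  then have "\<bar>x - xi (idx k)\<bar>\<^sup>2 \<le> l\<^sup>2" by (intro power_mono) auto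
  moreover have "(et (idx k) + 1)\<^sup>2 \<le> 2\<^sup>2" using e by (intro power_mono) auto
  ultimately have G2: "G \<le> l\<^sup>2 + 4" by (simp add: G_def)
  have "1 \<le> (et (idx k) + 1)\<^sup>2" using e by (intro one_le_power) auto
  then have G1: "1 \<le> G" unfolding G_def by (simp add: add_increasing)
  have lnG: "0 \<le> ln G" "ln G \<le> ln (l\<^sup>2 + 4)" using G1 G2 by auto
  have Dk: "D (idx k) x = ln G / 2 - ln (dd (idx k) x) / 2"
    using kI dp G1 by (simp add: D_def G_def[symmetric] ln_sqrt)
  show ?thesis using D_covered(2,3)[OF k] p1 p2 lnG mult_nonneg_nonneg[OF less_imp_le[OF K1_pos] C0_nonneg]
    unfolding L_def Dk K5_def by (simp add: abs_le_iff) linarith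
qed

lemma L_uncovered:
  assumes "\<And>k. k \<in> J \<Longrightarrow> \<not> (a k \<le> x \<and> x \<le> b k)"
  shows "\<bar>L x\<bar> \<le> K5"
proof -
  have "c1 \<le> p x" "p x \<le> c2" using plat[OF assms] by auto
  then have "ln c1 \<le> ln (p x)" "ln (p x) \<le> ln c2" using c1 by auto
  moreover have aux: "\<bar>P / 2 - S\<bar> \<le> \<bar>u\<bar> + \<bar>v\<bar> + \<bar>w\<bar> + M" if "u \<le> P" "P \<le> v" "0 \<le> S" "S \<le> M" for P S u v w M :: real
    using that by linarith
  ultimately show ?thesis using D_uncovered(2,3)[OF assms] aux unfolding L_def K5_def by blast
qed

definition K7 :: real where "K7 = \<bar>ln (c1 * d\<^sup>2 / c2)\<bar>"

text \<open>A mountain that touches a plateau has bounded height, since \<open>p\<close> is continuous and at its foot is of size \<open>\<eta>\<^sub>k\<close>.\<close>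

lemma edge:
  assumes k: "k \<in> J" and x: "x = a k \<or> x = b k" and p: "c1 \<le> p x"
  shows "\<bar>ln (et (idx k))\<bar> \<le> K7"
proof -
  have kI: "idx k \<in> I" using idx(2)[OF k] .
  have e: "0 < et (idx k)" "et (idx k) < 1" using et_pos[OF kI] et1[OF k] .
  have "d \<le> \<bar>x - xi (idx k)\<bar>" and ab: "a k \<le> x" "x \<le> b k" using x base'[OF k] d by auto
  then have "d\<^sup>2 \<le> \<bar>x - xi (idx k)\<bar>\<^sup>2" using d by (intro power_mono) auto
  then have dk: "d\<^sup>2 \<le> dd (idx k) x" unfolding dd_def by (simp add: add_increasing2)
  have "c1 \<le> c2 * (et (idx k) / dd (idx k) x)" using mount'(2)[OF k ab] p by linarith
  also have "\<dots> \<le> c2 * (et (idx k) / d\<^sup>2)" using dk d e c2 dd_pos[OF kI, of x] by (intro mult_left_mono divide_left_mono mult_pos_pos) auto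
  finally have "c1 * d\<^sup>2 / c2 \<le> et (idx k)" using d c2 by (simp add: field_simps)
  moreover have "0 < c1 * d\<^sup>2 / c2" using c1 c2 d by simp
  ultimately have "ln (c1 * d\<^sup>2 / c2) \<le> ln (et (idx k))" by (simp add: ln_mono)
  moreover have "ln (et (idx k)) < 0" using e by simp
  ultimately show ?thesis unfolding K7_def by linarith
qed

lemma p_right_limit:
  assumes "s < t" "\<And>x. s < x \<Longrightarrow> x < t \<Longrightarrow> c1 \<le> p x"
  shows "c1 \<le> p s" "c1 \<le> p t"
  using continuous_bounds_closure[OF continuous_on_const pcont assms(2) assms(1)] assms(1) by auto

definition K6 :: real where "K6 = 4 * K5 + 2 * K7"

text \<open>The growth condition is assumed only for indices far apart. Neighbouring mountains with a common foot have comparable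
heights by continuity of \<open>p\<close>, and if a plateau lies between them, both have bounded height.\<close>

lemma consecutive:
  assumes k: "k \<in> J" "k + 1 \<in> J"
  shows "\<bar>ln (et (idx k)) - ln (et (idx (k + 1)))\<bar> \<le> K6"
proof -
  have le: "b k \<le> a (k + 1)" using disj[OF k] by simp
  have ab: "a k \<le> b k" "a (k + 1) \<le> b (k + 1)" using base'[OF k(1)] base'[OF k(2)] d by linarith+
  have K5: "0 \<le> K5" using L_covered[OF k(1) order_refl ab(1)] by linarith
  have K7: "0 \<le> K7" by (simp add: K7_def)
  show ?thesis
  proof (cases "b k = a (k + 1)")
    case True
    have "\<bar>L (b k) - ln (et (idx k)) / 2\<bar> \<le> K5" "\<bar>L (b k) - ln (et (idx (k + 1))) / 2\<bar> \<le> K5"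
      using L_covered[OF k(1), of "b k"] L_covered[OF k(2), of "b k"] ab True by auto
    then show ?thesis using K7 unfolding K6_def by linarith
  next
    case False
    then have lt: "b k < a (k + 1)" using le by simp
    have gap: "c1 \<le> p x" if x: "b k < x" "x < a (k + 1)" for x
    proof -
      have "\<not> (a i \<le> x \<and> x \<le> b i)" if i: "i \<in> J" for i
      proof -
        consider "i < k" | "i = k" | "i = k + 1" | "k + 1 < i" by linarith
        then show ?thesis
        proof cases
          case 1 then show ?thesis using disj[OF i k(1)] ab x by auto
        next
          case 4 then show ?thesis using disj[OF k(2) i] ab x by auto
        qed (use x in auto)
      qed
      then show ?thesis using plat by blast
    qed
    have "c1 \<le> p (b k)" "c1 \<le> p (a (k + 1))" using p_right_limit[OF lt gap] by auto
    then have "\<bar>ln (et (idx k))\<bar> \<le> K7" "\<bar>ln (et (idx (k + 1)))\<bar> \<le> K7" using edge k by blast+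
    then show ?thesis using K5 unfolding K6_def by linarith
  qed
qed

lemma chain:
  assumes "k \<in> J" "k + int n \<in> J"
  shows "\<bar>ln (et (idx k)) - ln (et (idx (k + int n)))\<bar> \<le> real n * K6"
  using assms(2)
proof (induction n)
  case (Suc n)
  have "k + int n \<in> {k..k + int (Suc n)}" by simp
  then have kn: "k + int n \<in> J" using Jconv[OF assms(1) Suc.prems] by blast
  have "\<bar>ln (et (idx (k + int n))) - ln (et (idx (k + int n + 1)))\<bar> \<le> K6"
  proof (rule consecutive[OF kn])
    have "k + int n + 1 = k + int (Suc n)" by simp
    then show "k + int n + 1 \<in> J" using Suc.prems by metis
  qed
  moreover have "k + int (Suc n) = k + int n + 1" by simp
  ultimately show ?case using Suc.IH[OF kn] by (simp add: algebra_simps)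
qed simp

lemma log_et_diff:
  assumes "k \<in> J" "j \<in> J"
  shows "\<bar>ln (et (idx k)) - ln (et (idx j))\<bar> \<le> A * \<bar>xi (idx k) - xi (idx j)\<bar> powr q + real N * \<bar>K6\<bar>"
proof (cases "int N \<le> \<bar>k - j\<bar>")
  case True
  then have "\<bar>ln (et (idx k)) - ln (et (idx j))\<bar> \<le> A * \<bar>xi (idx k) - xi (idx j)\<bar> powr q"
    using slow[OF assms] by (simp add: et_def xi_def)
  then show ?thesis by (simp add: add_increasing2)
next
  case False
  have *: "\<bar>ln (et (idx i)) - ln (et (idx m))\<bar> \<le> real N * \<bar>K6\<bar>" if im: "i \<in> J" "m \<in> J" "i \<le> m" "m - i < int N" for i m
  proof -
    define n where "n = nat (m - i)"
    have m: "m = i + int n" "n \<le> N" using im by (auto simp: n_def)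
    have "\<bar>ln (et (idx i)) - ln (et (idx m))\<bar> \<le> real n * K6" using chain[of i n] im m by simp
    also have "\<dots> \<le> real n * \<bar>K6\<bar>" by (intro mult_left_mono) auto
    also have "\<dots> \<le> real N * \<bar>K6\<bar>" using m by (intro mult_right_mono) auto
    finally show ?thesis .
  qed
  have "\<bar>ln (et (idx k)) - ln (et (idx j))\<bar> \<le> real N * \<bar>K6\<bar>"
    using *[OF assms] *[OF assms(2,1)] False by (cases "k \<le> j") (auto simp: abs_minus_commute)
  then show ?thesis using A by (simp add: add_increasing)
qed

lemma xi_spread:
  assumes "k \<in> J" "k + int n \<in> J"
  shows "xi (idx k) + 2 * d * real n \<le> xi (idx (k + int n))"
  using assms(2)
proof (induction n)
  case (Suc n)
  have "k + int n \<in> {k..k + int (Suc n)}" by simp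
  then have kn: "k + int n \<in> J" using Jconv[OF assms(1) Suc.prems] by blast
  have "b (k + int n) \<le> a (k + int (Suc n))" using disj[OF kn Suc.prems] by simp
  then have "xi (idx (k + int n)) + 2 * d \<le> xi (idx (k + int (Suc n)))"
    using base'[OF kn] base'[OF Suc.prems] by linarith
  then show ?case using Suc.IH[OF kn] by (simp add: algebra_simps)
qed simp

lemma finite_J_between:
  assumes "k \<in> J"
  shows "finite {j \<in> J. k \<le> j \<and> xi (idx j) < y}" "finite {j \<in> J. j \<le> k \<and> y < xi (idx j)}"
proof -
  define n where "n = nat \<lceil>\<bar>y - xi (idx k)\<bar> / (2 * d)\<rceil>"
  have n: "\<bar>y - xi (idx k)\<bar> \<le> 2 * d * real n" using d
    by (simp add: n_def pos_divide_le_eq[symmetric] mult.commute) (metis le_of_int_ceiling of_nat_nat divide_le_eq pos_divide_le_eq mult_pos_pos zero_less_numeral real_nat_ceiling_ge mult.commute)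
  have "{j \<in> J. k \<le> j \<and> xi (idx j) < y} \<subseteq> {k..k + int n}"
  proof
    fix j assume j: "j \<in> {j \<in> J. k \<le> j \<and> xi (idx j) < y}"
    define i where "i = nat (j - k)"
    have ji: "j = k + int i" using j by (simp add: i_def)
    have "2 * d * real i < 2 * d * real n" using xi_spread[OF assms, of i] j n unfolding ji by auto
    then have "i < n" using d by simp
    then show "j \<in> {k..k + int n}" using ji by simp
  qed
  then show "finite {j \<in> J. k \<le> j \<and> xi (idx j) < y}" by (rule finite_subset) simp
  have "{j \<in> J. j \<le> k \<and> y < xi (idx j)} \<subseteq> {k - int n..k}"
  proof
    fix j assume j: "j \<in> {j \<in> J. j \<le> k \<and> y < xi (idx j)}"
    define i where "i = nat (k - j)"
    have ji: "k = j + int i" using j by (simp add: i_def)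
    have "2 * d * real i < 2 * d * real n" using xi_spread[of j i] assms j n unfolding ji[symmetric] by auto
    then have "i < n" using d by simp
    then show "j \<in> {k - int n..k}" using ji by simp
  qed
  then show "finite {j \<in> J. j \<le> k \<and> y < xi (idx j)}" by (rule finite_subset) simp
qed

text \<open>Between a point of a base and a point of a plateau there is a mountain that touches a plateau: the last one before
the plateau point. It links \<open>ln \<eta>\<^sub>k\<close> to the bounded values of \<open>L\<close> on plateaux.\<close>

lemma boundary_mountain:
  assumes k: "k \<in> J" "a k \<le> x" "x \<le> b k" and y: "\<And>i. i \<in> J \<Longrightarrow> \<not> (a i \<le> y \<and> y \<le> b i)"
  shows "\<exists>j\<in>J. \<bar>ln (et (idx j))\<bar> \<le> K7 \<and> \<bar>xi (idx k) - xi (idx j)\<bar> \<le> \<bar>x - y\<bar> + l"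
proof (cases "x < y")
  case True
  define S where "S = {j \<in> J. k \<le> j \<and> xi (idx j) < y}"
  have finS: "finite S" unfolding S_def by (rule finite_J_between[OF k(1)])
  have "b k < y" using y[OF k(1)] k True by auto
  then have kS: "k \<in> S" using k base'[OF k(1)] d by (auto simp: S_def)
  define j where "j = Max S"
  have jS: "j \<in> S" unfolding j_def using finS kS by (intro Max_in) auto
  then have j: "j \<in> J" "k \<le> j" "xi (idx j) < y" by (auto simp: S_def)
  have jmax: "i \<le> j" if "i \<in> S" for i unfolding j_def using finS that by simp
  have bj: "b j < y" using y[OF j(1)] j base'[OF j(1)] d by auto
  have "c1 \<le> p t" if t: "b j < t" "t < y" for t
  proof -
    have "\<not> (a i \<le> t \<and> t \<le> b i)" if i: "i \<in> J" for i
    proof (cases "i \<le> j")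
      case True
      then have "b i \<le> b j" using disj[OF i j(1)] base'[OF j(1)] d by (cases "i = j") auto
      then show ?thesis using t by auto
    next
      case False
      then have "i \<notin> S" using jmax by blast
      then have "y \<le> xi (idx i)" using False i j by (auto simp: S_def)
      then show ?thesis using y[OF i] base'[OF i] d t by auto
    qed
    then show ?thesis using plat by blast
  qed
  then have "c1 \<le> p (b j)" using p_right_limit(1)[OF bj] by blast
  then have "\<bar>ln (et (idx j))\<bar> \<le> K7" using edge[OF j(1)] by blast
  moreover have "xi (idx k) \<le> xi (idx j)"
    using j disj[OF k(1) j(1)] base'[OF k(1)] base'[OF j(1)] d by (cases "k = j") auto
  then have "\<bar>xi (idx k) - xi (idx j)\<bar> \<le> \<bar>x - y\<bar> + l"
    using j(3) True k base'[OF k(1)] base(3)[OF k(1)] d by auto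
  ultimately show ?thesis using j by blast
next
  case False
  then have yx: "y < x" using y[OF k(1)] k by (cases "x = y") auto
  define S where "S = {j \<in> J. j \<le> k \<and> y < xi (idx j)}"
  have finS: "finite S" unfolding S_def by (rule finite_J_between[OF k(1)])
  have "y < a k" using y[OF k(1)] k yx by auto
  then have kS: "k \<in> S" using k base'[OF k(1)] d by (auto simp: S_def)
  define j where "j = Min S"
  have jS: "j \<in> S" unfolding j_def using finS kS by (intro Min_in) auto
  then have j: "j \<in> J" "j \<le> k" "y < xi (idx j)" by (auto simp: S_def)
  have jmin: "j \<le> i" if "i \<in> S" for i unfolding j_def using finS that by simp
  have aj: "y < a j" using y[OF j(1)] j base'[OF j(1)] d by auto
  have "c1 \<le> p t" if t: "y < t" "t < a j" for t
  proof -
    have "\<not> (a i \<le> t \<and> t \<le> b i)" if i: "i \<in> J" for i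
    proof (cases "j \<le> i")
      case True
      then have "a j \<le> a i" using disj[OF j(1) i] base'[OF j(1)] d by (cases "i = j") auto
      then show ?thesis using t by auto
    next
      case False
      then have "i \<notin> S" using jmin by blast
      then have "xi (idx i) \<le> y" using False i j by (auto simp: S_def)
      then show ?thesis using y[OF i] base'[OF i] d t by auto
    qed
    then show ?thesis using plat by blast
  qed
  then have "c1 \<le> p (a j)" using p_right_limit(2)[OF aj] by blast
  then have "\<bar>ln (et (idx j))\<bar> \<le> K7" using edge[OF j(1)] by blast
  moreover have "xi (idx j) \<le> xi (idx k)"
    using j disj[OF j(1) k(1)] base'[OF k(1)] base'[OF j(1)] d by (cases "k = j") auto
  then have "\<bar>xi (idx k) - xi (idx j)\<bar> \<le> \<bar>x - y\<bar> + l"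
    using j(3) yx k base'[OF k(1)] base(3)[OF k(1)] d by auto
  ultimately show ?thesis using j by blast
qed

lemma L_large_scale_Holder: "\<exists>C\<ge>0. \<forall>x y. \<bar>L x - L y\<bar> \<le> C * (1 + \<bar>x - y\<bar>) powr q"
proof -
  define l' where "l' = \<bar>l\<bar>"
  define B where "B = \<bar>K5\<bar> + \<bar>K5\<bar> + K7 + real N * \<bar>K6\<bar>"
  define C where "C = B + A * (1 + 2 * l') powr q"
  have B0: "0 \<le> B" unfolding B_def K7_def by simp
  have one: "1 \<le> (1 + \<bar>t\<bar>) powr q" for t :: real using q by (intro ge_one_powr_ge_zero) auto
  have dist: "A * u powr q \<le> A * (1 + 2 * l') powr q * (1 + \<bar>t\<bar>) powr q" if "0 \<le> u" "u \<le> \<bar>t\<bar> + 2 * l'" for u t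
  proof -
    have "u \<le> (1 + 2 * l') * (1 + \<bar>t\<bar>)" 
    proof -
      have "(1 + 2 * l') * (1 + \<bar>t\<bar>) = 1 + 2 * l' + \<bar>t\<bar> + 2 * l' * \<bar>t\<bar>" by (simp add: algebra_simps)
      moreover have "0 \<le> 2 * l' * \<bar>t\<bar>" by (simp add: l'_def)
      ultimately show ?thesis using that by linarith
    qed
    then have "u powr q \<le> ((1 + 2 * l') * (1 + \<bar>t\<bar>)) powr q" using that q by (intro powr_mono2) auto
    then have "u powr q \<le> (1 + 2 * l') powr q * (1 + \<bar>t\<bar>) powr q" by (simp add: powr_mult l'_def)
    then show ?thesis using A by (simp add: mult_left_mono mult.assoc)
  qed
  have fin: "v \<le> C * (1 + \<bar>t\<bar>) powr q" if "v \<le> B + A * u powr q" "0 \<le> u" "u \<le> \<bar>t\<bar> + 2 * l'" for u v t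
  proof -
    have "B * 1 \<le> B * (1 + \<bar>t\<bar>) powr q" using B0 one by (intro mult_left_mono) auto
    then show ?thesis using that(1) dist[OF that(2,3)] by (simp add: C_def algebra_simps)
  qed
  have half: "\<bar>L x - L y\<bar> \<le> C * (1 + \<bar>x - y\<bar>) powr q"
    if k: "k \<in> J" "a k \<le> x" "x \<le> b k" and y: "\<And>i. i \<in> J \<Longrightarrow> \<not> (a i \<le> y \<and> y \<le> b i)" for k x y
  proof -
    obtain j where j: "j \<in> J" "\<bar>ln (et (idx j))\<bar> \<le> K7" "\<bar>xi (idx k) - xi (idx j)\<bar> \<le> \<bar>x - y\<bar> + l"
      using boundary_mountain[OF k y] by blast
    have Ly: "\<bar>L y\<bar> \<le> K5" by (rule L_uncovered) (rule y)
    show ?thesis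
    proof (rule fin[of _ "\<bar>xi (idx k) - xi (idx j)\<bar>"])
      have "0 \<le> A * \<bar>xi (idx k) - xi (idx j)\<bar> powr q" using A by simp
      then show "\<bar>L x - L y\<bar> \<le> B + A * \<bar>xi (idx k) - xi (idx j)\<bar> powr q"
        using L_covered[OF k] Ly log_et_diff[OF k(1) j(1)] j(2) unfolding B_def by linarith
    qed (use j in \<open>auto simp: l'_def\<close>)
  qed
  show ?thesis
  proof (intro exI[of _ C] conjI allI)
    show "0 \<le> C" using B0 A by (simp add: C_def)
    fix x y
    consider k j where "k \<in> J" "a k \<le> x" "x \<le> b k" "j \<in> J" "a j \<le> y" "y \<le> b j"
      | k where "k \<in> J" "a k \<le> x" "x \<le> b k" "\<And>i. i \<in> J \<Longrightarrow> \<not> (a i \<le> y \<and> y \<le> b i)"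
      | k where "k \<in> J" "a k \<le> y" "y \<le> b k" "\<And>i. i \<in> J \<Longrightarrow> \<not> (a i \<le> x \<and> x \<le> b i)"
      | "\<And>i. i \<in> J \<Longrightarrow> \<not> (a i \<le> x \<and> x \<le> b i)" "\<And>i. i \<in> J \<Longrightarrow> \<not> (a i \<le> y \<and> y \<le> b i)"
      by blast
    then show "\<bar>L x - L y\<bar> \<le> C * (1 + \<bar>x - y\<bar>) powr q"
    proof cases
      case 1
      show ?thesis
      proof (rule fin[of _ "\<bar>xi (idx k) - xi (idx j)\<bar>"])
        have "0 \<le> A * \<bar>xi (idx k) - xi (idx j)\<bar> powr q" "0 \<le> K7" using A by (simp_all add: K7_def)
        then show "\<bar>L x - L y\<bar> \<le> B + A * \<bar>xi (idx k) - xi (idx j)\<bar> powr q"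
          using L_covered[OF 1(1-3)] L_covered[OF 1(4-6)] log_et_diff[OF 1(1,4)] unfolding B_def by linarith
        show "\<bar>xi (idx k) - xi (idx j)\<bar> \<le> \<bar>x - y\<bar> + 2 * l'"
          using 1 base'[OF 1(1)] base(3)[OF 1(1)] base'[OF 1(4)] base(3)[OF 1(4)] d by (simp add: l'_def)
      qed simp
    next
      case 2 then show ?thesis by (rule half)
    next
      case 3 then show ?thesis using half[OF 3] by (simp add: abs_minus_commute)
    next
      case 4
      have "\<bar>L x - L y\<bar> \<le> B + A * 0 powr q"
      proof -
        have "\<bar>L x\<bar> \<le> K5" "\<bar>L y\<bar> \<le> K5" by (rule L_uncovered, rule 4(1), assumption) (rule L_uncovered, rule 4(2), assumption)
        moreover have "0 \<le> K7" "0 \<le> real N * \<bar>K6\<bar>" "A * 0 powr q = 0" by (simp_all add: K7_def)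
        ultimately show ?thesis unfolding B_def by linarith
      qed
      then show ?thesis by (rule fin) (auto simp: l'_def)
    qed
  qed
qed

lemma L_measurable: "L \<in> borel_measurable borel"
proof -
  have [measurable]: "p \<in> borel_measurable borel" using pcont by (rule borel_measurable_continuous_onI)
  have [measurable]: "D n \<in> borel_measurable borel" for n unfolding D_def dd_def by measurable
  show ?thesis unfolding L_def[abs_def] by measurable
qed

end

section \<open>Canonical factorisation of a product over the lower half-plane\<close>

text \<open>The product in the definition of a considered HB-function. As the polynomials \<open>pp n\<close> are real,
the convergence factors are positive on the line.\<close>

locale zero_product =
  fixes I :: "nat set" and lam :: "nat \<Rightarrow> complex" and pp :: "nat \<Rightarrow> real poly" and P :: "complex \<Rightarrow> complex"
  assumes low: "\<And>n. n \<in> I \<Longrightarrow> Im (lam n) < 0"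
    and ul: "\<And>K. compact K \<Longrightarrow> uniform_limit K
             (\<lambda>N z. \<Prod>n\<in>I \<inter> {..<N}. (1 - z / lam n) * exp (poly (map_poly complex_of_real (pp n)) z)) P sequentially"
    and nontriv: "\<exists>z. P z \<noteq> 0"
begin

definition fct :: "nat \<Rightarrow> complex \<Rightarrow> complex" where
  "fct n z = (if n \<in> I then (1 - z / lam n) * exp (poly (map_poly complex_of_real (pp n)) z) else 1)"

lemma lam_nz: "n \<in> I \<Longrightarrow> lam n \<noteq> 0" using low by force

lemma prod_fct: "(\<Prod>n\<in>I \<inter> {..<N}. (1 - z / lam n) * exp (poly (map_poly complex_of_real (pp n)) z)) = (\<Prod>n<N. fct n z)"
  unfolding fct_def by (subst prod.inter_restrict[symmetric]) (auto simp: Int_commute)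

lemma ul_fct: "compact K \<Longrightarrow> uniform_limit K (\<lambda>N z. \<Prod>n<N. fct n z) P sequentially"
  using ul unfolding prod_fct .

lemma lim_fct: "(\<lambda>N. \<Prod>n<N. fct n z) \<longlonglongrightarrow> P z"
  by (rule tendsto_uniform_limitI[OF ul_fct[of "{z}"]]) auto

lemma hol_fct: "fct n holomorphic_on S"
  unfolding fct_def by (cases "n \<in> I") (auto intro!: holomorphic_intros simp: lam_nz)

lemma hol_P: "P holomorphic_on S"
proof -
  have "P holomorphic_on UNIV"
  proof (rule holomorphic_uniform_sequence)
    show "(\<lambda>z. \<Prod>n<N. fct n z) holomorphic_on UNIV" for N by (intro holomorphic_intros hol_fct)
    show "\<exists>d>0. cball x d \<subseteq> UNIV \<and> uniform_limit (cball x d) (\<lambda>N z. \<Prod>n<N. fct n z) P sequentially" for x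
      by (intro exI[of _ 1] conjI ul_fct) auto
  qed simp
  then show ?thesis using holomorphic_on_subset by blast
qed

lemma fct_eq_0_iff: "fct n z = 0 \<longleftrightarrow> n \<in> I \<and> z = lam n"
  using lam_nz[of n] by (auto simp: fct_def field_simps)

lemma P_lam: "n \<in> I \<Longrightarrow> P (lam n) = 0"
proof -
  assume n: "n \<in> I"
  have "eventually (\<lambda>N. (\<Prod>k<N. fct k (lam n)) = 0) sequentially"
    using eventually_gt_at_top[of n] by eventually_elim (use n in \<open>auto simp: fct_eq_0_iff\<close>)
  then have "(\<lambda>N. \<Prod>k<N. fct k (lam n)) \<longlonglongrightarrow> 0" by (rule tendsto_eventually)
  then show ?thesis using lim_fct LIMSEQ_unique by blast
qed

lemma zeros_P: "P z = 0 \<longleftrightarrow> z \<in> lam ` I"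
proof
  assume z: "P z = 0"
  show "z \<in> lam ` I"
  proof (rule ccontr)
    assume no: "z \<notin> lam ` I"
    obtain \<beta> where "P \<beta> \<noteq> 0" using nontriv by blast
    then obtain r where r: "0 < r" "\<And>w. w \<in> ball z r - {z} \<Longrightarrow> P w \<noteq> 0"
      using isolated_zeros[OF hol_P[of UNIV] open_UNIV connected_UNIV _ z] by auto
    have "P z \<noteq> 0"
    proof (rule Hurwitz_no_zeros[of "ball z r" "\<lambda>N w. \<Prod>n<N. fct n w" P])
      show "(\<lambda>w. \<Prod>n<N. fct n w) holomorphic_on ball z r" for N by (intro holomorphic_intros hol_fct)
      show "uniform_limit K (\<lambda>N w. \<Prod>n<N. fct n w) P sequentially" if "compact K" for K by (rule ul_fct[OF that])
      show "\<not> P constant_on ball z r"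
      proof
        assume "P constant_on ball z r"
        then obtain c where c: "\<And>w. w \<in> ball z r \<Longrightarrow> P w = c" by (auto simp: constant_on_def)
        have "z + of_real (r / 2) \<in> ball z r" "z + of_real (r / 2) \<noteq> z" using r(1) by (auto simp: dist_norm)
        then show False using c[of z] c[of "z + of_real (r / 2)"] r z by auto
      qed
      show "(\<Prod>n<N. fct n w) \<noteq> 0" if w: "w \<in> ball z r" for N w
      proof -
        have "fct n w \<noteq> 0" for n
        proof
          assume "fct n w = 0"
          then have n: "n \<in> I" "w = lam n" by (auto simp: fct_eq_0_iff)
          then have "w \<noteq> z" using no by auto
          then show False using r(2)[of w] w P_lam[OF n(1)] n(2) by auto
        qed
        then show ?thesis by simp
      qed
    qed (use r hol_P in auto)
    then show False using z by simp
  qed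
qed (auto simp: P_lam)

lemma P_nz_upper: "0 \<le> Im z \<Longrightarrow> P z \<noteq> 0"
  using low by (force simp: zeros_P)

text \<open>A zero that is listed twice is a multiple zero; hence the simple zeroes of the strip occur once in the list.\<close>

lemma deriv_P_double_zero:
  assumes "n \<in> I" "m \<in> I" "n \<noteq> m" "lam n = lam m"
  shows "deriv P (lam n) = 0"
proof -
  define w where "w = lam n"
  have "(\<lambda>N. deriv (\<lambda>z. \<Prod>k<N. fct k z) w) \<longlonglongrightarrow> deriv P w"
  proof (rule deriv_complex_uniform_limit)
    show "uniform_limit (ball w 1) (\<lambda>N z. \<Prod>k<N. fct k z) P sequentially"
      by (rule uniform_limit_on_subset[OF ul_fct[of "cball w 1"]]) auto
    show "\<forall>\<^sub>F N in sequentially. (\<lambda>z. \<Prod>k<N. fct k z) holomorphic_on ball w 1"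
      by (intro always_eventually allI holomorphic_intros hol_fct)
  qed auto
  moreover have "eventually (\<lambda>N. deriv (\<lambda>z. \<Prod>k<N. fct k z) w = 0) sequentially"
    using eventually_gt_at_top[of n] eventually_gt_at_top[of m]
  proof eventually_elim
    case (elim N)
    define G where "G z = (\<Prod>k\<in>{..<N} - {n} - {m}. fct k z)" for z
    have eq: "(\<lambda>z. \<Prod>k<N. fct k z) = (\<lambda>z. fct n z * (fct m z * G z))"
    proof
      fix z
      have "(\<Prod>k<N. fct k z) = fct n z * (\<Prod>k\<in>{..<N} - {n}. fct k z)" using elim by (intro prod.remove) auto
      also have "(\<Prod>k\<in>{..<N} - {n}. fct k z) = fct m z * G z" unfolding G_def using elim assms(3) by (intro prod.remove) auto
      finally show "(\<Prod>k<N. fct k z) = fct n z * (fct m z * G z)" .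
    qed
    have z0: "fct n w = 0" "fct m w = 0" using assms by (auto simp: fct_eq_0_iff w_def)
    have holG: "(\<lambda>z. fct m z * G z) holomorphic_on UNIV" unfolding G_def by (intro holomorphic_intros hol_fct)
    have "((\<lambda>z. fct n z * (fct m z * G z)) has_field_derivative (deriv (fct n) w * (fct m w * G w) + deriv (\<lambda>z. fct m z * G z) w * fct n w)) (at w)"
      by (intro DERIV_mult holomorphic_derivI[OF hol_fct[of _ UNIV]] holomorphic_derivI[OF holG]) auto
    then show ?case unfolding eq using z0 by (simp add: DERIV_imp_deriv)
  qed
  then have "(\<lambda>N. deriv (\<lambda>z. \<Prod>k<N. fct k z) w) \<longlonglongrightarrow> 0" by (rule tendsto_eventually)
  ultimately show ?thesis unfolding w_def using LIMSEQ_unique by blast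
qed

lemma poly_of_real: "poly (map_poly complex_of_real q) (of_real x) = of_real (poly q x)"
  by (induction q) (auto simp: map_poly_pCons)

text \<open>The logarithmic derivatives of the convergence factors are real on the line and do not contribute to the imaginary part.\<close>

lemma logderiv_sums:
  fixes x :: real
  shows "(\<lambda>n. if n \<in> I then - Im (lam n) / (cmod (of_real x - lam n))\<^sup>2 else 0) sums (- Im (deriv P (of_real x) / P (of_real x)))"
proof -
  let ?x = "of_real x :: complex"
  have "(\<lambda>n. deriv (fct n) ?x / fct n ?x) sums (deriv P ?x / P ?x)"
  proof (rule logderiv_prodinf_complex_uniform_limit)
    show "uniform_limit (ball ?x 1) (\<lambda>N z. \<Prod>k<N. fct k z) P sequentially"
      by (rule uniform_limit_on_subset[OF ul_fct[of "cball ?x 1"]]) auto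
  qed (use hol_fct P_nz_upper[of ?x] in auto)
  then have "(\<lambda>n. - Im (deriv (fct n) ?x / fct n ?x)) sums (- Im (deriv P ?x / P ?x))"
    by (intro sums_minus bounded_linear.sums[OF bounded_linear_Im])
  moreover have "- Im (deriv (fct n) ?x / fct n ?x) = (if n \<in> I then - Im (lam n) / (cmod (?x - lam n))\<^sup>2 else 0)" for n
  proof (cases "n \<in> I")
    case True
    define q where "q = map_poly complex_of_real (pp n)"
    have l: "lam n \<noteq> 0" using lam_nz[OF True] .
    have l2: "?x \<noteq> lam n" using low[OF True] by (metis Im_complex_of_real less_irrefl)
    from l l2 have x1: "1 - ?x / lam n \<noteq> 0" "?x - lam n \<noteq> 0" by (auto simp: field_simps)
    have f: "fct n = (\<lambda>z. (1 - z / lam n) * exp (poly q z))" using True by (auto simp: fct_def q_def)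
    have "(fct n has_field_derivative ((1 - ?x / lam n) * (exp (poly q ?x) * poly (pderiv q) ?x) + (- 1 / lam n) * exp (poly q ?x))) (at ?x)"
      unfolding f using l by (auto intro!: derivative_eq_intros)
    then have "deriv (fct n) ?x / fct n ?x = poly (pderiv q) ?x + (- 1 / lam n) / (1 - ?x / lam n)"
    proof -
      have gen: "(u * (e * q) + v * e) / (u * e) = q + v / u" if "u \<noteq> 0" "e \<noteq> 0" for u e q v :: complex
        using that by (simp add: field_simps)
      assume "(fct n has_field_derivative ((1 - ?x / lam n) * (exp (poly q ?x) * poly (pderiv q) ?x) + (- 1 / lam n) * exp (poly q ?x))) (at ?x)"
      then have "deriv (fct n) ?x = (1 - ?x / lam n) * (exp (poly q ?x) * poly (pderiv q) ?x) + (- 1 / lam n) * exp (poly q ?x)"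
        by (rule DERIV_imp_deriv)
      moreover have "fct n ?x = (1 - ?x / lam n) * exp (poly q ?x)" by (simp only: f)
      ultimately show ?thesis using gen[OF x1(1), of "exp (poly q ?x)"] by (simp only: exp_not_eq_zero not_False_eq_True)
    qed
    also have "(- 1 / lam n) / (1 - ?x / lam n) = 1 / (?x - lam n)"
      using x1 l by (simp add: divide_simps)
    also have "pderiv q = map_poly complex_of_real (pderiv (pp n))"
      unfolding q_def by (rule poly_eqI) (simp add: coeff_pderiv coeff_map_poly)
    finally have "- Im (deriv (fct n) ?x / fct n ?x) = - Im (1 / (?x - lam n))" by (simp add: poly_of_real)
    also have "\<dots> = - Im (lam n) / (cmod (?x - lam n))\<^sup>2"
      by (simp add: Im_divide cmod_power2)
    finally show ?thesis using True by simp
  next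
    case False
    then have "fct n = (\<lambda>z. 1)" by (auto simp: fct_def)
    then show ?thesis using False by simp
  qed
  ultimately show ?thesis by simp
qed

lemma Re_cinverse: "Re (1 / z) = Re z / (cmod z)\<^sup>2" "Im (1 / z) = - Im z / (cmod z)\<^sup>2"
  by (simp_all add: Re_divide Im_divide cmod_power2)

text \<open>With \<open>Re (1 / \<lambda>)\<close> in the convergence factors in place of \<open>1 / \<lambda>\<close>, these are real on the line, and the product still converges
because \<open>\<Sum> |Im (1 / \<lambda>)|\<close> is finite (it is \<open>\<phi>'\<close> at 0 by \<open>logderiv_sums\<close>). In the closed upper half-plane, where there are no zeroes,
\<open>S\<close> is the logarithm of this product. The quotient \<open>P exp (- S)\<close> is positive on the line, since its factors are;
by reflection it is a zero-free entire function, and its logarithm can be chosen real.\<close>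

lemma canonical_factorisation:
  assumes sq: "summable (\<lambda>n. if n \<in> I then 1 / (cmod (lam n))\<^sup>2 else 0)"
  obtains g where "real_entire g"
    "\<And>x::real. (\<lambda>n. if n \<in> I then ln (cmod (1 - of_real x / lam n)) + x * Re (1 / lam n) else 0)
        sums (ln (cmod (P (of_real x))) - Re (g (of_real x)))"
proof -
  define s where "s n z = (if n \<in> I then Ln (1 - z / lam n) + z * of_real (Re (1 / lam n)) else 0)" for n z
  define w where "w n = (if n \<in> I then - Im (lam n) / (cmod (lam n))\<^sup>2 else 0)" for n
  define v where "v n = (if n \<in> I then 1 / (cmod (lam n))\<^sup>2 else 0)" for n
  have weq: "w = (\<lambda>n. if n \<in> I then - Im (lam n) / (cmod (of_real 0 - lam n))\<^sup>2 else 0)"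
    by (auto simp: w_def fun_eq_iff)
  have sw: "summable w" unfolding weq by (rule sums_summable[OF logderiv_sums])
  have sv: "summable v" using sq unfolding v_def .
  have w0: "0 \<le> w n" for n using low[of n] by (auto simp: w_def intro!: divide_nonpos_nonneg)
  have v0: "0 \<le> v n" for n by (simp add: v_def)
  have notneg: "1 - z / lam n \<notin> \<real>\<^sub>\<le>\<^sub>0" if n: "n \<in> I" and z: "0 \<le> Im z" for n z
  proof
    assume "1 - z / lam n \<in> \<real>\<^sub>\<le>\<^sub>0"
    then obtain t where t: "1 - z / lam n = of_real t" "t \<le> 0" by (auto elim: nonpos_Reals_cases)
    then have "z = of_real (1 - t) * lam n" using lam_nz[OF n] by (simp add: field_simps)
    then have "Im z = (1 - t) * Im (lam n)" by simp
    moreover have "(1 - t) * Im (lam n) < 0" using t low[OF n] by (intro mult_pos_neg) auto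
    ultimately show False using z by linarith
  qed
  have sbound: "cmod (s n z) \<le> \<rho> * w n + 2 * \<rho>\<^sup>2 * v n" if z: "cmod z \<le> \<rho>" and big: "\<rho>\<^sup>2 * v n \<le> 1/4" for n z \<rho>
  proof (cases "n \<in> I")
    case True
    have \<rho>0: "0 \<le> \<rho>" using z norm_ge_zero[of z] by linarith
    define u where "u = z / lam n"
    have lp: "0 < cmod (lam n)" using lam_nz[OF True] by simp
    have "(cmod u)\<^sup>2 = (cmod z)\<^sup>2 * v n" using True by (simp add: u_def v_def norm_divide power_divide)
    also have "\<dots> \<le> \<rho>\<^sup>2 * v n" using z v0 by (intro mult_right_mono power_mono) auto
    finally have u2: "(cmod u)\<^sup>2 \<le> \<rho>\<^sup>2 * v n" .
    then have "(cmod u)\<^sup>2 \<le> (1/2)\<^sup>2" using big by (simp add: power2_eq_square)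
    then have uh: "cmod u \<le> 1/2" by (rule power2_le_imp_le) simp
    have "cmod (Ln (1 - u) + u) \<le> 2 * (cmod u)\<^sup>2"
    proof -
      have "cmod (ln (1 + (- u)) - (- u)) \<le> cmod (- u)^2 / (1 - cmod (- u))" using uh by (intro Ln_approx_linear) simp
      also have "\<dots> \<le> (cmod u)\<^sup>2 / (1/2)" using uh unfolding norm_minus_cancel by (intro divide_left_mono mult_pos_pos) auto
      finally show ?thesis by simp
    qed
    moreover have sn: "s n z = (Ln (1 - u) + u) - \<i> * z * of_real (Im (1 / lam n))"
    proof -
      have "1 / lam n = of_real (Re (1 / lam n)) + \<i> * of_real (Im (1 / lam n))" by (rule complex_eq)
      then have "u = z * (of_real (Re (1 / lam n)) + \<i> * of_real (Im (1 / lam n)))"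
        unfolding u_def by (metis mult.right_neutral times_divide_eq_right)
      then show ?thesis using True by (simp add: s_def u_def algebra_simps)
    qed
    moreover have "cmod (\<i> * z * of_real (Im (1 / lam n))) \<le> \<rho> * w n"
    proof -
      have "\<bar>Im (1 / lam n)\<bar> = w n" using True low[OF True] by (simp only: Re_cinverse) (simp add: w_def)
      then show ?thesis using z w0[of n] by (simp add: norm_mult mult_right_mono)
    qed
    ultimately have "cmod (s n z) \<le> 2 * (cmod u)\<^sup>2 + \<rho> * w n"
      using order_trans[OF norm_triangle_ineq4 add_mono[of "cmod (Ln (1 - u) + u)" "2 * (cmod u)\<^sup>2"
        "cmod (\<i> * z * of_real (Im (1 / lam n)))" "\<rho> * w n"]] by (simp only:)
    then show ?thesis using u2 by simp
  next
    case False
    then show ?thesis by (simp add: s_def w_def v_def)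
  qed
  define S where "S z = (\<Sum>n. s n z)" for z
  have ulS: "uniform_limit {z. 0 \<le> Im z \<and> cmod z \<le> \<rho>} (\<lambda>N z. \<Sum>n<N. s n z) S sequentially" for \<rho>
    unfolding S_def
  proof (rule Weierstrass_m_test_ev)
    show "summable (\<lambda>n. \<rho> * w n + 2 * \<rho>\<^sup>2 * v n)" by (intro summable_add summable_mult sw sv)
    have "(\<lambda>n. \<rho>\<^sup>2 * v n) \<longlonglongrightarrow> \<rho>\<^sup>2 * 0" using summable_LIMSEQ_zero[OF sv] by (rule tendsto_mult_left)
    then have "eventually (\<lambda>n. \<rho>\<^sup>2 * v n < 1/4) sequentially" by (intro order_tendstoD(2)) auto
    then show "\<forall>\<^sub>F n in sequentially. \<forall>x\<in>{z. 0 \<le> Im z \<and> cmod z \<le> \<rho>}. norm (s n x) \<le> \<rho> * w n + 2 * \<rho>\<^sup>2 * v n"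
      by eventually_elim (use sbound in auto)
  qed
  have limS: "(\<lambda>N. \<Sum>n<N. s n z) \<longlonglongrightarrow> S z" if "0 \<le> Im z" for z
    by (rule tendsto_uniform_limitI[OF ulS[of "cmod z"]]) (use that in auto)
  have cont_s: "continuous_on {z. 0 \<le> Im z} (s n)" for n
    unfolding s_def using notneg[of n] by (cases "n \<in> I") (auto intro!: continuous_intros simp: lam_nz)
  have hol_s: "s n holomorphic_on {z. 0 < Im z}" for n
    unfolding s_def using notneg[of n] by (cases "n \<in> I") (auto intro!: holomorphic_intros simp: lam_nz)
  have contS: "continuous_on {z. 0 \<le> Im z} S"
    unfolding continuous_on_eq_continuous_within
  proof
    fix z assume z: "z \<in> {z. 0 \<le> Im z}"
    have c: "continuous_on {w. 0 \<le> Im w \<and> cmod w \<le> cmod z + 1} S"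
      by (rule uniform_limit_theorem[OF _ ulS])
         (auto intro!: always_eventually continuous_intros continuous_on_subset[OF cont_s])
    have "continuous (at z within {w. 0 \<le> Im w \<and> cmod w \<le> cmod z + 1}) S"
      using c z by (simp add: continuous_on_eq_continuous_within)
    moreover have "at z within {w. 0 \<le> Im w \<and> cmod w \<le> cmod z + 1} = at z within {w. 0 \<le> Im w}"
    proof (rule at_within_nhd[of _ "ball z 1"])
      show "{w. 0 \<le> Im w \<and> cmod w \<le> cmod z + 1} \<inter> ball z 1 - {z} = {w. 0 \<le> Im w} \<inter> ball z 1 - {z}"
      proof -
        have "cmod w \<le> cmod z + 1" if "w \<in> ball z 1" for w
          using that norm_triangle_ineq2[of w z] by (simp add: dist_norm norm_minus_commute)
        then show ?thesis by auto
      qed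
    qed auto
    ultimately show "continuous (at z within {z. 0 \<le> Im z}) S" by simp
  qed
  have holS: "S holomorphic_on {z. 0 < Im z}"
  proof (rule holomorphic_uniform_sequence[OF open_halfspace_Im_gt])
    show "(\<lambda>z. \<Sum>n<N. s n z) holomorphic_on {z. 0 < Im z}" for N by (intro holomorphic_intros hol_s)
    fix z assume "z \<in> {z. 0 < Im z}"
    then obtain d where d: "0 < d" "cball z d \<subseteq> {z. 0 < Im z}"
      using open_halfspace_Im_gt[of 0] open_contains_cball by blast
    have "cball z d \<subseteq> {w. 0 \<le> Im w \<and> cmod w \<le> cmod z + d}"
    proof
      fix w assume w: "w \<in> cball z d"
      then have "cmod w \<le> cmod z + d" using norm_triangle_ineq2[of w z] by (simp add: dist_norm norm_minus_commute)
      then show "w \<in> {w. 0 \<le> Im w \<and> cmod w \<le> cmod z + d}" using d w by force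
    qed
    then show "\<exists>d>0. cball z d \<subseteq> {z. 0 < Im z} \<and> uniform_limit (cball z d) (\<lambda>N z. \<Sum>n<N. s n z) S sequentially"
      using d uniform_limit_on_subset[OF ulS] by blast
  qed
  define R where "R z = P z * exp (- S z)" for z
  have R_nz: "R z \<noteq> 0" if "0 \<le> Im z" for z using P_nz_upper[OF that] by (simp add: R_def)
  have R_real: "R (of_real x) \<in> \<real> \<and> 0 < Re (R (of_real x))" for x
  proof -
    define y where "y n = (if n \<in> I then poly (pp n) x - x * Re (1 / lam n) else 0)" for n
    have t: "fct n (of_real x) * exp (- s n (of_real x)) = of_real (exp (y n))" for n
    proof (cases "n \<in> I")
      case True
      have nz: "1 - of_real x / lam n \<noteq> 0" using notneg[OF True, of "of_real x"] by auto
      have "exp (- s n (of_real x)) = exp (- Ln (1 - of_real x / lam n)) * exp (- (of_real x * of_real (Re (1 / lam n))))"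
        using True by (simp add: s_def flip: exp_add)
      also have "exp (- Ln (1 - of_real x / lam n)) = 1 / (1 - of_real x / lam n)"
        using nz by (simp add: exp_minus inverse_eq_divide)
      finally have "fct n (of_real x) * exp (- s n (of_real x)) = exp (of_real (poly (pp n) x)) * exp (- (of_real x * of_real (Re (1 / lam n))))"
        using True nz by (simp add: fct_def poly_of_real)
      also have "\<dots> = exp (of_real (poly (pp n) x - x * Re (1 / lam n)))" by (simp flip: exp_add)
      also have "\<dots> = of_real (exp (poly (pp n) x - x * Re (1 / lam n)))" by (rule exp_of_real)
      finally show ?thesis using True by (simp only: y_def if_True)
    qed (simp add: fct_def s_def y_def)
    have "(\<lambda>N. (\<Prod>n<N. fct n (of_real x)) * exp (- (\<Sum>n<N. s n (of_real x)))) \<longlonglongrightarrow> R (of_real x)"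
      unfolding R_def by (intro tendsto_intros lim_fct limS) simp
    moreover have "(\<Prod>n<N. fct n (of_real x)) * exp (- (\<Sum>n<N. s n (of_real x))) = of_real (\<Prod>n<N. exp (y n))" for N
    proof -
      have "exp (- (\<Sum>n<N. s n (of_real x))) = (\<Prod>n<N. exp (- s n (of_real x)))" by (simp add: exp_sum flip: sum_negf)
      then show ?thesis by (simp only: prod.distrib[symmetric] t of_real_prod)
    qed
    ultimately have lim: "(\<lambda>N. complex_of_real (\<Prod>n<N. exp (y n))) \<longlonglongrightarrow> R (of_real x)" by simp
    have "R (of_real x) \<in> \<real>"
      by (rule closed_sequentially[OF closed_complex_Reals _ lim]) auto
    moreover have "0 \<le> Re (R (of_real x))"
      by (rule tendsto_lowerbound[OF tendsto_Re[OF lim]]) (intro always_eventually allI, simp only: Re_complex_of_real, intro prod_nonneg, auto)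
    moreover have "Re (R (of_real x)) \<noteq> 0"
      using R_nz[of "of_real x"] \<open>R (of_real x) \<in> \<real>\<close> by (auto simp: complex_is_Real_iff complex_eq_iff)
    ultimately show ?thesis by simp
  qed
  define Rh where "Rh z = (if 0 \<le> Im z then R z else cnj (R (cnj z)))" for z
  have holRh: "Rh holomorphic_on UNIV" unfolding Rh_def
  proof (rule Schwarz_reflection)
    show "R holomorphic_on UNIV \<inter> {z. 0 < Im z}" unfolding R_def by (intro holomorphic_intros hol_P) (use holS in auto)
    show "continuous_on (UNIV \<inter> {z. 0 \<le> Im z}) R" unfolding R_def
      by (intro continuous_intros holomorphic_on_imp_continuous_on[OF hol_P]) (use contS in auto)
    show "R z \<in> \<real>" if "z \<in> \<real>" for z using that R_real by (auto elim: Reals_cases)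
  qed auto
  have Rh_nz: "Rh z \<noteq> 0" for z using R_nz[of z] R_nz[of "cnj z"] by (auto simp: Rh_def)
  obtain g0 where g0: "g0 holomorphic_on UNIV" "\<And>z. Rh z = exp (g0 z)"
    using holomorphic_logarithm_exists[of UNIV Rh 0] holRh Rh_nz by (metis UNIV_I convex_UNIV open_UNIV)
  have cg0: "conj_fun g0 = cnj \<circ> g0 \<circ> cnj" by (auto simp: conj_fun_def)
  have hol_cg0: "conj_fun g0 holomorphic_on UNIV"
    unfolding cg0 using g0(1) by (intro holomorphic_on_compose_cnj_cnj) (auto simp: image_def intro: holomorphic_on_subset)
  define g where "g z = (g0 z + conj_fun g0 z) / 2" for z
  have re: "real_entire g" unfolding real_entire_def
  proof
    show "g holomorphic_on UNIV" unfolding g_def by (intro holomorphic_intros g0 hol_cg0) auto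
    show "conj_fun g = g" by (auto simp: conj_fun_def g_def add.commute)
  qed
  have Reg: "Re (g (of_real x)) = ln (cmod (R (of_real x)))" for x
  proof -
    have "Re (g (of_real x)) = Re (g0 (of_real x))" by (simp add: g_def conj_fun_def)
    moreover have "cmod (R (of_real x)) = exp (Re (g0 (of_real x)))" using g0(2)[of "of_real x"] by (simp add: Rh_def)
    ultimately show ?thesis by simp
  qed
  show thesis
  proof (rule that[OF re])
    fix x :: real
    have "(\<lambda>N. \<Sum>n<N. Re (s n (of_real x))) \<longlonglongrightarrow> Re (S (of_real x))"
      using tendsto_Re[OF limS[of "of_real x"]] by simp
    moreover have "Re (S (of_real x)) = ln (cmod (P (of_real x))) - Re (g (of_real x))"
    proof -
      have "cmod (R (of_real x)) = cmod (P (of_real x)) * exp (- Re (S (of_real x)))" by (simp add: R_def norm_mult)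
      then have "ln (cmod (R (of_real x))) = ln (cmod (P (of_real x))) + - Re (S (of_real x))"
        using P_nz_upper[of "of_real x"] by (simp add: ln_mult)
      then show ?thesis by (simp add: Reg)
    qed
    moreover have "Re (s n (of_real x)) = (if n \<in> I then ln (cmod (1 - of_real x / lam n)) + x * Re (1 / lam n) else 0)" for n
    proof (cases "n \<in> I")
      case True
      have nz: "1 - of_real x / lam n \<noteq> 0" using notneg[OF True, of "of_real x"] by auto
      have "Re (of_real x * complex_of_real (Re (1 / lam n))) = x * Re (1 / lam n)" by simp
      then show ?thesis using True Re_Ln[OF nz] by (simp add: s_def)
    qed (simp add: s_def)
    ultimately show "(\<lambda>n. if n \<in> I then ln (cmod (1 - of_real x / lam n)) + x * Re (1 / lam n) else 0)
        sums (ln (cmod (P (of_real x))) - Re (g (of_real x)))" by (simp add: sums_def)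
  qed
qed

end

section \<open>The density and the real-entire function\<close>

lemma real_entire_deriv_real:
  assumes "real_entire h" shows "Im (deriv h (of_real x)) = 0"
proof -
  have hol: "h holomorphic_on UNIV" and c: "cnj \<circ> h \<circ> cnj = h"
    using assms by (auto simp: real_entire_def conj_fun_def fun_eq_iff)
  have d: "(h has_field_derivative deriv h (of_real x)) (at (of_real x))" by (rule holomorphic_derivI[OF hol]) auto
  then have "(cnj \<circ> h \<circ> cnj has_field_derivative cnj (deriv h (of_real x))) (at (of_real x))"
    by (intro has_field_derivative_cnj_cnj) simp
  then have "cnj (deriv h (of_real x)) = deriv h (of_real x)" using d unfolding c by (rule DERIV_unique)
  then show ?thesis by (metis Reals_cnj_iff complex_is_Real_iff)
qed

lemma real_entire_add: "real_entire f \<Longrightarrow> real_entire g \<Longrightarrow> real_entire (\<lambda>z. f z + g z)"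
  unfolding real_entire_def conj_fun_def fun_eq_iff by (auto intro!: holomorphic_intros)

lemma real_entire_linear: "real_entire (\<lambda>z. of_real c * z)"
  unfolding real_entire_def conj_fun_def fun_eq_iff by (auto intro!: holomorphic_intros)

lemma simple_zero_deriv:
  assumes hol: "f holomorphic_on UNIV" and z: "f z = 0" and nt: "f b \<noteq> 0" and ord: "zorder f z = 1"
  shows "deriv f z \<noteq> 0"
proof -
  obtain r where r: "0 < r" and hg: "zor_poly f z holomorphic_on cball z r"
    and eq: "\<And>w. w \<in> cball z r \<Longrightarrow> f w = zor_poly f z w * (w - z) ^ nat (zorder f z) \<and> zor_poly f z w \<noteq> 0"
    using zorder_exist_zero[OF hol open_UNIV connected_UNIV UNIV_I, of z] nt by blast
  define G where "G = zor_poly f z"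
  have hG: "G holomorphic_on ball z r" unfolding G_def by (rule holomorphic_on_subset[OF hg]) auto
  have dG: "(G has_field_derivative deriv G z) (at z)" by (rule holomorphic_derivI[OF hG]) (use r in auto)
  have d1: "((\<lambda>w. w - z) has_field_derivative 1) (at z)" by (auto intro!: derivative_eq_intros)
  have "((\<lambda>w. G w * (w - z)) has_field_derivative G z) (at z)" using DERIV_mult[OF dG d1] by simp
  then have "(f has_field_derivative G z) (at z)"
    by (rule has_field_derivative_transform_within_open[of _ _ _ "ball z r"]) (use eq r ord in \<open>auto simp: G_def\<close>)
  moreover have "G z \<noteq> 0" using eq[of z] r by (simp add: G_def)
  ultimately show ?thesis by (simp add: DERIV_imp_deriv)
qed

text \<open>Every point that lies on no closed mountain base belongs to a plateau, because bases and plateaux cover the line.\<close>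

lemma mountain_chain_bases:
  assumes mc: "mountain_chain \<gamma> ((\<lambda>w. ({x. cz x = w}, Re w, - Im w)) ` Z)"
  obtains a b :: "complex \<Rightarrow> real" and l d where "0 < d"
    "\<forall>w\<in>Z. {a w<..<b w} \<subseteq> {x. cz x = w} \<and> {x. cz x = w} \<subseteq> {a w..b w} \<and> a w + d \<le> Re w \<and> Re w + d \<le> b w \<and> b w - a w \<le> l"
    "\<forall>x. (\<forall>w\<in>Z. \<not> (a w \<le> x \<and> x \<le> b w)) \<longrightarrow> \<gamma> x = 1"
proof -
  let ?M = "(\<lambda>w. ({x. cz x = w}, Re w, - Im w)) ` Z"
  obtain Ps where part: "partition_on UNIV (fst ` ?M \<union> Ps)" and Ps: "\<And>Q x. Q \<in> Ps \<Longrightarrow> x \<in> Q \<Longrightarrow> \<gamma> x = 1"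
    using mc unfolding mountain_chain_def by (elim exE conjE) (rule that, assumption, drule bspec, assumption, simp)
  obtain ll l d where all: "\<forall>(B, \<xi>, \<eta>)\<in>?M. \<exists>a b. {a<..<b} \<subseteq> B \<and> B \<subseteq> {a..b} \<and> a < \<xi> \<and> \<xi> < b \<and>
              0 < \<eta> \<and> 1 / \<eta> > 1 \<and> ll \<le> b - a \<and> b - a \<le> l \<and> d \<le> \<xi> - a \<and> d \<le> b - \<xi> \<and>
              (\<forall>x\<in>B. \<gamma> x = \<eta> / ((x - \<xi>)\<^sup>2 + \<eta>\<^sup>2))"
    and pos: "0 < d"
    using mc unfolding mountain_chain_def by (elim exE conjE) (rule that; assumption)
  have "\<forall>w\<in>Z. \<exists>ab. {fst ab<..<snd ab} \<subseteq> {x. cz x = w} \<and> {x. cz x = w} \<subseteq> {fst ab..snd ab}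
      \<and> fst ab + d \<le> Re w \<and> Re w + d \<le> snd ab \<and> snd ab - fst ab \<le> l"
  proof
    fix w assume "w \<in> Z"
    then have "({x. cz x = w}, Re w, - Im w) \<in> ?M" by blast
    from bspec[OF all this, unfolded case_prod_conv]
    obtain a b where "{a<..<b} \<subseteq> {x. cz x = w}" "{x. cz x = w} \<subseteq> {a..b}" "b - a \<le> l" "d \<le> Re w - a" "d \<le> b - Re w"
      by (elim exE conjE) (rule that)
    then show "\<exists>ab. {fst ab<..<snd ab} \<subseteq> {x. cz x = w} \<and> {x. cz x = w} \<subseteq> {fst ab..snd ab}
      \<and> fst ab + d \<le> Re w \<and> Re w + d \<le> snd ab \<and> snd ab - fst ab \<le> l"
      by (intro exI[of _ "(a, b)"]) auto
  qed
  from bchoice[OF this] obtain ab where "\<forall>w\<in>Z. {fst (ab w)<..<snd (ab w)} \<subseteq> {x. cz x = w} \<and> {x. cz x = w} \<subseteq> {fst (ab w)..snd (ab w)}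
      \<and> fst (ab w) + d \<le> Re w \<and> Re w + d \<le> snd (ab w) \<and> snd (ab w) - fst (ab w) \<le> l" ..
  note all_ab = this
  note ab = bspec[OF all_ab]
  show thesis
  proof (rule that[OF pos all_ab], intro allI impI)
    fix x assume x: "\<forall>w\<in>Z. \<not> (fst (ab w) \<le> x \<and> x \<le> snd (ab w))"
    obtain X where X: "X \<in> fst ` ?M \<union> Ps" "x \<in> X" using part unfolding partition_on_def by blast
    have "X \<notin> fst ` ?M"
    proof
      assume "X \<in> fst ` ?M"
      then obtain w where w: "w \<in> Z" "X = {x. cz x = w}" by auto
      then have "x \<in> {fst (ab w)..snd (ab w)}" using conjunct1[OF conjunct2[OF ab[OF w(1)]]] X(2) by blast
      then show False using bspec[OF x w(1)] by simp
    qed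
    then show "\<gamma> x = 1" using X Ps by blast
  qed
qed

lemma comparable_expI:
  assumes "\<And>x. 0 < f x" "\<And>x. \<bar>ln (f x) - u x\<bar> \<le> B"
  shows "comparable f (\<lambda>x. exp (u x))"
  unfolding comparable_def lesssim_def
proof (intro conjI exI allI)
  show "0 < exp B" "0 < exp B" by simp_all
  fix x
  have "exp (ln (f x)) \<le> exp (B + u x)" "exp (u x) \<le> exp (B + ln (f x))"
    using assms(2)[of x] by (simp_all only: exp_le_cancel_iff abs_le_iff) linarith+
  then show "f x \<le> exp B * exp (u x)" "exp (u x) \<le> exp B * f x"
    using assms(1)[of x] by (simp_all add: exp_add)
qed

theorem theorem1:
  fixes H :: "(complex \<Rightarrow> complex) set"
    and ip :: "(complex \<Rightarrow> complex) \<Rightarrow> (complex \<Rightarrow> complex) \<Rightarrow> complex"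
  assumes "MC_space H ip"
  shows "\<exists>(m :: real \<Rightarrow> real) (g :: complex \<Rightarrow> complex).
           m \<in> borel_measurable lebesgue \<and> (\<forall>t. m t > 0) \<and> comparable m (\<lambda>t. 1) \<and>
           real_entire g \<and>
           comparable (\<lambda>x::real. majorant H ip (of_real x))
             (\<lambda>x::real. exp (Re (g (of_real x))) * exp (potential m (of_real x)))"
proof -
  obtain E where dB: "de_branges_space H ip" and cHB: "considered_HB E" and mca: "mountain_chain_axioms E"
    and HE: "H = HE_space E" and nrm: "\<And>f. f \<in> H \<Longrightarrow> ip_norm ip f = HE_norm E f"
    using assms unfolding MC_space_def by blast
  have HB: "hermite_biehler E" using cHB by (simp add: considered_HB_def)
  have holE: "E holomorphic_on UNIV" using HB by (simp add: hermite_biehler_def)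
  obtain Cc h I lam pp P where ul: "\<forall>A. compact A \<longrightarrow> uniform_limit A
             (\<lambda>N z. \<Prod>n\<in>I \<inter> {..<N}. (1 - z / lam n) * exp (poly (map_poly complex_of_real (pp n)) z)) P sequentially"
    and EP': "\<forall>z. E z = Cc * exp (h z) * P z" and h: "real_entire h" and lamI: "lam ` I \<subseteq> lower_half_plane"
    using cHB unfolding considered_HB_def by (elim exE conjE) (rule that; assumption)
  note EP = spec[OF EP']
  have Ei: "E \<i> \<noteq> 0"
  proof -
    have "\<forall>z\<in>upper_half_plane. cmod (E z) > cmod (E (cnj z))" using HB unfolding hermite_biehler_def by (rule conjunct2)
    from bspec[OF this, of \<i>] have "cmod (E (cnj \<i>)) < cmod (E \<i>)" by (simp add: upper_half_plane_def)
    then have "0 < cmod (E \<i>)" using norm_ge_zero[of "E (cnj \<i>)"] by (rule le_less_trans[rotated])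
    then show ?thesis by simp
  qed
  then have Cc: "Cc \<noteq> 0" and Pi: "P \<i> \<noteq> 0" using EP[of \<i>] by auto
  interpret Z: zero_product I lam pp P
    by unfold_locales (use lamI ul Pi in \<open>auto simp: lower_half_plane_def\<close>)
  have E0: "E z = 0 \<longleftrightarrow> z \<in> lam ` I" for z using EP[of z] Cc by (simp add: Z.zeros_P)
  have nzr: "E (of_real x) \<noteq> 0" for x :: real
  proof
    assume "E (of_real x) = 0"
    then obtain n where n: "n \<in> I" "of_real x = lam n" unfolding E0 by blast
    then have "Im (lam n) = 0" by (metis Im_complex_of_real)
    then show False using Z.low[OF n(1)] by simp
  qed
  have zE: "zeros E = lam ` I" by (auto simp: zeros_def E0)
  obtain \<delta> \<phi> J \<xi> \<eta> \<epsilon> CA NA where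
    mc: "mountain_chain (gamma_delta E \<delta>)
          ((\<lambda>w. ({x. closest_zero E x = w}, Re w, - Im w)) ` (zeros E \<inter> critical_strip \<delta>))"
    and \<delta>: "0 < \<delta>" "\<delta> \<le> 1" and cmp: "comparable (deriv \<phi>) (gamma_delta E \<delta>)" and ph: "is_phase E \<phi>"
    and simple: "\<forall>w\<in>zeros E \<inter> critical_strip \<delta>. zorder E w = 1"
    and bij: "bij_betw (\<lambda>k. Complex (\<xi> k) (- \<eta> k)) (J::int set) (zeros E \<inter> critical_strip \<delta>)"
    and smono: "strict_mono_on J \<xi>" and Jconv: "\<forall>i\<in>J. \<forall>j\<in>J. {i..j} \<subseteq> J"
    and slow: "\<forall>k\<in>J. \<forall>l\<in>J. \<bar>k - l\<bar> \<ge> NA \<longrightarrow>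
        \<bar>ln (\<eta> k) - ln (\<eta> l)\<bar> \<le> CA * \<bar>\<xi> k - \<xi> l\<bar> powr (1 - \<epsilon>)" and \<epsilon>: "0 < \<epsilon>" "\<epsilon> < 1"
    using mca unfolding mountain_chain_axioms_def by (elim exE conjE) (rule that; assumption)
  define p where "p = deriv \<phi>"
  have pE: "p x = - Im (deriv E (of_real x) / E (of_real x))" for x
    unfolding p_def by (rule phase_deriv[OF holE nzr ph])
  have pP: "p x = - Im (deriv P (of_real x) / P (of_real x))" for x
  proof -
    have Pn: "P (of_real x) \<noteq> 0" by (rule Z.P_nz_upper) simp
    have holh: "h holomorphic_on UNIV" using h by (simp add: real_entire_def)
    have "((\<lambda>z. Cc * exp (h z) * P z) has_field_derivative
        (Cc * exp (h (of_real x)) * deriv P (of_real x) + Cc * (exp (h (of_real x)) * deriv h (of_real x)) * P (of_real x))) (at (of_real x))"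
      by (auto intro!: derivative_eq_intros holomorphic_derivI[OF holh] holomorphic_derivI[OF Z.hol_P[of UNIV]])
    then have "deriv E (of_real x) = Cc * exp (h (of_real x)) * deriv P (of_real x) + Cc * (exp (h (of_real x)) * deriv h (of_real x)) * P (of_real x)"
      using EP by (simp add: DERIV_imp_deriv[symmetric] fun_eq_iff flip: EP[abs_def]) (metis DERIV_imp_deriv EP ext)
    then have "deriv E (of_real x) / E (of_real x) = deriv P (of_real x) / P (of_real x) + deriv h (of_real x)"
      using Cc Pn by (simp add: EP field_simps)
    then show ?thesis using real_entire_deriv_real[OF h, of x] by (simp add: pE)
  qed
  have psum: "(\<lambda>n. if n \<in> I then - Im (lam n) / (cmod (of_real x - lam n))\<^sup>2 else 0) sums p x" for x
    unfolding pP by (rule Z.logderiv_sums)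
  have pcont: "continuous_on UNIV p"
  proof -
    have "continuous_on UNIV (\<lambda>x::real. - Im (deriv E (of_real x) / E (of_real x)))"
      by (intro continuous_intros continuous_on_compose2[OF holomorphic_on_imp_continuous_on[OF holE]]
        continuous_on_compose2[OF holomorphic_on_imp_continuous_on[OF holomorphic_deriv[OF holE open_UNIV]]]) (use nzr in auto)
    moreover have "p = (\<lambda>x. - Im (deriv E (of_real x) / E (of_real x)))" by (rule ext) (rule pE)
    ultimately show ?thesis by (simp only:)
  qed
  obtain c2 c1' where c2: "0 < c2" "\<And>x. p x \<le> c2 * gamma_delta E \<delta> x"
    and c1': "0 < c1'" "\<And>x. gamma_delta E \<delta> x \<le> c1' * p x"
    using cmp unfolding comparable_def lesssim_def p_def by blast
  define c1 where "c1 = 1 / c1'"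
  have c1: "0 < c1" "\<And>x. c1 * gamma_delta E \<delta> x \<le> p x"
    using c1' by (auto simp: c1_def field_simps)
  define Zs where "Zs = zeros E \<inter> critical_strip \<delta>"
  obtain aw bw l d where d: "0 < d"
    and ab': "\<forall>w\<in>Zs. {aw w<..<bw w} \<subseteq> {x. closest_zero E x = w} \<and> {x. closest_zero E x = w} \<subseteq> {aw w..bw w}
        \<and> aw w + d \<le> Re w \<and> Re w + d \<le> bw w \<and> bw w - aw w \<le> l"
    and plat1: "\<forall>x. (\<forall>w\<in>Zs. \<not> (aw w \<le> x \<and> x \<le> bw w)) \<longrightarrow> gamma_delta E \<delta> x = 1"
    by (rule mountain_chain_bases[OF mc, folded Zs_def]) (rule that; assumption)
  note ab = bspec[OF ab']
  define W where "W k = Complex (\<xi> k) (- \<eta> k)" for k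
  have bijW: "bij_betw W J Zs" using bij unfolding W_def[abs_def] Zs_def .
  have WZ: "W k \<in> Zs" if "k \<in> J" for k using bijW that by (auto simp: bij_betw_def)
  have surW: "\<exists>k\<in>J. w = W k" if "w \<in> Zs" for w
    using that bij_betw_imp_surj_on[OF bijW] by blast
  have "\<forall>k\<in>J. \<exists>n. n \<in> I \<and> lam n = W k"
    using WZ by (force simp: Zs_def zE)
  then obtain idx where idx: "\<And>k. k \<in> J \<Longrightarrow> idx k \<in> I" "\<And>k. k \<in> J \<Longrightarrow> lam (idx k) = W k" by metis
  have inj: "inj_on idx J"
    using bijW idx(2) unfolding bij_betw_def inj_on_def by metis
  have dist_gap: "bw (W k) \<le> aw (W j)" if kj: "k \<in> J" "j \<in> J" "k < j" for k j
  proof (rule ccontr)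
    assume not: "\<not> bw (W k) \<le> aw (W j)"
    have lt: "\<xi> k < \<xi> j" using smono kj by (auto simp: strict_mono_on_def)
    note A = ab[OF WZ[OF kj(1)]] ab[OF WZ[OF kj(2)]]
    have ne: "max (aw (W k)) (aw (W j)) < min (bw (W k)) (bw (W j))"
      using not lt A d by (auto simp: W_def)
    define t where "t = (max (aw (W k)) (aw (W j)) + min (bw (W k)) (bw (W j))) / 2"
    have "t \<in> {aw (W k)<..<bw (W k)}" "t \<in> {aw (W j)<..<bw (W j)}" using ne by (auto simp: t_def field_simps)
    then have "closest_zero E t = W k" "closest_zero E t = W j"
      using subsetD[OF conjunct1[OF A(1)]] subsetD[OF conjunct1[OF A(2)]] by blast+
    then have "W k = W j" by simp
    then show False using bijW kj by (auto simp: bij_betw_def inj_on_def)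
  qed
  interpret M: mountain_zeros I lam J idx "\<lambda>k. aw (W k)" "\<lambda>k. bw (W k)" p \<delta> d l c1 c2 "1 - \<epsilon>" "\<bar>CA\<bar>" "nat NA"
  proof unfold_locales
    show "Im (lam n) < 0" if "n \<in> I" for n by (rule Z.low[OF that])
    show "(\<lambda>n. if n \<in> I then - Im (lam n) / (cmod (of_real x - lam n))\<^sup>2 else 0) sums p x" for x by (rule psum)
    show "Im (lam n) \<le> - \<delta>" if n: "n \<in> I" "n \<notin> idx ` J" for n
    proof (rule ccontr)
      assume "\<not> Im (lam n) \<le> - \<delta>"
      then have "lam n \<in> Zs" using n Z.low[OF n(1)] by (auto simp: Zs_def zE critical_strip_def)
      then obtain k where k: "k \<in> J" "lam n = W k" using surW by blast
      then have same: "lam n = lam (idx k)" "n \<noteq> idx k" using idx n by auto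
      have "deriv P (lam n) = 0" by (rule Z.deriv_P_double_zero[OF n(1) idx(1)[OF k(1)] same(2,1)])
      have holh: "h holomorphic_on UNIV" using h by (simp add: real_entire_def)
      have "((\<lambda>z. Cc * exp (h z) * P z) has_field_derivative
          (Cc * exp (h (lam n)) * deriv P (lam n) + Cc * (exp (h (lam n)) * deriv h (lam n)) * P (lam n))) (at (lam n))"
        by (auto intro!: derivative_eq_intros holomorphic_derivI[OF holh] holomorphic_derivI[OF Z.hol_P[of UNIV]])
      then have "deriv (\<lambda>z. Cc * exp (h z) * P z) (lam n) = 0"
        using \<open>deriv P (lam n) = 0\<close> Z.P_lam[OF n(1)] by (simp add: DERIV_imp_deriv)
      moreover have "E = (\<lambda>z. Cc * exp (h z) * P z)" by (rule ext) (rule EP)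
      then have "deriv E (lam n) = deriv (\<lambda>z. Cc * exp (h z) * P z) (lam n)" by (rule arg_cong)
      ultimately have "deriv E (lam n) = 0" by (simp only:)
      moreover have "deriv E (lam n) \<noteq> 0"
        by (rule simple_zero_deriv[OF holE _ Ei]) (use bspec[OF simple, of "lam n"] \<open>lam n \<in> Zs\<close> E0 n in \<open>auto simp: Zs_def\<close>)
      ultimately show False by simp
    qed
    show "- 1 < Im (lam (idx k))" if "k \<in> J" for k
      using WZ[OF that] \<delta> by (auto simp: idx(2)[OF that] Zs_def critical_strip_def)
    show "aw (W k) + d \<le> Re (lam (idx k))" "Re (lam (idx k)) + d \<le> bw (W k)" "bw (W k) - aw (W k) \<le> l" if "k \<in> J" for k
      using ab[OF WZ[OF that]] by (auto simp: idx(2)[OF that])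
    show "bw (W k) \<le> aw (W j)" if "k \<in> J" "j \<in> J" "k < j" for k j by (rule dist_gap[OF that])
    show "c1 * (- Im (lam (idx k)) / (cmod (of_real x - lam (idx k)))\<^sup>2) \<le> p x \<and>
        p x \<le> c2 * (- Im (lam (idx k)) / (cmod (of_real x - lam (idx k)))\<^sup>2)"
      if k: "k \<in> J" "aw (W k) < x" "x < bw (W k)" for k x
    proof -
      have "closest_zero E x = W k" using ab[OF WZ[OF k(1)]] k by auto
      then have "gamma_delta E \<delta> x = - Im (lam (idx k)) / (cmod (of_real x - lam (idx k)))\<^sup>2"
        using WZ[OF k(1)] by (simp add: gamma_delta_def idx(2)[OF k(1)] Zs_def)
      then show ?thesis using c1(2)[of x] c2(2)[of x] by simp
    qed
    show "c1 \<le> p x \<and> p x \<le> c2" if x: "\<And>k. k \<in> J \<Longrightarrow> \<not> (aw (W k) \<le> x \<and> x \<le> bw (W k))" for x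
    proof -
      have "gamma_delta E \<delta> x = 1"
      proof (rule plat1[rule_format])
        fix w assume "w \<in> Zs"
        then obtain k where "k \<in> J" "w = W k" using surW by blast
        then show "\<not> (aw w \<le> x \<and> x \<le> bw w)" using x by blast
      qed
      then show ?thesis using c1(2)[of x] c2(2)[of x] by simp
    qed
    show "\<bar>ln (- Im (lam (idx k))) - ln (- Im (lam (idx j)))\<bar> \<le> \<bar>CA\<bar> * \<bar>Re (lam (idx k)) - Re (lam (idx j))\<bar> powr (1 - \<epsilon>)"
      if kj: "k \<in> J" "j \<in> J" "int (nat NA) \<le> \<bar>k - j\<bar>" for k j
    proof -
      have "\<bar>ln (\<eta> k) - ln (\<eta> j)\<bar> \<le> CA * \<bar>\<xi> k - \<xi> j\<bar> powr (1 - \<epsilon>)"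
        by (rule slow[rule_format, OF kj(1,2)]) (use kj(3) in linarith)
      also have "\<dots> \<le> \<bar>CA\<bar> * \<bar>\<xi> k - \<xi> j\<bar> powr (1 - \<epsilon>)" by (intro mult_right_mono) auto
      finally show ?thesis by (simp add: idx(2)[OF kj(1)] idx(2)[OF kj(2)] W_def)
    qed
  qed (use \<delta> d inj idx Jconv c1 c2 \<epsilon> pcont in auto)
  define m0 where "m0 t = (\<Sum>n. M.r n t) / pi" for t
  have sums0: "(\<lambda>n. if n \<in> I then poisson (M.et n + 1) (t - M.xi n) else 0) sums m0 t" for t
  proof -
    have "(\<lambda>n. M.r n t / pi) sums m0 t" unfolding m0_def by (intro sums_divide summable_sums M.summable_r)
    moreover have "M.r n t / pi = (if n \<in> I then poisson (M.et n + 1) (t - M.xi n) else 0)" for n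
      by (simp add: M.r_def poisson_def)
    ultimately show ?thesis by simp
  qed
  have m0_le: "m0 t \<le> M.C0 / pi" for t unfolding m0_def by (intro divide_right_mono M.suminf_r_le) simp
  obtain c where c: "0 < c" "\<And>t. c \<le> (\<Sum>n. M.r n t)" using M.suminf_r_ge by blast
  have m0_ge: "c / pi \<le> m0 t" for t unfolding m0_def by (intro divide_right_mono c) simp
  have hpos: "0 < M.et n + 1" if "n \<in> I" for n using M.et_pos[OF that] by simp
  have m0_meas: "m0 \<in> borel_measurable borel" by (rule log_kernel_poisson_series(1)[OF hpos sums0 m0_le])
  define cn where "cn n = (LINT t|lborel. tail_inverse t * poisson (M.et n + 1) (t - M.xi n))" for n
  have pot0: "(\<lambda>n. if n \<in> I then ln (sqrt ((x - M.xi n)\<^sup>2 + (M.et n + 1)\<^sup>2)) - ln (sqrt ((M.xi n)\<^sup>2 + (M.et n + 1)\<^sup>2)) + x * cn n else 0)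
      sums (LINT t|lborel. log_kernel x t * m0 t)" for x
    unfolding cn_def by (rule log_kernel_poisson_series(2)[OF hpos sums0 m0_le])
  obtain g where g: "real_entire g"
    and gs: "\<And>x::real. (\<lambda>n. if n \<in> I then ln (cmod (1 - of_real x / lam n)) + x * Re (1 / lam n) else 0)
        sums (ln (cmod (P (of_real x))) - Re (g (of_real x)))"
    using Z.canonical_factorisation[OF M.summable_inverse_squares] by blast
  define S where "S x = (\<Sum>n. M.D n x)" for x
  have Ssum: "(\<lambda>n. M.D n x) sums S x" for x unfolding S_def by (intro summable_sums M.summable_D)
  (* The potential of m0, the logarithm of the product P and the sum of the D all converge termwise.
     Their combination leaves only the linear terms, so the sum of these converges as well and is
     linear in x. *)
  define en where "en n = (if n \<in> I then cn n - Re (1 / lam n) else 0)" for n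
  have comb: "(\<lambda>n. x * en n) sums ((LINT t|lborel. log_kernel x t * m0 t) - (ln (cmod (P (of_real x))) - Re (g (of_real x))) - S x + S 0)" for x
  proof -
    have "(\<lambda>n. (if n \<in> I then ln (sqrt ((x - M.xi n)\<^sup>2 + (M.et n + 1)\<^sup>2)) - ln (sqrt ((M.xi n)\<^sup>2 + (M.et n + 1)\<^sup>2)) + x * cn n else 0)
       - (if n \<in> I then ln (cmod (1 - of_real x / lam n)) + x * Re (1 / lam n) else 0) - M.D n x + M.D n 0)
       sums ((LINT t|lborel. log_kernel x t * m0 t) - (ln (cmod (P (of_real x))) - Re (g (of_real x))) - S x + S 0)"
      by (intro sums_add sums_diff pot0 gs Ssum)
    moreover have "(if n \<in> I then ln (sqrt ((x - M.xi n)\<^sup>2 + (M.et n + 1)\<^sup>2)) - ln (sqrt ((M.xi n)\<^sup>2 + (M.et n + 1)\<^sup>2)) + x * cn n else 0)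
       - (if n \<in> I then ln (cmod (1 - of_real x / lam n)) + x * Re (1 / lam n) else 0) - M.D n x + M.D n 0 = x * en n" for n
    proof (cases "n \<in> I")
      case True
      have "1 - of_real x / lam n = - ((of_real x - lam n) / lam n)" using Z.lam_nz[OF True] by (simp add: field_simps)
      then have "cmod (1 - of_real x / lam n) = cmod (of_real x - lam n) / cmod (lam n)" by (simp only: norm_minus_cancel norm_divide)
      moreover have "cmod (of_real x - lam n) = sqrt (M.dd n x)" for x unfolding M.cmod_dd[symmetric] by simp
      moreover from this[of 0] have "cmod (lam n) = sqrt (M.dd n 0)" by simp
      ultimately have "ln (cmod (1 - of_real x / lam n)) = ln (sqrt (M.dd n x)) - ln (sqrt (M.dd n 0))"
        using M.dd_pos[OF True, of x] M.dd_pos[OF True, of 0] by (simp add: ln_div)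
      then show ?thesis using True by (simp add: M.D_def en_def algebra_simps)
    qed (simp add: M.D_def en_def)
    ultimately show ?thesis by simp
  qed
  define \<alpha> where "\<alpha> = suminf en"
  have "en sums \<alpha>" using comb[of 1] unfolding \<alpha>_def by (simp add: sums_iff)
  then have lin: "(LINT t|lborel. log_kernel x t * m0 t) = ln (cmod (P (of_real x))) - Re (g (of_real x)) + S x - S 0 + \<alpha> * x" for x
    using sums_unique2[OF comb[of x] sums_mult[of en \<alpha> x]] by (simp add: mult.commute)
  obtain CL where CL: "0 \<le> CL" "\<And>x y. \<bar>M.L x - M.L y\<bar> \<le> CL * (1 + \<bar>x - y\<bar>) powr (1 - \<epsilon>)"
    using M.L_large_scale_Holder by blast
  have e2: "0 < c / (2 * pi)" using c by simp
  have q01: "0 \<le> 1 - \<epsilon>" "1 - \<epsilon> < 1" using \<epsilon> by auto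
  obtain m1 Lt c' B where m1: "m1 \<in> borel_measurable borel" "\<And>t. \<bar>m1 t\<bar> \<le> c / (2 * pi)"
    and Lt: "\<And>x. \<bar>Lt x - M.L x\<bar> \<le> B" and pot1: "\<And>x. (LINT t|lborel. log_kernel x t * m1 t) = Lt x - Lt 0 + c' * x"
  proof (rule smoothing[OF M.L_measurable q01 CL e2])
    fix m Lt c' B
    assume "m \<in> borel_measurable borel" "\<And>t. \<bar>m t\<bar> \<le> c / (2 * pi)" "\<And>x. \<bar>Lt x - M.L x\<bar> \<le> B"
      "\<And>x. (LINT t|lborel. log_kernel x t * m t) = Lt x - Lt 0 + c' * x"
    then show thesis by (rule that)
  qed
  (* |m1| is at most half of the lower bound c / \<pi> of m0. *)
  define m where "m t = m0 t + m1 t" for t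
  define G where "G z = h z + g z + of_real (- \<alpha> - c') * z" for z
  have m_meas: "m \<in> borel_measurable borel" using m0_meas m1(1) by (simp add: m_def[abs_def])
  have m_ge: "c / (2 * pi) \<le> m t" for t using m0_ge[of t] m1(2)[of t] by (simp add: m_def abs_le_iff field_simps)
  have m_le: "m t \<le> M.C0 / pi + c / (2 * pi)" for t using m0_le[of t] m1(2)[of t] by (simp add: m_def abs_le_iff)
  have pot: "potential m (of_real x) = (LINT t|lborel. log_kernel x t * m0 t) + (LINT t|lborel. log_kernel x t * m1 t)" for x
  proof -
    have "integrable lborel (\<lambda>t. log_kernel x t * m0 t)"
    proof (rule integrable_log_kernel_mult[OF m0_meas, of 0 "M.C0 / pi"])
      have "0 \<le> m0 t" for t using m0_ge[of t] c by (smt (verit) divide_nonneg_nonneg pi_ge_zero)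
      moreover have "(1 + \<bar>t\<bar>) powr 0 = 1" for t :: real
      proof -
        have "1 + \<bar>t\<bar> \<noteq> 0" using abs_ge_zero[of t] by linarith
        then show ?thesis by simp
      qed
      ultimately show "\<bar>m0 t\<bar> \<le> M.C0 / pi * (1 + \<bar>t\<bar>) powr 0" for t
        using m0_le[of t] by (simp only: abs_of_nonneg mult_1_right)
    qed auto
    moreover have "integrable lborel (\<lambda>t. log_kernel x t * m1 t)"
      by (rule integrable_log_kernel_mult[OF m1(1), of 0 "c / (2 * pi)"]) (use m1(2) in auto)
    ultimately show ?thesis unfolding potential_eq_log_kernel[OF m_meas] by (simp add: m_def distrib_left)
  qed
  define k where "k = ln (cmod Cc) + S 0 + Lt 0 - ln pi / 2"
  have lnM: "ln (majorant H ip (of_real x)) = Re (G (of_real x)) + potential m (of_real x) + (M.L x - Lt x) + k"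
    and Mpos: "0 < majorant H ip (of_real x)" for x
  proof -
    have maj: "majorant H ip (of_real x) = cmod (E (of_real x)) * sqrt (p x / pi)"
      unfolding p_def by (rule majorant_on_real_line[OF HB nzr dB HE nrm ph]) (use M.p_pos[of x] in \<open>simp_all add: p_def\<close>)
    have Ex: "0 < cmod (E (of_real x))" using nzr[of x] by simp
    show "0 < majorant H ip (of_real x)" unfolding maj using Ex M.p_pos[of x] by simp
    have Px: "P (of_real x) \<noteq> 0" by (rule Z.P_nz_upper) simp
    have "ln (cmod (E (of_real x))) = ln (cmod Cc) + Re (h (of_real x)) + ln (cmod (P (of_real x)))"
      unfolding EP using Cc Px by (simp add: norm_mult ln_mult)
    moreover have "ln (majorant H ip (of_real x)) = ln (cmod (E (of_real x))) + (ln (p x) - ln pi) / 2"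
      unfolding maj using Ex M.p_pos[of x] by (simp add: ln_mult ln_sqrt ln_div)
    moreover have "ln (p x) / 2 = M.L x + S x" by (simp add: M.L_def S_def)
    ultimately show "ln (majorant H ip (of_real x)) = Re (G (of_real x)) + potential m (of_real x) + (M.L x - Lt x) + k"
      unfolding pot pot1 lin G_def k_def by (simp add: diff_divide_distrib algebra_simps)
  qed
  show ?thesis
  proof (intro exI[of _ m] exI[of _ G] conjI allI)
    show "m \<in> borel_measurable lebesgue" using m_meas by (simp add: measurable_completion)
    show "0 < m t" for t using m_ge[of t] e2 by linarith
    show "comparable m (\<lambda>t. 1)" unfolding comparable_def lesssim_def
    proof (intro conjI exI allI)
      show "0 < M.C0 / pi + c / (2 * pi)" using M.C0_nonneg e2 by (intro add_nonneg_pos) auto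
      show "m t \<le> (M.C0 / pi + c / (2 * pi)) * 1" for t using m_le[of t] by simp
      show "0 < 1 / (c / (2 * pi))" using e2 by (rule divide_pos_pos[OF zero_less_one])
      show "1 \<le> 1 / (c / (2 * pi)) * m t" for t using m_ge[of t] e2 by (simp add: field_simps)
    qed
    show "real_entire G" unfolding G_def by (intro real_entire_add real_entire_linear h g)
    have "comparable (\<lambda>x::real. majorant H ip (of_real x)) (\<lambda>x::real. exp (Re (G (of_real x)) + potential m (of_real x)))"
    proof (rule comparable_expI[OF Mpos])
      fix x
      show "\<bar>ln (majorant H ip (of_real x)) - (Re (G (of_real x)) + potential m (of_real x))\<bar> \<le> B + \<bar>k\<bar>"
        unfolding lnM using Lt[of x] by linarith
    qed
    then show "comparable (\<lambda>x::real. majorant H ip (of_real x)) (\<lambda>x::real. exp (Re (G (of_real x))) * exp (potential m (of_real x)))"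
      by (simp only: exp_add)
  qed
qed

end
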